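(* Let $\mathbb{G}$ be a Carnot group of homogeneous dimension $Q>2$, with horizontal layer equipped with a fixed inner product, and let $\mathbf{N}_u = u^{1/(2-Q)}$ denote Folland's homogeneous quasi-norm on $\mathbb{G}$. Then the following are equivalent: \begin{itemize} \item[(i)] $\mathcal{L}_\infty(\mathbf{N}_u) = 0$ in $\mathbb{G}\setminus\{\mathtt{e}\}$, the complement of the identity element; \item[(ii)] $\mathbb{G}$ admits a coherent family of singular solutions to the horizontal $p$-Laplacians for all $1<p\le\infty$; \item[(iii)] $\mathbb{G}$ admits horizontal polar coordinates with respect to $\mathbf{N}_u$. \end{itemize}
   Context: **Carnot group.** $\mathbb{G}$ is a connected, simply connected nilpotent Lie group whose Lie algebra is stratified, $\mathfrak{g}=\mathfrak{v}_1\oplus\cdots\oplus\mathfrak{v}_\iota$, with $[\mathfrak{v}_1,\mathfrak{v}_j]=\mathfrak{v}_{j+1}$ for $j<\iota$ and $[\mathfrak{v}_1,\mathfrak{v}_\iota]=0$. An inner product $\langle\cdot,\cdot\rangle_0$ on $\mathfrak{v}_1$ (the horizontal layer) is fixed, with norm $\|\cdot\|_0$ and orthonormal basis $X_1,\dots,X_m$, regarded as left-invariant vector fields; these extend the inner product to the left-invariant horizontal distribution spanned by $X_1,\dots,X_m$. $\mathbb{G}$ is identified with $\mathfrak{g}\simeq\mathbb{R}^N$ by the exponential map. The identity element is $\mathtt{e}$ (also written $0$). The dilations $\delta_\lambda:\mathbb{G}\to\mathbb{G}$, $\lambda>0$, are defined at the Lie algebra level by $\delta_\lambda|_{\mathfrak{v}_j}=\lambda^j$.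 The homogeneous dimension is $Q=\sum_{j=1}^\iota j\dim\mathfrak{v}_j$. Haar measure is $\mu$ (Lebesgue measure on $\mathbb{R}^N$ up to a constant); $d\mathtt{g}=d\mu(\mathtt{g})$. **Operators.** $\nabla_0 f=(X_1f,\dots,X_mf)$, identified with the horizontal vector field $\sum_i (X_if)X_i$; for a horizontal vector field $V=\sum_i a_iX_i$, $\operatorname{div}_0V=\sum_i X_i(a_i)$. The horizontal Laplacian is $\mathcal{L}f=\operatorname{div}_0(\nabla_0f)=\sum_iX_i^2f$. For $1<p<\infty$ the horizontal $p$-Laplacian is $\mathcal{L}_pf=\operatorname{div}_0(\|\nabla_0f\|_0^{p-2}\nabla_0f)$. The horizontal $\infty$-Laplacian is $\mathcal{L}_\infty f=\tfrac12\langle\nabla_0(\|\nabla_0f\|_0^2),\nabla_0f\rangle_0$. For $1<p<\infty$, the equation $\mathcal{L}_pf=0$ in an open set $\Omega$ (for $f\in C^\infty(\Omega)$) is understood in the weak sense: $\int_\Omega\|\nabla_0f\|_0^{p-2}\langle\nabla_0f,\nabla_0\varphi\rangle_0\,d\mu=0$ for all $\varphi\in C_0^\infty(\Omega)$, the integrand being $0$ where $\nabla_0f=0$. The equation $\mathcal{L}_\infty f=0$ is understood pointwise. **Folland's quasi-norm.** For $Q>2$ let $u$ be Folland's fundamental solution of the sub-Laplacian with pole at $\mathtt{e}$: $u$ is positive and $C^\infty$ on $\mathbb{G}\setminus\{\mathtt{e}\}$, $u\circ\delta_\lambda=\lambda^{2-Q}u$ for all $\lambda>0$, and $-\mathcal{L}u$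 is the Dirac mass at $\mathtt{e}$ in the sense of distributions (with respect to $\mu$). Such $u$ exists on every Carnot group with $Q>2$ (Folland). Set $\mathbf{N}_u=u^{1/(2-Q)}$ on $\mathbb{G}\setminus\{\mathtt{e}\}$ and $\mathbf{N}_u(\mathtt{e})=0$. It satisfies $\mathbf{N}_u\circ\delta_\lambda=\lambda\mathbf{N}_u$ and is a quasi-norm. **Coherent family of singular solutions.** $\mathbb{G}$ admits a coherent family of singular solutions to the horizontal $p$-Laplacians for all $1<p\le\infty$ if, for each $1<p\le\infty$, the function $$u_p=\begin{cases}\mathbf{N}_u^{(p-Q)/(p-1)},&p\neq Q,\\ \log(1/\mathbf{N}_u),&p=Q,\end{cases}$$ with the interpretation $u_\infty=\mathbf{N}_u$, satisfies $\mathcal{L}_pu_p=0$ in $\mathbb{G}\setminus\{\mathtt{e}\}$. **Horizontal polar coordinates.** Let $S=\{\mathtt{g}\in\mathbb{G}:\mathbf{N}_u(\mathtt{g})=1\}$. $\mathbb{G}$ admits horizontal polar coordinates with respect to $\mathbf{N}_u$ if there exist a $\mu$-null set $Z\subset\mathbb{G}$ and, for each $\mathtt{a}\in S\setminus Z$, a horizontal curve $\gamma_{\mathtt{a}}:(0,\infty)\to\mathbb{G}$ (differentiable, with velocity $\dot\gamma_{\mathtt{a}}(s)$ in the horizontal distribution for every $s$) with $\gamma_{\mathtt{a}}(1)=\mathtt{a}$, such that $\mathbb{G}\setminus Z$ is the disjoint union of the images of the curves $\gamma_{\mathtt{a}}$, $\mathtt{a}\in S\setminus Z$, and for all $\mathtt{a}\in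 S\setminus Z$: (i) $\mathbf{N}_u(\gamma_{\mathtt{a}}(s))=s$ for all $s>0$; (ii) $\dot\gamma_{\mathtt{a}}(s)$ is a (real scalar) multiple of $\nabla_0\mathbf{N}_u(\gamma_{\mathtt{a}}(s))$ for all $s>0$; (iii) $\|\dot\gamma_{\mathtt{a}}(s)\|_0$ is independent of $s$; and, furthermore, there exists a unique Radon measure $\sigma$ on $S$ (with $\sigma(S\cap Z)=0$) such that $$\int_{\mathbb{G}}f(\mathtt{g})\,d\mathtt{g}=\int_S\int_0^\infty f(\gamma_{\mathtt{a}}(s))\,s^{Q-1}\,ds\,d\sigma(\mathtt{a})\quad\text{for all }f\in L^1(\mathbb{G}).$$ *)

theory Defs
  imports "HOL-Analysis.Analysis"
begin

section \<open>Smooth functions\<close>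

text \<open>\<open>C\<^sup>k\<close> regularity on an open set, by iterating directional derivatives; the set is always
  open where this is used.\<close>

fun Ck_on :: "nat \<Rightarrow> 'a::euclidean_space set \<Rightarrow> ('a \<Rightarrow> 'b::real_normed_vector) \<Rightarrow> bool" where
  "Ck_on 0 U f \<longleftrightarrow> continuous_on U f"
| "Ck_on (Suc k) U f \<longleftrightarrow>
     (\<forall>x\<in>U. f differentiable (at x)) \<and> (\<forall>v. Ck_on k U (\<lambda>x. frechet_derivative f (at x) v))"

definition smooth_on :: "'a::euclidean_space set \<Rightarrow> ('a \<Rightarrow> 'b::real_normed_vector) \<Rightarrow> bool" where
  "smooth_on U f \<longleftrightarrow> (\<forall>k. Ck_on k U f)"

definition test_function :: "'a::euclidean_space set \<Rightarrow> ('a \<Rightarrow> real) \<Rightarrow> bool" where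
  "test_function U \<phi> \<longleftrightarrow> smooth_on UNIV \<phi> \<and>
     compact (closure {x. \<phi> x \<noteq> 0}) \<and> closure {x. \<phi> x \<noteq> 0} \<subseteq> U"


section \<open>Carnot groups\<close>

text \<open>A Carnot group in exponential coordinates: the Euclidean space \<open>'a\<close> is the Lie algebra, and the
  group lives on \<open>'a\<close> with the identity map as exponential map, so that the identity element is \<open>0\<close>.
  The ambient inner product of \<open>'a\<close> only supplies topology, smooth structure and Lebesgue measure. In
  particular \<open>inner0\<close>, the fixed inner product on the horizontal layer, is unrelated to it, and only
  its values on the first layer matter. The fields \<open>layer\<close> and \<open>frame\<close> are indexed from 1.\<close>

record 'a carnot =
  mult   :: "'a \<Rightarrow> 'a \<Rightarrow> 'a"
  layer  :: "nat \<Rightarrow> 'a set"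
  nsteps :: nat
  inner0 :: "'a \<Rightarrow> 'a \<Rightarrow> real"
  frame  :: "nat \<Rightarrow> 'a"
  haar   :: "'a measure"

text \<open>Value at \<open>g\<close> of the left-invariant vector field with value \<open>v\<close> at the identity.\<close>

definition left_field :: "('a::euclidean_space, 'b) carnot_scheme \<Rightarrow> 'a \<Rightarrow> 'a \<Rightarrow> 'a" where
  "left_field G v g = frechet_derivative (mult G g) (at 0) v"

text \<open>Commutator of left-invariant vector fields, evaluated at the identity. The sign is that of
  \<open>[X, Y] f = X (Y f) - Y (X f)\<close>, that is \<open>[X, Y] = DY X - DX Y\<close>.\<close>

definition lie_bracket :: "('a::euclidean_space, 'b) carnot_scheme \<Rightarrow> 'a \<Rightarrow> 'a \<Rightarrow> 'a" where
  "lie_bracket G v w =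
     frechet_derivative (left_field G w) (at 0) v - frechet_derivative (left_field G v) (at 0) w"

definition bracket_span :: "('a::euclidean_space, 'b) carnot_scheme \<Rightarrow> 'a set \<Rightarrow> 'a set \<Rightarrow> 'a set" where
  "bracket_span G A B = span {lie_bracket G x y | x y. x \<in> A \<and> y \<in> B}"

fun lower_central :: "('a::euclidean_space, 'b) carnot_scheme \<Rightarrow> nat \<Rightarrow> 'a set" where
  "lower_central G 0 = UNIV"
| "lower_central G (Suc k) = bracket_span G UNIV (lower_central G k)"

definition stratified :: "('a::euclidean_space, 'b) carnot_scheme \<Rightarrow> bool" where
  "stratified G \<longleftrightarrow>
     1 \<le> nsteps G \<and>
     (\<forall>j\<in>{1..nsteps G}. subspace (layer G j)) \<and>
     (\<forall>x. \<exists>!c. (\<forall>j\<in>{1..nsteps G}. c j \<in> layer G j) \<and> (\<forall>j. j \<notin> {1..nsteps G} \<longrightarrow> c j = 0) \<and>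
            x = (\<Sum>j=1..nsteps G. c j)) \<and>
     (\<forall>j\<in>{1..<nsteps G}. bracket_span G (layer G 1) (layer G j) = layer G (Suc j)) \<and>
     bracket_span G (layer G 1) (layer G (nsteps G)) = {0}"

definition inner_product_on :: "'a::real_vector set \<Rightarrow> ('a \<Rightarrow> 'a \<Rightarrow> real) \<Rightarrow> bool" where
  "inner_product_on V b \<longleftrightarrow>
     (\<forall>x\<in>V. \<forall>y\<in>V. b x y = b y x) \<and>
     (\<forall>x\<in>V. \<forall>y\<in>V. \<forall>z\<in>V. b (x + y) z = b x z + b y z) \<and>
     (\<forall>r. \<forall>x\<in>V. \<forall>y\<in>V. b (r *\<^sub>R x) y = r * b x y) \<and>
     (\<forall>x\<in>V. x \<noteq> 0 \<longrightarrow> b x x > 0)"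

definition hdim :: "('a::euclidean_space, 'b) carnot_scheme \<Rightarrow> nat" where
  "hdim G = dim (layer G 1)"

text \<open>The one-parameter condition says that the exponential map is the identity; it forces the
  inverse of \<open>x\<close> to be \<open>-x\<close>. The underlying manifold being a vector space, the group is connected and
  simply connected. Nilpotency follows from the stratification but is part of the definition.\<close>

locale carnot_group =
  fixes G :: "('a::euclidean_space, 'b) carnot_scheme"
  assumes group_mult: "group (mult G) 0 uminus"
    and smooth_mult: "smooth_on UNIV (\<lambda>(x, y). mult G x y)"
    and one_param: "\<And>x s t. mult G (s *\<^sub>R x) (t *\<^sub>R x) = (s + t) *\<^sub>R x"
    and nilpotent: "\<exists>k. lower_central G k = {0}"
    and stratified: "stratified G"
    and inner0: "inner_product_on (layer G 1) (inner0 G)"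
    and frame_layer: "\<And>i. i \<in> {1..hdim G} \<Longrightarrow> frame G i \<in> layer G 1"
    and frame_orthonormal: "\<And>i j. i \<in> {1..hdim G} \<Longrightarrow> j \<in> {1..hdim G} \<Longrightarrow>
          inner0 G (frame G i) (frame G j) = (if i = j then 1 else 0)"
    and haar: "\<exists>c>0. haar G = scale_measure (ennreal c) lebesgue"

definition hom_dim :: "('a::euclidean_space, 'b) carnot_scheme \<Rightarrow> nat" where
  "hom_dim G = (\<Sum>j=1..nsteps G. j * dim (layer G j))"

definition dilation :: "('a::euclidean_space, 'b) carnot_scheme \<Rightarrow> real \<Rightarrow> 'a \<Rightarrow> 'a" where
  "dilation G r = (THE f. linear f \<and> (\<forall>j\<in>{1..nsteps G}. \<forall>x\<in>layer G j. f x = r ^ j *\<^sub>R x))"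


section \<open>Horizontal calculus\<close>

text \<open>Tangent vectors at every point are elements of \<open>'a\<close>. The inner product of the first layer is
  transported to the horizontal space at \<open>g\<close> by left translation; the norm and inner product below
  are meaningful for tangent vectors in the horizontal space at \<open>g\<close> only.\<close>

definition horizontal_space :: "('a::euclidean_space, 'b) carnot_scheme \<Rightarrow> 'a \<Rightarrow> 'a set" where
  "horizontal_space G g = (\<lambda>v. left_field G v g) ` layer G 1"

definition hinner :: "('a::euclidean_space, 'b) carnot_scheme \<Rightarrow> 'a \<Rightarrow> 'a \<Rightarrow> 'a \<Rightarrow> real" where
  "hinner G g v w = inner0 G (inv (\<lambda>z. left_field G z g) v) (inv (\<lambda>z. left_field G z g) w)"

definition hnorm :: "('a::euclidean_space, 'b) carnot_scheme \<Rightarrow> 'a \<Rightarrow> 'a \<Rightarrow> real" where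
  "hnorm G g v = sqrt (hinner G g v v)"

definition X_deriv :: "('a::euclidean_space, 'b) carnot_scheme \<Rightarrow> nat \<Rightarrow> ('a \<Rightarrow> real) \<Rightarrow> 'a \<Rightarrow> real" where
  "X_deriv G i f g = frechet_derivative f (at g) (left_field G (frame G i) g)"

definition hgrad :: "('a::euclidean_space, 'b) carnot_scheme \<Rightarrow> ('a \<Rightarrow> real) \<Rightarrow> 'a \<Rightarrow> 'a" where
  "hgrad G f g = (\<Sum>i=1..hdim G. X_deriv G i f g *\<^sub>R left_field G (frame G i) g)"

definition hlaplace :: "('a::euclidean_space, 'b) carnot_scheme \<Rightarrow> ('a \<Rightarrow> real) \<Rightarrow> 'a \<Rightarrow> real" where
  "hlaplace G f g = (\<Sum>i=1..hdim G. X_deriv G i (X_deriv G i f) g)"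

definition inf_laplace :: "('a::euclidean_space, 'b) carnot_scheme \<Rightarrow> ('a \<Rightarrow> real) \<Rightarrow> 'a \<Rightarrow> real" where
  "inf_laplace G f g =
     1 / 2 * hinner G g (hgrad G (\<lambda>x. (hnorm G x (hgrad G f x))\<^sup>2) g) (hgrad G f g)"

text \<open>The convention \<open>0 powr a = 0\<close> makes the integrand vanish where the horizontal gradient does.\<close>

definition weak_p_harmonic ::
    "('a::euclidean_space, 'b) carnot_scheme \<Rightarrow> real \<Rightarrow> ('a \<Rightarrow> real) \<Rightarrow> 'a set \<Rightarrow> bool" where
  "weak_p_harmonic G p f U \<longleftrightarrow>
     (\<forall>\<phi>. test_function U \<phi> \<longrightarrow>
        (LINT g:U|haar G. hnorm G g (hgrad G f g) powr (p - 2) *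
                            hinner G g (hgrad G f g) (hgrad G \<phi> g)) = 0)"

definition p_harmonic ::
    "('a::euclidean_space, 'b) carnot_scheme \<Rightarrow> ereal \<Rightarrow> ('a \<Rightarrow> real) \<Rightarrow> 'a set \<Rightarrow> bool" where
  "p_harmonic G p f U \<longleftrightarrow>
     (if p = \<infinity> then \<forall>g\<in>U. inf_laplace G f g = 0 else weak_p_harmonic G (real_of_ereal p) f U)"


section \<open>Folland's solution, coherent families and horizontal polar coordinates\<close>

text \<open>The value of \<open>u\<close> at the pole is immaterial. The left-invariant fields are skew-adjoint with
  respect to Haar measure, hence the sub-Laplacian is formally self-adjoint and the last clause says
  that minus the sub-Laplacian of \<open>u\<close> is the Dirac mass at \<open>0\<close>; the clause before it makes \<open>u\<close> a distribution.\<close>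

definition folland_solution ::
    "('a::euclidean_space, 'b) carnot_scheme \<Rightarrow> ('a \<Rightarrow> real) \<Rightarrow> bool" where
  "folland_solution G u \<longleftrightarrow>
     (\<forall>g. g \<noteq> 0 \<longrightarrow> u g > 0) \<and>
     smooth_on (- {0}) u \<and>
     (\<forall>r>0. \<forall>g. g \<noteq> 0 \<longrightarrow> u (dilation G r g) = r powr (2 - real (hom_dim G)) * u g) \<and>
     (\<forall>K. compact K \<longrightarrow> set_integrable (haar G) K u) \<and>
     (\<forall>\<phi>. test_function UNIV \<phi> \<longrightarrow> - (LINT g|haar G. u g * hlaplace G \<phi> g) = \<phi> 0)"

definition folland_norm ::
    "('a::euclidean_space, 'b) carnot_scheme \<Rightarrow> ('a \<Rightarrow> real) \<Rightarrow> 'a \<Rightarrow> real" where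
  "folland_norm G u g = (if g = 0 then 0 else u g powr (1 / (2 - real (hom_dim G))))"

definition singular_solution ::
    "('a::euclidean_space, 'b) carnot_scheme \<Rightarrow> ('a \<Rightarrow> real) \<Rightarrow> ereal \<Rightarrow> 'a \<Rightarrow> real" where
  "singular_solution G N p g =
     (let Q = real (hom_dim G); q = real_of_ereal p in
      if p = \<infinity> then N g
      else if q = Q then ln (1 / N g)
      else N g powr ((q - Q) / (q - 1)))"

definition coherent_family ::
    "('a::euclidean_space, 'b) carnot_scheme \<Rightarrow> ('a \<Rightarrow> real) \<Rightarrow> bool" where
  "coherent_family G u \<longleftrightarrow>
     (\<forall>p::ereal. 1 < p \<and> p \<le> \<infinity> \<longrightarrow>
        p_harmonic G p (singular_solution G (folland_norm G u) p) (- {0}))"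

definition radon_measure_on :: "'a::topological_space set \<Rightarrow> 'a measure \<Rightarrow> bool" where
  "radon_measure_on S \<sigma> \<longleftrightarrow>
     space \<sigma> = S \<and> sets \<sigma> = sets (restrict_space borel S) \<and>
     (\<forall>K\<subseteq>S. compact K \<longrightarrow> emeasure \<sigma> K < \<infinity>) \<and>
     (\<forall>A\<in>sets \<sigma>. emeasure \<sigma> A = (SUP K\<in>{K. K \<subseteq> A \<and> compact K}. emeasure \<sigma> K))"

text \<open>\<open>\<gamma> a\<close> is only meaningful for \<open>a\<close> outside \<open>Z\<close>; the remaining points of the sphere form a
  \<open>\<sigma>\<close>-null set. As Bochner integrals of non-integrable functions are \<open>0\<close> in the library, existence of
  the iterated integral is stated explicitly. Completion of \<open>\<sigma>\<close> is needed because \<open>f\<close> is only Lebesgue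
  measurable and \<open>Z\<close> only Lebesgue null.\<close>

definition polar_measure ::
    "('a::euclidean_space, 'b) carnot_scheme \<Rightarrow> 'a set \<Rightarrow> 'a set \<Rightarrow> ('a \<Rightarrow> real \<Rightarrow> 'a) \<Rightarrow> 'a measure \<Rightarrow> bool"
  where
  "polar_measure G S Z \<gamma> \<sigma> \<longleftrightarrow>
     radon_measure_on S \<sigma> \<and> S \<inter> Z \<in> null_sets (completion \<sigma>) \<and>
     (\<forall>f::'a \<Rightarrow> real. integrable (haar G) f \<longrightarrow>
        (AE a in completion \<sigma>. set_integrable lebesgue {0<..} (\<lambda>s. f (\<gamma> a s) * s ^ (hom_dim G - 1))) \<and>
        integrable (completion \<sigma>)
          (\<lambda>a. LINT s:{0<..}|lebesgue. f (\<gamma> a s) * s ^ (hom_dim G - 1)) \<and>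
        (LINT g|haar G. f g) =
          (LINT a|completion \<sigma>. (LINT s:{0<..}|lebesgue. f (\<gamma> a s) * s ^ (hom_dim G - 1))))"

definition horizontal_curve ::
    "('a::euclidean_space, 'b) carnot_scheme \<Rightarrow> (real \<Rightarrow> 'a) \<Rightarrow> bool" where
  "horizontal_curve G c \<longleftrightarrow>
     (\<forall>s>0. c differentiable (at s) \<and> vector_derivative c (at s) \<in> horizontal_space G (c s))"

definition horizontal_polar_coordinates ::
    "('a::euclidean_space, 'b) carnot_scheme \<Rightarrow> ('a \<Rightarrow> real) \<Rightarrow> bool" where
  "horizontal_polar_coordinates G N \<longleftrightarrow>
     (let S = {g. N g = 1} in
      \<exists>Z\<in>null_sets (haar G). \<exists>\<gamma> :: 'a \<Rightarrow> real \<Rightarrow> 'a.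
        (\<forall>a\<in>S - Z. horizontal_curve G (\<gamma> a) \<and> \<gamma> a 1 = a) \<and>
        UNIV - Z = (\<Union>a\<in>S - Z. \<gamma> a ` {0<..}) \<and>
        disjoint_family_on (\<lambda>a. \<gamma> a ` {0<..}) (S - Z) \<and>
        (\<forall>a\<in>S - Z.
           (\<forall>s>0. N (\<gamma> a s) = s) \<and>
           (\<forall>s>0. \<exists>r. vector_derivative (\<gamma> a) (at s) = r *\<^sub>R hgrad G N (\<gamma> a s)) \<and>
           (\<exists>k. \<forall>s>0. hnorm G (\<gamma> a s) (vector_derivative (\<gamma> a) (at s)) = k)) \<and>
        (\<exists>!\<sigma>. polar_measure G S Z \<gamma> \<sigma>))"

end

theory Submission
  imports Defs
begin

text \<open>Write \<open>N\<close> for the quasi-norm and \<open>h\<close> for the squared length of its horizontal gradient \<open>\<nabla>N\<close>. As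
  \<open>u\<close> is harmonic off the pole, the field \<open>N\<^bsup>1-Q\<^esup> \<nabla>N\<close> is divergence free; the \<open>\<infinity>\<close>-Laplace equation
  says that \<open>h\<close> is constant along \<open>\<nabla>N\<close>. The flux of the \<open>p\<close>-Laplacian of \<open>u\<^sub>p\<close> is a multiple of
  \<open>h\<^bsup>(p-2)/2\<^esup> N\<^bsup>1-Q\<^esup> \<nabla>N\<close>, so it is divergence free too; conversely take \<open>p = \<infinity>\<close>.

  The field \<open>W = \<nabla>N / h\<close> increases \<open>N\<close> at unit speed, preserves \<open>h\<close> and has divergence \<open>(Q-1)/N\<close>. Its
  flow lines are the polar curves: they exist for all positive times where \<open>h > 0\<close>, because
  \<open>{a \<le> N \<le> b, h \<ge> c}\<close> is compact, and the divergence accounts for the factor \<open>s\<^bsup>Q-1\<^esup>\<close>. The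
  characteristic set \<open>{h = 0}\<close> is null by the bracket generating condition. Conversely, on a polar curve
  with velocity \<open>r \<nabla>N\<close> both \<open>r h = 1\<close> and \<open>r\<^sup>2 h\<close> are constant, so \<open>h\<close> is constant along it; this gives
  the \<open>\<infinity>\<close>-Laplace equation almost everywhere, hence everywhere by continuity.\<close>

section \<open>Calculus of \<open>C\<^sup>k\<close> functions\<close>

text \<open>The flow of \<open>W\<close> is treated as a Lipschitz map only: neither its derivative
  in the starting point nor a Jacobian occurs. The divergence of \<open>W\<close> enters weakly: a
  Lipschitz \<open>F\<close> that is constant along a compactly supported field \<open>Z\<close>
  integrates to zero against the divergence of \<open>Z\<close>. With \<open>F\<close> a function of
  the point where a trajectory crosses \<open>N = 1\<close>, and \<open>Z\<close> the field
  \<open>W\<close> times a profile in \<open>N\<close>, this says that Lebesgue measure weighted by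
  \<open>N^(1-Q)\<close> is a product in the coordinates crossing point and level. Its factor on the
  sphere gives \<sigma>.

  The length of \<open>W\<close> grows without bound where \<open>h\<close> tends to 0, so only
  cutoffs of \<open>W\<close> are integrated. Conservation of \<open>h\<close> keeps a trajectory
  where the cutoff is 1 for as long as \<open>N\<close> stays in a given band.

  Integration by parts along left-invariant fields needs them to be divergence free for Lebesgue
  measure. This comes from nilpotency: their derivatives push the lower central series down by one
  step. For \<open>p < 2\<close> the power \<open>h^((p-2)/2)\<close> is singular; it is reached as
  a limit after adding a positive constant to \<open>h\<close>, with a bound available for
  \<open>p > 1\<close>.\<close>

lemma Ck_on_cong:
  assumes "open U" "\<And>x. x \<in> U \<Longrightarrow> f x = g x"
  shows "Ck_on k U f \<longleftrightarrow> Ck_on k U g"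
  using assms(2)
proof (induction k arbitrary: f g)
  case 0
  then show ?case by (simp cong: continuous_on_cong)
next
  case (Suc k)
  have *: "(f has_derivative D) (at x) \<longleftrightarrow> (g has_derivative D) (at x)" if "x \<in> U" for x D
    using has_derivative_transform_within_open[of f D x UNIV U g]
      has_derivative_transform_within_open[of g D x UNIV U f] assms(1) that Suc.prems by auto
  have d: "f differentiable (at x) \<longleftrightarrow> g differentiable (at x)" if "x \<in> U" for x
    using *[OF that] by (auto simp: differentiable_def)
  have e: "frechet_derivative f (at x) = frechet_derivative g (at x)" if "x \<in> U" for x
    using *[OF that] by (auto simp: frechet_derivative_def)
  have "Ck_on k U (\<lambda>x. frechet_derivative f (at x) v) \<longleftrightarrow> Ck_on k U (\<lambda>x. frechet_derivative g (at x) v)" for v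
    using Suc.IH e by presburger
  then show ?case using d by simp
qed

lemma Ck_on_SucI:
  assumes "open U" "\<And>x. x \<in> U \<Longrightarrow> (f has_derivative f' x) (at x)"
    and "\<And>v. Ck_on k U (\<lambda>x. f' x v)"
  shows "Ck_on (Suc k) U f"
proof -
  have "frechet_derivative f (at x) = f' x" if "x \<in> U" for x
    using frechet_derivative_at[OF assms(2)[OF that]] by simp
  then have "Ck_on k U (\<lambda>x. frechet_derivative f (at x) v)" for v
    using Ck_on_cong[OF assms(1), of "\<lambda>x. frechet_derivative f (at x) v" "\<lambda>x. f' x v" k] assms(3) by auto
  then show ?thesis using assms(2) by (auto simp: differentiable_def)
qed

lemma Ck_on_Suc_imp: "Ck_on (Suc k) U f \<Longrightarrow> Ck_on k U f"
proof (induction k arbitrary: f)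
  case 0
  then show ?case
    by (auto simp: continuous_on_eq_continuous_within
        intro!: continuous_at_imp_continuous_at_within[OF differentiable_imp_continuous_within])
next
  case (Suc k)
  then show ?case by (metis Ck_on.simps(2))
qed

lemma Ck_on_mono: "Ck_on k U f \<Longrightarrow> j \<le> k \<Longrightarrow> Ck_on j U f"
  by (induction k) (auto simp: le_Suc_eq dest: Ck_on_Suc_imp simp del: Ck_on.simps(2))

lemma Ck_on_subset: "Ck_on k U f \<Longrightarrow> V \<subseteq> U \<Longrightarrow> Ck_on k V f"
  by (induction k arbitrary: f) (auto intro: continuous_on_subset)

lemma Ck_on_continuous_on: "Ck_on k U f \<Longrightarrow> continuous_on U f"
  using Ck_on_mono[of k U f 0] by simp

lemma Ck_on_has_derivative:
  "Ck_on (Suc k) U f \<Longrightarrow> x \<in> U \<Longrightarrow> (f has_derivative frechet_derivative f (at x)) (at x)"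
  using frechet_derivative_works by auto

lemma Ck_on_derivative: "Ck_on (Suc k) U f \<Longrightarrow> Ck_on k U (\<lambda>x. frechet_derivative f (at x) v)"
  by simp

lemma C1_on_differentiable: "Ck_on 1 U f \<Longrightarrow> x \<in> U \<Longrightarrow> f differentiable (at x)"
  and C1_on_continuous_derivative: "Ck_on 1 U f \<Longrightarrow> continuous_on U (\<lambda>x. frechet_derivative f (at x) v)"
  and C1_on_has_derivative: "Ck_on 1 U f \<Longrightarrow> x \<in> U \<Longrightarrow> (f has_derivative frechet_derivative f (at x)) (at x)"
  using frechet_derivative_works by auto

lemma Ck_on_const: "Ck_on k U (\<lambda>x. c)"
  by (induction k arbitrary: c) (auto)

lemma Ck_on_add:
  assumes "open U" "Ck_on k U f" "Ck_on k U g"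
  shows "Ck_on k U (\<lambda>x. f x + g x)"
  using assms(2,3)
proof (induction k arbitrary: f g)
  case 0
  then show ?case by (auto intro: continuous_on_add)
next
  case (Suc k)
  show ?case
  proof (rule Ck_on_SucI[OF assms(1)])
    show "((\<lambda>x. f x + g x) has_derivative (\<lambda>v. frechet_derivative f (at x) v + frechet_derivative g (at x) v)) (at x)"
      if "x \<in> U" for x
      using that Suc.prems by (intro has_derivative_add Ck_on_has_derivative)
  qed (use Suc in auto)
qed

lemma Ck_on_linear:
  assumes "open U" "bounded_linear L" "Ck_on k U f"
  shows "Ck_on k U (\<lambda>x. L (f x))"
  using assms(3)
proof (induction k arbitrary: f)
  case 0
  then show ?case using bounded_linear.continuous_on[OF assms(2)] by auto
next
  case (Suc k)
  show ?case
    by (rule Ck_on_SucI[OF assms(1) bounded_linear.has_derivative[OF assms(2)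
          Ck_on_has_derivative[OF Suc.prems]]]) (use Suc in auto)
qed

lemma Ck_on_bounded_linear:
  assumes "open U" "bounded_linear L"
  shows "Ck_on k U L"
proof (cases k)
  case 0
  then show ?thesis using linear_continuous_on[OF assms(2)] by auto
next
  case (Suc j)
  then show ?thesis
    using Ck_on_SucI[OF assms(1) bounded_linear_imp_has_derivative[OF assms(2)]] Ck_on_const by blast
qed

lemma Ck_on_ident: "open U \<Longrightarrow> Ck_on k U (\<lambda>x. x)"
  using Ck_on_bounded_linear[of U "\<lambda>x. x" k] bounded_linear_ident by auto

lemma Ck_on_minus: "open U \<Longrightarrow> Ck_on k U f \<Longrightarrow> Ck_on k U (\<lambda>x. - f x)"
  by (rule Ck_on_linear[of U uminus]) (auto intro: bounded_linear_minus bounded_linear_ident)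

lemma Ck_on_diff:
  assumes "open U" "Ck_on k U f" "Ck_on k U g"
  shows "Ck_on k U (\<lambda>x. f x - g x)"
  using Ck_on_add[OF assms(1,2) Ck_on_minus[OF assms(1,3)]] by simp

lemma Ck_on_sum:
  assumes "open U" "\<And>i. i \<in> I \<Longrightarrow> Ck_on k U (f i)"
  shows "Ck_on k U (\<lambda>x. \<Sum>i\<in>I. f i x)"
  using assms(2)
  by (induction I rule: infinite_finite_induct) (auto intro: Ck_on_const Ck_on_add[OF assms(1)])

lemma Ck_on_bilinear:
  assumes "open U" "bounded_bilinear B" "Ck_on k U f" "Ck_on k U g"
  shows "Ck_on k U (\<lambda>x. B (f x) (g x))"
  using assms(3,4)
proof (induction k arbitrary: f g)
  case 0
  then show ?case using bounded_bilinear.continuous_on[OF assms(2)] by auto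
next
  case (Suc k)
  show ?case
  proof (rule Ck_on_SucI[OF assms(1)])
    show "((\<lambda>x. B (f x) (g x)) has_derivative
       (\<lambda>v. B (f x) (frechet_derivative g (at x) v) + B (frechet_derivative f (at x) v) (g x))) (at x)"
      if "x \<in> U" for x
      using that Suc.prems by (intro bounded_bilinear.FDERIV[OF assms(2)] Ck_on_has_derivative)
    show "Ck_on k U (\<lambda>x. B (f x) (frechet_derivative g (at x) v) + B (frechet_derivative f (at x) v) (g x))" for v
      using Suc.prems by (intro Ck_on_add[OF assms(1)] Suc.IH Ck_on_derivative) (auto intro: Ck_on_Suc_imp simp del: Ck_on.simps(2))
  qed
qed

lemmas Ck_on_scaleR = Ck_on_bilinear[OF _ bounded_bilinear_scaleR]
lemmas Ck_on_mult = Ck_on_bilinear[OF _ bounded_bilinear_mult]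
lemmas Ck_on_inner = Ck_on_bilinear[OF _ bounded_bilinear_inner]

lemma Ck_on_power:
  fixes f :: "'a::euclidean_space \<Rightarrow> real"
  shows "open U \<Longrightarrow> Ck_on k U f \<Longrightarrow> Ck_on k U (\<lambda>x. f x ^ n)"
  by (induction n) (auto intro: Ck_on_const Ck_on_mult)

lemma linear_sum_Basis:
  fixes L :: "'a::euclidean_space \<Rightarrow> 'b::real_vector"
  assumes "linear L"
  shows "L v = (\<Sum>b\<in>Basis. (v \<bullet> b) *\<^sub>R L b)"
proof -
  have "L v = L (\<Sum>b\<in>Basis. (v \<bullet> b) *\<^sub>R b)" by (simp add: euclidean_representation)
  also have "\<dots> = (\<Sum>b\<in>Basis. (v \<bullet> b) *\<^sub>R L b)"
    by (simp add: linear_sum[OF assms] linear_scale[OF assms])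
  finally show ?thesis .
qed

text \<open>\<open>Ck_on\<close> controls derivatives in fixed directions, whereas the chain rule
  differentiates \<open>f\<close> in the direction \<open>Dg(x) v\<close>, which moves with
  \<open>x\<close>. Expanding that direction over \<open>Basis\<close> gives a finite sum of
  products to which the induction hypothesis applies.\<close>

lemma Ck_on_compose:
  fixes g :: "'a::euclidean_space \<Rightarrow> 'b::euclidean_space"
  assumes "open U" "open V" "Ck_on k V f" "Ck_on k U g" "g ` U \<subseteq> V"
  shows "Ck_on k U (\<lambda>x. f (g x))"
  using assms(3,4)
proof (induction k arbitrary: f)
  case 0
  then show ?case using assms(5) continuous_on_compose2 by fastforce
next
  case (Suc k)
  let ?D = "\<lambda>y. frechet_derivative f (at y)"
  show ?case
  proof (rule Ck_on_SucI[OF assms(1)])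
    show "((\<lambda>x. f (g x)) has_derivative
        (\<lambda>v. \<Sum>b\<in>Basis. (frechet_derivative g (at x) v \<bullet> b) *\<^sub>R ?D (g x) b)) (at x)" if "x \<in> U" for x
    proof -
      have f: "(f has_derivative ?D (g x)) (at (g x))"
        using that assms(5) Suc.prems(1) by (auto intro: Ck_on_has_derivative simp del: Ck_on.simps(2))
      have "((\<lambda>x. f (g x)) has_derivative (\<lambda>v. ?D (g x) (frechet_derivative g (at x) v))) (at x)"
        using has_derivative_compose[OF Ck_on_has_derivative[OF Suc.prems(2) that] f] .
      moreover have "(\<lambda>v. ?D (g x) (frechet_derivative g (at x) v)) =
          (\<lambda>v. \<Sum>b\<in>Basis. (frechet_derivative g (at x) v \<bullet> b) *\<^sub>R ?D (g x) b)"
        using linear_sum_Basis[OF has_derivative_linear[OF f]] by blast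
      ultimately show ?thesis by simp
    qed
    show "Ck_on k U (\<lambda>x. \<Sum>b\<in>Basis. (frechet_derivative g (at x) v \<bullet> b) *\<^sub>R ?D (g x) b)" for v
      using Suc.prems
      by (intro Ck_on_sum[OF assms(1)] Ck_on_scaleR[OF assms(1)] Ck_on_inner[OF assms(1)] Ck_on_const
          Ck_on_derivative Suc.IH Ck_on_Suc_imp[of k U g])
  qed
qed

lemma Ck_on_real_SucI:
  fixes f :: "real \<Rightarrow> real"
  assumes "open U" "\<And>x. x \<in> U \<Longrightarrow> (f has_real_derivative f' x) (at x)" "Ck_on k U f'"
  shows "Ck_on (Suc k) U f"
  by (rule Ck_on_SucI[OF assms(1) assms(2)[unfolded has_field_derivative_def]])
    (auto intro!: Ck_on_mult Ck_on_const assms)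

lemma Ck_on_powr_real: "Ck_on k {0<..} (\<lambda>t::real. t powr a)"
proof (induction k arbitrary: a)
  case 0
  then show ?case by (auto intro!: continuous_intros)
next
  case (Suc k)
  show ?case
  proof (rule Ck_on_real_SucI[where f' = "\<lambda>t. a * t powr (a - 1)"])
    show "Ck_on k {0<..} (\<lambda>t::real. a * t powr (a - 1))"
      by (intro Ck_on_mult Ck_on_const Suc) auto
  qed (auto intro!: has_real_derivative_powr)
qed

lemma Ck_on_powr:
  fixes f :: "'a::euclidean_space \<Rightarrow> real"
  assumes "open U" "Ck_on k U f" "\<And>x. x \<in> U \<Longrightarrow> f x > 0"
  shows "Ck_on k U (\<lambda>x. f x powr a)"
  by (rule Ck_on_compose[OF assms(1) _ Ck_on_powr_real assms(2)]) (use assms(3) in auto)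

lemma Ck_on_inverse:
  fixes f :: "'a::euclidean_space \<Rightarrow> real"
  assumes "open U" "Ck_on k U f" "\<And>x. x \<in> U \<Longrightarrow> f x \<noteq> 0"
  shows "Ck_on k U (\<lambda>x. inverse (f x))"
proof -
  \<comment> \<open>Smoothness of powers is known for positive bases; \<open>f * f\<close> is
    positive whatever the sign of \<open>f\<close>.\<close>
  have "Ck_on k U (\<lambda>x. f x * (f x * f x) powr (- 1))"
    using assms by (intro Ck_on_mult Ck_on_powr) (auto simp: zero_less_mult_iff linorder_neq_iff)
  moreover have "f x * (f x * f x) powr (- 1) = inverse (f x)" if "x \<in> U" for x
    using assms(3)[OF that] by (simp add: powr_minus field_simps)
  ultimately show ?thesis using Ck_on_cong[OF assms(1)] by (metis (no_types, lifting))
qed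

lemma Ck_on_divide:
  fixes f g :: "'a::euclidean_space \<Rightarrow> real"
  assumes "open U" "Ck_on k U f" "Ck_on k U g" "\<And>x. x \<in> U \<Longrightarrow> g x \<noteq> 0"
  shows "Ck_on k U (\<lambda>x. f x / g x)"
  using Ck_on_mult[OF assms(1,2) Ck_on_inverse[OF assms(1,3,4)]] by (simp add: field_simps)

text \<open>\<open>U\<close> and the complement of \<open>K\<close> are open and cover the space,
  \<open>f\<close> is zero on the latter, and the property is local. This turns functions that are
  regular only off the pole, or only on \<open>\<Omega>\<close>, into compactly supported functions
  on the whole space.\<close>

lemma Ck_on_zero_extension:
  fixes f :: "'a::euclidean_space \<Rightarrow> 'b::real_normed_vector"
  assumes "open U" "Ck_on k U f" "closed K" "K \<subseteq> U" "\<And>x. x \<notin> K \<Longrightarrow> f x = 0"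
  shows "Ck_on k UNIV f"
proof -
  have "Ck_on k (- K) f" using Ck_on_cong[of "-K" f "\<lambda>_. 0" k] assms(3,5) Ck_on_const by auto
  moreover have "Ck_on k (V \<union> W) g" if "open V" "open W" "Ck_on k V g" "Ck_on k W g"
    for V W :: "'a set" and g :: "'a \<Rightarrow> 'b"
    using that(3,4)
    by (induction k arbitrary: g) (auto intro: continuous_on_open_Un that)
  ultimately have "Ck_on k (U \<union> - K) f" using assms by blast
  moreover have "U \<union> - K = UNIV" using assms(4) by auto
  ultimately show ?thesis by simp
qed

lemma frechet_derivative_zero_outside:
  fixes f :: "'a::euclidean_space \<Rightarrow> 'b::real_normed_vector"
  assumes "closed K" "\<And>x. x \<notin> K \<Longrightarrow> f x = 0" "x \<notin> K"
  shows "frechet_derivative f (at x) v = 0"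
proof -
  have "(f has_derivative (\<lambda>_. 0)) (at x)"
    using has_derivative_transform_within_open[of "\<lambda>_. 0" "\<lambda>_. 0" x UNIV "-K" f] assms by auto
  then show ?thesis using frechet_derivative_at by metis
qed

section \<open>Cutoff functions\<close>

text \<open>For \<open>m = 0\<close> this is the standard function that is flat at 0. The powers of
  \<open>1 / t\<close> are included because derivatives then stay in the linear span of the family,
  so that one induction on the order of differentiability serves all \<open>m\<close>.\<close>

definition flat_exp :: "nat \<Rightarrow> real \<Rightarrow> real" where
  "flat_exp m t = (if t > 0 then (1 / t) ^ m * exp (- (1 / t)) else 0)"

text \<open>Comparison of \<open>exp (1 / t)\<close> with the term of order \<open>m + 2\<close> of
  its series. The exponent 2 on the right makes the difference quotient at 0 tend to 0.\<close>

lemma flat_exp_bound: "\<bar>flat_exp m t\<bar> \<le> fact (m + 2) * t\<^sup>2"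
proof (cases "t > 0")
  case True
  have "(1 / t) ^ (m + 2) / fact (m + 2) \<le> exp (1 / t)"
  proof -
    have "(\<Sum>k\<in>{m + 2}. (1 / t) ^ k /\<^sub>R fact k) \<le> (\<Sum>k. (1 / t) ^ k /\<^sub>R fact k)"
      using True by (intro sum_le_suminf summable_exp_generic) auto
    then show ?thesis by (simp add: exp_def divide_inverse mult.commute)
  qed
  then have "(1 / t) ^ (m + 2) \<le> fact (m + 2) * exp (1 / t)"
    by (simp add: divide_le_eq mult.commute del: fact_Suc power_Suc)
  then have "(1 / t) ^ (m + 2) * exp (- (1 / t)) * t\<^sup>2 \<le> fact (m + 2) * t\<^sup>2"
    by (intro mult_right_mono) (simp_all add: exp_minus divide_le_eq power2_eq_square flip: divide_inverse del: fact_Suc power_Suc)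
  moreover have "(1 / t) ^ (m + 2) * exp (- (1 / t)) * t\<^sup>2 = flat_exp m t"
    using True by (simp add: flat_exp_def power_add field_simps power2_eq_square)
  moreover have "flat_exp m t \<ge> 0" by (simp add: flat_exp_def)
  ultimately show ?thesis by simp
qed (simp add: flat_exp_def)

lemma flat_exp_deriv:
  "(flat_exp m has_real_derivative (flat_exp (m + 2) t - real m * flat_exp (m + 1) t)) (at t)"
proof -
  consider "t > 0" | "t < 0" | "t = 0" by linarith
  then show ?thesis
  proof cases
    case 1
    have "((\<lambda>t. (1 / t) ^ m * exp (- (1 / t))) has_real_derivative
        (flat_exp (m + 2) t - real m * flat_exp (m + 1) t)) (at t)"
    proof -
      have "(\<lambda>t. (1 / t) ^ m) = (\<lambda>t::real. inverse (t ^ m))" by (auto simp: field_simps)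
      moreover have "real m * t ^ (m - Suc 0) * (inverse (t ^ m) * inverse (t ^ m)) = real m * (1 / t) ^ (m + 1)"
        using 1 by (cases m) (auto simp: field_simps)
      ultimately show ?thesis
        using 1 by (auto intro!: derivative_eq_intros simp: flat_exp_def) (simp add: field_simps power2_eq_square)
    qed
    then show ?thesis
      by (rule has_field_derivative_transform_within_open[of _ _ _ "{0<..}"]) (auto simp: 1 flat_exp_def)
  next
    case 2
    have "((\<lambda>t. 0) has_real_derivative (flat_exp (m + 2) t - real m * flat_exp (m + 1) t)) (at t)"
      using 2 by (auto simp: flat_exp_def)
    then show ?thesis
      by (rule has_field_derivative_transform_within_open[of _ _ _ "{..<0}"]) (auto simp: 2 flat_exp_def)
  next
    case 3
    have "((\<lambda>h. (flat_exp m (0 + h) - flat_exp m 0) / h) \<longlongrightarrow> 0) (at 0)"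
    proof (rule Lim_null_comparison[where g = "\<lambda>h. fact (m + 2) * \<bar>h\<bar>"])
      have "norm ((flat_exp m (0 + h) - flat_exp m 0) / h) \<le> fact (m + 2) * \<bar>h\<bar>" if "h \<noteq> 0" for h
      proof -
        have "\<bar>flat_exp m h\<bar> / \<bar>h\<bar> \<le> fact (m + 2) * h\<^sup>2 / \<bar>h\<bar>"
          using flat_exp_bound by (intro divide_right_mono) auto
        also have "\<dots> = fact (m + 2) * \<bar>h\<bar>"
          using that by (metis (no_types, opaque_lifting) abs_mult_self_eq nonzero_mult_div_cancel_right power2_eq_square times_divide_eq_right abs_eq_0 mult.assoc)
        finally show ?thesis by (simp add: flat_exp_def)
      qed
      then show "\<forall>\<^sub>F h in at 0. norm ((flat_exp m (0 + h) - flat_exp m 0) / h) \<le> fact (m + 2) * \<bar>h\<bar>"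
        by (auto simp: eventually_at intro!: exI[of _ 1])
      show "((\<lambda>h::real. fact (m + 2) * \<bar>h\<bar>) \<longlongrightarrow> 0) (at 0)" by (rule tendsto_eq_intros | simp)+
    qed
    then show ?thesis unfolding 3 DERIV_def by (simp add: flat_exp_def)
  qed
qed

lemma Ck_on_flat_exp: "Ck_on k UNIV (flat_exp m)"
proof (induction k arbitrary: m)
  case 0
  then show ?case using flat_exp_deriv by (auto intro!: DERIV_continuous_on)
next
  case (Suc k)
  show ?case
    by (rule Ck_on_real_SucI[OF _ flat_exp_deriv]) (auto intro!: Ck_on_diff Ck_on_mult Ck_on_const Suc)
qed

definition smooth_step :: "real \<Rightarrow> real" where
  "smooth_step t = flat_exp 0 t / (flat_exp 0 t + flat_exp 0 (1 - t))"

lemma smooth_step_denom: "flat_exp 0 t + flat_exp 0 (1 - t) > 0"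
  by (auto simp: flat_exp_def add_pos_pos)

lemma Ck_on_smooth_step: "Ck_on k UNIV smooth_step"
proof -
  have "Ck_on k UNIV (\<lambda>t::real. flat_exp 0 (1 - t))"
    by (rule Ck_on_compose[OF _ _ Ck_on_flat_exp]) (auto intro!: Ck_on_diff Ck_on_const Ck_on_ident)
  then have "Ck_on k UNIV (\<lambda>t. flat_exp 0 t / (flat_exp 0 t + flat_exp 0 (1 - t)))"
    using smooth_step_denom by (intro Ck_on_divide Ck_on_add Ck_on_flat_exp) (auto simp: less_imp_neq[symmetric])
  then show ?thesis unfolding smooth_step_def[abs_def] .
qed

lemma smooth_step_bounds: "0 \<le> smooth_step t" "smooth_step t \<le> 1"
  using smooth_step_denom[of t] by (auto simp: smooth_step_def field_simps flat_exp_def)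

lemma smooth_step_0: "t \<le> 0 \<Longrightarrow> smooth_step t = 0"
  by (simp add: smooth_step_def flat_exp_def)

lemma smooth_step_1: "t \<ge> 1 \<Longrightarrow> smooth_step t = 1"
  by (simp add: smooth_step_def flat_exp_def)

text \<open>The squared distance is polynomial in \<open>x\<close>, hence smooth at the centre too.
  The function is not normalised.\<close>

definition bump :: "'a::euclidean_space \<Rightarrow> real \<Rightarrow> 'a \<Rightarrow> real" where
  "bump a r x = flat_exp 0 (r\<^sup>2 - (x - a) \<bullet> (x - a))"

lemma Ck_on_bump: "Ck_on k UNIV (bump a r)"
  unfolding bump_def[abs_def]
  by (rule Ck_on_compose[OF _ _ Ck_on_flat_exp])
    (auto intro!: Ck_on_diff Ck_on_const Ck_on_inner Ck_on_ident)

lemma bump_nonneg: "bump a r x \<ge> 0"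
  by (simp add: bump_def flat_exp_def)

lemma bump_pos_iff: "r > 0 \<Longrightarrow> bump a r x > 0 \<longleftrightarrow> dist a x < r"
  unfolding bump_def flat_exp_def dist_norm
  by (auto simp: norm_minus_commute[of a x] power2_norm_eq_inner[symmetric] abs_less_iff
      power_mono_iff not_le[symmetric] abs_le_square_iff[of r "norm (x - a)", simplified])

lemma bump_zero: "r > 0 \<Longrightarrow> dist a x \<ge> r \<Longrightarrow> bump a r x = 0"
  using bump_pos_iff[of r a x] bump_nonneg[of a r x] by linarith

section \<open>Derivatives and integrals\<close>

lemma has_real_derivative_along_curve:
  fixes f :: "'a::euclidean_space \<Rightarrow> real"
  assumes "(c has_vector_derivative v) (at t within S)" "f differentiable (at (c t))"
  shows "((\<lambda>s. f (c s)) has_real_derivative frechet_derivative f (at (c t)) v) (at t within S)"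
proof -
  let ?D = "frechet_derivative f (at (c t))"
  have f: "(f has_derivative ?D) (at (c t))" using assms(2) by (simp add: frechet_derivative_works)
  have "((\<lambda>s. f (c s)) has_derivative (\<lambda>s. ?D (s *\<^sub>R v))) (at t within S)"
    using has_derivative_compose[OF assms(1)[unfolded has_vector_derivative_def] f] .
  moreover have "(\<lambda>s. ?D (s *\<^sub>R v)) = (*) (?D v)"
    using linear_scale[OF has_derivative_linear[OF f]] by (auto simp: mult.commute)
  ultimately show ?thesis by (simp add: has_field_derivative_def)
qed

lemma has_real_derivative_along_line:
  fixes f :: "'a::euclidean_space \<Rightarrow> real"
  assumes "f differentiable (at (x + t *\<^sub>R v))"
  shows "((\<lambda>t. f (x + t *\<^sub>R v)) has_real_derivative frechet_derivative f (at (x + t *\<^sub>R v)) v) (at t)"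
proof -
  have "((\<lambda>t. x + t *\<^sub>R v) has_vector_derivative v) (at t)" by (auto intro!: derivative_eq_intros)
  then show ?thesis by (rule has_real_derivative_along_curve[where c = "\<lambda>t. x + t *\<^sub>R v", OF _ assms])
qed

lemma mvt_along_line:
  fixes f :: "'a::euclidean_space \<Rightarrow> real"
  assumes "s > 0" "\<And>t. 0 \<le> t \<Longrightarrow> t \<le> s \<Longrightarrow> f differentiable (at (x + t *\<^sub>R v))"
  obtains t where "0 < t" "t < s" "f (x + s *\<^sub>R v) - f x = s * frechet_derivative f (at (x + t *\<^sub>R v)) v"
proof -
  have "\<exists>z>0. z < s \<and> f (x + s *\<^sub>R v) - f (x + 0 *\<^sub>R v) = (s - 0) * frechet_derivative f (at (x + z *\<^sub>R v)) v"
    by (rule MVT2[OF assms(1)]) (rule has_real_derivative_along_line[OF assms(2)])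
  then show ?thesis using that by auto
qed

section \<open>Symmetry of second derivatives\<close>

lemma frechet_derivative_diff_shift:
  fixes f :: "'a::euclidean_space \<Rightarrow> real"
  assumes "f differentiable (at (x + w))" "f differentiable (at x)"
  shows "(\<lambda>y. f (y + w) - f y) differentiable (at x)"
    "frechet_derivative (\<lambda>y. f (y + w) - f y) (at x) v =
     frechet_derivative f (at (x + w)) v - frechet_derivative f (at x) v"
proof -
  have 1: "((\<lambda>y. y + w) has_derivative (\<lambda>v. v)) (at x)" by (auto intro!: derivative_eq_intros)
  have "((\<lambda>y. f (y + w) - f y) has_derivative
      (\<lambda>v. frechet_derivative f (at (x + w)) v - frechet_derivative f (at x) v)) (at x)"
    using has_derivative_diff[OF has_derivative_compose[OF 1]] assms frechet_derivative_works by blast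
  then show "(\<lambda>y. f (y + w) - f y) differentiable (at x)"
    "frechet_derivative (\<lambda>y. f (y + w) - f y) (at x) v =
     frechet_derivative f (at (x + w)) v - frechet_derivative f (at x) v"
    using frechet_derivative_at[of "\<lambda>y. f (y + w) - f y" _ x, symmetric] by (auto simp: differentiable_def)
qed

text \<open>The mean value theorem twice: along \<open>v\<close> for the difference of
  \<open>f\<close> in the direction \<open>s w\<close>, then along \<open>w\<close> for the
  derivative of \<open>f\<close> in the direction \<open>v\<close>. The left side is symmetric in
  \<open>v\<close> and \<open>w\<close>, and the symmetry of second derivatives rests on
  this.\<close>

lemma second_difference:
  fixes f :: "'a::euclidean_space \<Rightarrow> real"
  assumes "Ck_on 2 U f" "s > 0"
    and "\<And>a b. 0 \<le> a \<Longrightarrow> a \<le> s \<Longrightarrow> 0 \<le> b \<Longrightarrow> b \<le> s \<Longrightarrow> x + a *\<^sub>R v + b *\<^sub>R w \<in> U"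
  obtains a b where "0 < a" "a < s" "0 < b" "b < s"
    "f (x + s *\<^sub>R v + s *\<^sub>R w) - f (x + s *\<^sub>R v) - f (x + s *\<^sub>R w) + f x =
     s\<^sup>2 * frechet_derivative (\<lambda>y. frechet_derivative f (at y) v) (at (x + a *\<^sub>R v + b *\<^sub>R w)) w"
proof -
  have f: "\<And>y. y \<in> U \<Longrightarrow> f differentiable (at y)"
    "\<And>y. y \<in> U \<Longrightarrow> (\<lambda>y. frechet_derivative f (at y) v) differentiable (at y)"
    using assms(1) by (auto simp: numeral_2_eq_2)
  have in1: "x + a *\<^sub>R v \<in> U" if "0 \<le> a" "a \<le> s" for a using assms(2) assms(3)[of a 0] that by auto
  have in2: "x + a *\<^sub>R v + s *\<^sub>R w \<in> U" if "0 \<le> a" "a \<le> s" for a using assms(2) assms(3)[of a s] that by auto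
  obtain a where a: "0 < a" "a < s"
    "(\<lambda>y. f (y + s *\<^sub>R w) - f y) (x + s *\<^sub>R v) - (\<lambda>y. f (y + s *\<^sub>R w) - f y) x =
     s * frechet_derivative (\<lambda>y. f (y + s *\<^sub>R w) - f y) (at (x + a *\<^sub>R v)) v"
    using mvt_along_line[OF assms(2), of "\<lambda>y. f (y + s *\<^sub>R w) - f y" x v]
      frechet_derivative_diff_shift(1)[OF f(1)[OF in2] f(1)[OF in1]] by blast
  have a2: "frechet_derivative (\<lambda>y. f (y + s *\<^sub>R w) - f y) (at (x + a *\<^sub>R v)) v =
     frechet_derivative f (at (x + a *\<^sub>R v + s *\<^sub>R w)) v - frechet_derivative f (at (x + a *\<^sub>R v)) v"
    using a by (intro frechet_derivative_diff_shift(2) f in1 in2) auto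
  obtain b where b: "0 < b" "b < s" "frechet_derivative f (at (x + a *\<^sub>R v + s *\<^sub>R w)) v - frechet_derivative f (at (x + a *\<^sub>R v)) v
     = s * frechet_derivative (\<lambda>y. frechet_derivative f (at y) v) (at (x + a *\<^sub>R v + b *\<^sub>R w)) w"
    using mvt_along_line[OF assms(2), of "\<lambda>y. frechet_derivative f (at y) v" "x + a *\<^sub>R v" w] f(2) assms(3) a by auto
  show ?thesis using a b a2 by (intro that[of a b]) (auto simp: power2_eq_square algebra_simps)
qed

theorem second_derivative_symmetric_real:
  fixes f :: "'a::euclidean_space \<Rightarrow> real"
  assumes "open U" "Ck_on 2 U f" "x \<in> U"
  shows "frechet_derivative (\<lambda>y. frechet_derivative f (at y) v) (at x) w =
         frechet_derivative (\<lambda>y. frechet_derivative f (at y) w) (at x) v" (is "?A x = ?B x")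
proof (rule ccontr)
  assume ne: "?A x \<noteq> ?B x"
  \<comment> \<open>The same second difference yields a point near \<open>x\<close> for each of the
    two mixed derivatives at which their values coincide. With \<open>e\<close> half the gap at
    \<open>x\<close>, continuity makes this impossible.\<close>
  define e where "e = \<bar>?A x - ?B x\<bar> / 2"
  have e: "e > 0" using ne by (simp add: e_def)
  have c: "continuous_on U ?A" "continuous_on U ?B" using assms(2) by (auto simp: numeral_2_eq_2)
  obtain d1 where d1: "d1 > 0" "\<And>y. y \<in> U \<Longrightarrow> dist y x < d1 \<Longrightarrow> dist (?A y) (?A x) < e"
    using c(1) assms(3) e unfolding continuous_on_iff by metis
  obtain d2 where d2: "d2 > 0" "\<And>y. y \<in> U \<Longrightarrow> dist y x < d2 \<Longrightarrow> dist (?B y) (?B x) < e"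
    using c(2) assms(3) e unfolding continuous_on_iff by metis
  obtain d3 where d3: "d3 > 0" "\<And>y. dist y x < d3 \<Longrightarrow> y \<in> U"
    using assms(1,3) by (meson open_dist)
  define d where "d = min d1 (min d2 d3)"
  \<comment> \<open>Small enough for the whole parallelogram with sides \<open>s v\<close> and
    \<open>s w\<close> to stay within distance \<open>d\<close> of \<open>x\<close>; the summand 1
    keeps the denominator positive.\<close>
  define s where "s = d / (2 * (norm v + norm w + 1))"
  have d: "d > 0" using d1 d2 d3 by (simp add: d_def)
  have s: "s > 0" using d by (simp add: s_def add_nonneg_pos)
  have sm: "s * (norm v + norm w) < d"
  proof -
    have "s * (norm v + norm w) \<le> s * (norm v + norm w + 1)" using s by simp
    also have "\<dots> = d / 2"
    proof -
      have "norm v + norm w + 1 > 0" by (simp add: add_nonneg_pos)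
      then show ?thesis by (simp add: s_def field_simps)
    qed
    finally show ?thesis using d by simp
  qed
  have nr: "dist (x + a *\<^sub>R v + b *\<^sub>R w) x < d" if "0 \<le> a" "a \<le> s" "0 \<le> b" "b \<le> s" for a b
  proof -
    have "dist (x + a *\<^sub>R v + b *\<^sub>R w) x \<le> a * norm v + b * norm w"
      using that norm_triangle_ineq[of "a *\<^sub>R v" "b *\<^sub>R w"] by (simp add: dist_norm add.assoc)
    also have "\<dots> \<le> s * (norm v + norm w)" using that by (simp add: distrib_left add_mono mult_right_mono)
    finally show ?thesis using sm by simp
  qed
  have nr': "dist (x + a *\<^sub>R w + b *\<^sub>R v) x < d" if "0 \<le> a" "a \<le> s" "0 \<le> b" "b \<le> s" for a b
    using nr[of b a] that by (simp add: algebra_simps)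
  have inU: "y \<in> U" if "dist y x < d" for y using d3(2) that by (simp add: d_def)
  obtain a b where ab: "0 < a" "a < s" "0 < b" "b < s"
    "f (x + s *\<^sub>R v + s *\<^sub>R w) - f (x + s *\<^sub>R v) - f (x + s *\<^sub>R w) + f x = s\<^sup>2 * ?A (x + a *\<^sub>R v + b *\<^sub>R w)"
    using second_difference[OF assms(2) s, of x v w] nr inU by metis
  obtain a' b' where ab': "0 < a'" "a' < s" "0 < b'" "b' < s"
    "f (x + s *\<^sub>R w + s *\<^sub>R v) - f (x + s *\<^sub>R w) - f (x + s *\<^sub>R v) + f x = s\<^sup>2 * ?B (x + a' *\<^sub>R w + b' *\<^sub>R v)"
    using second_difference[OF assms(2) s, of x w v] nr' inU by metis
  have "s\<^sup>2 * ?A (x + a *\<^sub>R v + b *\<^sub>R w) = s\<^sup>2 * ?B (x + a' *\<^sub>R w + b' *\<^sub>R v)"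
    using ab(5) ab'(5) by (simp add: algebra_simps)
  then have "?A (x + a *\<^sub>R v + b *\<^sub>R w) = ?B (x + a' *\<^sub>R w + b' *\<^sub>R v)" using s by simp
  moreover have "dist (?A (x + a *\<^sub>R v + b *\<^sub>R w)) (?A x) < e"
    using nr[of a b] ab inU by (intro d1) (auto simp: d_def)
  moreover have "dist (?B (x + a' *\<^sub>R w + b' *\<^sub>R v)) (?B x) < e"
    using nr'[of a' b'] ab' inU by (intro d2) (auto simp: d_def)
  ultimately show False unfolding e_def dist_real_def by argo
qed

lemma frechet_derivative_linear_image:
  assumes "f differentiable (at x)" "bounded_linear L"
  shows "frechet_derivative (\<lambda>y. L (f y)) (at x) v = L (frechet_derivative f (at x) v)"
proof -
  have "((\<lambda>y. L (f y)) has_derivative (\<lambda>v. L (frechet_derivative f (at x) v))) (at x)"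
    using bounded_linear.has_derivative[OF assms(2)] assms(1) frechet_derivative_works by blast
  then show ?thesis using frechet_derivative_at by metis
qed

theorem second_derivative_symmetric:
  fixes f :: "'a::euclidean_space \<Rightarrow> 'b::euclidean_space"
  assumes "open U" "Ck_on 2 U f" "x \<in> U"
  shows "frechet_derivative (\<lambda>y. frechet_derivative f (at y) v) (at x) w =
         frechet_derivative (\<lambda>y. frechet_derivative f (at y) w) (at x) v"
proof (rule euclidean_eqI)
  fix b :: 'b assume "b \<in> Basis"
  have bl: "bounded_linear (\<lambda>z. z \<bullet> b)" by (rule bounded_linear_inner_left)
  have df: "f differentiable (at y)" "(\<lambda>y. frechet_derivative f (at y) v) differentiable (at y)" if "y \<in> U" for y v
    using assms(2) that by (auto simp: numeral_2_eq_2)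
  have 1: "frechet_derivative (\<lambda>y. frechet_derivative (\<lambda>y. f y \<bullet> b) (at y) v) (at x) w =
      frechet_derivative (\<lambda>y. frechet_derivative f (at y) v) (at x) w \<bullet> b" for v w
  proof -
    have "((\<lambda>y. frechet_derivative f (at y) v \<bullet> b) has_derivative
        (\<lambda>w. frechet_derivative (\<lambda>y. frechet_derivative f (at y) v) (at x) w \<bullet> b)) (at x)"
      using bounded_linear.has_derivative[OF bl] df(2)[OF assms(3)] frechet_derivative_works by blast
    then have "((\<lambda>y. frechet_derivative (\<lambda>y. f y \<bullet> b) (at y) v) has_derivative
        (\<lambda>w. frechet_derivative (\<lambda>y. frechet_derivative f (at y) v) (at x) w \<bullet> b)) (at x)"
      by (rule has_derivative_transform_within_open[OF _ assms(1,3)])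
        (simp add: frechet_derivative_linear_image[OF df(1) bl])
    then show ?thesis using frechet_derivative_at by metis
  qed
  show "frechet_derivative (\<lambda>y. frechet_derivative f (at y) v) (at x) w \<bullet> b =
      frechet_derivative (\<lambda>y. frechet_derivative f (at y) w) (at x) v \<bullet> b"
    unfolding 1[symmetric]
    by (rule second_derivative_symmetric_real[OF assms(1) _ assms(3)]) (rule Ck_on_linear[OF assms(1) bl assms(2)])
qed

section \<open>Integrals of derivatives of compactly supported functions\<close>

lemma integrable_continuous_compact_support:
  fixes f :: "'a::euclidean_space \<Rightarrow> 'b::{banach, second_countable_topology}"
  assumes "continuous_on UNIV f" "compact K" "\<And>x. x \<notin> K \<Longrightarrow> f x = 0"
  shows "integrable lborel f"
proof -
  have "integrable lborel (\<lambda>x. indicator K x *\<^sub>R f x)"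
    using assms by (intro borel_integrable_compact) (auto intro: continuous_on_subset)
  moreover have "indicator K x *\<^sub>R f x = f x" for x using assms(3) by (auto simp: indicator_def)
  ultimately show ?thesis by simp
qed

lemma lborel_integral_translate:
  fixes f :: "'a::euclidean_space \<Rightarrow> 'b::{banach, second_countable_topology}"
  assumes "f \<in> borel_measurable borel"
  shows "(LINT x|lborel. f (c + x)) = (LINT x|lborel. f x)"
proof -
  have "(LINT x|lborel. f x) = (LINT x|distr lborel borel ((+) c). f x)" by (simp only: lborel_distr_plus)
  also have "\<dots> = (LINT x|lborel. f (c + x))" using assms by (intro integral_distr) auto
  finally show ?thesis ..
qed

lemma bounded_continuous_compact_support:
  fixes f :: "'a::euclidean_space \<Rightarrow> 'b::real_normed_vector"
  assumes "continuous_on UNIV f" "compact K" "\<And>x. x \<notin> K \<Longrightarrow> f x = 0"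
  obtains M where "M \<ge> 0" "\<And>x. norm (f x) \<le> M"
proof -
  have "bounded (f ` K)"
    using assms by (intro compact_imp_bounded compact_continuous_image) (auto intro: continuous_on_subset)
  then obtain M where "\<And>x. x \<in> K \<Longrightarrow> norm (f x) \<le> M" by (auto simp: bounded_iff)
  then show ?thesis using that[of "max 0 M"] assms(3) by (metis max.cobounded1 max.coboundedI2 norm_zero)
qed

text \<open>Each difference quotient in the direction \<open>v\<close> has integral 0 by translation
  invariance; the quotients are bounded by the supremum of the derivative and converge to it, so
  dominated convergence applies.\<close>

theorem integral_directional_derivative_zero:
  fixes f :: "'a::euclidean_space \<Rightarrow> real"
  assumes f: "Ck_on 1 UNIV f" and K: "compact K" "\<And>x. x \<notin> K \<Longrightarrow> f x = 0"
  shows "(LINT x|lborel. frechet_derivative f (at x) v) = 0"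
proof -
  let ?D = "\<lambda>x. frechet_derivative f (at x) v"
  have diff: "f differentiable (at x)" for x using f by auto
  have cf: "continuous_on UNIV f" and cD: "continuous_on UNIV ?D"
    using Ck_on_continuous_on[OF f] f by auto
  have D0: "?D x = 0" if "x \<notin> K" for x
    using frechet_derivative_zero_outside[OF compact_imp_closed[OF K(1)] K(2) that] .
  obtain M where M: "M \<ge> 0" "\<And>x. norm (?D x) \<le> M"
    using bounded_continuous_compact_support[OF cD K(1) D0] by blast
  define s where "s n = 1 / real (Suc n)" for n
  have s: "s n > 0" "s n \<le> 1" for n by (auto simp: s_def)
  define g where "g n x = (f (x + s n *\<^sub>R v) - f x) / s n" for n x
  \<comment> \<open>All points from which a translation by at most \<open>v\<close> reaches
    \<open>K\<close>. As the step sizes are at most 1, this one compact set carries all difference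
    quotients.\<close>
  define K' where "K' = (\<lambda>(x, t). x - t *\<^sub>R v) ` (K \<times> {0..1::real})"
  have K': "compact K'"
    unfolding K'_def using K(1)
    by (intro compact_continuous_image compact_Times) (auto intro!: continuous_intros simp: split_beta)
  have gb: "norm (g n x) \<le> M * indicator K' x" for n x
  proof (cases "x \<in> K'")
    case True
    obtain t where "f (x + s n *\<^sub>R v) - f x = s n * ?D (x + t *\<^sub>R v)"
      using mvt_along_line[OF s(1)] diff by metis
    then show ?thesis using True M(2)[of "x + t *\<^sub>R v"] s[of n] by (simp add: g_def)
  next
    case False
    have "x \<notin> K" "x + s n *\<^sub>R v \<notin> K"
      using False s[of n] by (force simp: K'_def image_iff)+
    then show ?thesis using K(2) M(1) by (simp add: g_def)
  qed
  have sl: "s \<longlonglongrightarrow> 0" unfolding s_def by (rule LIMSEQ_Suc[OF lim_1_over_n])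
  have lim: "(\<lambda>n. g n x) \<longlonglongrightarrow> ?D x" for x
  proof -
    have "((\<lambda>t. f (x + t *\<^sub>R v)) has_real_derivative ?D x) (at 0)"
      using has_real_derivative_along_line[of f x 0 v] diff by simp
    then have "((\<lambda>h. (f (x + h *\<^sub>R v) - f x) / h) \<longlongrightarrow> ?D x) (at 0)" by (simp add: DERIV_def)
    moreover have "filterlim s (at 0) sequentially"
      using sl s(1) by (auto simp: filterlim_at less_imp_neq[symmetric])
    ultimately show ?thesis unfolding g_def by (rule filterlim_compose)
  qed
  have fm: "f \<in> borel_measurable borel" using cf by (rule borel_measurable_continuous_onI)
  have gm: "g n \<in> borel_measurable borel" for n
    unfolding g_def by (intro borel_measurable_continuous_onI)
      (use cf s in \<open>auto intro!: continuous_intros continuous_on_compose2[OF cf] simp: less_imp_neq[symmetric]\<close>)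
  have intf: "integrable lborel f" by (rule integrable_continuous_compact_support[OF cf K])
  have gz: "(LINT x|lborel. g n x) = 0" for n
  proof -
    have m: "f \<in> borel_measurable lborel" using fm by simp
    have "integrable (distr lborel borel ((+) (s n *\<^sub>R v))) f" using intf by (simp add: lborel_distr_plus)
    then have "integrable lborel (\<lambda>x. f (s n *\<^sub>R v + x))" by (subst (asm) integrable_distr_eq) (auto intro: fm)
    then show ?thesis
      using lborel_integral_translate[OF fm, of "s n *\<^sub>R v"] intf by (simp add: g_def add.commute)
  qed
  have "(\<lambda>n. LINT x|lborel. g n x) \<longlonglongrightarrow> (LINT x|lborel. ?D x)"
  proof (rule integral_dominated_convergence[where w = "\<lambda>x. M * indicator K' x"])
    show "integrable lborel (\<lambda>x. M * indicator K' x)"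
      using K' by (intro integrable_mult_right) (auto intro!: integrable_real_indicator borel_compact emeasure_bounded_finite compact_imp_bounded)
  qed (use cD gm gb lim in \<open>auto intro: borel_measurable_continuous_onI\<close>)
  then show ?thesis by (simp add: gz LIMSEQ_const_iff)
qed

definition euclidean_div :: "('a::euclidean_space \<Rightarrow> 'a) \<Rightarrow> 'a \<Rightarrow> real" where
  "euclidean_div Z x = (\<Sum>b\<in>Basis. frechet_derivative Z (at x) b \<bullet> b)"

theorem integral_euclidean_div_zero:
  fixes Z :: "'a::euclidean_space \<Rightarrow> 'a"
  assumes Z: "Ck_on 1 UNIV Z" and K: "compact K" "\<And>x. x \<notin> K \<Longrightarrow> Z x = 0"
  shows "(LINT x|lborel. euclidean_div Z x) = 0"
proof -
  have d: "frechet_derivative Z (at x) b \<bullet> b = frechet_derivative (\<lambda>x. Z x \<bullet> b) (at x) b" for x b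
    using Z frechet_derivative_linear_image[OF _ bounded_linear_inner_left, of Z] by simp
  have Zb: "Ck_on 1 UNIV (\<lambda>x. Z x \<bullet> b)" for b
    by (rule Ck_on_linear[OF _ bounded_linear_inner_left Z]) simp
  have "(LINT x|lborel. euclidean_div Z x) =
      (\<Sum>b\<in>Basis. LINT x|lborel. frechet_derivative (\<lambda>x. Z x \<bullet> b) (at x) b)"
    unfolding euclidean_div_def d
  proof (rule Bochner_Integration.integral_sum)
    fix b :: 'a
    show "integrable lborel (\<lambda>x. frechet_derivative (\<lambda>x. Z x \<bullet> b) (at x) b)"
    proof (rule integrable_continuous_compact_support[OF _ K(1)])
      show "continuous_on UNIV (\<lambda>x. frechet_derivative (\<lambda>x. Z x \<bullet> b) (at x) b)"
        using Zb by simp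
      show "frechet_derivative (\<lambda>x. Z x \<bullet> b) (at x) b = 0" if "x \<notin> K" for x
        by (rule frechet_derivative_zero_outside[OF compact_imp_closed[OF K(1)] _ that]) (simp add: K(2))
    qed
  qed
  also have "\<dots> = 0" using integral_directional_derivative_zero[OF Zb K(1)] K(2) by simp
  finally show ?thesis .
qed

lemma euclidean_div_scaleR:
  assumes "f differentiable (at x)" "Z differentiable (at x)"
  shows "euclidean_div (\<lambda>x. f x *\<^sub>R Z x) x = f x * euclidean_div Z x + frechet_derivative f (at x) (Z x)"
proof -
  have f: "(f has_derivative frechet_derivative f (at x)) (at x)"
    and Z: "(Z has_derivative frechet_derivative Z (at x)) (at x)"
    using assms frechet_derivative_works by auto
  have "frechet_derivative (\<lambda>x. f x *\<^sub>R Z x) (at x) =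
      (\<lambda>v. f x *\<^sub>R frechet_derivative Z (at x) v + frechet_derivative f (at x) v *\<^sub>R Z x)"
    by (rule frechet_derivative_at[OF has_derivative_scaleR[OF f Z], symmetric])
  moreover have "frechet_derivative f (at x) (Z x) = (\<Sum>b\<in>Basis. (Z x \<bullet> b) * frechet_derivative f (at x) b)"
    using linear_sum_Basis[OF has_derivative_linear[OF f], of "Z x"] by simp
  ultimately show ?thesis
    by (simp add: euclidean_div_def inner_add_left sum.distrib sum_distrib_left mult.commute)
qed

text \<open>Near a point where \<open>\<partial>\<^sub>v f \<noteq> 0\<close> the zero set meets each line parallel to \<open>v\<close> at most once, so its
  translates by distinct multiples of \<open>v\<close> are disjoint sets of equal measure inside a bounded set.\<close>

theorem negligible_zeros_with_nonzero_derivative: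
  fixes f :: "'a::euclidean_space \<Rightarrow> real"
  assumes U: "open U" and f: "Ck_on 1 U f"
  shows "negligible {x \<in> U. f x = 0 \<and> frechet_derivative f (at x) v \<noteq> 0}"
proof -
  let ?D = "\<lambda>x. frechet_derivative f (at x) v"
  let ?S = "{x \<in> U. f x = 0 \<and> ?D x \<noteq> 0}"
  have cD: "continuous_on U ?D" and cf: "continuous_on U f"
    using f Ck_on_continuous_on[OF f] by auto
  have "\<exists>V. openin (top_of_set ?S) V \<and> x \<in> V \<and> negligible V" if x: "x \<in> ?S" for x
  proof -
    have "open (U \<inter> ?D -` (- {0}))" using cD U continuous_open_preimage by blast
    then obtain r where r: "r > 0" "cball x r \<subseteq> U \<inter> ?D -` (- {0})"
      using x by (metis (mono_tags, lifting) ComplI Int_iff mem_Collect_eq open_contains_cball singletonD vimageI)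
    define B where "B = ball x r"
    have B: "convex B" "B \<subseteq> U" "\<And>y. y \<in> B \<Longrightarrow> ?D y \<noteq> 0" "open B" "x \<in> B"
      using r unfolding B_def by (auto simp: subset_iff)
    define E where "E = {y \<in> B. f y = 0}"
    have E: "E \<in> lmeasurable"
    proof (rule bounded_set_imp_lmeasurable)
      have "open (B \<inter> f -` (- {0}))"
        using continuous_on_subset[OF cf B(2)] B(4) continuous_open_preimage by blast
      moreover have "E = B - (B \<inter> f -` (- {0}))" by (auto simp: E_def)
      ultimately show "E \<in> sets lebesgue" using B(4) by auto
      show "bounded E" by (rule bounded_subset[of "ball x r"]) (auto simp: E_def B_def)
    qed
    have line: "s = 0" if "y \<in> E" "y + s *\<^sub>R v \<in> E" "s \<ge> 0" for y s
    proof (rule ccontr)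
      assume "s \<noteq> 0"
      then have s: "s > 0" using that by simp
      have seg: "y + t *\<^sub>R v \<in> B" if "0 \<le> t" "t \<le> s" for t
      proof -
        have "y + t *\<^sub>R v = (1 - t / s) *\<^sub>R y + (t / s) *\<^sub>R (y + s *\<^sub>R v)"
          using s by (simp add: algebra_simps)
        then show ?thesis using convexD_alt[OF B(1), of y "y + s *\<^sub>R v" "t / s"] that \<open>y \<in> E\<close> \<open>y + s *\<^sub>R v \<in> E\<close> s
          by (simp add: E_def)
      qed
      obtain t where "0 < t" "t < s" "f (y + s *\<^sub>R v) - f y = s * ?D (y + t *\<^sub>R v)"
        using mvt_along_line[OF s, of f y v] seg B(2) f by (auto simp: subset_iff)
      then show False using that s B(3)[OF seg[of t]] by (auto simp: E_def)
    qed
    define T where "T i = (+) ((1 / real (Suc i)) *\<^sub>R v) ` E" for i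
    have disj: "disjnt (T i) (T j)" if "i \<noteq> j" for i j
    proof -
      have *: "disjnt ((+) (p *\<^sub>R v) ` E) ((+) (q *\<^sub>R v) ` E)" if "p < q" for p q
      proof -
        have False if "y \<in> E" "z \<in> E" "p *\<^sub>R v + y = q *\<^sub>R v + z" for y z
        proof -
          have "y = z + (q - p) *\<^sub>R v" using that(3) by (simp add: algebra_simps)
          then show False using line[of z "q - p"] that(1,2) \<open>p < q\<close> by auto
        qed
        then show ?thesis unfolding disjnt_iff by blast
      qed
      show ?thesis
      proof (cases "1 / real (Suc i) < 1 / real (Suc j)")
        case True
        then show ?thesis unfolding T_def by (rule *)
      next
        case False
        then have "1 / real (Suc j) < 1 / real (Suc i)" using that by (simp add: field_simps)
        from *[OF this] show ?thesis unfolding T_def by (rule disjnt_sym)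
      qed
    qed
    have Tm: "T i \<in> lmeasurable" "measure lebesgue (T i) = measure lebesgue E" for i
      unfolding T_def using E measure_translation measurable_translation by auto
    define R where "R = r + norm v"
    have sub: "T i \<subseteq> ball x R" for i
    proof
      fix y assume "y \<in> T i"
      then obtain z where z: "dist x z < r" "y = (1 / real (Suc i)) *\<^sub>R v + z" by (auto simp: T_def E_def B_def)
      have "dist x y \<le> dist x z + norm ((1 / real (Suc i)) *\<^sub>R v)"
        unfolding z dist_norm by (metis add.commute diff_add_eq_diff_diff_swap norm_triangle_ineq4)
      also have "norm ((1 / real (Suc i)) *\<^sub>R v) \<le> norm v"
        using mult_right_mono[of "1 / real (Suc i)" 1 "norm v"] by simp
      finally show "y \<in> ball x R" using z by (simp add: R_def)
    qed
    have "real n * measure lebesgue E \<le> measure lebesgue (ball x R)" for n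
    proof -
      have "measure lebesgue (\<Union>i\<in>{..<n}. T i) = (\<Sum>i<n. measure lebesgue (T i))"
        by (rule measure_UNION') (auto simp: Tm pairwise_def disj)
      moreover have "measure lebesgue (\<Union>i\<in>{..<n}. T i) \<le> measure lebesgue (ball x R)"
        using sub Tm by (intro measure_mono_fmeasurable) (auto intro!: fmeasurableD)
      ultimately show ?thesis by (simp add: Tm)
    qed
    then have "measure lebesgue E \<le> 0"
      using reals_Archimedean3[of "measure lebesgue E"] by (meson not_le order.strict_trans2 order_less_irrefl)
    then have "negligible E" using E by (simp add: negligible_iff_measure measure_le_0_iff)
    moreover have "?S \<inter> B \<subseteq> E" by (auto simp: E_def)
    ultimately have "negligible (?S \<inter> B)" using negligible_subset by blast
    moreover have "openin (top_of_set ?S) (?S \<inter> B)" using B(4) by (simp add: openin_open_Int)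
    ultimately show ?thesis using x B(5) by blast
  qed
  then show ?thesis using locally_negligible_alt[of ?S] by simp
qed

lemma Lipschitz_C1_compact_support:
  fixes f :: "'a::euclidean_space \<Rightarrow> 'b::euclidean_space"
  assumes f: "Ck_on 1 UNIV f" and K: "compact K" "\<And>x. x \<notin> K \<Longrightarrow> f x = 0"
  obtains L where "L \<ge> 0" "\<And>x y. norm (f x - f y) \<le> L * norm (x - y)"
proof -
  have "\<exists>M\<ge>0. \<forall>x. norm (frechet_derivative f (at x) b) \<le> M" for b
  proof -
    have c: "continuous_on UNIV (\<lambda>x. frechet_derivative f (at x) b)"
      by (rule C1_on_continuous_derivative[OF f])
    have z: "frechet_derivative f (at x) b = 0" if "x \<notin> K" for x
      by (rule frechet_derivative_zero_outside[OF compact_imp_closed[OF K(1)] K(2) that])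
    show ?thesis by (rule bounded_continuous_compact_support[OF c K(1) z]) auto
  qed
  then have "\<exists>M. \<forall>b. M b \<ge> 0 \<and> (\<forall>x. norm (frechet_derivative f (at x) b) \<le> M b)"
    by (intro choice) blast
  then obtain M where M: "\<And>b. M b \<ge> 0" "\<And>b x. norm (frechet_derivative f (at x) b) \<le> M b" by blast
  have der: "(f has_derivative frechet_derivative f (at x)) (at x)" for x
    using C1_on_has_derivative[OF f] by simp
  have "onorm (frechet_derivative f (at x)) \<le> (\<Sum>b\<in>Basis. M b)" for x
  proof (rule onorm_bound)
    show "0 \<le> sum M Basis" using M(1) by (simp add: sum_nonneg)
    fix v
    have "norm (frechet_derivative f (at x) v) \<le> (\<Sum>b\<in>Basis. norm ((v \<bullet> b) *\<^sub>R frechet_derivative f (at x) b))"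
      using linear_sum_Basis[OF has_derivative_linear[OF der[of x]], of v] norm_sum by metis
    also have "\<dots> \<le> (\<Sum>b\<in>Basis. norm v * M b)"
      by (intro sum_mono) (auto intro!: mult_mono Basis_le_norm M)
    finally show "norm (frechet_derivative f (at x) v) \<le> sum M Basis * norm v"
      by (simp add: sum_distrib_left mult.commute)
  qed
  then have "norm (f x - f y) \<le> (\<Sum>b\<in>Basis. M b) * norm (x - y)" for x y
    using differentiable_bound[of UNIV f "\<lambda>x. frechet_derivative f (at x)"] der by auto
  moreover have "0 \<le> sum M Basis" using M(1) by (simp add: sum_nonneg)
  ultimately show ?thesis using that by blast
qed

section \<open>Mollification along an invariant vector field\<close>

lemma norm_integral_le:
  fixes f :: "'a \<Rightarrow> 'b::{banach, second_countable_topology}"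
  assumes "integrable M f" "integrable M g" "\<And>x. norm (f x) \<le> g x"
  shows "norm (LINT x|M. f x) \<le> (LINT x|M. g x)"
  using order_trans[OF integral_norm_bound integral_mono[OF integrable_norm[OF assms(1)] assms(2,3)]] .

lemma has_derivative_quadratic:
  fixes G :: "'a::euclidean_space \<Rightarrow> 'b::real_normed_vector"
  assumes "linear D" "\<And>v. norm v \<le> 1 \<Longrightarrow> norm (G (x + v) - G x - D v) \<le> C * (norm v)\<^sup>2"
  shows "(G has_derivative D) (at x)"
  unfolding has_derivative_at
proof
  show "bounded_linear D" using assms(1) linear_conv_bounded_linear by blast
  show "(\<lambda>h. norm (G (x + h) - G x - D h) / norm h) \<midarrow>0\<rightarrow> 0"
  proof (rule Lim_null_comparison[where g = "\<lambda>h. C * norm h"])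
    have "norm (norm (G (x + h) - G x - D h) / norm h) \<le> C * norm h" if "h \<noteq> 0" "norm h \<le> 1" for h
      using assms(2)[OF that(2)] that(1) by (simp add: divide_le_eq power2_eq_square mult.assoc)
    then show "\<forall>\<^sub>F h in at 0. norm (norm (G (x + h) - G x - D h) / norm h) \<le> C * norm h"
      unfolding eventually_at by (intro exI[of _ 1]) auto
    show "((\<lambda>h. C * norm h) \<longlongrightarrow> 0) (at 0)" by (rule tendsto_eq_intros | simp)+
  qed
qed

lemma Taylor2_compact_support:
  fixes g :: "'a::euclidean_space \<Rightarrow> real"
  assumes g: "Ck_on 2 UNIV g" and K: "compact K" "\<And>x. x \<notin> K \<Longrightarrow> g x = 0"
  obtains C where "C \<ge> 0"
    "\<And>w v. \<bar>g (w + v) - g w - frechet_derivative g (at w) v\<bar> \<le> C * (norm v)\<^sup>2"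
proof -
  let ?D = "\<lambda>b x. frechet_derivative g (at x) b"
  have g1: "Ck_on 1 UNIV g" by (rule Ck_on_mono[OF g]) simp
  have Db: "Ck_on 1 UNIV (?D b)" for b using g by (simp add: numeral_2_eq_2)
  have "\<exists>L\<ge>0. \<forall>x y. norm (?D b x - ?D b y) \<le> L * norm (x - y)" for b
    by (rule Lipschitz_C1_compact_support[OF Db K(1)
          frechet_derivative_zero_outside[OF compact_imp_closed[OF K(1)] K(2)]]) auto
  then have "\<exists>L. \<forall>b. L b \<ge> 0 \<and> (\<forall>x y. norm (?D b x - ?D b y) \<le> L b * norm (x - y))"
    by (intro choice) blast
  then obtain L where L: "\<And>b. L b \<ge> 0" "\<And>b x y. norm (?D b x - ?D b y) \<le> L b * norm (x - y)" by blast
  show ?thesis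
  proof (rule that[of "\<Sum>b\<in>Basis. L b"])
    show "0 \<le> sum L Basis" by (simp add: sum_nonneg L)
    fix w v
    obtain t where t: "0 < t" "t < 1" "g (w + 1 *\<^sub>R v) - g w = 1 * ?D v (w + t *\<^sub>R v)"
      by (rule mvt_along_line[of 1 g w v]) (use C1_on_differentiable[OF g1] in auto)
    have lin: "linear (\<lambda>v. ?D v x)" for x
      using C1_on_has_derivative[OF g1] has_derivative_linear by blast
    have "?D v (w + t *\<^sub>R v) - ?D v w = (\<Sum>b\<in>Basis. (v \<bullet> b) * (?D b (w + t *\<^sub>R v) - ?D b w))"
      using linear_sum_Basis[OF lin[of "w + t *\<^sub>R v"], of v] linear_sum_Basis[OF lin[of w], of v]
      by (simp add: sum_subtractf right_diff_distrib)
    also have "\<bar>\<dots>\<bar> \<le> (\<Sum>b\<in>Basis. \<bar>(v \<bullet> b) * (?D b (w + t *\<^sub>R v) - ?D b w)\<bar>)" by (rule sum_abs)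
    also have "\<dots> \<le> (\<Sum>b\<in>Basis. norm v * (L b * norm v))"
    proof (rule sum_mono)
      fix b :: 'a assume b: "b \<in> Basis"
      have "\<bar>?D b (w + t *\<^sub>R v) - ?D b w\<bar> \<le> L b * (t * norm v)"
        using L(2)[where b = b and x = "w + t *\<^sub>R v" and y = w] t by simp
      also have "\<dots> \<le> L b * norm v"
        using t mult_right_mono[of t 1 "norm v"] by (intro mult_left_mono L) auto
      finally show "\<bar>(v \<bullet> b) * (?D b (w + t *\<^sub>R v) - ?D b w)\<bar> \<le> norm v * (L b * norm v)"
        unfolding abs_mult using Basis_le_norm[OF b, of v] by (intro mult_mono) auto
    qed
    also have "(\<Sum>b\<in>Basis. norm v * (L b * norm v)) = sum L Basis * (norm v)\<^sup>2"
      unfolding sum_distrib_right by (simp add: power2_eq_square mult_ac)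
    finally show "\<bar>g (w + v) - g w - ?D v w\<bar> \<le> sum L Basis * (norm v)\<^sup>2"
      using t(3) by simp
  qed
qed

text \<open>A translation of the integration variable moves the increment from \<open>F\<close> to
  the kernel, where the second order Taylor bound applies; hence continuity of \<open>F\<close>
  suffices. Since \<open>F\<close> is evaluated at \<open>x + z\<close>, the kernel is shifted by
  \<open>- v\<close>, which explains the minus sign.\<close>

lemma mollify_has_derivative:
  fixes F g :: "'a::euclidean_space \<Rightarrow> real"
  assumes F: "continuous_on UNIV F" and g: "Ck_on 2 UNIV g" and R: "\<And>z. norm z > R \<Longrightarrow> g z = 0"
  shows "((\<lambda>x. LINT z|lborel. F (x + z) * g z) has_derivative
          (\<lambda>v. - (LINT z|lborel. F (x + z) * frechet_derivative g (at z) v))) (at x)"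
proof -
  have K: "z \<notin> cball 0 R \<Longrightarrow> g z = 0" for z using R[of z] by simp
  have g1: "Ck_on 1 UNIV g" by (rule Ck_on_mono[OF g]) simp
  obtain C where C: "C \<ge> 0" "\<And>w v. \<bar>g (w + v) - g w - frechet_derivative g (at w) v\<bar> \<le> C * (norm v)\<^sup>2"
    using Taylor2_compact_support[OF g compact_cball K] by metis
  have cg: "continuous_on UNIV g" using Ck_on_continuous_on[OF g] .
  have cD: "continuous_on UNIV (\<lambda>z. frechet_derivative g (at z) v)" for v
    by (rule C1_on_continuous_derivative[OF g1])
  have D0: "frechet_derivative g (at z) v = 0" if "z \<notin> cball 0 R" for z v
    by (rule frechet_derivative_zero_outside[OF closed_cball K that])
  have lin: "linear (\<lambda>v. frechet_derivative g (at z) v)" for z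
    using C1_on_has_derivative[OF g1] has_derivative_linear by blast
  have iD: "integrable lborel (\<lambda>z. F (x + z) * frechet_derivative g (at z) v)" for x v
    by (rule integrable_continuous_compact_support[OF _ compact_cball[of 0 R]])
      (auto intro!: continuous_intros cD continuous_on_compose2[OF F] D0)
  have ig: "integrable lborel (\<lambda>z. F (x + z) * g (z + y))" for x y
    by (rule integrable_continuous_compact_support[OF _ compact_cball[of "-y" R]])
      (auto intro!: continuous_intros continuous_on_compose2[OF F] continuous_on_compose2[OF cg] K
        simp: dist_norm add.commute norm_minus_commute) 
  let ?D = "\<lambda>v. - (LINT z|lborel. F (x + z) * frechet_derivative g (at z) v)"
  \<comment> \<open>For increments of norm at most 1 this ball contains the supports of both the
    kernel and its translate.\<close>
  have "bounded ((\<lambda>z. F (x + z)) ` cball 0 (R + 1))"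
    by (intro compact_imp_bounded compact_continuous_image)
      (auto intro!: continuous_intros continuous_on_compose2[OF F])
  then obtain B where "\<forall>y\<in>(\<lambda>z. F (x + z)) ` cball 0 (R + 1). norm y \<le> B" unfolding bounded_iff by blast
  then have B: "\<And>z. z \<in> cball 0 (R + 1) \<Longrightarrow> \<bar>F (x + z)\<bar> \<le> B" by auto
  show ?thesis
  proof (rule has_derivative_quadratic[where C = "measure lborel (cball 0 (R + 1) :: 'a set) * (\<bar>B\<bar> * C)"])
    show "linear ?D"
      by (rule linearI) (simp_all add: linear_add[OF lin] linear_scale[OF lin] distrib_left iD mult.left_commute)
    fix v :: 'a assume v: "norm v \<le> 1"
    have "(LINT z|lborel. F (x + v + z) * g z) = (LINT z|lborel. F (x + v + (- v + z)) * g (- v + z))"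
      by (rule lborel_integral_translate[symmetric], rule borel_measurable_continuous_onI)
        (auto intro!: continuous_intros continuous_on_compose2[OF F] cg)
    then have "(LINT z|lborel. F (x + v + z) * g z) - (LINT z|lborel. F (x + z) * g z) - ?D v =
       (LINT z|lborel. F (x + z) * g (z + - v) - F (x + z) * g (z + 0) + F (x + z) * frechet_derivative g (at z) v)"
      using ig[of x "-v"] ig[of x 0] iD[of x v] by (simp add: algebra_simps)
    also have "\<dots> = (LINT z|lborel. F (x + z) * (g (z + - v) - g z - frechet_derivative g (at z) (- v)))"
      by (simp add: algebra_simps linear_neg[OF lin])
    also have "norm \<dots> \<le> (LINT z|(lborel :: 'a measure). indicator (cball 0 (R + 1)) z * (\<bar>B\<bar> * C * (norm v)\<^sup>2))"
    proof (rule norm_integral_le)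
      show "integrable lborel (\<lambda>z. F (x + z) * (g (z + - v) - g z - frechet_derivative g (at z) (- v)))"
        using ig[of x "-v"] ig[of x 0] iD[of x "-v"] by (simp add: algebra_simps)
      show "integrable lborel (\<lambda>z::'a. indicator (cball 0 (R + 1)) z * (\<bar>B\<bar> * C * (norm v)\<^sup>2))"
        by (intro integrable_mult_left integrable_real_indicator) (auto intro!: emeasure_bounded_finite[unfolded infinity_ennreal_def])
      fix z :: 'a
      show "norm (F (x + z) * (g (z + - v) - g z - frechet_derivative g (at z) (- v)))
        \<le> indicator (cball 0 (R + 1)) z * (\<bar>B\<bar> * C * (norm v)\<^sup>2)"
      proof (cases "z \<in> cball 0 (R + 1)")
        case True
        have "\<bar>F (x + z)\<bar> * \<bar>g (z + - v) - g z - frechet_derivative g (at z) (- v)\<bar> \<le> \<bar>B\<bar> * (C * (norm (- v))\<^sup>2)"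
          using B[OF True] by (intro mult_mono C) auto
        then show ?thesis using True by (simp add: abs_mult mult.assoc)
      next
        case False
        then have "norm z > R" "norm (z + - v) > R"
          using v norm_triangle_ineq2[of z v] by (auto simp: dist_norm)
        then show ?thesis using R D0[of z "-v"] False by simp
      qed
    qed
    also have "\<dots> = measure lborel (cball 0 (R + 1) :: 'a set) * (\<bar>B\<bar> * C) * (norm v)\<^sup>2"
      by simp
    finally show "norm ((LINT z|lborel. F (x + v + z) * g z) - (LINT z|lborel. F (x + z) * g z) - ?D v)
       \<le> measure lborel (cball 0 (R + 1) :: 'a set) * (\<bar>B\<bar> * C) * (norm v)\<^sup>2" .
  qed
qed

lemma Lipschitz_imp_continuous_on:
  fixes f :: "'a::real_normed_vector \<Rightarrow> 'b::real_normed_vector"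
  assumes "\<And>x y. norm (f x - f y) \<le> L * norm (x - y)"
  shows "continuous_on UNIV f"
  unfolding continuous_on_def
proof
  fix x :: 'a
  have "((\<lambda>y. L * norm (y - x)) \<longlongrightarrow> L * norm (x - x)) (at x)" by (intro tendsto_intros)
  then have "((\<lambda>y. L * norm (y - x)) \<longlongrightarrow> 0) (at x)" by simp
  then have "((\<lambda>y. f y - f x) \<longlongrightarrow> 0) (at x)"
    by (rule Lim_null_comparison[rotated]) (simp add: assms)
  then show "(f \<longlongrightarrow> f x) (at x)" by (simp add: Lim_null[symmetric])
qed

text \<open>Applied with a derivative of the kernel for \<open>k\<close>, this gives continuity of
  the first derivatives of a mollification.\<close>

lemma continuous_on_mollify:
  fixes F k :: "'a::euclidean_space \<Rightarrow> real"
  assumes F: "\<And>x y. \<bar>F x - F y\<bar> \<le> L * norm (x - y)"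
    and k: "continuous_on UNIV k" "compact K" "\<And>z. z \<notin> K \<Longrightarrow> k z = 0"
  shows "continuous_on UNIV (\<lambda>x. LINT z|lborel. F (x + z) * k z)"
proof (rule Lipschitz_imp_continuous_on)
  have cF: "continuous_on UNIV F"
    by (rule Lipschitz_imp_continuous_on[of _ L]) (simp add: F)
  have int: "integrable lborel (\<lambda>z. H z * k z)" if "continuous_on UNIV H" for H
    by (rule integrable_continuous_compact_support[OF _ k(2)]) (auto intro!: continuous_intros that k)
  have ik: "integrable lborel (\<lambda>z. \<bar>k z\<bar>)" using int[of "\<lambda>_. 1"] by simp
  have iF: "integrable lborel (\<lambda>z. F (x + z) * k z)" for x
    by (rule int) (auto intro!: continuous_intros continuous_on_compose2[OF cF])
  fix x y
  have "(LINT z|lborel. F (x + z) * k z) - (LINT z|lborel. F (y + z) * k z)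
      = (LINT z|lborel. F (x + z) * k z - F (y + z) * k z)" using iF by simp
  also have "norm \<dots> \<le> (LINT z|lborel. (L * norm (x - y)) * \<bar>k z\<bar>)"
  proof (rule norm_integral_le)
    show "norm (F (x + z) * k z - F (y + z) * k z) \<le> L * norm (x - y) * \<bar>k z\<bar>" for z
      using F[of "x + z" "y + z"] by (simp add: abs_mult mult_right_mono flip: left_diff_distrib)
  qed (use iF ik in auto)
  finally show "norm ((LINT z|lborel. F (x + z) * k z) - (LINT z|lborel. F (y + z) * k z))
      \<le> (L * (LINT z|lborel. \<bar>k z\<bar>)) * norm (x - y)" by (simp add: mult_ac)
qed

lemma integral_bump_pos:
  assumes "r > 0"
  shows "(LINT x|lborel. bump (a::'a::euclidean_space) r x) > 0"
proof -
  have c: "continuous_on UNIV (bump a r)" using Ck_on_continuous_on[OF Ck_on_bump] .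
  have i: "integrable lborel (bump a r)"
    by (rule integrable_continuous_compact_support[OF c compact_cball[of a r]]) (auto intro: bump_zero assms)
  have "(LINT x|lborel. bump a r x) \<noteq> 0"
  proof
    assume "(LINT x|lborel. bump a r x) = 0"
    then have "AE x in lborel. bump a r x = 0"
      using integral_nonneg_eq_0_iff_AE[OF i] bump_nonneg by auto
    then have "AE x in lborel. x \<notin> ball a r"
      by eventually_elim (use bump_pos_iff[OF assms, of a] in \<open>auto simp: less_le\<close>)
    then have "ball a r \<in> null_sets lborel" by (subst (asm) AE_iff_null_sets[symmetric]) auto
    then have "negligible (ball a r)" by (simp add: negligible_iff_null_sets null_sets_completionI)
    then show False using open_not_negligible[of "ball a r"] assms by auto
  qed
  moreover have "(LINT x|lborel. bump a r x) \<ge> 0" by (simp add: bump_nonneg)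
  ultimately show ?thesis by linarith
qed

text \<open>The Lipschitz function \<open>F\<close> is invariant to first order along \<open>Z\<close>, so its mollifications
  \<open>F\<^sub>\<epsilon>\<close> satisfy \<open>\<bar>DF\<^sub>\<epsilon> Z\<bar> = O(\<epsilon>)\<close>: translating \<open>F\<close> by \<open>z\<close> only replaces \<open>Z x\<close> by
  \<open>Z (x + z)\<close>, which is off by \<open>O(\<epsilon>)\<close>. This avoids differentiating \<open>F\<close>.\<close>

theorem integral_invariant_times_div:
  fixes F :: "'a::euclidean_space \<Rightarrow> real" and Z :: "'a \<Rightarrow> 'a"
  assumes F: "\<And>x y. \<bar>F x - F y\<bar> \<le> L * norm (x - y)"
    and Z: "Ck_on 1 UNIV Z" and K: "compact K" "\<And>x. x \<notin> K \<Longrightarrow> Z x = 0"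
    and inv: "\<delta> > 0" "\<And>\<tau> x. 0 < \<tau> \<Longrightarrow> \<tau> < \<delta> \<Longrightarrow> \<bar>F (x + \<tau> *\<^sub>R Z x) - F x\<bar> \<le> C * \<tau>\<^sup>2"
  shows "(LINT x|lborel. F x * euclidean_div Z x) = 0"
proof -
  have L0: "L \<ge> 0"
  proof -
    obtain b :: 'a where "b \<in> Basis" using nonempty_Basis by blast
    then show ?thesis using F[of b 0] abs_ge_zero[of "F b - F 0"] by simp
  qed
  have cF: "continuous_on UNIV F"
    by (rule Lipschitz_imp_continuous_on[of _ L]) (simp add: F)
  obtain M where M: "M \<ge> 0" "\<And>x y. norm (Z x - Z y) \<le> M * norm (x - y)"
    using Lipschitz_C1_compact_support[OF Z K] by metis
  have cZ: "continuous_on UNIV Z" using Ck_on_continuous_on[OF Z] .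
  have cdiv: "continuous_on UNIV (euclidean_div Z)"
    unfolding euclidean_div_def[abs_def]
    by (intro continuous_intros C1_on_continuous_derivative[OF Z])
  have div0: "euclidean_div Z x = 0" if "x \<notin> K" for x
    using frechet_derivative_zero_outside[OF compact_imp_closed[OF K(1)] K(2) that]
    by (simp add: euclidean_div_def)
  have idiv: "integrable lborel (\<lambda>x. H x * euclidean_div Z x)" if "continuous_on UNIV H" for H
    by (rule integrable_continuous_compact_support[OF _ K(1)])
      (auto intro!: continuous_intros that cdiv div0)
  have iabs: "integrable lborel (\<lambda>x. \<bar>euclidean_div Z x\<bar>)"
    using idiv[of "\<lambda>_. 1"] by simp
  \<comment> \<open>Collects the two errors, both linear in the mollification radius: the first term
    comes from replacing \<open>F\<close> by its mollification, the second from the derivative of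
    the mollification along \<open>Z\<close>, which is at most \<open>L * M\<close> times the radius
    and vanishes off \<open>K\<close>.\<close>
  define A where "A = L * (LINT x|lborel. \<bar>euclidean_div Z x\<bar>) + L * M * measure lborel K"
  let ?I = "LINT x|lborel. F x * euclidean_div Z x"
  have main: "\<bar>?I\<bar> \<le> A * \<epsilon>" if e: "\<epsilon> > 0" for \<epsilon>
  proof -
    define c where "c = (LINT x|lborel. bump (0::'a) \<epsilon> x)"
    have c: "c > 0" unfolding c_def by (rule integral_bump_pos[OF e])
    define g where "g z = bump (0::'a) \<epsilon> z / c" for z
    have g: "Ck_on k UNIV g" for k
      unfolding g_def[abs_def] by (intro Ck_on_divide Ck_on_bump Ck_on_const) (use c in auto)
    have g_nn: "g z \<ge> 0" for z unfolding g_def using c bump_nonneg[of 0 \<epsilon> z] by simp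
    have g0: "g z = 0" if "norm z \<ge> \<epsilon>" for z unfolding g_def using bump_zero[OF e, of 0 z] that by simp
    have cg: "continuous_on UNIV g" using Ck_on_continuous_on[OF g] .
    have g1: "(LINT z|lborel. g z) = 1" unfolding g_def using c by (simp add: c_def[symmetric])
    have ig: "integrable lborel (\<lambda>z. H z * g z)" if "continuous_on UNIV H" for H
      by (rule integrable_continuous_compact_support[OF _ compact_cball[of 0 \<epsilon>]])
        (auto intro!: continuous_intros that cg g0)
    define Fe where "Fe x = (LINT z|lborel. F (x + z) * g z)" for x
    have iF: "integrable lborel (\<lambda>z. F (x + z) * g z)" for x
      by (rule ig) (auto intro!: continuous_intros continuous_on_compose2[OF cF])
    have Fe_F: "\<bar>Fe x - F x\<bar> \<le> L * \<epsilon>" for x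
    proof -
      have "Fe x - F x = (LINT z|lborel. (F (x + z) - F x) * g z)"
        using iF ig[of "\<lambda>_. F x"] g1 by (simp add: Fe_def left_diff_distrib)
      also have "norm \<dots> \<le> (LINT z|lborel. (L * \<epsilon>) * g z)"
      proof (rule norm_integral_le)
        show "integrable lborel (\<lambda>z. (F (x + z) - F x) * g z)"
          by (rule ig) (auto intro!: continuous_intros continuous_on_compose2[OF cF])
        show "integrable lborel (\<lambda>z. (L * \<epsilon>) * g z)" by (rule ig) simp
        fix z :: 'a
        show "norm ((F (x + z) - F x) * g z) \<le> (L * \<epsilon>) * g z"
        proof (cases "norm z \<ge> \<epsilon>")
          case False
          then have "\<bar>F (x + z) - F x\<bar> \<le> L * \<epsilon>"
            using F[of "x + z" x] mult_left_mono[of "norm z" \<epsilon> L] L0 by simp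
          then show ?thesis using g_nn[of z] by (simp add: abs_mult mult_right_mono)
        qed (simp add: g0)
      qed
      also have "\<dots> = L * \<epsilon>" using g1 by simp
      finally show ?thesis by simp
    qed
    have dFe: "(Fe has_derivative (\<lambda>v. - (LINT z|lborel. F (x + z) * frechet_derivative g (at z) v))) (at x)" for x
      unfolding Fe_def[abs_def] by (rule mollify_has_derivative[OF cF g, of \<epsilon>]) (simp add: g0)
    have Dg0: "frechet_derivative g (at z) v = 0" if "z \<notin> cball 0 \<epsilon>" for z v
      by (rule frechet_derivative_zero_outside[OF closed_cball _ that]) (simp add: g0)
    have Fe1: "Ck_on (Suc 0) UNIV Fe"
    proof (rule Ck_on_SucI[OF open_UNIV dFe])
      show "Ck_on 0 UNIV (\<lambda>x. - (LINT z|lborel. F (x + z) * frechet_derivative g (at z) v))" for v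
        using continuous_on_mollify[OF F C1_on_continuous_derivative[OF g] compact_cball[of 0 \<epsilon>] Dg0]
        by (auto intro!: continuous_on_minus)
    qed
    have Fe1': "Ck_on 1 UNIV Fe" using Fe1 by simp
    have dd: "Fe differentiable (at x)" "Z differentiable (at x)" for x
      using C1_on_differentiable[OF Fe1'] C1_on_differentiable[OF Z] by auto
    let ?d = "\<lambda>x. frechet_derivative Fe (at x) (Z x)"
    have db: "\<bar>?d x\<bar> \<le> L * M * \<epsilon>" for x
    proof -
      have "((\<lambda>t. Fe (x + t *\<^sub>R Z x)) has_real_derivative ?d x) (at 0)"
        using has_real_derivative_along_line[of Fe x 0 "Z x"] dd by simp
      then have "((\<lambda>h. (Fe (x + h *\<^sub>R Z x) - Fe x) / h) \<longlongrightarrow> ?d x) (at 0)" by (simp add: DERIV_def)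
      then have lim: "((\<lambda>h. \<bar>(Fe (x + h *\<^sub>R Z x) - Fe x) / h\<bar>) \<longlongrightarrow> \<bar>?d x\<bar>) (at_right 0)"
        by (intro tendsto_rabs) (auto intro: filterlim_mono at_le)
      have "((\<lambda>h. L * M * \<epsilon> + C * h) \<longlongrightarrow> L * M * \<epsilon> + C * 0) (at_right 0)" by (intro tendsto_intros)
      moreover have "\<bar>(Fe (x + h *\<^sub>R Z x) - Fe x) / h\<bar> \<le> L * M * \<epsilon> + C * h" if h: "0 < h" "h < \<delta>" for h
      proof -
        have "Fe (x + h *\<^sub>R Z x) - Fe x = (LINT z|lborel. (F (x + h *\<^sub>R Z x + z) - F (x + z)) * g z)"
          using iF by (simp add: Fe_def left_diff_distrib)
        also have "norm \<dots> \<le> (LINT z|lborel. (L * M * \<epsilon> * h + C * h\<^sup>2) * g z)"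
        proof (rule norm_integral_le)
          show "integrable lborel (\<lambda>z. (F (x + h *\<^sub>R Z x + z) - F (x + z)) * g z)"
            by (rule ig) (auto intro!: continuous_intros continuous_on_compose2[OF cF])
          show "integrable lborel (\<lambda>z. (L * M * \<epsilon> * h + C * h\<^sup>2) * g z)" by (rule ig) simp
          fix z :: 'a
          show "norm ((F (x + h *\<^sub>R Z x + z) - F (x + z)) * g z) \<le> (L * M * \<epsilon> * h + C * h\<^sup>2) * g z"
          proof (cases "norm z \<ge> \<epsilon>")
            case False
            have "\<bar>F (x + h *\<^sub>R Z x + z) - F (x + z + h *\<^sub>R Z (x + z))\<bar>
               \<le> L * norm (h *\<^sub>R (Z x - Z (x + z)))"
              using F[of "x + h *\<^sub>R Z x + z" "x + z + h *\<^sub>R Z (x + z)"] by (simp add: algebra_simps)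
            also have "\<dots> \<le> L * (h * (M * \<epsilon>))"
            proof -
              have "norm (Z x - Z (x + z)) \<le> M * \<epsilon>"
                using M(2)[of x "x + z"] mult_left_mono[of "norm z" \<epsilon> M] M(1) False by simp
              then show ?thesis using h L0 by (simp add: mult_left_mono)
            qed
            finally have "\<bar>F (x + h *\<^sub>R Z x + z) - F (x + z)\<bar> \<le> L * M * \<epsilon> * h + C * h\<^sup>2"
              using inv(2)[OF h, of "x + z"] by (simp add: mult_ac)
            then show ?thesis using g_nn[of z] by (simp add: abs_mult mult_right_mono)
          qed (simp add: g0)
        qed
        also have "\<dots> = L * M * \<epsilon> * h + C * h\<^sup>2" using g1 by simp
        finally show ?thesis using h by (simp add: divide_le_eq power2_eq_square algebra_simps)
      qed
      then have "\<forall>\<^sub>F h in at_right 0. \<bar>(Fe (x + h *\<^sub>R Z x) - Fe x) / h\<bar> \<le> L * M * \<epsilon> + C * h"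
        unfolding eventually_at_right_field using inv(1) by blast
      ultimately show ?thesis using tendsto_le[OF _ _ lim] by fastforce
    qed
    have d0: "?d x = 0" if "x \<notin> K" for x
      using K(2)[OF that] has_derivative_linear[OF C1_on_has_derivative[OF Fe1']] linear_0 by auto
    have cFe: "continuous_on UNIV Fe" using Ck_on_continuous_on[OF Fe1'] .
    have cd: "continuous_on UNIV ?d"
    proof -
      have "?d = (\<lambda>x. \<Sum>b\<in>Basis. (Z x \<bullet> b) *\<^sub>R frechet_derivative Fe (at x) b)"
        by (rule ext) (rule linear_sum_Basis[OF has_derivative_linear[OF C1_on_has_derivative[OF Fe1' UNIV_I]]])
      then show ?thesis by (simp only:) (intro continuous_intros cZ C1_on_continuous_derivative[OF Fe1'])
    qed
    have id: "integrable lborel ?d" by (rule integrable_continuous_compact_support[OF cd K(1) d0])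
    \<comment> \<open>The divergence of \<open>Fe Z\<close> integrates to 0, so the integral of
      \<open>Fe\<close> against the divergence of \<open>Z\<close> is minus that of the derivative
      of \<open>Fe\<close> along \<open>Z\<close>, which has just been bounded.\<close>
    have "Ck_on 1 UNIV (\<lambda>x. Fe x *\<^sub>R Z x)" by (intro Ck_on_scaleR Fe1' Z open_UNIV)
    then have "(LINT x|lborel. euclidean_div (\<lambda>x. Fe x *\<^sub>R Z x) x) = 0"
      by (rule integral_euclidean_div_zero[OF _ K(1)]) (simp add: K(2))
    then have z: "(LINT x|lborel. Fe x * euclidean_div Z x) + (LINT x|lborel. ?d x) = 0"
      by (simp add: euclidean_div_scaleR[OF dd] idiv[OF cFe] id)
    have "?I - (LINT x|lborel. Fe x * euclidean_div Z x) = (LINT x|lborel. (F x - Fe x) * euclidean_div Z x)"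
      using idiv[OF cF] idiv[OF cFe] by (simp add: left_diff_distrib)
    also have "norm \<dots> \<le> (LINT x|lborel. (L * \<epsilon>) * \<bar>euclidean_div Z x\<bar>)"
    proof (rule norm_integral_le)
      show "integrable lborel (\<lambda>x. (F x - Fe x) * euclidean_div Z x)"
        by (rule idiv) (intro continuous_intros cF cFe)
      show "norm ((F x - Fe x) * euclidean_div Z x) \<le> L * \<epsilon> * \<bar>euclidean_div Z x\<bar>" for x
        using Fe_F[of x] by (simp add: abs_mult abs_minus_commute mult_right_mono)
    qed (use iabs in simp)
    finally have 1: "\<bar>?I - (LINT x|lborel. Fe x * euclidean_div Z x)\<bar> \<le> L * \<epsilon> * (LINT x|lborel. \<bar>euclidean_div Z x\<bar>)"
      by simp
    have "norm (LINT x|lborel. ?d x) \<le> (LINT x|lborel. indicator K x * (L * M * \<epsilon>))"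
    proof (rule norm_integral_le[OF id])
      show "integrable lborel (\<lambda>x. indicator K x * (L * M * \<epsilon>))"
        using K(1) by (intro integrable_mult_left integrable_real_indicator)
          (auto intro!: emeasure_bounded_finite[unfolded infinity_ennreal_def] compact_imp_bounded borel_compact)
      show "norm (?d x) \<le> indicator K x * (L * M * \<epsilon>)" for x
        using db[of x] d0[of x] by (cases "x \<in> K") auto
    qed
    then have "\<bar>LINT x|lborel. ?d x\<bar> \<le> measure lborel K * (L * M * \<epsilon>)"
      using K(1) by (simp add: borel_compact)
    then show ?thesis using 1 z unfolding A_def by (simp add: algebra_simps)
  qed
  show ?thesis
  proof (rule ccontr)
    assume ne: "?I \<noteq> 0"
    define e where "e = \<bar>?I\<bar> / (2 * (\<bar>A\<bar> + 1))"
    have e: "e > 0" using ne by (simp add: e_def add_nonneg_pos)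
    have "\<bar>?I\<bar> \<le> A * e" by (rule main[OF e])
    also have "\<dots> \<le> (\<bar>A\<bar> + 1) * e" using e by (intro mult_right_mono) auto
    also have "\<dots> = \<bar>?I\<bar> / 2"
    proof -
      have *: "c * (i / (2 * c)) = i / 2" if "c \<noteq> 0" for c i :: real using that by simp
      have "\<bar>A\<bar> + 1 \<noteq> 0" by linarith
      from *[OF this, of "\<bar>?I\<bar>"] show ?thesis by (simp only: e_def)
    qed
    finally show False using ne by linarith
  qed
qed

section \<open>Flows of Lipschitz vector fields\<close>

definition antiderivative :: "(real \<Rightarrow> 'a::euclidean_space) \<Rightarrow> real \<Rightarrow> 'a" where
  "antiderivative g t = (if 0 \<le> t then integral {0..t} g else - integral {t..0} g)"

lemma antiderivative_has_vector_derivative: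
  fixes g :: "real \<Rightarrow> 'a::euclidean_space"
  assumes g: "continuous_on UNIV g"
  shows "(antiderivative g has_vector_derivative g t) (at t)"
proof -
  define T where "T = \<bar>t\<bar> + 1"
  have int: "g integrable_on {a..b}" for a b
    using g by (intro integrable_continuous_real) (auto intro: continuous_on_subset)
  have eq: "antiderivative g s = integral {- T..s} g - integral {- T..0} g" if "s \<in> {- T<..<T}" for s
  proof (cases "0 \<le> s")
    case True
    then show ?thesis
      using Henstock_Kurzweil_Integration.integral_combine[of "-T" 0 s g] that int
      by (simp add: antiderivative_def T_def algebra_simps)
  next
    case False
    then show ?thesis
      using Henstock_Kurzweil_Integration.integral_combine[of "-T" s 0 g] that int
      by (simp add: antiderivative_def T_def algebra_simps)
  qed
  have "((\<lambda>s. integral {- T..s} g) has_vector_derivative g t) (at t within {- T..T})"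
    using g by (intro integral_has_vector_derivative) (auto intro: continuous_on_subset simp: T_def)
  then have "((\<lambda>s. integral {- T..s} g) has_vector_derivative g t) (at t)"
  proof -
    have "t \<in> interior {- T..T}" unfolding interior_atLeastAtMost_real by (auto simp: T_def)
    from at_within_interior[OF this] show "((\<lambda>s. integral {- T..s} g) has_vector_derivative g t) (at t within {- T..T}) \<Longrightarrow>
      ((\<lambda>s. integral {- T..s} g) has_vector_derivative g t) (at t)" by (simp only:)
  qed
  then have "((\<lambda>s. integral {- T..s} g - integral {- T..0} g) has_vector_derivative g t) (at t)"
    by (auto intro!: derivative_eq_intros)
  then show ?thesis
    by (rule has_vector_derivative_transform_within_open[of _ _ _ "{- T<..<T}"]) (auto simp: T_def eq)
qed

lemma antiderivative_0 [simp]: "antiderivative g 0 = 0"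
  by (simp add: antiderivative_def)

lemma norm_diff_le_of_derivative:
  fixes f :: "real \<Rightarrow> 'a::euclidean_space"
  assumes "a \<le> b"
    and f: "\<And>t. (f has_vector_derivative f' t) (at t)"
    and \<phi>: "\<And>t. (\<phi> has_real_derivative \<phi>' t) (at t)"
    and le: "\<And>t. a < t \<Longrightarrow> t < b \<Longrightarrow> norm (f' t) \<le> \<phi>' t"
  shows "norm (f b - f a) \<le> \<phi> b - \<phi> a"
proof (cases "a < b")
  case True
  then show ?thesis
  proof (rule differentiable_bound_general[where f' = f' and \<phi>' = \<phi>'])
    show "continuous_on {a..b} f"
      by (intro continuous_at_imp_continuous_on ballI has_vector_derivative_continuous[OF f])
    show "continuous_on {a..b} \<phi>"
      by (intro continuous_at_imp_continuous_on ballI DERIV_isCont[OF \<phi>])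
    show "(\<phi> has_vector_derivative \<phi>' t) (at t)" for t
      using \<phi> by (simp add: has_real_derivative_iff_has_vector_derivative)
  qed (use f le in auto)
qed (use assms(1) in auto)

text \<open>In the supremum norm with weight \<open>exp (- k \<bar>t\<bar>)\<close>, integration
  from 0 gains a factor \<open>1 / k\<close>. This makes the Picard iteration contract on the whole
  line at once.\<close>

lemma antiderivative_exp_bound:
  fixes g :: "real \<Rightarrow> 'a::euclidean_space"
  assumes g: "continuous_on UNIV g" and "k > 0" "c \<ge> 0"
    and le: "\<And>t. norm (g t) \<le> k * c * exp (k * \<bar>t\<bar>)"
  shows "norm (antiderivative g t) \<le> c * exp (k * \<bar>t\<bar>)"
proof -
  have d: "((\<lambda>s. c * exp (k * s)) has_real_derivative k * c * exp (k * s)) (at s)" for s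
    by (auto intro!: derivative_eq_intros)
  show ?thesis
  proof (cases "0 \<le> t")
    case True
    have "norm (antiderivative g t - antiderivative g 0) \<le> c * exp (k * t) - c * exp (k * 0)"
    proof (rule norm_diff_le_of_derivative[OF True antiderivative_has_vector_derivative[OF g] d])
      show "norm (g s) \<le> k * c * exp (k * s)" if "0 < s" for s using le[of s] that by simp
    qed
    then show ?thesis using True assms(3) by simp
  next
    case False
    have d': "((\<lambda>s. antiderivative g (- s)) has_vector_derivative - g (- s)) (at s)" for s
    proof -
      have "((\<lambda>s. - s) has_vector_derivative - 1) (at s)" by (auto intro!: derivative_eq_intros)
      from vector_diff_chain_at[OF this antiderivative_has_vector_derivative[OF g]]
      show ?thesis by (simp add: o_def)
    qed
    have "norm ((\<lambda>s. antiderivative g (- s)) (- t) - (\<lambda>s. antiderivative g (- s)) 0)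
        \<le> c * exp (k * (- t)) - c * exp (k * 0)"
    proof (rule norm_diff_le_of_derivative[OF _ d' d])
      show "norm (- g (- s)) \<le> k * c * exp (k * s)" if "0 < s" for s using le[of "- s"] that by simp
    qed (use False in auto)
    then show ?thesis using False assms(3) by simp
  qed
qed

text \<open>Picard iteration for all times simultaneously. For a solution \<open>w\<close>, the
  unknown is \<open>y t = exp (- k \<bar>t\<bar>) (w t - x)\<close>, which is bounded because
  \<open>Z\<close> is; the choice \<open>k = 2 L\<close> gives the contraction factor 1/2 in the
  space of bounded continuous functions.\<close>

lemma ode_solution_exists:
  fixes Z :: "'a::euclidean_space \<Rightarrow> 'a"
  assumes Lip: "\<And>x y. norm (Z x - Z y) \<le> L * norm (x - y)" and bdd: "\<And>x. norm (Z x) \<le> M" and L: "L > 0"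
  shows "\<exists>y. y 0 = x \<and> (\<forall>t. (y has_vector_derivative Z (y t)) (at t))"
proof -
  have cZ: "continuous_on UNIV Z" by (rule Lipschitz_imp_continuous_on[of _ L, OF Lip])
  have M: "M \<ge> 0" using bdd[of 0] norm_ge_zero order_trans by blast
  define k where "k = 2 * L"
  have k: "k > 0" using L by (simp add: k_def)
  define G where "G y s = Z (x + exp (k * \<bar>s\<bar>) *\<^sub>R y s)" for y :: "real \<Rightarrow> 'a" and s
  define P where "P y t = exp (- (k * \<bar>t\<bar>)) *\<^sub>R antiderivative (G y) t" for y t
  have cG: "continuous_on UNIV (G y)" if "continuous_on UNIV y" for y
    unfolding G_def[abs_def] by (intro continuous_on_compose2[OF cZ] continuous_intros that) auto
  have cA: "continuous_on UNIV (antiderivative (G y))" if "continuous_on UNIV y" for y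
    using has_vector_derivative_continuous[OF antiderivative_has_vector_derivative[OF cG[OF that]]]
    by (auto intro!: continuous_at_imp_continuous_on)
  have P_in: "P (apply_bcontfun y) \<in> bcontfun" for y
  proof (rule bcontfun_normI)
    show "continuous_on UNIV (P (apply_bcontfun y))"
      unfolding P_def[abs_def] by (intro continuous_intros cA) auto
    fix t
    have "norm (antiderivative (G y) t) \<le> M / k * exp (k * \<bar>t\<bar>)"
    proof (rule antiderivative_exp_bound[OF cG k])
      fix t
      have "M * 1 \<le> M * exp (k * \<bar>t\<bar>)" using k by (intro mult_left_mono M) auto
      then show "norm (G y t) \<le> k * (M / k) * exp (k * \<bar>t\<bar>)"
        using bdd[of "x + exp (k * \<bar>t\<bar>) *\<^sub>R y t"] k by (simp add: G_def)
    qed (use M k in auto)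
    then show "norm (P (apply_bcontfun y) t) \<le> M / k" by (simp add: P_def exp_minus field_simps)
  qed
  define T where "T y = Bcontfun (P (apply_bcontfun y))" for y
  have T: "apply_bcontfun (T y) = P (apply_bcontfun y)" for y
    unfolding T_def by (rule Bcontfun_inverse[OF P_in])
  have "\<exists>!y. T y = y"
  proof (rule banach_fix_type[of "1/2"])
    show "\<forall>y z. dist (T y) (T z) \<le> 1/2 * dist y z"
    proof (intro allI dist_bound)
      fix y z :: "real \<Rightarrow>\<^sub>C 'a" and t
      let ?h = "\<lambda>t. G y t - G z t"
      have ch: "continuous_on UNIV ?h" by (intro continuous_intros cG) auto
      have "((\<lambda>t. antiderivative (G y) t - antiderivative (G z) t) has_vector_derivative ?h t) (at t)" for t
        by (intro has_vector_derivative_diff antiderivative_has_vector_derivative cG) auto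
      have "antiderivative (G y) t - antiderivative (G z) t = antiderivative ?h t"
        unfolding antiderivative_def
        using cG[of y] cG[of z] 
        by (auto simp: Henstock_Kurzweil_Integration.integral_diff integrable_continuous_real continuous_on_subset[OF _ subset_UNIV])
      moreover have "norm (antiderivative ?h t) \<le> (dist y z / 2) * exp (k * \<bar>t\<bar>)"
      proof (rule antiderivative_exp_bound[OF ch k])
        fix t
        have "norm (?h t) \<le> L * norm (exp (k * \<bar>t\<bar>) *\<^sub>R (y t - z t))"
          using Lip[of "x + exp (k * \<bar>t\<bar>) *\<^sub>R y t" "x + exp (k * \<bar>t\<bar>) *\<^sub>R z t"]
          by (simp add: G_def scaleR_diff_right)
        also have "\<dots> \<le> L * (exp (k * \<bar>t\<bar>) * dist y z)"
          using L dist_bounded[of y t z] by (simp add: dist_norm)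
        finally show "norm (?h t) \<le> k * (dist y z / 2) * exp (k * \<bar>t\<bar>)" by (simp add: k_def mult_ac)
      qed simp
      ultimately have "norm (antiderivative (G y) t - antiderivative (G z) t) \<le> (dist y z / 2) * exp (k * \<bar>t\<bar>)" by simp
      then show "dist (T y t) (T z t) \<le> 1/2 * dist y z"
      proof -
        assume *: "norm (antiderivative (G y) t - antiderivative (G z) t) \<le> (dist y z / 2) * exp (k * \<bar>t\<bar>)"
        have "dist (T y t) (T z t) = exp (- (k * \<bar>t\<bar>)) * norm (antiderivative (G y) t - antiderivative (G z) t)"
          unfolding T P_def dist_norm scaleR_diff_right[symmetric] by simp
        also have "\<dots> \<le> exp (- (k * \<bar>t\<bar>)) * ((dist y z / 2) * exp (k * \<bar>t\<bar>))"
          by (intro mult_left_mono *) simp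
        also have "\<dots> = 1/2 * dist y z" by (simp add: exp_minus)
        finally show ?thesis .
      qed
    qed
  qed auto
  then obtain y where y: "T y = y" by blast
  then have Py: "P y t = y t" for t using T[of y] by metis
  define w where "w t = x + antiderivative (G y) t" for t
  have "G y t = Z (w t)" for t
    using Py[of t, symmetric] by (simp add: G_def w_def P_def exp_minus)
  moreover have "(w has_vector_derivative G y t) (at t)" for t
    unfolding w_def[abs_def]
    using antiderivative_has_vector_derivative[OF cG[of y], of t] by (auto intro!: derivative_eq_intros)
  ultimately show ?thesis by (intro exI[of _ w]) (auto simp: w_def)
qed

lemma ode_gronwall:
  fixes Z :: "'a::euclidean_space \<Rightarrow> 'a"
  assumes Lip: "\<And>x y. norm (Z x - Z y) \<le> L * norm (x - y)"
    and x: "\<And>t. t \<in> {a..b} \<Longrightarrow> (x has_vector_derivative Z (x t)) (at t within {a..b})"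
    and y: "\<And>t. t \<in> {a..b} \<Longrightarrow> (y has_vector_derivative Z (y t)) (at t within {a..b})"
    and st: "s \<in> {a..b}" "t \<in> {a..b}"
  shows "norm (x t - y t) \<le> exp (L * \<bar>t - s\<bar>) * norm (x s - y s)"
proof -
  define w where "w t = (norm (x t - y t))\<^sup>2" for t
  have w': "(w has_real_derivative 2 * ((x t - y t) \<bullet> (Z (x t) - Z (y t)))) (at t within {a..b})"
    if "t \<in> {a..b}" for t
  proof -
    have "((\<lambda>t. x t - y t) has_vector_derivative (Z (x t) - Z (y t))) (at t within {a..b})"
      by (intro has_vector_derivative_diff x y that)
    then have "((\<lambda>t. (x t - y t) \<bullet> (x t - y t)) has_derivative
       (\<lambda>h. (x t - y t) \<bullet> (h *\<^sub>R (Z (x t) - Z (y t))) + (h *\<^sub>R (Z (x t) - Z (y t))) \<bullet> (x t - y t))) (at t within {a..b})"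
      unfolding has_vector_derivative_def by (intro has_derivative_inner)
    then show ?thesis
      unfolding w_def power2_norm_eq_inner has_field_derivative_def
      by (rule has_derivative_eq_rhs) (auto simp: inner_commute)
  qed
  have b: "\<bar>2 * ((x t - y t) \<bullet> (Z (x t) - Z (y t)))\<bar> \<le> 2 * L * w t" for t
  proof -
    have "\<bar>(x t - y t) \<bullet> (Z (x t) - Z (y t))\<bar> \<le> norm (x t - y t) * (L * norm (x t - y t))"
      using Cauchy_Schwarz_ineq2[of "x t - y t" "Z (x t) - Z (y t)"] Lip[of "x t" "y t"]
      by (meson mult_left_mono norm_ge_zero order_trans)
    then show ?thesis unfolding w_def power2_eq_square abs_mult by (simp add: mult_ac)
  qed
  have mono: "w q \<le> exp (2 * L * (q - p)) * w p" "w p \<le> exp (2 * L * (q - p)) * w q"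
    if pq: "p \<in> {a..b}" "q \<in> {a..b}" "p \<le> q" for p q
  proof -
    \<comment> \<open>Used with \<open>k = - 2 L\<close> and with \<open>k = 2 L\<close>, one for
      each of the two inequalities.\<close>
    have key: "\<exists>r\<in>{p..q}. exp (k * q) * w q - exp (k * p) * w p =
       (k * exp (k * r) * w r + exp (k * r) * (2 * ((x r - y r) \<bullet> (Z (x r) - Z (y r))))) * (q - p)" for k
    proof (rule mvt_very_simple[OF \<open>p \<le> q\<close>])
      fix r assume r: "p \<le> r" "r \<le> q"
      then have r': "r \<in> {a..b}" using pq by auto
      have "(w has_real_derivative 2 * ((x r - y r) \<bullet> (Z (x r) - Z (y r)))) (at r within {p..q})"
        by (rule DERIV_subset[OF w'[OF r']]) (use pq in auto)
      then have "((\<lambda>r. exp (k * r) * w r) has_real_derivative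
        (k * exp (k * r) * w r + exp (k * r) * (2 * ((x r - y r) \<bullet> (Z (x r) - Z (y r)))))) (at r within {p..q})"
        by (auto intro!: derivative_eq_intros)
      then show "((\<lambda>r. exp (k * r) * w r) has_derivative
        (*) (k * exp (k * r) * w r + exp (k * r) * (2 * ((x r - y r) \<bullet> (Z (x r) - Z (y r)))))) (at r within {p..q})"
        by (simp add: has_field_derivative_def)
    qed
    obtain r where r: "exp (- (2 * L) * q) * w q - exp (- (2 * L) * p) * w p =
       (- (2 * L) * exp (- (2 * L) * r) * w r + exp (- (2 * L) * r) * (2 * ((x r - y r) \<bullet> (Z (x r) - Z (y r))))) * (q - p)"
      using key[of "- (2 * L)"] by blast
    have "\<dots> = exp (- (2 * L) * r) * (2 * ((x r - y r) \<bullet> (Z (x r) - Z (y r))) - 2 * L * w r) * (q - p)"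
      by (simp add: algebra_simps)
    also have "\<dots> \<le> 0" using b[of r] pq by (intro mult_nonpos_nonneg mult_nonneg_nonpos) auto
    finally have "exp (2 * L * q) * (exp (- (2 * L) * q) * w q) \<le> exp (2 * L * q) * (exp (- (2 * L) * p) * w p)"
      using r by (intro mult_left_mono) auto
    then show "w q \<le> exp (2 * L * (q - p)) * w p"
      by (simp add: mult.assoc[symmetric] exp_add[symmetric] right_diff_distrib)
    obtain r where r: "exp ((2 * L) * q) * w q - exp ((2 * L) * p) * w p =
       ((2 * L) * exp ((2 * L) * r) * w r + exp ((2 * L) * r) * (2 * ((x r - y r) \<bullet> (Z (x r) - Z (y r))))) * (q - p)"
      using key[of "2 * L"] by blast
    have "\<dots> = exp ((2 * L) * r) * (2 * ((x r - y r) \<bullet> (Z (x r) - Z (y r))) + 2 * L * w r) * (q - p)"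
      by (simp add: algebra_simps)
    also have "\<dots> \<ge> 0" using b[of r] pq by (intro mult_nonneg_nonneg) auto
    finally have "exp (- (2 * L) * p) * (exp (2 * L * p) * w p) \<le> exp (- (2 * L) * p) * (exp (2 * L * q) * w q)"
      using r by (intro mult_left_mono) auto
    then show "w p \<le> exp (2 * L * (q - p)) * w q"
      by (simp add: mult.assoc[symmetric] exp_add[symmetric] right_diff_distrib)
  qed
  have "w t \<le> exp (2 * L * \<bar>t - s\<bar>) * w s"
    using mono(1)[of s t] mono(2)[of t s] st by (cases "s \<le> t") (auto simp: abs_if)
  also have "\<dots> = (exp (L * \<bar>t - s\<bar>) * norm (x s - y s))\<^sup>2"
    by (simp add: w_def power_mult_distrib exp_double[symmetric] mult.assoc)
  finally show ?thesis unfolding w_def by (rule power2_le_imp_le) simp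
qed

lemma tendsto_norm_bound:
  fixes f :: "'a::t2_space \<Rightarrow> 'b::real_normed_vector"
  assumes "(B \<longlongrightarrow> 0) (at p)" "\<And>q. norm (f q - f p) \<le> B q"
  shows "(f \<longlongrightarrow> f p) (at p)"
proof -
  have "((\<lambda>q. f q - f p) \<longlongrightarrow> 0) (at p)"
    by (rule Lim_null_comparison[OF _ assms(1)]) (simp add: assms(2))
  then show ?thesis by (simp add: Lim_null[symmetric])
qed

text \<open>Of the properties collected here, the quadratic estimate is the link to the integral
  theorem above: it turns exact invariance along the flow into invariance up to the square of the
  step along straight segments.\<close>

theorem Lipschitz_flow:
  fixes Z :: "'a::euclidean_space \<Rightarrow> 'a"
  assumes Lip0: "\<And>x y. norm (Z x - Z y) \<le> L0 * norm (x - y)" and bdd: "\<And>x. norm (Z x) \<le> M"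
  obtains \<theta> L where "\<And>x. \<theta> 0 x = x"
    "\<And>t x. ((\<lambda>t. \<theta> t x) has_vector_derivative Z (\<theta> t x)) (at t)"
    "\<And>s t x. \<theta> (s + t) x = \<theta> s (\<theta> t x)"
    "\<And>t x y. norm (\<theta> t x - \<theta> t y) \<le> exp (L * \<bar>t\<bar>) * norm (x - y)"
    "\<And>s t x. norm (\<theta> t x - \<theta> s x) \<le> M * \<bar>t - s\<bar>"
    "\<And>t x. norm (\<theta> t x - x - t *\<^sub>R Z x) \<le> L * M * t\<^sup>2"
    "\<And>t x. Z x \<noteq> 0 \<Longrightarrow> Z (\<theta> t x) \<noteq> 0" "L > 0"
    "continuous_on UNIV (\<lambda>(x, t). \<theta> t x)"
proof -
  \<comment> \<open>The weighted norm in the existence proof requires a positive Lipschitz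
    constant.\<close>
  define L where "L = \<bar>L0\<bar> + 1"
  have L: "L > 0" by (simp add: L_def)
  have Lip: "norm (Z x - Z y) \<le> L * norm (x - y)" for x y
  proof -
    have "L0 \<le> L" unfolding L_def by linarith
    then show ?thesis using Lip0[of x y] mult_right_mono[of L0 L "norm (x - y)"] by simp
  qed
  have M: "M \<ge> 0" using bdd[of 0] norm_ge_zero order_trans by blast
  have "\<exists>\<theta>. \<forall>x. \<theta> x 0 = x \<and> (\<forall>t. (\<theta> x has_vector_derivative Z (\<theta> x t)) (at t))"
    by (rule choice) (use ode_solution_exists[OF Lip bdd L] in blast)
  then obtain \<Theta> where \<Theta>: "\<And>x. \<Theta> x 0 = x" "\<And>x t. (\<Theta> x has_vector_derivative Z (\<Theta> x t)) (at t)" by blast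
  have gron: "norm (y t - z t) \<le> exp (L * \<bar>t - s\<bar>) * norm (y s - z s)"
    if "\<And>t. (y has_vector_derivative Z (y t)) (at t)" "\<And>t. (z has_vector_derivative Z (z t)) (at t)" for y z s t
    by (rule ode_gronwall[OF Lip, where a = "min s t" and b = "max s t"])
      (use that in \<open>auto intro: has_vector_derivative_at_within\<close>)
  have speed: "norm (\<Theta> x t - \<Theta> x s) \<le> M * \<bar>t - s\<bar>" for x s t
  proof -
    have *: "norm (\<Theta> x q - \<Theta> x p) \<le> M * q - M * p" if "p \<le> q" for p q
      by (rule norm_diff_le_of_derivative[OF that \<Theta>(2), where \<phi>' = "\<lambda>_. M"])
        (auto intro!: derivative_eq_intros bdd)
    show ?thesis using *[of s t] *[of t s] by (cases "s \<le> t") (auto simp: norm_minus_commute algebra_simps)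
  qed
  show ?thesis
  proof (rule that[of "\<lambda>t x. \<Theta> x t" L])
    show add: "\<Theta> x (s + t) = \<Theta> (\<Theta> x t) s" for x s t
    proof -
      have d: "((\<lambda>s. \<Theta> x (s + t)) has_vector_derivative Z (\<Theta> x (s + t))) (at s)" for s
      proof -
        have "((\<lambda>s. s + t) has_vector_derivative 1) (at s)" by (auto intro!: derivative_eq_intros)
        from vector_diff_chain_at[OF this \<Theta>(2)] show ?thesis by (simp add: o_def)
      qed
      show ?thesis using gron[OF d \<Theta>(2)[of "\<Theta> x t"], of s 0] \<Theta>(1) by simp
    qed
    show lip: "norm (\<Theta> x t - \<Theta> y t) \<le> exp (L * \<bar>t\<bar>) * norm (x - y)" for t x y
      using gron[OF \<Theta>(2) \<Theta>(2), of x t y 0] \<Theta>(1) by simp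
    show "continuous_on UNIV (\<lambda>(x, t). \<Theta> x t)"
      unfolding continuous_on_def
    proof
      fix p :: "'a \<times> real"
      obtain y s where p: "p = (y, s)" by (cases p)
      let ?B = "\<lambda>q. M * \<bar>snd q - s\<bar> + exp (L * \<bar>s\<bar>) * norm (fst q - y)"
      have "(?B \<longlongrightarrow> M * \<bar>snd p - s\<bar> + exp (L * \<bar>s\<bar>) * norm (fst p - y)) (at p)"
        by (intro tendsto_intros)
      then have "(?B \<longlongrightarrow> 0) (at p)" by (simp add: p)
      moreover have "norm ((\<lambda>(x, t). \<Theta> x t) q - (\<lambda>(x, t). \<Theta> x t) p) \<le> ?B q" for q
        using norm_triangle_ineq[of "\<Theta> (fst q) (snd q) - \<Theta> (fst q) s" "\<Theta> (fst q) s - \<Theta> y s"]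
          speed[of "fst q" "snd q" s] lip[of "fst q" s y] by (simp add: p split_beta)
      ultimately show "((\<lambda>(x, t). \<Theta> x t) \<longlongrightarrow> (\<lambda>(x, t). \<Theta> x t) p) (at p)"
        by (rule tendsto_norm_bound)
    qed
    show "norm (\<Theta> x t - x - t *\<^sub>R Z x) \<le> L * M * t\<^sup>2" for t x
    proof -
      define h where "h t = \<Theta> x t - t *\<^sub>R Z x" for t
      have h': "(h has_vector_derivative Z (\<Theta> x s) - Z x) (at s)" for s
        unfolding h_def[abs_def]
        by (rule has_vector_derivative_diff[OF \<Theta>(2)]) (auto intro!: derivative_eq_intros)
      have h'b: "norm (Z (\<Theta> x s) - Z x) \<le> L * M * \<bar>s\<bar>" for s
      proof -
        have "L * norm (\<Theta> x s - x) \<le> L * (M * \<bar>s\<bar>)"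
          using speed[of x s 0] \<Theta>(1)[of x] L by (intro mult_left_mono) auto
        then show ?thesis using Lip[of "\<Theta> x s" x] by (simp only: mult.assoc)
      qed
      have *: "norm (h q - h p) \<le> L * M * max \<bar>p\<bar> \<bar>q\<bar> * q - L * M * max \<bar>p\<bar> \<bar>q\<bar> * p" if "p \<le> q" for p q
      proof (rule norm_diff_le_of_derivative[OF that h', where \<phi>' = "\<lambda>_. L * M * max \<bar>p\<bar> \<bar>q\<bar>"])
        fix s assume "p < s" "s < q"
        then have "\<bar>s\<bar> \<le> max \<bar>p\<bar> \<bar>q\<bar>" by auto
        then show "norm (Z (\<Theta> x s) - Z x) \<le> L * M * max \<bar>p\<bar> \<bar>q\<bar>"
          using order_trans[OF h'b[of s] mult_left_mono[of "\<bar>s\<bar>" "max \<bar>p\<bar> \<bar>q\<bar>" "L * M"]] L M by simp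
      qed (auto intro!: derivative_eq_intros)
      have "norm (h t - h 0) \<le> L * M * t\<^sup>2"
        using *[of 0 t] *[of t 0] by (cases "0 \<le> t") (auto simp: norm_minus_commute power2_eq_square abs_if)
      then show ?thesis by (simp add: h_def \<Theta>(1) algebra_simps)
    qed
    \<comment> \<open>A zero of \<open>Z\<close> is a rest point; by uniqueness a trajectory that
      meets one is constant.\<close>
    show "Z (\<Theta> x t) \<noteq> 0" if "Z x \<noteq> 0" for t x
    proof
      assume 0: "Z (\<Theta> x t) = 0"
      have c: "((\<lambda>_. \<Theta> x t) has_vector_derivative Z ((\<lambda>_. \<Theta> x t) s)) (at s)" for s by (simp add: 0)
      have "\<Theta> x 0 = \<Theta> x t" using gron[OF \<Theta>(2)[of x] c, of 0 t] by simp
      then show False using 0 that \<Theta>(1) by simp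
    qed
  qed (use \<Theta> speed L in auto)
qed

section \<open>The flow of a horizontal polar field\<close>

text \<open>In the application \<open>N\<close> is the quasi-norm, \<open>h\<close> the squared length of its horizontal gradient,
  \<open>W\<close> that gradient divided by \<open>h\<close>, and \<open>\<Omega>\<close> the set where neither \<open>N\<close> nor \<open>h\<close> vanishes. The
  derivative and divergence conditions then express \<open>\<L>\<^sub>\<infinity> N = 0\<close> and \<open>\<L> u = 0\<close>.\<close>

locale polar_flow =
  fixes \<Omega> :: "'a::euclidean_space set" and N h :: "'a \<Rightarrow> real" and W :: "'a \<Rightarrow> 'a" and Q :: nat
  assumes open_\<Omega>: "open \<Omega>"
    and N_C1: "Ck_on 1 \<Omega> N" and h_C1: "Ck_on 1 \<Omega> h" and W_C1: "Ck_on 1 \<Omega> W"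
    and N_pos: "x \<in> \<Omega> \<Longrightarrow> N x > 0" and h_pos: "x \<in> \<Omega> \<Longrightarrow> h x > 0"
    and DN_W: "x \<in> \<Omega> \<Longrightarrow> frechet_derivative N (at x) (W x) = 1"
    and Dh_W: "x \<in> \<Omega> \<Longrightarrow> frechet_derivative h (at x) (W x) = 0"
    and div_W: "x \<in> \<Omega> \<Longrightarrow> euclidean_div W x = (real Q - 1) / N x"
    and compact_core: "0 < a \<Longrightarrow> 0 < c \<Longrightarrow> compact {x \<in> \<Omega>. a \<le> N x \<and> N x \<le> b \<and> c \<le> h x}"
    and bounded_band: "0 < a \<Longrightarrow> bounded {x \<in> \<Omega>. a \<le> N x \<and> N x \<le> b}"
    and Q_pos: "Q > 0"
begin

section \<open>Compact cores and cutoffs of \<open>W\<close>\<close>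

definition core :: "real \<Rightarrow> real \<Rightarrow> real \<Rightarrow> 'a set" where
  "core a b c = {x \<in> \<Omega>. a \<le> N x \<and> N x \<le> b \<and> c \<le> h x}"

text \<open>For positive parameters the three factors rise from 0 to 1 over
  \<open>a / 2 \<le> N \<le> a\<close>, fall back to 0 over \<open>b \<le> N \<le> 2 b\<close>, and
  rise from 0 to 1 over \<open>c / 2 \<le> h \<le> c\<close>.\<close>

definition cutoff :: "real \<Rightarrow> real \<Rightarrow> real \<Rightarrow> 'a \<Rightarrow> real" where
  "cutoff a b c x = (if x \<in> \<Omega> then smooth_step (N x / (a / 2) - 1) * smooth_step (2 - N x / b) *
     smooth_step (h x / (c / 2) - 1) else 0)"

lemma W_nz: "x \<in> \<Omega> \<Longrightarrow> W x \<noteq> 0"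
  using DN_W[of x] has_derivative_linear[OF C1_on_has_derivative[OF N_C1, of x]] linear_0 by force

lemma compact_core': "0 < a \<Longrightarrow> 0 < c \<Longrightarrow> compact (core a b c)"
  unfolding core_def by (rule compact_core)

lemma core_subset: "core a b c \<subseteq> \<Omega>"
  by (auto simp: core_def)

lemma cutoff_bounds: "0 \<le> cutoff a b c x" "cutoff a b c x \<le> 1"
  using smooth_step_bounds by (auto simp: cutoff_def mult_le_one)

lemma cutoff_eq_1: "0 < a \<Longrightarrow> 0 < b \<Longrightarrow> 0 < c \<Longrightarrow> x \<in> core a b c \<Longrightarrow> cutoff a b c x = 1"
  by (auto simp: cutoff_def core_def smooth_step_1 field_simps)

lemma cutoff_eq_0:
  assumes "0 < a" "0 < b" "0 < c" "x \<notin> core (a / 2) (2 * b) (c / 2)"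
  shows "cutoff a b c x = 0"
proof (cases "x \<in> \<Omega>")
  case True
  then have "N x < a / 2 \<or> N x > 2 * b \<or> h x < c / 2" using assms(4) by (auto simp: core_def)
  then have "N x / (a / 2) - 1 \<le> 0 \<or> 2 - N x / b \<le> 0 \<or> h x / (c / 2) - 1 \<le> 0"
    using assms by (auto simp: field_simps)
  then show ?thesis using smooth_step_0 by (auto simp: cutoff_def)
qed (simp add: cutoff_def)

lemma C1_smooth_step_comp:
  assumes "Ck_on 1 \<Omega> f"
  shows "Ck_on 1 \<Omega> (\<lambda>x. smooth_step (f x))"
  by (rule Ck_on_compose[OF open_\<Omega> open_UNIV Ck_on_smooth_step assms]) simp

lemma cutoff_C1_\<Omega>: 
  assumes "0 < a" "0 < b" "0 < c"
  shows "Ck_on 1 \<Omega> (cutoff a b c)"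
proof -
  have "Ck_on 1 \<Omega> (\<lambda>x. smooth_step (N x / (a / 2) - 1) * smooth_step (2 - N x / b) * smooth_step (h x / (c / 2) - 1))"
    using assms by (intro Ck_on_mult C1_smooth_step_comp Ck_on_diff Ck_on_divide Ck_on_const open_\<Omega> N_C1 h_C1) auto
  then show ?thesis
    by (subst Ck_on_cong[OF open_\<Omega>]) (auto simp: cutoff_def)
qed

lemma cutoff_C1:
  assumes "0 < a" "0 < b" "0 < c"
  shows "Ck_on 1 UNIV (cutoff a b c)"
  by (rule Ck_on_zero_extension[OF open_\<Omega> cutoff_C1_\<Omega>[OF assms]
        compact_imp_closed[OF compact_core'[of "a / 2" "c / 2" "2 * b"]] core_subset cutoff_eq_0[OF assms]])
    (use assms in auto)

text \<open>Globally Lipschitz and bounded for positive parameters, so its flow exists for all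
  times, and equal to \<open>W\<close> on the core.\<close>

definition cut_field :: "real \<Rightarrow> real \<Rightarrow> real \<Rightarrow> 'a \<Rightarrow> 'a" where
  "cut_field a b c x = cutoff a b c x *\<^sub>R W x"

lemma cut_field_C1:
  assumes "0 < a" "0 < b" "0 < c"
  shows "Ck_on 1 UNIV (cut_field a b c)"
proof (rule Ck_on_zero_extension[OF open_\<Omega> _ compact_imp_closed[OF compact_core'[of "a / 2" "c / 2" "2 * b"]] core_subset])
  show "Ck_on 1 \<Omega> (cut_field a b c)"
    unfolding cut_field_def[abs_def] by (intro Ck_on_scaleR open_\<Omega> cutoff_C1_\<Omega> W_C1 assms)
  show "cut_field a b c x = 0" if "x \<notin> core (a / 2) (2 * b) (c / 2)" for x
    using cutoff_eq_0[OF assms that] by (simp add: cut_field_def)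
qed (use assms in auto)

lemma cut_field_eq:
  assumes "0 < a" "0 < b" "0 < c" "x \<in> core a b c"
  shows "cut_field a b c x = W x"
  using cutoff_eq_1[OF assms] by (simp add: cut_field_def)

lemma cut_field_nz_imp: "cut_field a b c x \<noteq> 0 \<Longrightarrow> x \<in> \<Omega>"
  by (auto simp: cut_field_def cutoff_def split: if_splits)

lemma cut_field_Lipschitz:
  assumes "0 < a" "0 < b" "0 < c"
  obtains L M where "\<And>x y. norm (cut_field a b c x - cut_field a b c y) \<le> L * norm (x - y)"
    "\<And>x. norm (cut_field a b c x) \<le> M"
proof -
  have K: "compact (core (a / 2) (2 * b) (c / 2))" using assms by (intro compact_core') auto
  have z: "cut_field a b c x = 0" if "x \<notin> core (a / 2) (2 * b) (c / 2)" for x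
    using cutoff_eq_0[OF assms that] by (simp add: cut_field_def)
  obtain L where L: "\<And>x y. norm (cut_field a b c x - cut_field a b c y) \<le> L * norm (x - y)"
    using Lipschitz_C1_compact_support[OF cut_field_C1[OF assms] K z] by metis
  obtain M where M: "\<And>x. norm (cut_field a b c x) \<le> M"
    using bounded_continuous_compact_support[OF Ck_on_continuous_on[OF cut_field_C1[OF assms]] K z] by metis
  show ?thesis by (rule that[OF L M])
qed

section \<open>Integral curves of \<open>W\<close> parametrised by the level\<close>

lemma has_vector_derivative_comp:
  fixes f :: "'a \<Rightarrow> real"
  assumes "(c has_vector_derivative v) (at t within S)" "Ck_on 1 \<Omega> f" "c t \<in> \<Omega>"
  shows "((\<lambda>s. f (c s)) has_real_derivative frechet_derivative f (at (c t)) v) (at t within S)"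
  by (rule has_real_derivative_along_curve[OF assms(1) C1_on_differentiable[OF assms(2,3)]])

text \<open>Since \<open>N\<close> grows at unit speed along \<open>W\<close>, the level itself can
  serve as time. Integral curves through a common point then agree without any shift of the
  parameter.\<close>

definition segment_curve :: "(real \<Rightarrow> 'a) \<Rightarrow> real \<Rightarrow> real \<Rightarrow> bool" where
  "segment_curve c a b \<longleftrightarrow> (\<forall>s\<in>{a..b}. c s \<in> \<Omega> \<and> N (c s) = s \<and>
     (c has_vector_derivative W (c s)) (at s within {a..b}))"

lemma segment_curve_h:
  assumes "segment_curve c a b" "s \<in> {a..b}" "t \<in> {a..b}"
  shows "h (c s) = h (c t)"
proof -
  have "((\<lambda>s. h (c s)) has_real_derivative 0) (at r within {a..b})" if "r \<in> {a..b}" for r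
    using has_vector_derivative_comp[of c "W (c r)" r "{a..b}" h] assms(1) that h_C1 Dh_W[of "c r"]
    by (simp add: segment_curve_def)
  then obtain k where "\<And>r. r \<in> {a..b} \<Longrightarrow> h (c r) = k"
    using has_field_derivative_zero_constant[of "{a..b}" "\<lambda>s. h (c s)"] by auto
  then show ?thesis using assms by metis
qed

lemma segment_curve_core:
  assumes "segment_curve c a b" "s0 \<in> {a..b}" "s \<in> {a..b}"
  shows "c s \<in> core a b (h (c s0))"
  using assms segment_curve_h[OF assms] by (auto simp: core_def segment_curve_def)

text \<open>Both curves conserve \<open>h\<close>, and they share its value at \<open>s0\<close>, so
  both stay in one core. There \<open>W\<close> coincides with a globally Lipschitz cut field, and
  Gronwall's estimate applies.\<close>

lemma segment_curve_unique:
  assumes c: "segment_curve c a b" and d: "segment_curve d a b" and "0 < a"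
    and s0: "s0 \<in> {a..b}" "c s0 = d s0" and t: "t \<in> {a..b}"
  shows "c t = d t"
proof -
  define k where "k = h (c s0)"
  have pos: "0 < a" "0 < b" "0 < k"
    using assms h_pos by (auto simp: k_def segment_curve_def)
  obtain L M where L: "\<And>x y. norm (cut_field a b k x - cut_field a b k y) \<le> L * norm (x - y)"
    by (rule cut_field_Lipschitz[OF pos]) (rule that, assumption+)
  have c': "(c has_vector_derivative cut_field a b k (c s)) (at s within {a..b})" if "s \<in> {a..b}" for s
    using c that cut_field_eq[OF pos segment_curve_core[OF c s0(1) that, folded k_def]]
    by (simp add: segment_curve_def)
  have d': "(d has_vector_derivative cut_field a b k (d s)) (at s within {a..b})" if "s \<in> {a..b}" for s
    using d that cut_field_eq[OF pos segment_curve_core[OF d s0(1) that, folded s0(2), folded k_def]]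
    by (simp add: segment_curve_def)
  show ?thesis using ode_gronwall[OF L c' d' s0(1) t] s0(2) by simp
qed

lemma segment_curve_subset:
  "segment_curve c a b \<Longrightarrow> a \<le> a' \<Longrightarrow> b' \<le> b \<Longrightarrow> segment_curve c a' b'"
  unfolding segment_curve_def
  by (auto intro: has_vector_derivative_within_subset[of _ _ _ "{a..b}"])

text \<open>The point of level \<open>s\<close> on the trajectory through \<open>x\<close>, not the
  position after time \<open>s\<close>. The curve is chosen on the shortest interval that contains
  both levels; by uniqueness any longer curve gives the same point.\<close>

definition flow :: "'a \<Rightarrow> real \<Rightarrow> 'a" where
  "flow x s = (SOME c. segment_curve c (min s (N x)) (max s (N x)) \<and> c (N x) = x) s"

lemma flow_eqI:
  assumes c: "segment_curve c a b" "c (N x) = x" and "0 < a" and "N x \<in> {a..b}" "s \<in> {a..b}"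
  shows "flow x s = c s"
proof -
  let ?P = "\<lambda>c. segment_curve c (min s (N x)) (max s (N x)) \<and> c (N x) = x"
  define d where "d = (SOME c. ?P c)"
  have "?P c" using assms by (auto intro: segment_curve_subset)
  moreover from this have "?P d" unfolding d_def by (rule someI[where P = ?P])
  ultimately have "d s = c s"
    using assms by (intro segment_curve_unique[of d "min s (N x)" "max s (N x)" c "N x" s]) auto
  then show ?thesis by (simp add: flow_def d_def)
qed

text \<open>A trajectory of the cut field that starts in the core stays in \<open>\<Omega>\<close>,
  as the field never vanishes on it, and it conserves \<open>h\<close>. \<open>N\<close> moves along
  it at speed between 0 and 1, so during the times from \<open>a - N x\<close> to
  \<open>b - N x\<close> it cannot leave \<open>{a..b}\<close>. Hence the cutoff is 1 during these
  times, the speed is exactly 1, and the trajectory is one of \<open>W\<close>.\<close>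

lemma window:
  assumes "0 < a" "a \<le> b" "0 < c"
  obtains \<theta> L M where
    "\<And>x. \<theta> 0 x = x" "\<And>t x y. norm (\<theta> t x - \<theta> t y) \<le> exp (L * \<bar>t\<bar>) * norm (x - y)"
    "\<And>s t x. norm (\<theta> t x - \<theta> s x) \<le> M * \<bar>t - s\<bar>"
    "\<And>t x. norm (\<theta> t x - x - t *\<^sub>R cut_field a b c x) \<le> L * M * t\<^sup>2" "L > 0"
    "continuous_on UNIV (\<lambda>(x, t). \<theta> t x)"
    "\<And>x. x \<in> core a b c \<Longrightarrow> segment_curve (\<lambda>s. \<theta> (s - N x) x) a b"
    "\<And>x s. x \<in> core a b c \<Longrightarrow> s \<in> {a..b} \<Longrightarrow> flow x s = \<theta> (s - N x) x"
proof -
  have pos: "0 < a" "0 < b" "0 < c" using assms by auto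
  let ?Z = "cut_field a b c"
  obtain L0 M where Z: "\<And>x y. norm (?Z x - ?Z y) \<le> L0 * norm (x - y)" "\<And>x. norm (?Z x) \<le> M"
    by (rule cut_field_Lipschitz[OF pos])  (rule that, assumption+)
  obtain \<theta> L where \<theta>: "\<And>x. \<theta> 0 x = x"
    "\<And>t x. ((\<lambda>t. \<theta> t x) has_vector_derivative ?Z (\<theta> t x)) (at t)"
    "\<And>s t x. \<theta> (s + t) x = \<theta> s (\<theta> t x)"
    "\<And>t x y. norm (\<theta> t x - \<theta> t y) \<le> exp (L * \<bar>t\<bar>) * norm (x - y)"
    "\<And>s t x. norm (\<theta> t x - \<theta> s x) \<le> M * \<bar>t - s\<bar>"
    "\<And>t x. norm (\<theta> t x - x - t *\<^sub>R ?Z x) \<le> L * M * t\<^sup>2"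
    "\<And>t x. ?Z x \<noteq> 0 \<Longrightarrow> ?Z (\<theta> t x) \<noteq> 0" "L > 0"
    "continuous_on UNIV (\<lambda>(x, t). \<theta> t x)"
    by (rule Lipschitz_flow[OF Z]) (rule that, assumption+)
  have seg: "segment_curve (\<lambda>s. \<theta> (s - N x) x) a b" if x: "x \<in> core a b c" for x
  proof -
    have x\<Omega>: "x \<in> \<Omega>" using x by (simp add: core_def)
    have "?Z x \<noteq> 0" using cut_field_eq[OF pos x] W_nz[OF x\<Omega>] by simp
    then have in\<Omega>: "\<theta> t x \<in> \<Omega>" for t using \<theta>(7) cut_field_nz_imp by blast
    have lin: "frechet_derivative f (at y) (?Z y) = cutoff a b c y * frechet_derivative f (at y) (W y)"
      if "Ck_on 1 \<Omega> f" "y \<in> \<Omega>" for f :: "'a \<Rightarrow> real" and y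
      using linear_scale[OF has_derivative_linear[OF C1_on_has_derivative[OF that]]] by (simp add: cut_field_def)
    have "((\<lambda>t. h (\<theta> t x)) has_real_derivative 0) (at t)" for t
      using has_vector_derivative_comp[OF \<theta>(2) h_C1 in\<Omega>, of t] lin[OF h_C1 in\<Omega>[of t]] Dh_W[OF in\<Omega>[of t]] by simp
    then have "h (\<theta> t x) = h (\<theta> 0 x)" for t using DERIV_isconst_all by blast
    then have hc: "h (\<theta> t x) \<ge> c" for t using x \<theta>(1) by (simp add: core_def)
    define n where "n t = N (\<theta> t x)" for t
    have n': "(n has_real_derivative cutoff a b c (\<theta> t x)) (at t)" for t
      unfolding n_def
      using has_vector_derivative_comp[OF \<theta>(2) N_C1 in\<Omega>, of t] lin[OF N_C1 in\<Omega>[of t]] DN_W[OF in\<Omega>[of t]] by simp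
    \<comment> \<open>The derivative of \<open>n\<close> is the value of the cutoff, which lies
      between 0 and 1.\<close>
    have mono: "n p \<le> n q" "n q - n p \<le> q - p" if "p \<le> q" for p q
    proof -
      show "n p \<le> n q"
        by (rule DERIV_nonneg_imp_nondecreasing[OF that]) (use n' cutoff_bounds(1) in blast)
      have "n q - q \<le> n p - p"
      proof (rule DERIV_nonpos_imp_nonincreasing[OF that, of "\<lambda>t. n t - t"])
        fix t
        show "\<exists>y. ((\<lambda>t. n t - t) has_real_derivative y) (at t) \<and> y \<le> 0"
          by (rule exI[of _ "cutoff a b c (\<theta> t x) - 1"])
            (auto intro!: derivative_eq_intros n' simp: cutoff_bounds)
      qed
      then show "n q - n p \<le> q - p" by simp
    qed
    have n0: "n 0 = N x" by (simp add: n_def \<theta>(1))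
    have Nx: "a \<le> N x" "N x \<le> b" using x by (auto simp: core_def)
    have nab: "n t \<in> {a..b}" if "t \<in> {a - N x..b - N x}" for t
      using mono[of 0 t] mono[of t 0] n0 Nx that by (cases "0 \<le> t") auto
    have incore: "\<theta> t x \<in> core a b c" if "t \<in> {a - N x..b - N x}" for t
      using nab[OF that] in\<Omega> hc by (auto simp: core_def n_def)
    have neq: "n t = N x + t" if t: "t \<in> {a - N x..b - N x}" for t
    proof -
      have "((\<lambda>t. n t - t) has_real_derivative 0) (at r within {a - N x..b - N x})" if "r \<in> {a - N x..b - N x}" for r
        by (rule DERIV_subset[of _ _ _ UNIV])
          (auto intro!: derivative_eq_intros n' simp: cutoff_eq_1[OF pos incore[OF that]])
      then obtain k where k: "\<And>r. r \<in> {a - N x..b - N x} \<Longrightarrow> n r - r = k"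
        using has_field_derivative_zero_constant[of "{a - N x..b - N x}" "\<lambda>t. n t - t"] by auto
      have "0 \<in> {a - N x..b - N x}" using Nx by simp
      from k[OF this] k[OF t] show ?thesis using n0 by simp
    qed
    show ?thesis
      unfolding segment_curve_def
    proof (intro ballI conjI)
      fix s assume s: "s \<in> {a..b}"
      then have s': "s - N x \<in> {a - N x..b - N x}" by auto
      show "\<theta> (s - N x) x \<in> \<Omega>" by (rule in\<Omega>)
      show "N (\<theta> (s - N x) x) = s" using neq[OF s'] by (simp add: n_def)
      have "((\<lambda>s. s - N x) has_vector_derivative 1) (at s)" by (auto intro!: derivative_eq_intros)
      from vector_diff_chain_at[OF this \<theta>(2)]
      have "((\<lambda>s. \<theta> (s - N x) x) has_vector_derivative ?Z (\<theta> (s - N x) x)) (at s)" by (simp add: o_def)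
      then show "((\<lambda>s. \<theta> (s - N x) x) has_vector_derivative W (\<theta> (s - N x) x)) (at s within {a..b})"
        using cut_field_eq[OF pos incore[OF s']] by (simp add: has_vector_derivative_at_within)
    qed
  qed
  have fl: "flow x s = \<theta> (s - N x) x" if "x \<in> core a b c" "s \<in> {a..b}" for x s
    by (rule flow_eqI[OF seg[OF that(1)]]) (use that pos \<theta>(1) in \<open>auto simp: core_def\<close>)
  show ?thesis by (rule that[OF \<theta>(1,4,5,6,8,9) seg fl])
qed

lemma flow_segment:
  assumes "x \<in> \<Omega>" "0 < a" "N x \<in> {a..b}"
  shows "segment_curve (flow x) a b"
proof -
  have ab: "a \<le> b" using assms by auto
  obtain \<theta> L M where \<theta>: "\<And>x'. x' \<in> core a b (h x) \<Longrightarrow> segment_curve (\<lambda>s. \<theta> (s - N x') x') a b"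
    "\<And>x' s. x' \<in> core a b (h x) \<Longrightarrow> s \<in> {a..b} \<Longrightarrow> flow x' s = \<theta> (s - N x') x'"
    by (rule window[OF assms(2) ab h_pos[OF assms(1)]]) (rule that, assumption+)
  have x: "x \<in> core a b (h x)" using assms by (auto simp: core_def)
  have "(flow x has_vector_derivative W (flow x s)) (at s within {a..b})" if "s \<in> {a..b}" for s
  proof (rule has_vector_derivative_transform[OF that])
    show "((\<lambda>s. \<theta> (s - N x) x) has_vector_derivative W (flow x s)) (at s within {a..b})"
      using \<theta>(1)[OF x] \<theta>(2)[OF x that] that by (simp add: segment_curve_def)
  qed (use \<theta>(2)[OF x] in simp)
  then show ?thesis using \<theta>(1)[OF x] \<theta>(2)[OF x] by (simp add: segment_curve_def)
qed

lemma flow_self: "x \<in> \<Omega> \<Longrightarrow> flow x (N x) = x"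
  and flow_in: "x \<in> \<Omega> \<Longrightarrow> s > 0 \<Longrightarrow> flow x s \<in> \<Omega>"
  and N_flow: "x \<in> \<Omega> \<Longrightarrow> s > 0 \<Longrightarrow> N (flow x s) = s"
  and h_flow: "x \<in> \<Omega> \<Longrightarrow> s > 0 \<Longrightarrow> h (flow x s) = h x"
  and flow_derivative: "x \<in> \<Omega> \<Longrightarrow> s > 0 \<Longrightarrow> (flow x has_vector_derivative W (flow x s)) (at s)"
proof -
  assume x: "x \<in> \<Omega>"
  obtain \<theta> L M where "\<And>x. \<theta> 0 x = x"
    "\<And>x' s. x' \<in> core (N x) (N x) (h x) \<Longrightarrow> s \<in> {N x..N x} \<Longrightarrow> flow x' s = \<theta> (s - N x') x'"
    by (rule window[OF N_pos[OF x] order_refl h_pos[OF x]]) (rule that, assumption+)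
  then show self: "flow x (N x) = x" using x by (simp add: core_def)
  assume s: "s > 0"
  let ?a = "min s (N x) / 2" and ?b = "2 * max s (N x)"
  have pos: "0 < ?a" "N x \<in> {?a..?b}" "s \<in> {?a..?b}" "s \<in> {?a<..<?b}" using s N_pos[OF x] by auto
  have seg: "segment_curve (flow x) ?a ?b" by (rule flow_segment[OF x pos(1,2)])
  then show "flow x s \<in> \<Omega>" "N (flow x s) = s" using pos(3) by (auto simp: segment_curve_def)
  show "h (flow x s) = h x" using segment_curve_h[OF seg pos(3,2)] self by simp
  have "s \<in> interior {?a..?b}" using pos(4) unfolding interior_atLeastAtMost_real .
  have "(flow x has_vector_derivative W (flow x s)) (at s within {?a..?b})"
    using seg pos(3) unfolding segment_curve_def by blast
  then show "(flow x has_vector_derivative W (flow x s)) (at s)"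
    unfolding at_within_interior[OF \<open>s \<in> interior {?a..?b}\<close>] .
qed

lemma flow_flow:
  assumes "x \<in> \<Omega>" "s > 0" "t > 0"
  shows "flow (flow x s) t = flow x t"
proof -
  let ?a = "min (min s t) (N x)" and ?b = "max (max s t) (N x)"
  have "segment_curve (flow x) ?a ?b" by (rule flow_segment) (use assms N_pos in auto)
  then show ?thesis
    by (rule flow_eqI) (use assms N_pos N_flow in auto)
qed

lemma flow_same_level:
  assumes "x \<in> \<Omega>" "y \<in> \<Omega>" "s > 0" "t > 0" "flow x s = flow y t" "N x = N y"
  shows "x = y"
proof -
  have "x = flow (flow x s) (N x)" using assms flow_flow[of x s "N x"] flow_self[of x] N_pos[of x] by simp
  also have "\<dots> = flow (flow y t) (N y)" using assms by simp
  also have "\<dots> = y" using assms flow_flow[of y t "N y"] flow_self[of y] N_pos[of y] by simp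
  finally show ?thesis .
qed

lemma continuous_on_flow: "continuous_on (\<Omega> \<times> {0<..}) (\<lambda>(x, s). flow x s)"
proof -
  have "isCont (\<lambda>(x, s). flow x s) p" if p: "p \<in> \<Omega> \<times> {0<..}" for p
  proof -
    obtain x s where xs: "p = (x, s)" "x \<in> \<Omega>" "s > 0" using p by auto
    \<comment> \<open>The factors 1/2 and 2 put \<open>x\<close> and \<open>s\<close> in the
      interior of the window, so that one window serves a whole neighbourhood of the point.\<close>
    define a b c where "a = min s (N x) / 2" and "b = 2 * max s (N x)" and "c = h x / 2"
    have pos: "0 < a" "a \<le> b" "0 < c" using xs N_pos[of x] h_pos[of x] by (auto simp: a_def b_def c_def)
    obtain \<theta> L M where \<theta>: "continuous_on UNIV (\<lambda>(x, t). \<theta> t x)"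
      "\<And>x s. x \<in> core a b c \<Longrightarrow> s \<in> {a..b} \<Longrightarrow> flow x s = \<theta> (s - N x) x"
      by (rule window[OF pos]) (rule that, assumption+)
    define V where "V = \<Omega> \<inter> N -` {a<..<b} \<inter> (\<Omega> \<inter> h -` {c<..})"
    have oV: "open V"
      unfolding V_def using Ck_on_continuous_on[OF N_C1] Ck_on_continuous_on[OF h_C1] open_\<Omega>
      by (intro open_Int continuous_open_preimage) auto
    have pV: "p \<in> V \<times> {a<..<b}" using xs N_pos[of x] h_pos[of x] by (auto simp: V_def a_def b_def c_def)
    have "continuous_on (V \<times> {a<..<b}) (\<lambda>q. (\<lambda>(x, t). \<theta> t x) (fst q, snd q - N (fst q)))"
      by (rule continuous_on_compose2[OF \<theta>(1)])
        (auto intro!: continuous_intros continuous_on_compose2[OF Ck_on_continuous_on[OF N_C1]] simp: V_def)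
    then have "continuous_on (V \<times> {a<..<b}) (\<lambda>(x, s). flow x s)"
      by (rule continuous_on_eq) (auto simp: V_def core_def intro!: \<theta>(2)[symmetric])
    moreover have "open (V \<times> {a<..<b})" using oV by (simp add: open_Times)
    ultimately show ?thesis using continuous_on_eq_continuous_at pV by blast
  qed
  then show ?thesis by (simp add: continuous_at_imp_continuous_on)
qed

end

section \<open>Derivative rules\<close>

lemma frechet_derivative_eqI: "(f has_derivative D) (at x) \<Longrightarrow> frechet_derivative f (at x) = D"
  using frechet_derivative_at by metis

lemma frechet_derivative_cong_open:
  assumes "open U" "x \<in> U" "\<And>y. y \<in> U \<Longrightarrow> f y = g y"
  shows "frechet_derivative f (at x) = frechet_derivative g (at x)"
proof -
  have "(f has_derivative D) (at x) \<longleftrightarrow> (g has_derivative D) (at x)" for D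
    using has_derivative_transform_within_open[of f D x UNIV U g]
      has_derivative_transform_within_open[of g D x UNIV U f] assms by auto
  then show ?thesis by (simp add: frechet_derivative_def)
qed

lemma frechet_derivative_chain_real:
  fixes f :: "'a::euclidean_space \<Rightarrow> real"
  assumes "f differentiable (at x)" "(k has_real_derivative k') (at (f x))"
  shows "(\<lambda>y. k (f y)) differentiable (at x)"
    "frechet_derivative (\<lambda>y. k (f y)) (at x) v = k' * frechet_derivative f (at x) v"
proof -
  have "((\<lambda>y. k (f y)) has_derivative (\<lambda>v. k' * frechet_derivative f (at x) v)) (at x)"
    using has_derivative_compose[of f "frechet_derivative f (at x)" x UNIV k "(*) k'"] assms
    by (simp add: has_field_derivative_def frechet_derivative_works)
  then show "(\<lambda>y. k (f y)) differentiable (at x)"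
    "frechet_derivative (\<lambda>y. k (f y)) (at x) v = k' * frechet_derivative f (at x) v"
    by (auto simp: differentiable_def frechet_derivative_eqI)
qed

lemma frechet_derivative_mult:
  fixes f g :: "'a::euclidean_space \<Rightarrow> real"
  assumes "f differentiable (at x)" "g differentiable (at x)"
  shows "frechet_derivative (\<lambda>y. f y * g y) (at x) v =
    f x * frechet_derivative g (at x) v + frechet_derivative f (at x) v * g x"
  using frechet_derivative_eqI[OF has_derivative_mult[OF
      assms(1)[unfolded frechet_derivative_works] assms(2)[unfolded frechet_derivative_works]]] by simp

lemma smooth_step_differentiable: "\<exists>d. (smooth_step has_real_derivative d) (at t)"
proof -
  have "smooth_step differentiable (at t)" by (rule C1_on_differentiable[OF Ck_on_smooth_step]) simp
  then show ?thesis using real_differentiable_def by blast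
qed

section \<open>Invariance of the flow under the continuity equation\<close>

context polar_flow
begin

text \<open>The invariant function is \<open>\<phi>\<close> at the crossing point with level 1; the
  field is \<open>\<xi> (N) \<kappa> (h) W\<close> with a cutoff \<open>\<kappa>\<close>. As
  \<open>W\<close> moves \<open>N\<close> at unit speed, preserves \<open>h\<close> and has
  divergence \<open>(Q - 1) / N\<close>, the divergence of that field is \<open>\<kappa> (h)\<close>
  times the bracket in the statement. Where \<open>\<kappa>\<close> is below 1 the factor
  \<open>\<phi>\<close> vanishes, so \<open>\<kappa>\<close> drops out.\<close>

lemma transport_identity:
  fixes \<phi> :: "'a \<Rightarrow> real" and \<xi> \<xi>' :: "real \<Rightarrow> real"
  assumes \<phi>: "\<And>x y. \<bar>\<phi> x - \<phi> y\<bar> \<le> L\<phi> * norm (x - y)"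
    and c: "c > 0" "\<And>y. y \<in> \<Omega> \<Longrightarrow> h y < c \<Longrightarrow> \<phi> y = 0"
    and ab: "0 < a" "a \<le> 1" "1 \<le> b"
    and \<xi>: "Ck_on 1 UNIV \<xi>" "\<And>s. s \<notin> {a..b} \<Longrightarrow> \<xi> s = 0" "\<And>s. (\<xi> has_real_derivative \<xi>' s) (at s)"
  shows "(LINT x|lborel. indicator \<Omega> x * (\<phi> (flow x 1) * (\<xi>' (N x) + (real Q - 1) * \<xi> (N x) / N x))) = 0"
proof -
  define A B c' where "A = a / 2" and "B = 2 * b" and "c' = c / 2"
  have pos: "0 < A" "A \<le> B" "0 < c'" "0 < B" using ab c by (auto simp: A_def B_def c'_def)
  obtain \<theta> L M where \<theta>: "\<And>t x y. norm (\<theta> t x - \<theta> t y) \<le> exp (L * \<bar>t\<bar>) * norm (x - y)"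
    "\<And>s t x. norm (\<theta> t x - \<theta> s x) \<le> M * \<bar>t - s\<bar>"
    "\<And>t x. norm (\<theta> t x - x - t *\<^sub>R cut_field A B c' x) \<le> L * M * t\<^sup>2" "L > 0"
    "\<And>x s. x \<in> core A B c' \<Longrightarrow> s \<in> {A..B} \<Longrightarrow> flow x s = \<theta> (s - N x) x"
    by (rule window[OF pos(1-3)]) (rule that, assumption+)
  have M0: "M \<ge> 0" using order_trans[OF norm_ge_zero \<theta>(2)[of 1 0 0]] by simp
  \<comment> \<open>A compactly supported substitute for \<open>N - 1\<close>. Running the cut flow
    for the time \<open>- N'\<close> gives a map that is Lipschitz on the whole space and is the
    projection to level 1 on the core.\<close>
  define N' where "N' x = cutoff A B c' x * (N x - 1)" for x
  define KK where "KK = core (A / 2) (2 * B) (c' / 2)"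
  have KK: "compact KK" unfolding KK_def using pos by (intro compact_core') auto
  have N'0: "N' x = 0" if "x \<notin> KK" for x
    using cutoff_eq_0[OF pos(1,4,3) that[unfolded KK_def]] by (simp add: N'_def)
  have N'1: "Ck_on 1 UNIV N'"
  proof (rule Ck_on_zero_extension[OF open_\<Omega> _ compact_imp_closed[OF KK] _ N'0])
    show "Ck_on 1 \<Omega> N'"
      unfolding N'_def[abs_def]
      by (intro Ck_on_mult Ck_on_diff Ck_on_const open_\<Omega> N_C1 cutoff_C1_\<Omega> pos)
    show "KK \<subseteq> \<Omega>" unfolding KK_def by (rule core_subset)
  qed
  obtain LN where LN: "LN \<ge> 0" "\<And>x y. norm (N' x - N' y) \<le> LN * norm (x - y)"
    by (rule Lipschitz_C1_compact_support[OF N'1 KK N'0]) (assumption, rule that, assumption+)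
  obtain BN where BN: "BN \<ge> 0" "\<And>x. norm (N' x) \<le> BN"
    by (rule bounded_continuous_compact_support[OF Ck_on_continuous_on[OF N'1] KK N'0]) (assumption, rule that, assumption+)
  define P where "P x = \<theta> (- N' x) x" for x
  define F where "F x = \<phi> (P x)" for x
  have P_core: "P x = flow x 1" if "x \<in> core A B c'" for x
    using \<theta>(5)[OF that, of 1] cutoff_eq_1[OF pos(1,4,3) that] ab by (simp add: P_def N'_def A_def B_def)
  define LP where "LP = exp (L * BN) + M * LN"
  have LP: "norm (P x - P y) \<le> LP * norm (x - y)" for x y
  proof -
    have "norm (P x - P y) \<le> norm (\<theta> (- N' x) x - \<theta> (- N' x) y) + norm (\<theta> (- N' x) y - \<theta> (- N' y) y)"
      unfolding P_def using norm_triangle_ineq[of "\<theta> (- N' x) x - \<theta> (- N' x) y" "\<theta> (- N' x) y - \<theta> (- N' y) y"] by simp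
    also have "norm (\<theta> (- N' x) x - \<theta> (- N' x) y) \<le> exp (L * BN) * norm (x - y)"
    proof (rule order_trans[OF \<theta>(1)])
      show "exp (L * \<bar>- N' x\<bar>) * norm (x - y) \<le> exp (L * BN) * norm (x - y)"
        using BN(2)[of x] \<theta>(4) by (intro mult_right_mono) auto
    qed
    also have "norm (\<theta> (- N' x) y - \<theta> (- N' y) y) \<le> M * (LN * norm (x - y))"
    proof (rule order_trans[OF \<theta>(2)])
      show "M * \<bar>- N' x - - N' y\<bar> \<le> M * (LN * norm (x - y))"
        using LN(2)[of x y] M0 by (intro mult_left_mono) (auto simp: abs_minus_commute)
    qed
    finally show ?thesis by (simp add: LP_def algebra_simps)
  qed
  have L\<phi>0: "L\<phi> \<ge> 0"
  proof -
    obtain e :: 'a where "e \<in> Basis" using nonempty_Basis by blast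
    then show ?thesis using \<phi>[of e 0] abs_ge_zero[of "\<phi> e - \<phi> 0"] by simp
  qed
  define LF where "LF = L\<phi> * LP"
  have LF: "\<bar>F x - F y\<bar> \<le> LF * norm (x - y)" for x y
    unfolding F_def LF_def mult.assoc
    by (rule order_trans[OF \<phi>]) (rule mult_left_mono[OF LP L\<phi>0])
  define \<kappa> where "\<kappa> t = smooth_step (t / (c / 2) - 1)" for t
  define \<psi> where "\<psi> x = (if x \<in> \<Omega> then \<xi> (N x) * \<kappa> (h x) else 0)" for x
  define Z where "Z x = \<psi> x *\<^sub>R W x" for x
  define K where "K = core a b (c / 2)"
  have K: "compact K" unfolding K_def using ab c by (intro compact_core') auto
  have K_sub: "K \<subseteq> core A B c'" using ab by (auto simp: K_def core_def A_def B_def c'_def)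
  have \<kappa>0: "\<kappa> t = 0" if "t \<le> c / 2" for t using that c by (auto simp: \<kappa>_def smooth_step_0 field_simps)
  have \<kappa>1: "\<kappa> t = 1" if "t \<ge> c" for t using that c by (auto simp: \<kappa>_def smooth_step_1 field_simps)
  have \<psi>0: "\<psi> x = 0" if "x \<notin> K" for x
    using that \<xi>(2)[of "N x"] \<kappa>0[of "h x"] by (auto simp: \<psi>_def K_def core_def)
  have \<xi>N: "Ck_on 1 \<Omega> (\<lambda>x. \<xi> (N x))"
    by (rule Ck_on_compose[OF open_\<Omega> open_UNIV \<xi>(1) N_C1]) simp
  have \<kappa>h: "Ck_on 1 \<Omega> (\<lambda>x. \<kappa> (h x))"
    unfolding \<kappa>_def using c
    by (intro C1_smooth_step_comp Ck_on_diff Ck_on_divide Ck_on_const open_\<Omega> h_C1) auto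
  have \<psi>\<Omega>: "Ck_on 1 \<Omega> \<psi>"
  proof -
    have "Ck_on 1 \<Omega> (\<lambda>x. \<xi> (N x) * \<kappa> (h x))" by (rule Ck_on_mult[OF open_\<Omega> \<xi>N \<kappa>h])
    then show ?thesis by (subst Ck_on_cong[OF open_\<Omega>]) (auto simp: \<psi>_def)
  qed
  have Z0: "Z x = 0" if "x \<notin> K" for x using \<psi>0[OF that] by (simp add: Z_def)
  have Z1: "Ck_on 1 UNIV Z"
  proof (rule Ck_on_zero_extension[OF open_\<Omega> _ compact_imp_closed[OF K] _ Z0])
    show "Ck_on 1 \<Omega> Z" unfolding Z_def[abs_def] by (intro Ck_on_scaleR open_\<Omega> \<psi>\<Omega> W_C1)
    show "K \<subseteq> \<Omega>" unfolding K_def by (rule core_subset)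
  qed
  have \<psi>1: "Ck_on 1 UNIV \<psi>"
    by (rule Ck_on_zero_extension[OF open_\<Omega> \<psi>\<Omega> compact_imp_closed[OF K] _ \<psi>0])
      (auto simp: K_def core_def)
  obtain B\<psi> where B\<psi>: "B\<psi> \<ge> 0" "\<And>x. norm (\<psi> x) \<le> B\<psi>"
    by (rule bounded_continuous_compact_support[OF Ck_on_continuous_on[OF \<psi>1] K \<psi>0]) (assumption, rule that, assumption+)
  \<comment> \<open>Steps shorter than this change the level by at most \<open>a / 2\<close>, so a
    point of \<open>K\<close> stays between the levels \<open>a / 2\<close> and \<open>2 b\<close>;
    here \<open>a \<le> 1 \<le> b\<close> is used.\<close>
  define \<delta> where "\<delta> = a / (2 * (B\<psi> + 1))"
  have \<delta>: "\<delta> > 0" using ab B\<psi> by (simp add: \<delta>_def)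
  have "(LINT x|lborel. F x * euclidean_div Z x) = 0"
  proof (rule integral_invariant_times_div[OF LF Z1 K Z0 \<delta>])
    fix \<tau> x assume \<tau>: "0 < \<tau>" "\<tau> < \<delta>"
    show "\<bar>F (x + \<tau> *\<^sub>R Z x) - F x\<bar> \<le> (LF * (L * M * B\<psi>\<^sup>2)) * \<tau>\<^sup>2"
    proof (cases "x \<in> K")
      case False
      have "LF \<ge> 0" using L\<phi>0 M0 LN(1) by (auto simp: LF_def LP_def)
      then show ?thesis using Z0[OF False] \<theta>(4) M0 by simp
    next
      case True
      then have xc: "x \<in> core A B c'" and x\<Omega>: "x \<in> \<Omega>" using K_sub core_subset by blast+
      define r where "r = \<tau> * \<psi> x"
      have rb: "\<bar>r\<bar> \<le> \<tau> * B\<psi>" using \<tau> B\<psi>(2)[of x] by (simp add: r_def abs_mult)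
      have "\<tau> * B\<psi> \<le> \<delta> * (B\<psi> + 1)" using \<tau> B\<psi>(1) by (intro mult_mono) auto
      also have "\<dots> = a / 2"
      proof -
        have "a / (2 * p) * p = a / 2" if "p \<noteq> 0" for p :: real using that by simp
        from this[of "B\<psi> + 1"] show ?thesis using B\<psi>(1) by (simp only: \<delta>_def)
      qed
      finally have r2: "\<bar>r\<bar> \<le> a / 2" using rb by linarith
      have Nr: "N x + r \<in> {A..B}"
        using True r2 ab by (auto simp: K_def core_def A_def B_def)
      have Nr0: "N x + r > 0" using Nr pos by auto
      have fr: "\<theta> r x = flow x (N x + r)" using \<theta>(5)[OF xc Nr] by simp
      have "\<theta> r x \<in> core A B c'"
        using flow_in[OF x\<Omega> Nr0] N_flow[OF x\<Omega> Nr0] h_flow[OF x\<Omega> Nr0] Nr xc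
        unfolding fr by (auto simp: core_def)
      then have "P (\<theta> r x) = flow (flow x (N x + r)) 1" using P_core fr by simp
      also have "\<dots> = P x" using flow_flow[OF x\<Omega> Nr0, of 1] P_core[OF xc] by simp
      \<comment> \<open>\<open>F\<close> is exactly constant along the flow; what remains is the
        second order gap between the flow and the straight step.\<close>
      finally have "F (\<theta> r x) = F x" by (simp add: F_def)
      then have "\<bar>F (x + \<tau> *\<^sub>R Z x) - F x\<bar> = \<bar>F (x + r *\<^sub>R cut_field A B c' x) - F (\<theta> r x)\<bar>"
        using cut_field_eq[OF pos(1,4,3) xc] by (simp add: Z_def r_def)
      also have "\<dots> \<le> LF * norm (x + r *\<^sub>R cut_field A B c' x - \<theta> r x)" by (rule LF)
      also have "\<dots> \<le> LF * (L * M * r\<^sup>2)"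
      proof (rule mult_left_mono)
        have "norm (x + r *\<^sub>R cut_field A B c' x - \<theta> r x) = norm (\<theta> r x - x - r *\<^sub>R cut_field A B c' x)"
          by (metis diff_diff_eq norm_minus_commute)
        then show "norm (x + r *\<^sub>R cut_field A B c' x - \<theta> r x) \<le> L * M * r\<^sup>2" using \<theta>(3)[of r x] by simp
        show "LF \<ge> 0" using L\<phi>0 M0 LN(1) by (auto simp: LF_def LP_def)
      qed
      also have "\<dots> \<le> LF * (L * M * (\<tau> * B\<psi>)\<^sup>2)"
      proof (intro mult_left_mono)
        show "r\<^sup>2 \<le> (\<tau> * B\<psi>)\<^sup>2" using rb by (metis abs_le_square_iff abs_of_nonneg abs_ge_zero order_trans)
        show "LF \<ge> 0" using L\<phi>0 M0 LN(1) by (auto simp: LF_def LP_def)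
      qed (use \<theta>(4) M0 in auto)
      also have "\<dots> = (LF * (L * M * B\<psi>\<^sup>2)) * \<tau>\<^sup>2" by (simp add: power_mult_distrib mult_ac)
      finally show ?thesis .
    qed
  qed
  moreover have "F x * euclidean_div Z x =
      indicator \<Omega> x * (\<phi> (flow x 1) * (\<xi>' (N x) + (real Q - 1) * \<xi> (N x) / N x))" for x
  proof (cases "x \<in> \<Omega>")
    case False
    then have "x \<notin> K" using core_subset by (auto simp: K_def)
    then have "euclidean_div Z x = 0"
      using frechet_derivative_zero_outside[OF compact_imp_closed[OF K] Z0] by (simp add: euclidean_div_def)
    then show ?thesis using False by simp
  next
    case True
    have dN: "N differentiable (at x)" and dh: "h differentiable (at x)" and dW: "W differentiable (at x)"
      and d\<psi>: "\<psi> differentiable (at x)"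
      using C1_on_differentiable True N_C1 h_C1 W_C1 \<psi>\<Omega> by blast+
    obtain k' where "(smooth_step has_real_derivative k') (at (h x / (c / 2) - 1))"
      using smooth_step_differentiable by blast
    then have \<kappa>': "(\<kappa> has_real_derivative k' * (1 / (c / 2))) (at (h x))"
      unfolding \<kappa>_def[abs_def]
      by (rule DERIV_chain2) (use c in \<open>auto intro!: derivative_eq_intros\<close>)
    have "frechet_derivative \<psi> (at x) (W x) = frechet_derivative (\<lambda>x. \<xi> (N x) * \<kappa> (h x)) (at x) (W x)"
      by (subst frechet_derivative_cong_open[OF open_\<Omega> True, of \<psi> "\<lambda>x. \<xi> (N x) * \<kappa> (h x)"]) (auto simp: \<psi>_def)
    also have "\<dots> = \<xi>' (N x) * \<kappa> (h x)"
      using frechet_derivative_chain_real[OF dN \<xi>(3)] frechet_derivative_chain_real[OF dh \<kappa>']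
        frechet_derivative_mult[of "\<lambda>x. \<xi> (N x)" x "\<lambda>x. \<kappa> (h x)" "W x"] DN_W[OF True] Dh_W[OF True] by simp
    finally have div: "euclidean_div Z x = \<kappa> (h x) * (\<xi>' (N x) + (real Q - 1) * \<xi> (N x) / N x)"
      using euclidean_div_scaleR[OF d\<psi> dW] div_W[OF True] True
      unfolding Z_def[abs_def] by (simp add: \<psi>_def algebra_simps)
    have fl: "flow x 1 \<in> \<Omega>" "h (flow x 1) = h x" using flow_in h_flow True by auto
    consider "N x \<notin> {a..b}" | "N x \<in> {a..b}" "h x \<ge> c / 2" | "h x < c / 2" by linarith
    then show ?thesis
    proof cases
      case 1
      have "((\<lambda>_. 0) has_real_derivative \<xi>' (N x)) (at (N x))"
        by (rule has_field_derivative_transform_within_open[OF \<xi>(3), where S = "- {a..b}"]) (use 1 \<xi>(2) in auto)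
      then have "\<xi>' (N x) = 0" using DERIV_const DERIV_unique by blast
      then show ?thesis using div \<xi>(2)[OF 1] by simp
    next
      case 2
      then have "x \<in> core A B c'" using True K_sub by (auto simp: K_def core_def)
      then have Fx: "F x = \<phi> (flow x 1)" using P_core by (simp add: F_def)
      show ?thesis
      proof (cases "h x \<ge> c")
        case True
        then show ?thesis using Fx div \<kappa>1[OF True] \<open>x \<in> \<Omega>\<close> by simp
      next
        case False
        then have "\<phi> (flow x 1) = 0" using c(2)[OF fl(1)] fl(2) by simp
        then show ?thesis using Fx by simp
      qed
    next
      case 3
      then have "\<phi> (flow x 1) = 0" using c fl by simp
      then show ?thesis using div \<kappa>0[of "h x"] 3 by simp
    qed
  qed
  ultimately show ?thesis by simp
qed

text \<open>With \<open>\<eta>\<close> the antiderivative of \<open>\<psi>\<close> and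
  \<open>\<xi> = \<eta> / s^(Q-1)\<close>, the expression \<open>\<xi>' + (Q - 1) \<xi> / s\<close>
  of the previous lemma collapses to \<open>\<psi> / s^(Q-1)\<close>. Mean zero is what makes
  \<open>\<eta>\<close>, and hence \<open>\<xi>\<close>, vanish above \<open>b\<close>.\<close>

lemma transport_mean_zero:
  fixes \<phi> :: "'a \<Rightarrow> real" and \<psi> :: "real \<Rightarrow> real"
  assumes \<phi>: "\<And>x y. \<bar>\<phi> x - \<phi> y\<bar> \<le> L\<phi> * norm (x - y)"
    and c: "c > 0" "\<And>y. y \<in> \<Omega> \<Longrightarrow> h y < c \<Longrightarrow> \<phi> y = 0"
    and ab: "0 < a" "a \<le> 1" "1 \<le> b"
    and \<psi>: "continuous_on UNIV \<psi>" "\<And>s. s \<notin> {a..b} \<Longrightarrow> \<psi> s = 0" "(LINT s|lborel. \<psi> s) = 0"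
  shows "(LINT x|lborel. indicator \<Omega> x * (\<phi> (flow x 1) * (\<psi> (N x) / N x ^ (Q - 1)))) = 0"
proof -
  define \<eta> where "\<eta> = antiderivative \<psi>"
  have \<eta>': "(\<eta> has_real_derivative \<psi> s) (at s)" for s
    using antiderivative_has_vector_derivative[OF \<psi>(1)]
    by (simp add: has_real_derivative_iff_has_vector_derivative \<eta>_def)
  have \<eta>1: "Ck_on 1 UNIV \<eta>"
    using Ck_on_real_SucI[OF open_UNIV \<eta>', of 0] \<psi>(1) by simp
  have z: "\<eta> s = 0" if "s \<notin> {a..b}" for s
  proof -
    have fin: "\<eta> 0 = 0" by (simp add: \<eta>_def)
    have const: "\<eta> p = \<eta> q" if "p \<le> q" "\<And>r. p \<le> r \<Longrightarrow> r \<le> q \<Longrightarrow> \<psi> r = 0" for p q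
    proof -
      have "(\<eta> has_real_derivative 0) (at r within {p..q})" if r: "r \<in> {p..q}" for r
        using \<eta>'[of r] that \<open>\<And>r. p \<le> r \<Longrightarrow> r \<le> q \<Longrightarrow> \<psi> r = 0\<close>[of r] by (simp add: has_field_derivative_at_within)
      then obtain k where "\<And>r. r \<in> {p..q} \<Longrightarrow> \<eta> r = k"
        using has_field_derivative_zero_constant[of "{p..q}" \<eta>] by auto
      then show ?thesis using that(1) by auto
    qed
    show ?thesis
    proof (cases "s < a")
      case True
      have "\<eta> (min s 0) = \<eta> (max s 0)" 
      proof (rule const)
        show "\<psi> r = 0" if "r \<le> max s 0" for r
          by (rule \<psi>(2)) (use that True ab in \<open>auto simp: max_def split: if_splits\<close>)
      qed simp
      then show ?thesis using fin by (cases "s \<le> 0") (auto simp: min_def max_def split: if_splits)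
    next
      case False
      then have s: "s > b" using that by auto
      have "integral {0..s} \<psi> = (LINT t|lborel. \<psi> t)"
      proof -
        have supp: "0 \<le> t \<and> t \<le> s" if "\<psi> t \<noteq> 0" for t
        proof -
          have "t \<in> {a..b}" using \<psi>(2) that by blast
          then show ?thesis using s ab by auto
        qed
        have "(LINT t|lborel. \<psi> t) = (LINT t:{0..s}|lborel. \<psi> t)"
          unfolding set_lebesgue_integral_def
          by (rule Bochner_Integration.integral_cong) (use supp in \<open>auto simp: indicator_def\<close>)
        also have "\<dots> = integral {0..s} \<psi>"
          using \<psi>(1) by (intro set_borel_integral_eq_integral(2) borel_integrable_atLeastAtMost')
            (auto intro: continuous_on_subset)
        finally show ?thesis ..
      qed
      then show ?thesis using \<psi>(3) s ab by (simp add: \<eta>_def antiderivative_def)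
    qed
  qed
  define \<xi> where "\<xi> s = \<eta> s / s ^ (Q - 1)" for s
  have \<xi>z: "\<xi> s = 0" if "s \<notin> {a..b}" for s using z[OF that] by (simp add: \<xi>_def)
  have \<xi>1: "Ck_on 1 UNIV \<xi>"
  proof (rule Ck_on_zero_extension[of "{0<..}" _ _ "{a..b}"])
    show "Ck_on 1 {0<..} \<xi>"
      unfolding \<xi>_def[abs_def]
      by (intro Ck_on_divide Ck_on_power Ck_on_ident Ck_on_subset[OF \<eta>1]) auto
  qed (use ab \<xi>z in auto)
  define \<xi>' where "\<xi>' s = (if s \<in> {a..b} then \<psi> s / s ^ (Q - 1) - (real Q - 1) * \<eta> s / s ^ Q else 0)" for s
  have \<xi>': "(\<xi> has_real_derivative \<xi>' s) (at s)" for s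
  proof (cases "s > 0")
    case True
    have "((\<lambda>s. \<eta> s / s ^ (Q - 1)) has_real_derivative
       (\<psi> s * s ^ (Q - 1) - \<eta> s * (real (Q - 1) * s ^ (Q - 1 - Suc 0))) / (s ^ (Q - 1) * s ^ (Q - 1))) (at s)"
      by (rule DERIV_divide[OF \<eta>' DERIV_pow]) (use True in simp)
    moreover have "(\<psi> s * s ^ (Q - 1) - \<eta> s * (real (Q - 1) * s ^ (Q - 1 - Suc 0))) / (s ^ (Q - 1) * s ^ (Q - 1))
        = \<psi> s / s ^ (Q - 1) - (real Q - 1) * \<eta> s / s ^ Q"
    proof (cases "Q = 1")
      case False
      then obtain k where Q: "Q = Suc (Suc k)" using Q_pos by (metis One_nat_def Suc_pred gr0_implies_Suc not_gr_zero)
      show ?thesis using True by (simp add: Q field_simps)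
    qed simp
    moreover have "\<psi> s / s ^ (Q - 1) - (real Q - 1) * \<eta> s / s ^ Q = \<xi>' s"
      using z[of s] \<psi>(2)[of s] by (auto simp: \<xi>'_def)
    ultimately show ?thesis by (simp add: \<xi>_def[abs_def])
  next
    case False
    then have s: "s \<notin> {a..b}" using ab by auto
    have "((\<lambda>_. 0) has_real_derivative 0) (at s)" by simp
    then have "(\<xi> has_real_derivative 0) (at s)"
      by (rule has_field_derivative_transform_within_open[of _ _ _ "- {a..b}"]) (use s \<xi>z in auto)
    moreover have "\<xi>' s = 0" using s by (simp only: \<xi>'_def if_False)
    ultimately show ?thesis by simp
  qed
  have "\<xi>' (N x) + (real Q - 1) * \<xi> (N x) / N x = \<psi> (N x) / N x ^ (Q - 1)" if "x \<in> \<Omega>" for x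
  proof -
    have p: "N x ^ Q = N x ^ (Q - 1) * N x" using Q_pos by (cases Q) auto
    show ?thesis
      using z[of "N x"] \<psi>(2)[of "N x"] N_pos[OF that] by (auto simp: \<xi>'_def \<xi>_def p)
  qed
  then have "(LINT x|lborel. indicator \<Omega> x * (\<phi> (flow x 1) * (\<psi> (N x) / N x ^ (Q - 1))))
     = (LINT x|lborel. indicator \<Omega> x * (\<phi> (flow x 1) * (\<xi>' (N x) + (real Q - 1) * \<xi> (N x) / N x)))"
    by (intro Bochner_Integration.integral_cong) (auto simp: indicator_def)
  also have "\<dots> = 0" by (rule transport_identity[OF \<phi> c ab \<xi>1 \<xi>z \<xi>'])
  finally show ?thesis .
qed

end

section \<open>Disintegration of Lebesgue measure along the flow\<close>

context polar_flow
begin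

text \<open>The point where the trajectory of \<open>x\<close> crosses the level 1. The value 0 off
  \<open>\<Omega>\<close> makes the map total and Borel.\<close>

definition proj :: "'a \<Rightarrow> 'a" where
  "proj x = (if x \<in> \<Omega> then flow x 1 else 0)"

definition level :: "'a \<Rightarrow> real" where
  "level x = (if x \<in> \<Omega> then N x else 0)"

text \<open>Equal to \<open>N^(1-Q)\<close> on \<open>\<Omega>\<close>. It cancels the factor
  \<open>s^(Q-1)\<close> of polar coordinates, so that the level becomes distributed by plain
  Lebesgue measure.\<close>

definition weight :: "'a \<Rightarrow> real" where
  "weight x = indicator \<Omega> x / level x ^ (Q - 1)"

text \<open>A reference profile in the level, of integral 1 and supported in \<open>{1..3}\<close>;
  the measure on the sphere is obtained by averaging with it.\<close>

definition unit_bump :: "real \<Rightarrow> real" where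
  "unit_bump s = bump 2 1 s / (LINT t|lborel. bump (2::real) 1 t)"

lemma \<Omega>_borel [measurable]: "\<Omega> \<in> sets borel"
  using open_\<Omega> by simp

lemma proj_measurable [measurable]: "proj \<in> borel_measurable borel"
  unfolding proj_def[abs_def]
proof (rule borel_measurable_continuous_on_if)
  show "continuous_on \<Omega> (\<lambda>x. flow x 1)"
  proof -
    have "continuous_on \<Omega> (\<lambda>x. (\<lambda>(x, s). flow x s) (x, 1))"
      by (rule continuous_on_compose2[OF continuous_on_flow, of \<Omega> "\<lambda>x. (x, 1)"])
        (auto intro!: continuous_on_Pair continuous_on_id continuous_on_const)
    then show ?thesis by simp
  qed
qed auto

lemma level_measurable [measurable]: "level \<in> borel_measurable borel"
  unfolding level_def[abs_def]
  by (rule borel_measurable_continuous_on_if) (auto intro: Ck_on_continuous_on[OF N_C1])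

lemma weight_measurable [measurable]: "weight \<in> borel_measurable borel"
  unfolding weight_def[abs_def] by measurable

lemma level_nonneg: "level x \<ge> 0"
  using N_pos by (auto simp: level_def less_imp_le)

lemma weight_nonneg: "weight x \<ge> 0"
  using level_nonneg by (simp add: weight_def)

lemma unit_bump: "unit_bump s \<ge> 0" "continuous_on UNIV unit_bump" "(LINT s|lborel. unit_bump s) = 1"
  "s \<notin> {1..3} \<Longrightarrow> unit_bump s = 0"
proof -
  have c: "(LINT t|lborel. bump (2::real) 1 t) > 0" by (rule integral_bump_pos) simp
  then show "unit_bump s \<ge> 0" by (simp add: unit_bump_def bump_nonneg)
  show "continuous_on UNIV unit_bump"
    unfolding unit_bump_def[abs_def] using c by (intro continuous_intros Ck_on_continuous_on[OF Ck_on_bump]) auto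
  show "(LINT s|lborel. unit_bump s) = 1" unfolding unit_bump_def using c by simp
  show "unit_bump s = 0" if "s \<notin> {1..3}"
    using bump_zero[of 1 2 s] that by (auto simp: unit_bump_def dist_real_def)
qed

lemma unit_bump_measurable [measurable]: "unit_bump \<in> borel_measurable borel"
  by (rule borel_measurable_continuous_onI[OF unit_bump(2)])

lemma unit_bump_bounded: "\<exists>B. \<forall>s. \<bar>unit_bump s\<bar> \<le> B"
proof -
  obtain B where "\<And>s. norm (unit_bump s) \<le> B"
    by (rule bounded_continuous_compact_support[OF unit_bump(2) compact_Icc[of 1 3] unit_bump(4)]) (assumption, rule that)
  then show ?thesis by auto
qed

text \<open>The integral of the product of \<open>\<phi>\<close> in the crossing point and
  \<open>\<psi>\<close> in the level. The aim is to show that it factorises, the second factor being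
  the integral of \<open>\<psi>\<close>.\<close>

definition flux :: "('a \<Rightarrow> real) \<Rightarrow> (real \<Rightarrow> real) \<Rightarrow> real" where
  "flux \<phi> \<psi> = (LINT x|lborel. weight x * (\<phi> (proj x) * \<psi> (level x)))"

lemma flux_bound:
  assumes "0 < a" "\<bar>\<phi> (proj x)\<bar> \<le> B" "\<bar>\<psi> (level x)\<bar> \<le> B'" "\<And>s. s \<notin> {a..b} \<Longrightarrow> \<psi> s = 0"
  shows "\<bar>weight x * (\<phi> (proj x) * \<psi> (level x))\<bar> \<le> (1 / a ^ (Q - 1) * (B * B')) * indicator {x \<in> \<Omega>. a \<le> N x \<and> N x \<le> b} x"
proof (cases "x \<in> \<Omega> \<and> N x \<in> {a..b}")
  case True
  then have "\<bar>weight x\<bar> \<le> 1 / a ^ (Q - 1)"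
    using assms(1) by (auto simp: weight_def level_def intro!: divide_left_mono power_mono mult_pos_pos)
  moreover have "\<bar>\<phi> (proj x) * \<psi> (level x)\<bar> \<le> B * B'"
    unfolding abs_mult using assms(2,3) by (intro mult_mono) auto
  ultimately have "\<bar>weight x\<bar> * \<bar>\<phi> (proj x) * \<psi> (level x)\<bar> \<le> 1 / a ^ (Q - 1) * (B * B')"
    using assms(1) by (intro mult_mono) auto
  then show ?thesis using True by (simp add: abs_mult)
next
  case False
  then have "weight x * (\<phi> (proj x) * \<psi> (level x)) = 0"
    using assms(4)[of "N x"] by (auto simp: weight_def level_def)
  then show ?thesis using False by (auto simp: indicator_def)
qed

lemma band_borel [measurable]: "{x \<in> \<Omega>. a \<le> N x \<and> N x \<le> b} \<in> sets borel"
proof -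
  have "{x \<in> \<Omega>. a \<le> N x \<and> N x \<le> b} = \<Omega> \<inter> (level -` {a..b} \<inter> space borel)" by (auto simp: level_def)
  also have "\<dots> \<in> sets borel" by (intro sets.Int measurable_sets[OF level_measurable]) auto
  finally show ?thesis .
qed

lemma band_integrable:
  assumes "0 < a"
  shows "integrable lborel (\<lambda>x. c * indicator {x \<in> \<Omega>. a \<le> N x \<and> N x \<le> b} x :: real)"
  using emeasure_bounded_finite[OF bounded_band[OF assms, of b]]
  by (intro integrable_mult_right integrable_real_indicator) auto

lemma flux_integrable:
  assumes [measurable]: "\<phi> \<in> borel_measurable borel" "\<psi> \<in> borel_measurable borel"
    and "0 < a" "\<And>y. \<bar>\<phi> y\<bar> \<le> B" "\<And>s. \<bar>\<psi> s\<bar> \<le> B'" "\<And>s. s \<notin> {a..b} \<Longrightarrow> \<psi> s = 0"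
  shows "integrable lborel (\<lambda>x. weight x * (\<phi> (proj x) * \<psi> (level x)))"
proof (rule Bochner_Integration.integrable_bound[OF band_integrable[OF assms(3)]])
  show "AE x in lborel. norm (weight x * (\<phi> (proj x) * \<psi> (level x)))
      \<le> norm ((1 / a ^ (Q - 1) * (B * B')) * indicator {x \<in> \<Omega>. a \<le> N x \<and> N x \<le> b} x)"
    unfolding real_norm_def by (intro AE_I2 order_trans[OF flux_bound abs_ge_self] assms(3-6))
qed measurable

text \<open>Subtracting from \<open>\<psi>\<close> the multiple of \<open>unit_bump\<close> with the
  same integral leaves a profile of mean zero, whose flux vanishes by the transport
  identity.\<close>

lemma flux_Lipschitz:
  fixes \<phi> :: "'a \<Rightarrow> real"
  assumes \<phi>: "\<And>x y. \<bar>\<phi> x - \<phi> y\<bar> \<le> L * norm (x - y)" "\<And>y. \<bar>\<phi> y\<bar> \<le> B"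
    and c: "c > 0" "\<And>y. y \<in> \<Omega> \<Longrightarrow> h y < c \<Longrightarrow> \<phi> y = 0"
    and ab: "0 < a"
    and \<psi>: "continuous_on UNIV \<psi>" "\<And>s. s \<notin> {a..b} \<Longrightarrow> \<psi> s = 0" "\<And>s. \<bar>\<psi> s\<bar> \<le> B'"
  shows "flux \<phi> \<psi> = (LINT s|lborel. \<psi> s) * flux \<phi> unit_bump"
proof -
  define I where "I = (LINT s|lborel. \<psi> s)"
  define \<psi>' where "\<psi>' s = \<psi> s - I * unit_bump s" for s
  have \<phi>m: "\<phi> \<in> borel_measurable borel"
    by (rule borel_measurable_continuous_onI, rule Lipschitz_imp_continuous_on[of _ L]) (simp add: \<phi>)
  have \<psi>m: "\<psi> \<in> borel_measurable borel" by (rule borel_measurable_continuous_onI[OF \<psi>(1)])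
  obtain Bu where Bu: "\<And>s. \<bar>unit_bump s\<bar> \<le> Bu" using unit_bump_bounded by blast
  have int\<psi>: "integrable lborel \<psi>"
    by (rule integrable_continuous_compact_support[OF \<psi>(1) compact_Icc \<psi>(2)])
  have intu: "integrable lborel unit_bump"
    by (rule integrable_continuous_compact_support[OF unit_bump(2) compact_Icc unit_bump(4)])
  have "(LINT x|lborel. indicator \<Omega> x * (\<phi> (flow x 1) * (\<psi>' (N x) / N x ^ (Q - 1)))) = 0"
  proof (rule transport_mean_zero[OF \<phi>(1) c])
    show "0 < min a 1" "min a 1 \<le> 1" "1 \<le> max b 3" using ab by auto
    show "continuous_on UNIV \<psi>'" unfolding \<psi>'_def[abs_def] by (intro continuous_intros \<psi>(1) unit_bump(2))
    show "\<psi>' s = 0" if "s \<notin> {min a 1..max b 3}" for s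
      using \<psi>(2)[of s] unit_bump(4)[of s] that by (auto simp: \<psi>'_def min_def max_def split: if_splits)
    show "(LINT s|lborel. \<psi>' s) = 0"
      using int\<psi> intu unit_bump(3) by (simp add: \<psi>'_def I_def)
  qed
  moreover have "indicator \<Omega> x * (\<phi> (flow x 1) * (\<psi>' (N x) / N x ^ (Q - 1)))
      = weight x * (\<phi> (proj x) * \<psi> (level x)) - I * (weight x * (\<phi> (proj x) * unit_bump (level x)))" for x
    by (cases "x \<in> \<Omega>") (auto simp: weight_def proj_def level_def \<psi>'_def diff_divide_distrib algebra_simps)
  moreover have "integrable lborel (\<lambda>x. weight x * (\<phi> (proj x) * \<psi> (level x)))"
    by (rule flux_integrable[OF \<phi>m \<psi>m ab \<phi>(2) \<psi>(3,2)])
  moreover have "integrable lborel (\<lambda>x. weight x * (\<phi> (proj x) * unit_bump (level x)))"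
    by (rule flux_integrable[OF \<phi>m _ _ \<phi>(2), of unit_bump 1 Bu 3]) (use Bu unit_bump(4) in auto)
  ultimately show ?thesis by (simp add: flux_def I_def)
qed

text \<open>Convergence of the \<open>\<phi> n\<close> is asked for only at points of
  \<open>\<Omega>\<close> with \<open>N = 1\<close>, since \<open>proj\<close> maps
  \<open>\<Omega>\<close> there. The bounded band provides the dominating function.\<close>

lemma flux_limit:
  fixes \<phi> :: "nat \<Rightarrow> 'a \<Rightarrow> real" and \<psi> :: "nat \<Rightarrow> real \<Rightarrow> real"
  assumes [measurable]: "\<And>n. \<phi> n \<in> borel_measurable borel" "\<And>n. \<psi> n \<in> borel_measurable borel"
      "\<phi>' \<in> borel_measurable borel" "\<psi>' \<in> borel_measurable borel"
    and a: "0 < a" and B: "\<And>n y. \<bar>\<phi> n y\<bar> \<le> B" "\<And>n s. \<bar>\<psi> n s\<bar> \<le> B'" "\<And>n s. s \<notin> {a..b} \<Longrightarrow> \<psi> n s = 0"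
    and \<phi>: "\<And>y. y \<in> \<Omega> \<Longrightarrow> N y = 1 \<Longrightarrow> (\<lambda>n. \<phi> n y) \<longlonglongrightarrow> \<phi>' y" and \<psi>: "\<And>s. (\<lambda>n. \<psi> n s) \<longlonglongrightarrow> \<psi>' s"
  shows "(\<lambda>n. flux (\<phi> n) (\<psi> n)) \<longlonglongrightarrow> flux \<phi>' \<psi>'"
  unfolding flux_def
proof (rule integral_dominated_convergence[OF _ _ band_integrable[OF a]])
  show "AE x in lborel. (\<lambda>n. weight x * (\<phi> n (proj x) * \<psi> n (level x))) \<longlonglongrightarrow> weight x * (\<phi>' (proj x) * \<psi>' (level x))"
  proof (rule AE_I2)
    fix x
    show "(\<lambda>n. weight x * (\<phi> n (proj x) * \<psi> n (level x))) \<longlonglongrightarrow> weight x * (\<phi>' (proj x) * \<psi>' (level x))"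
    proof (cases "x \<in> \<Omega>")
      case True
      then have "(\<lambda>n. \<phi> n (proj x)) \<longlonglongrightarrow> \<phi>' (proj x)"
        using flow_in[of x 1] N_flow[of x 1] by (intro \<phi>) (auto simp: proj_def)
      then show ?thesis by (intro tendsto_intros \<psi>)
    qed (simp add: weight_def)
  qed
  show "AE x in lborel. norm (weight x * (\<phi> n (proj x) * \<psi> n (level x)))
      \<le> (1 / a ^ (Q - 1) * (B * B')) * indicator {x \<in> \<Omega>. a \<le> N x \<and> N x \<le> b} x" for n
    unfolding real_norm_def by (intro AE_I2 flux_bound a B)
qed measurable

text \<open>The indicator of \<open>C\<close> is approximated by Lipschitz functions of the distance
  to \<open>C\<close>, cut off where \<open>h\<close> is below \<open>1 / (2 (n + 1))\<close> as the
  Lipschitz case demands; the indicator of the interval is approximated by trapezoids. Every point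
  of the sphere in \<open>\<Omega>\<close> has \<open>h > 0\<close>, so in the limit the cutoff
  disappears.\<close>

lemma flux_interval:
  assumes C: "closed C" and pq: "0 < p" "p < q"
  shows "flux (indicator C) (indicator {p<..<q}) = (q - p) * flux (indicator C) unit_bump"
\<comment> \<open>\<open>infdist\<close> to the empty set is 0 by convention, so the approximation
  below would tend to 1 instead of 0.\<close>
proof (cases "C = {}")
  case True
  then show ?thesis by (simp add: flux_def)
next
  case ne: False
  define g where "g n y = max 0 (1 - real n * infdist y C)" for n and y :: 'a
  define \<phi> where "\<phi> n y = g n y * cutoff 1 1 (1 / real (Suc n)) y" for n y
  define \<psi> where "\<psi> n s = min 1 (real n * max 0 (min (s - p) (q - s)))" for n and s :: real
  have gb: "0 \<le> g n y" "g n y \<le> 1" for n y using infdist_nonneg[of y C] by (auto simp: g_def)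
  have gL: "\<bar>g n x - g n y\<bar> \<le> real n * norm (x - y)" for n x y
  proof -
    have "\<bar>infdist x C - infdist y C\<bar> \<le> norm (x - y)"
      using infdist_triangle_abs[of x C y] by (simp add: dist_norm)
    then have "\<bar>real n * infdist x C - real n * infdist y C\<bar> \<le> real n * norm (x - y)"
      by (simp add: abs_mult mult_left_mono flip: right_diff_distrib)
    then show ?thesis unfolding g_def by linarith
  qed
  have \<phi>b: "\<bar>\<phi> n y\<bar> \<le> 1" for n y
    using gb cutoff_bounds by (auto simp: \<phi>_def abs_mult intro!: mult_le_one)
  have \<phi>L: "\<exists>L. \<forall>x y. \<bar>\<phi> n x - \<phi> n y\<bar> \<le> L * norm (x - y)" for n
  proof -
    let ?k = "cutoff 1 1 (1 / real (Suc n))"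
    have pos: "(0::real) < 1" "0 < 1 / real (Suc n)" by auto
    have K: "compact (core (1 / 2) (2 * 1) (1 / real (Suc n) / 2))" by (intro compact_core') auto
    obtain Lk where Lk: "\<And>x y. norm (?k x - ?k y) \<le> Lk * norm (x - y)"
      by (rule Lipschitz_C1_compact_support[OF cutoff_C1[OF pos(1) pos(1) pos(2)] K cutoff_eq_0[OF pos(1) pos(1) pos(2)]])
        (assumption, rule that)
    have "\<bar>\<phi> n x - \<phi> n y\<bar> \<le> (real n + Lk) * norm (x - y)" for x y
    proof -
      have "\<phi> n x - \<phi> n y = (g n x - g n y) * ?k x + g n y * (?k x - ?k y)"
        by (simp add: \<phi>_def algebra_simps)
      also have "\<bar>\<dots>\<bar> \<le> \<bar>g n x - g n y\<bar> * \<bar>?k x\<bar> + \<bar>g n y\<bar> * \<bar>?k x - ?k y\<bar>"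
        by (rule order_trans[OF abs_triangle_ineq]) (simp add: abs_mult)
      also have "\<dots> \<le> (real n * norm (x - y)) * 1 + 1 * (Lk * norm (x - y))"
        using gL[of n x y] gb[of n y] Lk[of x y] cutoff_bounds[of 1 1 "1 / real (Suc n)" x]
        by (intro add_mono mult_mono) auto
      finally show ?thesis by (simp add: algebra_simps)
    qed
    then show ?thesis by blast
  qed
  have \<phi>m [measurable]: "\<phi> n \<in> borel_measurable borel" for n
  proof -
    obtain L where "\<And>x y. \<bar>\<phi> n x - \<phi> n y\<bar> \<le> L * norm (x - y)" using \<phi>L by blast
    then show ?thesis
      by (intro borel_measurable_continuous_onI Lipschitz_imp_continuous_on[of _ L]) simp
  qed
  have \<psi>c: "continuous_on UNIV (\<psi> n)" for n unfolding \<psi>_def[abs_def] by (intro continuous_intros)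
  have \<psi>m [measurable]: "\<psi> n \<in> borel_measurable borel" for n by (rule borel_measurable_continuous_onI[OF \<psi>c])
  have \<psi>b: "\<bar>\<psi> n s\<bar> \<le> 1" for n s by (auto simp: \<psi>_def)
  have \<psi>0: "\<psi> n s = 0" if "s \<notin> {p..q}" for n s using that by (auto simp: \<psi>_def max_def min_def)
  have arch: "\<exists>n0. \<forall>n\<ge>n0. real n * d \<ge> 1" if "d > 0" for d
  proof -
    obtain n0 :: nat where "1 < real n0 * d" using reals_Archimedean3[OF \<open>d > 0\<close>] by blast
    then have "real n * d \<ge> 1" if "n \<ge> n0" for n
    proof -
      have "real n0 * d \<le> real n * d" using that \<open>d > 0\<close> by (intro mult_right_mono) auto
      then show ?thesis using \<open>1 < real n0 * d\<close> by linarith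
    qed
    then show ?thesis by blast
  qed
  have \<psi>lim: "(\<lambda>n. \<psi> n s) \<longlonglongrightarrow> indicator {p<..<q} s" for s
  proof (cases "s \<in> {p<..<q}")
    case True
    obtain n0 where "\<And>n. n \<ge> n0 \<Longrightarrow> real n * min (s - p) (q - s) \<ge> 1"
      using arch[of "min (s - p) (q - s)"] True by auto
    then have "\<forall>\<^sub>F n in sequentially. \<psi> n s = 1"
      using True unfolding eventually_sequentially by (intro exI[of _ n0]) (auto simp: \<psi>_def)
    then show ?thesis using True by (simp add: tendsto_eventually)
  next
    case False
    then have "min (s - p) (q - s) \<le> 0" by auto
    then have "\<psi> n s = 0" for n by (simp add: \<psi>_def max_absorb1)
    then show ?thesis using False by simp
  qed
  have \<phi>lim: "(\<lambda>n. \<phi> n y) \<longlonglongrightarrow> indicator C y" if y: "y \<in> \<Omega>" "N y = 1" for y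
  proof -
    have "\<forall>\<^sub>F n in sequentially. \<phi> n y = indicator C y"
    proof -
      obtain n1 where n1: "\<And>n. n \<ge> n1 \<Longrightarrow> real n * h y \<ge> 1" using arch[OF h_pos[OF y(1)]] by blast
      have k: "cutoff 1 1 (1 / real (Suc n)) y = 1" if "n \<ge> n1" for n
      proof (rule cutoff_eq_1)
        have "1 / real (Suc n) \<le> h y" using n1[OF that] h_pos[OF y(1)] by (simp add: field_simps)
        then show "y \<in> core 1 1 (1 / real (Suc n))" using y by (simp add: core_def)
      qed auto
      show ?thesis
      proof (cases "y \<in> C")
        case True
        then show ?thesis using k unfolding eventually_sequentially
          by (intro exI[of _ n1]) (auto simp: \<phi>_def g_def)
      next
        case False
        then have "infdist y C > 0" using C ne by (simp add: infdist_pos_not_in_closed)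
        then obtain n2 where "\<And>n. n \<ge> n2 \<Longrightarrow> real n * infdist y C \<ge> 1" using arch by blast
        then show ?thesis using False unfolding eventually_sequentially
          by (intro exI[of _ n2]) (auto simp: \<phi>_def g_def)
      qed
    qed
    then show ?thesis by (rule tendsto_eventually)
  qed
  have eq: "flux (\<phi> n) (\<psi> n) = (LINT s|lborel. \<psi> n s) * flux (\<phi> n) unit_bump" for n
  proof -
    obtain L where L: "\<And>x y. \<bar>\<phi> n x - \<phi> n y\<bar> \<le> L * norm (x - y)" using \<phi>L by blast
    show ?thesis
    proof (rule flux_Lipschitz[OF L \<phi>b _ _ pq(1) \<psi>c \<psi>0 \<psi>b])
      show "0 < 1 / real (Suc n) / 2" by simp
      show "\<phi> n y = 0" if "h y < 1 / real (Suc n) / 2" for y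
        using cutoff_eq_0[of 1 1 "1 / real (Suc n)" y] that by (auto simp: \<phi>_def core_def)
    qed
  qed
  have Cm: "indicator C \<in> borel_measurable borel" using C by simp
  have l1: "(\<lambda>n. flux (\<phi> n) (\<psi> n)) \<longlonglongrightarrow> flux (indicator C) (indicator {p<..<q})"
    by (rule flux_limit[where B = 1 and B' = 1 and a = p and b = q]) (use \<phi>b \<psi>b \<psi>0 pq \<phi>lim \<psi>lim Cm in auto)
  obtain Bu where Bu: "\<And>s. \<bar>unit_bump s\<bar> \<le> Bu" using unit_bump_bounded by blast
  have l2: "(\<lambda>n. flux (\<phi> n) unit_bump) \<longlonglongrightarrow> flux (indicator C) unit_bump"
    by (rule flux_limit[where B = 1 and B' = Bu and a = 1 and b = 3]) (use \<phi>b Bu unit_bump(4) \<phi>lim Cm in auto)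
  have "(\<lambda>n. LINT s|lborel. \<psi> n s) \<longlonglongrightarrow> (LINT s|lborel. indicator {p<..<q} s)"
  proof (rule integral_dominated_convergence)
    show "integrable lborel (indicator {p..q} :: real \<Rightarrow> real)"
      by (intro integrable_real_indicator) (use pq in auto)
    show "AE s in lborel. norm (\<psi> n s) \<le> indicator {p..q} s" for n
      using \<psi>b \<psi>0 by (intro AE_I2) (auto simp: indicator_def)
  qed (use \<psi>lim in auto)
  then have l3: "(\<lambda>n. LINT s|lborel. \<psi> n s) \<longlonglongrightarrow> q - p" using pq by simp
  have "(\<lambda>n. flux (\<phi> n) (\<psi> n)) \<longlonglongrightarrow> (q - p) * flux (indicator C) unit_bump"
    unfolding eq by (rule tendsto_mult[OF l3 l2])
  then show ?thesis using LIMSEQ_unique[OF l1] by blast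
qed

section \<open>Product structure of the weighted measure\<close>

definition level_measure :: "'a measure" where
  "level_measure = density lborel (\<lambda>x. ennreal (weight x))"

text \<open>Up to the constant of the Haar measure and restriction to the sphere this is \<sigma>.
  Averaging over a band of levels and projecting avoids a surface measure on the level set.\<close>

definition sphere_measure :: "'a measure" where
  "sphere_measure = distr (density level_measure (\<lambda>x. ennreal (unit_bump (level x)))) borel proj"

lemma space_level_measure [simp]: "space level_measure = UNIV"
  and sets_level_measure [simp, measurable_cong]: "sets level_measure = sets borel"
  by (simp_all add: level_measure_def)

lemma sets_sphere_measure [simp, measurable_cong]: "sets sphere_measure = sets borel"
  and space_sphere_measure [simp]: "space sphere_measure = UNIV"
  by (simp_all add: sphere_measure_def)

lemma nn_integral_level_measure:
  assumes [measurable]: "\<phi> \<in> borel_measurable borel" "\<psi> \<in> borel_measurable borel"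
    and "0 < a" "\<And>y. 0 \<le> \<phi> y" "\<And>y. \<phi> y \<le> B" "\<And>s. 0 \<le> \<psi> s" "\<And>s. \<psi> s \<le> B'" "\<And>s. s \<notin> {a..b} \<Longrightarrow> \<psi> s = 0"
  shows "(\<integral>\<^sup>+x. ennreal (\<psi> (level x)) * ennreal (\<phi> (proj x)) \<partial>level_measure) = ennreal (flux \<phi> \<psi>)"
proof -
  have "(\<integral>\<^sup>+x. ennreal (\<psi> (level x)) * ennreal (\<phi> (proj x)) \<partial>level_measure) =
      (\<integral>\<^sup>+x. ennreal (weight x) * (ennreal (\<psi> (level x)) * ennreal (\<phi> (proj x))) \<partial>lborel)"
    unfolding level_measure_def by (rule nn_integral_density) measurable
  also have "\<dots> = (\<integral>\<^sup>+x. ennreal (weight x * (\<phi> (proj x) * \<psi> (level x))) \<partial>lborel)"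
    using assms weight_nonneg by (intro nn_integral_cong) (simp add: ennreal_mult'[symmetric] mult_ac)
  also have "\<dots> = ennreal (flux \<phi> \<psi>)"
    unfolding flux_def
    using flux_integrable[OF assms(1-3), of B B' b] assms weight_nonneg
    by (intro nn_integral_eq_integral) (auto simp: abs_of_nonneg)
  finally show ?thesis .
qed

lemma emeasure_sphere_measure:
  assumes [measurable]: "A \<in> sets borel"
  shows "emeasure sphere_measure A = ennreal (flux (indicator A) unit_bump)"
proof -
  obtain Bu where Bu: "\<And>s. \<bar>unit_bump s\<bar> \<le> Bu" using unit_bump_bounded by blast
  have "emeasure sphere_measure A =
     emeasure (density level_measure (\<lambda>x. ennreal (unit_bump (level x)))) (proj -` A \<inter> space level_measure)"
    unfolding sphere_measure_def by (subst emeasure_distr) auto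
  also have "\<dots> = (\<integral>\<^sup>+x. ennreal (unit_bump (level x)) * indicator (proj -` A \<inter> space level_measure) x \<partial>level_measure)"
    by (rule emeasure_density) measurable
  also have "\<dots> = (\<integral>\<^sup>+x. ennreal (unit_bump (level x)) * ennreal (indicator A (proj x)) \<partial>level_measure)"
    by (intro nn_integral_cong) (auto simp: indicator_def)
  also have "\<dots> = ennreal (flux (indicator A) unit_bump)"
    by (rule nn_integral_level_measure[where a = 1 and b = 3 and B = 1 and B' = Bu])
      (use Bu unit_bump in \<open>auto simp: abs_le_iff\<close>)
  finally show ?thesis .
qed

lemma finite_sphere_measure: "finite_measure sphere_measure"
  by (rule finite_measureI) (simp add: emeasure_sphere_measure)

text \<open>The identity is known for closed sets. They are stable under intersection and generate
  the Borel sets, and the measures compared are finite, so it extends to all Borel sets.\<close>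

lemma emeasure_level_interval:
  assumes A: "A \<in> sets borel" and pq: "0 < p" "p < q"
  shows "emeasure level_measure {x. proj x \<in> A \<and> level x \<in> {p<..<q}} = ennreal (q - p) * emeasure sphere_measure A"
proof -
  let ?M = "distr (density level_measure (\<lambda>x. indicator {p<..<q} (level x))) borel proj"
  have M: "emeasure ?M A = emeasure level_measure {x. proj x \<in> A \<and> level x \<in> {p<..<q}}"
    if [measurable]: "A \<in> sets borel" for A
  proof -
    have "emeasure ?M A = (\<integral>\<^sup>+x. indicator {p<..<q} (level x) * indicator (proj -` A \<inter> space level_measure) x \<partial>level_measure)"
      by (subst emeasure_distr) (auto intro!: emeasure_density measurable_sets_borel[OF proj_measurable])
    also have "\<dots> = (\<integral>\<^sup>+x. indicator {x. proj x \<in> A \<and> level x \<in> {p<..<q}} x \<partial>level_measure)"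
      by (intro nn_integral_cong) (auto simp: indicator_def)
    also have "\<dots> = emeasure level_measure {x. proj x \<in> A \<and> level x \<in> {p<..<q}}"
      by (rule nn_integral_indicator) measurable
    finally show ?thesis .
  qed
  have closed_eq: "emeasure level_measure {x. proj x \<in> C \<and> level x \<in> {p<..<q}} = ennreal (q - p) * emeasure sphere_measure C"
    if C: "closed C" for C
  proof -
    have Cm: "C \<in> sets borel" using C by simp
    have "emeasure level_measure {x. proj x \<in> C \<and> level x \<in> {p<..<q}} =
      (\<integral>\<^sup>+x. ennreal (indicator {p<..<q} (level x)) * ennreal (indicator C (proj x)) \<partial>level_measure)"
    proof -
      note Cm [measurable]
      have "emeasure level_measure {x. proj x \<in> C \<and> level x \<in> {p<..<q}} =
          (\<integral>\<^sup>+x. indicator {x. proj x \<in> C \<and> level x \<in> {p<..<q}} x \<partial>level_measure)"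
        by (rule nn_integral_indicator[symmetric]) measurable
      also have "\<dots> = (\<integral>\<^sup>+x. ennreal (indicator {p<..<q} (level x)) * ennreal (indicator C (proj x)) \<partial>level_measure)"
        by (intro nn_integral_cong) (auto simp: indicator_def)
      finally show ?thesis .
    qed
    also have "\<dots> = ennreal (flux (indicator C) (indicator {p<..<q}))"
      by (rule nn_integral_level_measure[where a = p and b = q and B = 1 and B' = 1])
        (use pq Cm in \<open>auto simp: indicator_def\<close>)
    also have "\<dots> = ennreal (q - p) * emeasure sphere_measure C"
      using pq by (simp add: flux_interval[OF C pq] emeasure_sphere_measure[OF Cm] ennreal_mult')
    finally show ?thesis .
  qed
  have "?M = scale_measure (ennreal (q - p)) sphere_measure"
  proof (rule measure_eqI_generator_eq[where E = "Collect closed" and \<Omega> = UNIV and A = "\<lambda>_. UNIV"])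
    show "Int_stable (Collect closed :: 'a set set)" by (auto simp: Int_stable_def)
    show "emeasure ?M X = emeasure (scale_measure (ennreal (q - p)) sphere_measure) X" if "X \<in> Collect closed" for X
      using M[of X] closed_eq[of X] that by simp
    show "emeasure ?M UNIV \<noteq> \<infinity>"
      using M[of UNIV] closed_eq[of UNIV] finite_measure.emeasure_finite[OF finite_sphere_measure, of UNIV]
      by (auto simp: ennreal_mult_eq_top_iff)
  qed (auto simp: borel_eq_closed sets_measure_of_conv)
  then show ?thesis using M[OF A] by simp
qed

text \<open>Lebesgue measure of the positive half line, kept as a measure on all reals so that the
  product sigma-algebra is that of the Borel sets.\<close>

definition half_line :: "real measure" where
  "half_line = density lborel (indicator {0<..})"

lemma sets_half_line [simp, measurable_cong]: "sets half_line = sets borel"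
  and space_half_line [simp]: "space half_line = UNIV"
  by (simp_all add: half_line_def)

lemma emeasure_half_line: "B \<in> sets borel \<Longrightarrow> emeasure half_line B = emeasure lborel (B \<inter> {0<..})"
  unfolding half_line_def
  by (subst emeasure_density) (auto intro!: nn_integral_cong simp: indicator_def simp flip: nn_integral_indicator)

lemma sigma_finite_half_line: "sigma_finite_measure half_line"
proof
  have "emeasure half_line {- real n..real n} \<noteq> \<infinity>" for n
  proof -
    have "emeasure half_line {- real n..real n} \<le> emeasure lborel {- real n..real n}"
      by (simp only: emeasure_half_line atLeastAtMost_borel) (rule emeasure_mono, auto)
    also have "\<dots> < \<infinity>" by (simp add: emeasure_lborel_Icc_eq)
    finally show ?thesis by simp
  qed
  moreover have "(\<Union>n. {- real n..real n}) = UNIV"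
  proof (intro set_eqI iffI)
    fix x :: real
    obtain n where "\<bar>x\<bar> \<le> real n" using real_arch_simple by blast
    then show "x \<in> (\<Union>n. {- real n..real n})" by (intro UN_I[of n]) auto
  qed simp
  ultimately show "\<exists>A. countable A \<and> A \<subseteq> sets half_line \<and> \<Union> A = space half_line \<and> (\<forall>a\<in>A. emeasure half_line a \<noteq> \<infinity>)"
    by (intro exI[of _ "range (\<lambda>n. {- real n..real n})"]) auto
qed

end

section \<open>Passing between Borel and completed measures\<close>

lemma scale_measure_eq_density: "scale_measure r M = density M (\<lambda>_. r)"
  by (rule measure_eqI) (simp_all add: emeasure_density_const)

lemma borel_measurable_completion_AE_eq:
  fixes f g :: "'a \<Rightarrow> real"
  assumes g: "g \<in> borel_measurable M" and eq: "AE x in M. f x = g x"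
  shows "f \<in> borel_measurable (completion M)"
proof (rule measurableI)
  interpret completion: complete_measure "completion M" by (rule completion.complete_measure_axioms)
  fix A :: "real set" assume A: "A \<in> sets borel"
  show "f -` A \<inter> space (completion M) \<in> sets (completion M)"
  proof (rule completion.in_sets_AE)
    show "AE x in completion M. (x \<in> g -` A \<inter> space (completion M)) = (x \<in> f -` A \<inter> space (completion M))"
      using AE_completion[OF eq] by eventually_elim auto
    show "g -` A \<inter> space (completion M) \<in> sets (completion M)"
      using measurable_sets[OF g A] by simp
  qed simp
qed simp

text \<open>Product measures are handled with Borel functions, while the integrands of the polar
  formula are only Lebesgue measurable; this lets the latter be exchanged for Borel
  representatives.\<close>

lemma integrable_completion_AE_eq:
  fixes f g :: "'a \<Rightarrow> real"
  assumes g: "g \<in> borel_measurable M" and eq: "AE x in M. f x = g x"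
  shows "integrable (completion M) f \<longleftrightarrow> integrable M g"
    "integral\<^sup>L (completion M) f = integral\<^sup>L M g"
proof -
  have f: "f \<in> borel_measurable (completion M)" by (rule borel_measurable_completion_AE_eq[OF g eq])
  have g': "g \<in> borel_measurable (completion M)" by (rule measurable_completion[OF g])
  show "integrable (completion M) f \<longleftrightarrow> integrable M g"
    using integrable_cong_AE[OF f g' AE_completion[OF eq]] integrable_completion[OF g] by simp
  show "integral\<^sup>L (completion M) f = integral\<^sup>L M g"
    using integral_cong_AE[OF f g' AE_completion[OF eq]] integral_completion[OF g] by simp
qed

context polar_flow
begin

lemma AE_level_measure: "AE x in level_measure. x \<in> \<Omega>"
  unfolding level_measure_def
  by (subst AE_density) (auto simp: weight_def indicator_def)

text \<open>For fixed \<open>A\<close> both sides are measures in \<open>B\<close>, so intervals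
  suffice. The level is positive almost everywhere, which reduces an arbitrary interval to its
  positive part; intervals starting at 0 are increasing unions of those already treated.\<close>

lemma emeasure_level_rect:
  assumes A: "A \<in> sets borel" and B: "B \<in> sets borel"
  shows "emeasure level_measure {x. proj x \<in> A \<and> level x \<in> B} = emeasure sphere_measure A * emeasure half_line B"
proof -
  interpret sphere: finite_measure sphere_measure by (rule finite_sphere_measure)
  note A [measurable]
  let ?M = "distr (density level_measure (\<lambda>x. indicator A (proj x))) borel level"
  let ?M' = "scale_measure (emeasure sphere_measure A) half_line"
  have M: "emeasure ?M B = emeasure level_measure {x. proj x \<in> A \<and> level x \<in> B}"
    if [measurable]: "B \<in> sets borel" for B
  proof -
    have "emeasure ?M B = (\<integral>\<^sup>+x. indicator A (proj x) * indicator (level -` B \<inter> space level_measure) x \<partial>level_measure)"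
      by (subst emeasure_distr) (auto intro!: emeasure_density measurable_sets_borel[OF level_measurable])
    also have "\<dots> = (\<integral>\<^sup>+x. indicator {x. proj x \<in> A \<and> level x \<in> B} x \<partial>level_measure)"
      by (intro nn_integral_cong) (auto simp: indicator_def)
    also have "\<dots> = emeasure level_measure {x. proj x \<in> A \<and> level x \<in> B}"
      by (rule nn_integral_indicator) measurable
    finally show ?thesis .
  qed
  have pos: "emeasure ?M (B \<inter> {0<..}) = emeasure ?M B" if [measurable]: "B \<in> sets borel" for B
  proof -
    have "emeasure level_measure {x. proj x \<in> A \<and> level x \<in> B \<inter> {0<..}} = emeasure level_measure {x. proj x \<in> A \<and> level x \<in> B}"
    proof (rule emeasure_eq_AE)
      show "AE x in level_measure. (x \<in> {x. proj x \<in> A \<and> level x \<in> B \<inter> {0<..}}) = (x \<in> {x. proj x \<in> A \<and> level x \<in> B})"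
        using AE_level_measure by eventually_elim (auto simp: level_def N_pos)
    qed measurable
    then show ?thesis by (simp only: M that sets.Int greaterThan_borel)
  qed
  have pos': "emeasure ?M' (B \<inter> {0<..}) = emeasure ?M' B" if "B \<in> sets borel" for B
    using that by (simp add: emeasure_half_line Int_assoc)
  have Ioo: "emeasure ?M {p<..<q} = emeasure ?M' {p<..<q}" if "0 < p" "p < q" for p q
  proof -
    have "{p<..<q} \<inter> {0<..} = {p<..<q}" using that by auto
    then show ?thesis
      using that emeasure_level_interval[OF A that] M[of "{p<..<q}"] by (simp add: emeasure_half_line mult.commute)
  qed
  have Ioo0: "emeasure ?M {0<..<q} = emeasure ?M' {0<..<q}" if q: "0 < q" for q
  proof -
    \<comment> \<open>The offset 2 keeps the left end strictly below \<open>q\<close> for every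
      \<open>n\<close>, including \<open>n = 0\<close>.\<close>
    define I where "I n = {q / real (n + 2)<..<q}" for n
    have p: "0 < q / real (n + 2)" "q / real (n + 2) < q" for n
    proof -
      show "0 < q / real (n + 2)" using q by simp
      have "q * 1 < q * real (n + 2)" using q by (intro mult_strict_left_mono) auto
      then show "q / real (n + 2) < q" by (simp add: divide_less_eq)
    qed
    have inc: "incseq I"
    proof (rule incseq_SucI)
      fix n
      have "q / real (Suc n + 2) \<le> q / real (n + 2)" using q by (intro divide_left_mono) auto
      then show "I n \<le> I (Suc n)" by (auto simp: I_def)
    qed
    have U: "(\<Union>n. I n) = {0<..<q}"
    proof (intro set_eqI iffI)
      fix x assume "x \<in> (\<Union>n. I n)"
      then show "x \<in> {0<..<q}" using p(1) by (auto simp: I_def intro: less_trans)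
    next
      fix x assume x: "x \<in> {0<..<q}"
      then obtain n where n: "q < real n * x" using reals_Archimedean3[of x] by auto
      then have "q < real (n + 2) * x" using x by (simp add: distrib_right)
      then show "x \<in> (\<Union>n. I n)" using x by (auto simp: I_def divide_less_eq mult.commute intro!: exI[of _ n])
    qed
    have "emeasure ?M (\<Union>n. I n) = (SUP n. emeasure ?M (I n))"
      by (rule SUP_emeasure_incseq[symmetric, OF _ inc]) (auto simp: I_def)
    also have "\<dots> = (SUP n. emeasure ?M' (I n))"
      using Ioo[OF p] by (simp only: I_def)
    also have "\<dots> = emeasure ?M' (\<Union>n. I n)"
      by (rule SUP_emeasure_incseq[OF _ inc]) (auto simp: I_def)
    finally show ?thesis by (simp only: U)
  qed
  have "?M = ?M'"
  proof (rule measure_eqI_generator_eq[where E = "range (\<lambda>(a, b). box a b)" and \<Omega> = UNIV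
        and A = "\<lambda>n. box (- real n) (real n)"])
    show "Int_stable (range (\<lambda>(a, b). box a b :: real set))"
    proof (rule Int_stableI)
      fix X Y assume "X \<in> range (\<lambda>(a, b). box a b :: real set)" "Y \<in> range (\<lambda>(a, b). box a b :: real set)"
      then obtain a b c d where "X = box a b" "Y = box c d" by auto
      then have "X \<inter> Y = box (max a c) (min b d)" by (auto simp: box_real)
      then show "X \<inter> Y \<in> range (\<lambda>(a, b). box a b)" by (auto intro!: image_eqI[of _ _ "(max a c, min b d)"])
    qed
    show "emeasure ?M X = emeasure ?M' X" if X': "X \<in> range (\<lambda>(a, b). box a b)" for X
    proof -
      obtain p where p: "X = (\<lambda>(a, b). box a b) p" using X' by blast
      define a b where "a = fst p" and "b = snd p"
      have X: "X = {a<..<b}" using p by (simp add: a_def b_def split_beta box_real)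
      have "X \<inter> {0<..} = {max a 0<..<b}" using X by auto
      then have "emeasure ?M X = emeasure ?M {max a 0<..<b}" "emeasure ?M' X = emeasure ?M' {max a 0<..<b}"
        using pos[of X] pos'[of X] X by auto
      moreover have "emeasure ?M {max a 0<..<b} = emeasure ?M' {max a 0<..<b}"
        using Ioo[of a b] Ioo0[of b] by (cases "max a 0 < b") (auto simp: max_def split: if_splits)
      ultimately show ?thesis by simp
    qed
    show "(\<Union>i::nat. box (- real i) (real i)) = (UNIV :: real set)"
    proof (intro set_eqI iffI)
      fix x :: real
      obtain n where "\<bar>x\<bar> < real n" using reals_Archimedean2 by blast
      then show "x \<in> (\<Union>i::nat. box (- real i) (real i))" by (intro UN_I[of n]) (auto simp: box_real)
    qed simp
    show "emeasure ?M (box (- real i) (real i)) \<noteq> \<infinity>" for i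
    proof (cases "i = 0")
      case False
      have "emeasure ?M (box (- real i) (real i)) = emeasure ?M ({- real i<..<real i} \<inter> {0<..})"
        using pos[of "{- real i<..<real i}"] by (simp add: box_real)
      also have "{- real i<..<real i} \<inter> {0<..} = {0<..<real i}" by auto
      also have "emeasure ?M {0<..<real i} = emeasure ?M' {0<..<real i}" using Ioo0[of "real i"] False by simp
      also have "\<dots> < \<infinity>"
      proof -
        have "emeasure lborel ({0<..<real i} \<inter> {0<..}) < top"
          by (rule emeasure_bounded_finite[unfolded infinity_ennreal_def]) (simp add: bounded_Int)
        moreover have "emeasure sphere_measure A < top" using sphere.emeasure_finite[of A] by (simp add: less_top[symmetric])
        ultimately show ?thesis by (simp add: emeasure_half_line ennreal_mult_less_top)
      qed
      finally show ?thesis by simp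
    qed simp
  qed (auto simp: borel_eq_box sets_measure_of_conv)
  then show ?thesis using M[OF B] by simp
qed

lemma sigma_finite_sphere_measure: "sigma_finite_measure sphere_measure"
proof -
  interpret sphere: finite_measure sphere_measure by (rule finite_sphere_measure)
  show ?thesis by unfold_locales
qed

text \<open>This is the disintegration: in the coordinates crossing point and level, the weighted
  Lebesgue measure is a product. Agreement on rectangles suffices because both factors are
  sigma-finite.\<close>

lemma polar_product: "sphere_measure \<Otimes>\<^sub>M half_line = distr level_measure (borel \<Otimes>\<^sub>M borel) (\<lambda>x. (proj x, level x))"
proof (rule pair_measure_eqI)
  show "sigma_finite_measure sphere_measure" by (rule sigma_finite_sphere_measure)
  show "sigma_finite_measure half_line" by (rule sigma_finite_half_line)
  show "sets (sphere_measure \<Otimes>\<^sub>M half_line) = sets (distr level_measure (borel \<Otimes>\<^sub>M borel) (\<lambda>x. (proj x, level x)))"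
    by (simp cong: sets_pair_measure_cong)
  fix A :: "'a set" and B :: "real set" assume "A \<in> sets sphere_measure" "B \<in> sets half_line"
  then have AB [measurable]: "A \<in> sets borel" "B \<in> sets borel" by auto
  have "emeasure (distr level_measure (borel \<Otimes>\<^sub>M borel) (\<lambda>x. (proj x, level x))) (A \<times> B) =
      emeasure level_measure ((\<lambda>x. (proj x, level x)) -` (A \<times> B) \<inter> space level_measure)"
    by (rule emeasure_distr) measurable
  also have "(\<lambda>x. (proj x, level x)) -` (A \<times> B) \<inter> space level_measure = {x. proj x \<in> A \<and> level x \<in> B}" by auto
  finally show "emeasure sphere_measure A * emeasure half_line B =
      emeasure (distr level_measure (borel \<Otimes>\<^sub>M borel) (\<lambda>x. (proj x, level x))) (A \<times> B)"
    using emeasure_level_rect[OF AB] by simp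
qed

sublocale polar: pair_sigma_finite sphere_measure half_line
proof (rule pair_sigma_finite.intro)
  show "sigma_finite_measure sphere_measure" by (rule sigma_finite_sphere_measure)
qed (rule sigma_finite_half_line)

section \<open>The polar integration formula and the uniqueness of the measure\<close>

definition polar_map :: "'a \<times> real \<Rightarrow> 'a" where
  "polar_map p = (if p \<in> \<Omega> \<times> {0<..} then flow (fst p) (snd p) else 0)"

lemma polar_map_measurable [measurable]: "polar_map \<in> measurable (borel \<Otimes>\<^sub>M borel) borel"
proof -
  have "polar_map \<in> borel_measurable borel"
    unfolding polar_map_def[abs_def]
  proof (rule borel_measurable_continuous_on_if)
    show "(\<Omega> \<times> {0<..} :: ('a \<times> real) set) \<in> sets borel" using open_\<Omega> by (intro borel_open open_Times) auto
    show "continuous_on (\<Omega> \<times> {0<..}) (\<lambda>p. flow (fst p) (snd p))"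
      using continuous_on_flow by (simp add: split_beta)
  qed auto
  then show ?thesis by (simp add: borel_prod)
qed

lemma polar_map_proj: "x \<in> \<Omega> \<Longrightarrow> polar_map (proj x, level x) = x"
  using flow_flow[of x 1 "N x"] flow_in[of x 1] flow_self[of x] N_pos[of x]
  by (simp add: polar_map_def proj_def level_def)

lemma weight_level: "x \<in> \<Omega> \<Longrightarrow> weight x * level x ^ (Q - 1) = 1"
  using N_pos[of x] by (simp add: weight_def level_def)

text \<open>Pulled back by crossing point and level, the power \<open>s^(Q-1)\<close> cancels
  against the weight, and Lebesgue measure on \<open>\<Omega>\<close> remains.\<close>

lemma polar_borel:
  fixes f :: "'a \<Rightarrow> real"
  assumes [measurable]: "f \<in> borel_measurable borel"
  shows "integrable (sphere_measure \<Otimes>\<^sub>M half_line) (\<lambda>p. f (polar_map p) * snd p ^ (Q - 1))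
      \<longleftrightarrow> integrable lborel (\<lambda>x. indicator \<Omega> x * f x)" (is ?A)
    and "integral\<^sup>L (sphere_measure \<Otimes>\<^sub>M half_line) (\<lambda>p. f (polar_map p) * snd p ^ (Q - 1))
      = (LINT x|lborel. indicator \<Omega> x * f x)" (is ?B)
proof -
  let ?K = "\<lambda>p. f (polar_map p) * snd p ^ (Q - 1)"
  have K [measurable]: "?K \<in> borel_measurable (borel \<Otimes>\<^sub>M borel)" by measurable
  have eq: "weight x *\<^sub>R ?K (proj x, level x) = indicator \<Omega> x * f x" for x
  proof (cases "x \<in> \<Omega>")
    case True
    have "weight x *\<^sub>R ?K (proj x, level x) = f x * (weight x * level x ^ (Q - 1))"
      by (simp add: polar_map_proj[OF True])
    then show ?thesis using True by (simp only: weight_level) simp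
  qed (simp add: weight_def)
  have m: "(\<lambda>x. (proj x, level x)) \<in> measurable level_measure (borel \<Otimes>\<^sub>M borel)" by measurable
  have Km: "(\<lambda>x. ?K (proj x, level x)) \<in> borel_measurable lborel" by measurable
  have wn: "AE x in lborel. 0 \<le> weight x" by (simp add: weight_nonneg)
  show ?A
    unfolding polar_product integrable_distr_eq[OF m K] unfolding level_measure_def
    by (subst integrable_density[OF Km _ wn]) (simp_all only: eq, simp)
  show ?B
    unfolding polar_product integral_distr[OF m K] unfolding level_measure_def
    by (subst integral_density[OF Km _ wn]) (simp_all only: eq, simp)
qed

text \<open>Guarantees that changing a function on a Lebesgue null set does not affect its
  restriction to almost every curve, up to null sets of levels.\<close>

lemma AE_polar:
  assumes N0: "N0 \<in> null_sets lborel"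
  shows "AE a in sphere_measure. AE s in half_line. polar_map (a, s) \<notin> N0"
proof (rule polar.AE_pair)
  have [measurable]: "N0 \<in> sets borel" using N0 by auto
  have "AE x in level_measure. polar_map (proj x, level x) \<notin> N0"
  proof -
    have "AE x in level_measure. x \<notin> N0"
      unfolding level_measure_def using AE_not_in[OF N0] by (subst AE_density) auto
    with AE_level_measure show ?thesis by eventually_elim (simp add: polar_map_proj)
  qed
  then show "AE p in sphere_measure \<Otimes>\<^sub>M half_line. polar_map p \<notin> N0"
    unfolding polar_product by (subst AE_distr_iff) auto
qed

lemma AE_sphere_measure: "AE a in sphere_measure. a \<in> \<Omega> \<and> N a = 1"
proof -
  have [measurable]: "Measurable.pred borel (\<lambda>a. a \<in> \<Omega> \<and> level a = 1)" by measurable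
  have "AE x in density level_measure (\<lambda>x. ennreal (unit_bump (level x))). proj x \<in> \<Omega> \<and> level (proj x) = 1"
  proof (subst AE_density)
    show "(\<lambda>x. ennreal (unit_bump (level x))) \<in> borel_measurable level_measure" by measurable
    show "AE x in level_measure. 0 < ennreal (unit_bump (level x)) \<longrightarrow> proj x \<in> \<Omega> \<and> level (proj x) = 1"
      using AE_level_measure by eventually_elim (simp add: proj_def level_def flow_in N_flow)
  qed
  then have "AE a in sphere_measure. a \<in> \<Omega> \<and> level a = 1"
    unfolding sphere_measure_def by (subst AE_distr_iff) auto
  then show ?thesis by eventually_elim (auto simp: level_def split: if_splits)
qed

lemma integral_half_line:
  fixes k :: "real \<Rightarrow> real"
  assumes k: "k \<in> borel_measurable borel" and eq: "AE s in half_line. f s = k s" 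
  shows "set_integrable lebesgue {0<..} f \<longleftrightarrow> integrable half_line k"
    "(LINT s:{0<..}|lebesgue. f s) = (LINT s|half_line. k s)"
proof -
  have AE: "AE s in lborel. indicator {0<..} s *\<^sub>R f s = indicator {0<..} s *\<^sub>R k s"
  proof -
    have "AE s in lborel. 0 < (indicator {0<..} s :: ennreal) \<longrightarrow> f s = k s"
      using eq unfolding half_line_def by (subst (asm) AE_density) auto
    then show ?thesis by eventually_elim (auto simp: indicator_def)
  qed
  have m: "(\<lambda>s. indicator {0<..} s *\<^sub>R k s) \<in> borel_measurable lborel" using k by measurable
  have hl: "half_line = density lborel (\<lambda>s. ennreal (indicator {0<..} s))"
    unfolding half_line_def by (rule arg_cong[where f = "density lborel"]) (auto simp: indicator_def)
  show "set_integrable lebesgue {0<..} f \<longleftrightarrow> integrable half_line k"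
    unfolding set_integrable_def integrable_completion_AE_eq(1)[OF m AE] hl
    using k by (subst integrable_density) auto
  show "(LINT s:{0<..}|lebesgue. f s) = (LINT s|half_line. k s)"
    unfolding set_lebesgue_integral_def integrable_completion_AE_eq(2)[OF m AE] hl
    using k by (subst integral_density) auto
qed

theorem polar_measure_exists:
  fixes G :: "('a, 'b) carnot_scheme"
  assumes haar: "haar G = scale_measure (ennreal c) lebesgue" "c > 0" and Q: "hom_dim G = Q"
    and S: "S \<in> sets borel" "S \<inter> \<Omega> = {x \<in> \<Omega>. N x = 1}" and null: "- \<Omega> \<in> null_sets lebesgue"
  shows "\<exists>\<sigma>. polar_measure G S (- \<Omega>) flow \<sigma>"
proof -
  interpret sphere: finite_measure sphere_measure by (rule finite_sphere_measure)
  \<comment> \<open>The factor \<open>c\<close> accounts for the Haar measure being \<open>c\<close>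
    times Lebesgue measure. The restriction that follows is harmless, as
    \<open>sphere_measure\<close> is concentrated on points of \<open>\<Omega>\<close> with
    \<open>N = 1\<close>.\<close>
  define \<sigma>0 where "\<sigma>0 = density sphere_measure (\<lambda>_. ennreal c)"
  define \<sigma> where "\<sigma> = restrict_space \<sigma>0 S"
  have sets0 [simp]: "sets \<sigma>0 = sets borel" "space \<sigma>0 = UNIV" by (simp_all add: \<sigma>0_def)
  have S0: "S \<inter> space \<sigma>0 \<in> sets \<sigma>0" using S(1) by simp
  have e0: "emeasure \<sigma>0 A = ennreal c * emeasure sphere_measure A" if "A \<in> sets borel" for A
    using that unfolding \<sigma>0_def by (subst emeasure_density_const) auto
  have fin: "emeasure \<sigma>0 A < \<infinity>" if "A \<in> sets borel" for A
  proof -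
    have "emeasure sphere_measure A < top" using sphere.emeasure_finite[of A] by (simp add: less_top[symmetric])
    then show ?thesis using e0[OF that] by (simp add: ennreal_mult_less_top)
  qed
  have AE0: "(AE a in \<sigma>. P a) \<longleftrightarrow> (AE a in sphere_measure. a \<in> S \<longrightarrow> P a)" for P
  proof -
    have "(AE a in \<sigma>0. R a) \<longleftrightarrow> (AE a in sphere_measure. R a)" for R
      unfolding \<sigma>0_def using haar(2) by (subst AE_density) auto
    then show ?thesis unfolding \<sigma>_def AE_restrict_space_iff[OF S0] .
  qed
  have AE_S: "AE a in sphere_measure. a \<in> S"
    using AE_sphere_measure by eventually_elim (use S(2) in auto)
  have radon: "radon_measure_on S \<sigma>"
    unfolding radon_measure_on_def
  proof (intro conjI allI ballI impI)
    show "space \<sigma> = S" "sets \<sigma> = sets (restrict_space borel S)"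
      using S(1) by (auto simp: \<sigma>_def space_restrict_space sets_restrict_space)
    show "emeasure \<sigma> K < \<infinity>" if "K \<subseteq> S" "compact K" for K
      using that fin[OF borel_compact[OF that(2)]] by (simp add: \<sigma>_def emeasure_restrict_space[OF S0])
    fix A assume "A \<in> sets \<sigma>"
    then have A: "A \<subseteq> S" "A \<in> sets borel"
      using S(1) by (auto simp: \<sigma>_def sets_restrict_space)
    have "emeasure \<sigma>0 A = (SUP K \<in> {K. K \<subseteq> A \<and> compact K}. emeasure \<sigma>0 K)"
      by (rule inner_regular) (use fin[of UNIV] A in auto)
    also have "\<dots> = (SUP K \<in> {K. K \<subseteq> A \<and> compact K}. emeasure \<sigma> K)"
      using A(1) by (intro SUP_cong) (auto simp: \<sigma>_def emeasure_restrict_space[OF S0])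
    finally show "emeasure \<sigma> A = (SUP K \<in> {K. K \<subseteq> A \<and> compact K}. emeasure \<sigma> K)"
      using A(1) by (simp add: \<sigma>_def emeasure_restrict_space[OF S0])
  qed
  have nullS: "S \<inter> - \<Omega> \<in> null_sets (completion \<sigma>)"
  proof (rule null_sets_completionI)
    have m: "S \<inter> - \<Omega> \<in> sets borel" using S(1) by auto
    have "AE a in sphere_measure. a \<notin> S \<inter> - \<Omega>" using AE_sphere_measure by eventually_elim auto
    then have "S \<inter> - \<Omega> \<in> null_sets sphere_measure" using m by (subst AE_iff_null_sets) auto
    then have "S \<inter> - \<Omega> \<in> null_sets \<sigma>0" using e0[OF m] m by (simp add: null_sets_def)
    then show "S \<inter> - \<Omega> \<in> null_sets \<sigma>"
      unfolding \<sigma>_def using S0 by (subst null_sets_restrict_space) auto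
  qed
  have "(AE a in completion \<sigma>. set_integrable lebesgue {0<..} (\<lambda>s. f (flow a s) * s ^ (Q - 1))) \<and>
        integrable (completion \<sigma>) (\<lambda>a. LINT s:{0<..}|lebesgue. f (flow a s) * s ^ (Q - 1)) \<and>
        (LINT g|haar G. f g) = (LINT a|completion \<sigma>. (LINT s:{0<..}|lebesgue. f (flow a s) * s ^ (Q - 1)))"
    if f: "integrable (haar G) f" for f :: "'a \<Rightarrow> real"
  proof -
    have hd: "haar G = density lebesgue (\<lambda>_. ennreal c)" using haar(1) by (simp add: scale_measure_eq_density)
    have fm: "f \<in> borel_measurable lebesgue" using f by (simp add: hd borel_measurable_integrable)
    have f1: "integrable lebesgue f" "(LINT g|haar G. f g) = c * (LINT g|lebesgue. f g)"
    proof -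
      have "integrable lebesgue (\<lambda>x. c *\<^sub>R f x)"
        using f unfolding hd using fm haar(2) by (subst (asm) integrable_density) auto
      then show "integrable lebesgue f" using haar(2) by simp
      show "(LINT g|haar G. f g) = c * (LINT g|lebesgue. f g)"
        unfolding hd using fm haar(2) by (subst integral_density) auto
    qed
    \<comment> \<open>Fubini is applied to a Borel representative; the inner integrals of
      \<open>f\<close> are identified with those of \<open>f'\<close> on almost every curve
      afterwards.\<close>
    obtain f' where f' [measurable]: "f' \<in> borel_measurable lborel" and ff': "AE x in lborel. f x = f' x"
      using completion_ex_borel_measurable_real[OF fm] by blast
    have f'm [measurable]: "f' \<in> borel_measurable borel" using f' by simp
    have intf': "integrable lborel f'" "(LINT g|lebesgue. f g) = (LINT g|lborel. f' g)"
      using integrable_completion_AE_eq[OF f' ff'] f1(1) by auto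
    have AE\<Omega>: "AE x in lborel. x \<in> \<Omega>"
    proof -
      have "AE x in lebesgue. x \<notin> - \<Omega>" by (rule AE_not_in[OF null])
      then show ?thesis by (simp add: AE_completion_iff)
    qed
    have int\<Omega>: "integrable lborel (\<lambda>x. indicator \<Omega> x * f' x)"
      using intf'(1) integrable_mult_indicator[of \<Omega> lborel f'] by simp
    have eq\<Omega>: "(LINT x|lborel. indicator \<Omega> x * f' x) = (LINT x|lborel. f' x)"
      using AE\<Omega> by (intro integral_cong_AE) (auto elim!: eventually_mono)
    let ?K = "\<lambda>p. f' (polar_map p) * snd p ^ (Q - 1)"
    have K: "integrable (sphere_measure \<Otimes>\<^sub>M half_line) ?K"
      "integral\<^sup>L (sphere_measure \<Otimes>\<^sub>M half_line) ?K = (LINT x|lborel. f' x)"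
      using polar_borel[OF f'm] int\<Omega> eq\<Omega> by auto
    define I where "I a = (LINT s|half_line. ?K (a, s))" for a
    have intI: "integrable sphere_measure I"
      unfolding I_def[abs_def] by (rule polar.integrable_fst'[OF K(1)])
    have valI: "(LINT a|sphere_measure. I a) = (LINT x|lborel. f' x)"
      unfolding I_def using polar.integral_fst'[OF K(1)] K(2) by simp
    obtain N0 where N0: "N0 \<in> null_sets lborel" "{x. f x \<noteq> f' x} \<subseteq> N0"
      using ff' unfolding eventually_ae_filter by auto
    have Km: "(\<lambda>s. ?K (a, s)) \<in> borel_measurable borel" for a
    proof (rule measurable_compose[of "\<lambda>s. (a, s)" borel "borel \<Otimes>\<^sub>M borel" ?K])
      show "(\<lambda>s. (a, s)) \<in> measurable borel (borel \<Otimes>\<^sub>M borel)" by (intro measurable_Pair) auto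
      show "?K \<in> borel_measurable (borel \<Otimes>\<^sub>M borel)" by measurable
    qed
    have good: "AE a in sphere_measure. set_integrable lebesgue {0<..} (\<lambda>s. f (flow a s) * s ^ (Q - 1)) \<and>
        (LINT s:{0<..}|lebesgue. f (flow a s) * s ^ (Q - 1)) = I a"
      using AE_polar[OF N0(1)] AE_sphere_measure polar.AE_integrable_fst'[OF K(1)]
    proof eventually_elim
      fix a assume *: "AE s in half_line. polar_map (a, s) \<notin> N0" "a \<in> \<Omega> \<and> N a = 1"
        "integrable half_line (\<lambda>s. ?K (a, s))"
      have "AE s in half_line. 0 < s"
        unfolding half_line_def by (subst AE_density) (auto simp: indicator_def)
      with *(1) have "AE s in half_line. f (flow a s) * s ^ (Q - 1) = ?K (a, s)"
        by eventually_elim (use *(2) N0(2) in \<open>auto simp: polar_map_def\<close>)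
      from integral_half_line[OF Km this] *(3)
      show "set_integrable lebesgue {0<..} (\<lambda>s. f (flow a s) * s ^ (Q - 1)) \<and>
        (LINT s:{0<..}|lebesgue. f (flow a s) * s ^ (Q - 1)) = I a" by (simp add: I_def)
    qed
    have good\<sigma>: "AE a in \<sigma>. set_integrable lebesgue {0<..} (\<lambda>s. f (flow a s) * s ^ (Q - 1))"
      "AE a in \<sigma>. (LINT s:{0<..}|lebesgue. f (flow a s) * s ^ (Q - 1)) = I a"
      unfolding AE0 using good by (auto elim: eventually_mono)
    have Im0: "I \<in> borel_measurable sphere_measure" using intI by (rule borel_measurable_integrable)
    then have Im: "I \<in> borel_measurable \<sigma>0" by (simp add: \<sigma>0_def)
    have Im\<sigma>: "I \<in> borel_measurable \<sigma>" unfolding \<sigma>_def by (rule measurable_restrict_space1[OF Im])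
    have iS: "AE a in sphere_measure. c * (indicator S a * I a) = c * I a"
      using AE_S by eventually_elim simp
    have Sm: "(\<lambda>a. indicator S a * I a) \<in> borel_measurable sphere_measure" using Im0 S(1) by measurable
    have "integrable \<sigma> I \<longleftrightarrow> integrable sphere_measure (\<lambda>a. c * (indicator S a * I a))"
      unfolding \<sigma>_def integrable_restrict_space[OF S0] unfolding \<sigma>0_def real_scaleR_def
      using Sm haar(2) by (subst integrable_density) auto
    also have "\<dots> \<longleftrightarrow> integrable sphere_measure (\<lambda>a. c * I a)"
      by (rule integrable_cong_AE[OF _ _ iS]) (use Sm Im0 in measurable)
    finally have int\<sigma>: "integrable \<sigma> I" using intI by simp
    have "(LINT a|\<sigma>. I a) = (LINT a|sphere_measure. c * (indicator S a * I a))"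
      unfolding \<sigma>_def integral_restrict_space[OF S0] unfolding \<sigma>0_def real_scaleR_def
      using Sm haar(2) by (subst integral_density) auto
    also have "\<dots> = (LINT a|sphere_measure. c * I a)"
      by (rule integral_cong_AE[OF _ _ iS]) (use Sm Im0 in measurable)
    also have "\<dots> = (LINT g|haar G. f g)" using valI f1(2) intf'(2) by simp
    finally have val\<sigma>: "(LINT a|\<sigma>. I a) = (LINT g|haar G. f g)" .
    show ?thesis
      using AE_completion[OF good\<sigma>(1)] integrable_completion_AE_eq[OF Im\<sigma> good\<sigma>(2)] int\<sigma> val\<sigma> by simp
  qed
  then have "polar_measure G S (- \<Omega>) flow \<sigma>"
    unfolding polar_measure_def Q using radon nullS by blast
  then show ?thesis by blast
qed

text \<open>The polar formula is tested on \<open>F A\<close>: on the curve through \<open>a\<close>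
  it equals the indicator of \<open>A\<close> at \<open>a\<close> times \<open>unit_bump\<close> in
  the level, divided by \<open>s^(Q-1)\<close>. The inner integral is therefore the indicator of
  \<open>A\<close> itself, so the measure of \<open>A\<close> equals a Haar integral in which the
  measure does not occur.\<close>

theorem polar_measure_unique:
  fixes G :: "('a, 'b) carnot_scheme"
  assumes haar: "haar G = scale_measure (ennreal c) lebesgue" "c > 0" and Q: "hom_dim G = Q"
    and S: "S \<in> sets borel" "S \<inter> \<Omega> = {x \<in> \<Omega>. N x = 1}"
    and pm: "polar_measure G S (- \<Omega>) flow \<sigma>" "polar_measure G S (- \<Omega>) flow \<sigma>'"
  shows "\<sigma> = \<sigma>'"
proof -
  obtain Bu where Bu: "\<And>s. \<bar>unit_bump s\<bar> \<le> Bu" using unit_bump_bounded by blast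
  define F where "F A x = weight x * (indicator A (proj x) * unit_bump (level x))" for A x
  have key: "emeasure \<tau> A = ennreal (LINT g|haar G. F A g)"
    if \<tau>: "polar_measure G S (- \<Omega>) flow \<tau>" and A: "A \<in> sets \<tau>" for \<tau> A
  proof -
    have sp: "space \<tau> = S" "sets \<tau> = sets (restrict_space borel S)"
      using \<tau> by (auto simp: polar_measure_def radon_measure_on_def)
    have Ab: "A \<in> sets borel" and AS: "A \<subseteq> S" using A S(1) sp by (auto simp: sets_restrict_space)
    have iF: "integrable lborel (F A)"
      unfolding F_def[abs_def]
      by (rule flux_integrable[where a = 1 and b = 3 and B = 1 and B' = Bu])
        (use Ab Bu unit_bump(4) in \<open>auto simp: indicator_def\<close>)
    then have Fm: "F A \<in> borel_measurable lborel" by (rule borel_measurable_integrable)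
    have "integrable lebesgue (F A)" using integrable_completion[OF Fm] iF by simp
    then have "integrable (haar G) (F A)"
      unfolding haar(1) scale_measure_eq_density
      using haar(2) measurable_completion[OF Fm] by (subst integrable_density) auto
    then have pol: "integrable (completion \<tau>) (\<lambda>a. LINT s:{0<..}|lebesgue. F A (flow a s) * s ^ (Q - 1))"
      "(LINT g|haar G. F A g) = (LINT a|completion \<tau>. (LINT s:{0<..}|lebesgue. F A (flow a s) * s ^ (Q - 1)))"
      using \<tau> unfolding polar_measure_def Q by blast+
    have Z: "S \<inter> - \<Omega> \<in> null_sets (completion \<tau>)" using \<tau> by (simp add: polar_measure_def)
    have inner: "(LINT s:{0<..}|lebesgue. F A (flow a s) * s ^ (Q - 1)) = indicator A a"
      if a: "a \<in> S" "a \<in> \<Omega>" for a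
    proof -
      have Na: "N a = 1" using a S(2) by auto
      have fl: "flow a 1 = a" using flow_self[OF a(2)] Na by simp
      have pt: "F A (flow a s) * s ^ (Q - 1) = indicator A a * unit_bump s" if s: "s > 0" for s
      proof -
        have fin: "flow a s \<in> \<Omega>" by (rule flow_in[OF a(2) s])
        have "proj (flow a s) = a" using fin flow_flow[OF a(2) s, of 1] fl by (simp add: proj_def)
        moreover have "level (flow a s) = s" using fin N_flow[OF a(2) s] by (simp add: level_def)
        ultimately show ?thesis
          using weight_level[OF fin] by (simp add: F_def mult_ac)
      qed
      have "(LINT s:{0<..}|lebesgue. F A (flow a s) * s ^ (Q - 1)) = (LINT s|half_line. indicator A a * unit_bump s)"
      proof (rule integral_half_line(2))
        show "AE s in half_line. F A (flow a s) * s ^ (Q - 1) = indicator A a * unit_bump s"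
          unfolding half_line_def
        proof (subst AE_density)
          show "AE s in lborel. 0 < (indicator {0<..} s :: ennreal) \<longrightarrow> F A (flow a s) * s ^ (Q - 1) = indicator A a * unit_bump s"
            by (rule AE_I2) (use pt in \<open>auto simp: indicator_def split: if_splits\<close>)
        qed simp
      qed measurable
      also have "\<dots> = (LINT s:{0<..}|lebesgue. indicator A a * unit_bump s)"
        by (rule integral_half_line(2)[symmetric]) auto
      also have "\<dots> = (LINT s|lebesgue. indicator A a * unit_bump s)"
        unfolding set_lebesgue_integral_def
        by (rule Bochner_Integration.integral_cong) (use unit_bump(4) in \<open>auto simp: indicator_def\<close>)
      also have "\<dots> = indicator A a"
        using integral_completion[of unit_bump lborel] unit_bump(3) by simp
      finally show ?thesis .
    qed
    have AE: "AE a in completion \<tau>. (LINT s:{0<..}|lebesgue. F A (flow a s) * s ^ (Q - 1)) = indicator A a"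
      using AE_not_in[OF Z] AE_space by eventually_elim (use inner sp in auto)
    have Am: "A \<in> sets (completion \<tau>)" using A by simp
    have im: "(indicator A :: 'a \<Rightarrow> real) \<in> borel_measurable (completion \<tau>)" using Am by simp
    have int: "integrable (completion \<tau>) (indicator A :: 'a \<Rightarrow> real)"
      using integrable_cong_AE[OF borel_measurable_integrable[OF pol(1)] im AE] pol(1) by simp
    have "A \<inter> space (completion \<tau>) = A" using AS sp by auto
    with int have "emeasure (completion \<tau>) A < \<infinity>" unfolding integrable_indicator_iff by (simp del: emeasure_completion)
    then have fin: "emeasure \<tau> A \<noteq> \<infinity>" using A by simp
    have "(LINT g|haar G. F A g) = (LINT a|completion \<tau>. indicator A a)"
      unfolding pol(2) by (rule integral_cong_AE[OF borel_measurable_integrable[OF pol(1)] im AE])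
    also have "\<dots> = measure \<tau> A" using A sets.sets_into_space[OF A] by (simp add: Int_absorb2)
    finally show ?thesis using fin by (simp add: emeasure_eq_ennreal_measure)
  qed
  have sets: "sets \<sigma> = sets \<sigma>'" using pm by (simp add: polar_measure_def radon_measure_on_def)
  show ?thesis by (rule measure_eqI[OF sets]) (use key[OF pm(1)] key[OF pm(2)] sets in auto)
qed

end

section \<open>Subspaces and traces\<close>

text \<open>A subspace is its double orthogonal complement. Membership thereby reduces to scalar
  equations, which is how derivatives and curves are shown to stay in a subspace.\<close>

lemma in_subspace_if_orthogonal:
  fixes S :: "'a::euclidean_space set"
  assumes "subspace S" "\<And>e. (\<And>s. s \<in> S \<Longrightarrow> e \<bullet> s = 0) \<Longrightarrow> e \<bullet> x = 0"
  shows "x \<in> S"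
proof -
  obtain y z where yz: "y \<in> span S" "\<And>w. w \<in> span S \<Longrightarrow> orthogonal z w" "x = y + z"
    using orthogonal_subspace_decomp_exists by blast
  then have zS: "z \<bullet> w = 0" if "w \<in> S" for w using that by (simp add: orthogonal_def span_base)
  have "z \<bullet> y = 0" using yz(1,2) by (simp add: orthogonal_def)
  moreover have "z \<bullet> x = 0" using assms(2) zS by blast
  ultimately have "z \<bullet> z = 0" by (simp add: yz(3) inner_add_right)
  then have "x = y" by (simp add: yz(3))
  moreover have "y \<in> S" using yz(1) span_minimal[OF order_refl assms(1)] by (rule set_rev_mp)
  ultimately show ?thesis by (simp only:)
qed

lemma derivative_in_subspace:
  fixes f :: "'a::euclidean_space \<Rightarrow> 'b::euclidean_space"
  assumes S: "subspace S" and f: "f differentiable (at x)" and inS: "\<And>y. f y - w \<in> S"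
  shows "frechet_derivative f (at x) v \<in> S"
proof (rule in_subspace_if_orthogonal[OF S])
  fix e :: 'b assume e: "\<And>s. s \<in> S \<Longrightarrow> e \<bullet> s = 0"
  have "(\<lambda>y. e \<bullet> f y) = (\<lambda>y. e \<bullet> w)"
    using e[OF inS] by (auto simp: inner_diff_right)
  then have "frechet_derivative (\<lambda>y. e \<bullet> f y) (at x) v = 0" by simp
  then show "e \<bullet> frechet_derivative f (at x) v = 0"
    using frechet_derivative_linear_image[OF f bounded_linear_inner_right] by metis
qed

lemma curve_in_subspace:
  fixes c :: "real \<Rightarrow> 'b::euclidean_space"
  assumes S: "subspace S" and c: "\<And>t. (c has_vector_derivative c' t) (at t)"
    and inS: "\<And>t. c' t \<in> S" "c 0 \<in> S"
  shows "c t \<in> S"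
proof (rule in_subspace_if_orthogonal[OF S])
  fix e :: 'b assume e: "\<And>s. s \<in> S \<Longrightarrow> e \<bullet> s = 0"
  have "((\<lambda>t. e \<bullet> c t) has_vector_derivative e \<bullet> c' t) (at t)" for t
    by (rule bounded_linear.has_vector_derivative[OF bounded_linear_inner_right c])
  then have "((\<lambda>t. e \<bullet> c t) has_real_derivative 0) (at t)" for t
    using e[OF inS(1)] by (simp add: has_real_derivative_iff_has_vector_derivative)
  then have "e \<bullet> c t = e \<bullet> c 0" using DERIV_isconst_all by blast
  then show "e \<bullet> c t = 0" using e[OF inS(2)] by simp
qed

section \<open>Traces in orthogonal bases\<close>

lemma orthogonal_expansion:
  fixes B :: "'a::euclidean_space set"
  assumes "finite B" "pairwise orthogonal B" "x \<in> span B"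
  shows "x = (\<Sum>e\<in>B. ((x \<bullet> e) / (e \<bullet> e)) *\<^sub>R e)"
proof -
  define d where "d = x - (\<Sum>e\<in>B. ((x \<bullet> e) / (e \<bullet> e)) *\<^sub>R e)"
  have "orthogonal d e" if e: "e \<in> B" for e
  proof -
    have "(\<Sum>e'\<in>B. ((x \<bullet> e') / (e' \<bullet> e')) *\<^sub>R e') \<bullet> e = (\<Sum>e'\<in>B. if e' = e then x \<bullet> e else 0)"
      unfolding inner_sum_left
      by (rule sum.cong) (use assms(2) e in \<open>auto simp: pairwise_def orthogonal_def\<close>)
    also have "\<dots> = x \<bullet> e" using assms(1) e by simp
    finally show ?thesis by (simp add: d_def orthogonal_def inner_diff_left)
  qed
  moreover have "d \<in> span B"
    unfolding d_def by (intro span_diff assms span_sum span_scale span_base)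
  ultimately have "orthogonal d d" using orthogonal_to_span by blast
  then show ?thesis by (simp add: d_def orthogonal_def)
qed

lemma trace_orthogonal_basis:
  fixes T :: "'a::euclidean_space \<Rightarrow> 'a"
  assumes T: "linear T" and B: "finite B" "pairwise orthogonal B" "span B = UNIV"
  shows "(\<Sum>b\<in>Basis. T b \<bullet> b) = (\<Sum>e\<in>B. (T e \<bullet> e) / (e \<bullet> e))"
proof -
  have "T b \<bullet> b = (\<Sum>e\<in>B. ((b \<bullet> e) / (e \<bullet> e)) * (T e \<bullet> b))" for b
  proof -
    have "T b = T (\<Sum>e\<in>B. ((b \<bullet> e) / (e \<bullet> e)) *\<^sub>R e)"
      using orthogonal_expansion[OF B(1,2), of b] B(3) by simp
    then show ?thesis by (simp add: linear_sum[OF T] linear_scale[OF T] inner_sum_left)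
  qed
  then have "(\<Sum>b\<in>Basis. T b \<bullet> b) = (\<Sum>b\<in>Basis. \<Sum>e\<in>B. ((b \<bullet> e) / (e \<bullet> e)) * (T e \<bullet> b))" by simp
  also have "\<dots> = (\<Sum>e\<in>B. \<Sum>b\<in>Basis. ((b \<bullet> e) / (e \<bullet> e)) * (T e \<bullet> b))" by (rule sum.swap)
  also have "\<dots> = (\<Sum>e\<in>B. (T e \<bullet> e) / (e \<bullet> e))"
  proof (rule sum.cong[OF refl])
    fix e
    have "(\<Sum>b\<in>Basis. ((b \<bullet> e) / (e \<bullet> e)) * (T e \<bullet> b)) = (\<Sum>b\<in>Basis. (T e \<bullet> b) * (e \<bullet> b)) / (e \<bullet> e)"
      by (simp add: sum_divide_distrib inner_commute mult.commute)
    then show "(\<Sum>b\<in>Basis. ((b \<bullet> e) / (e \<bullet> e)) * (T e \<bullet> b)) = (T e \<bullet> e) / (e \<bullet> e)"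
      by (simp add: euclidean_inner[of "T e" e])
  qed
  finally show ?thesis .
qed

text \<open>In an orthogonal basis adapted to the flag, \<open>T\<close> is strictly triangular. The
  basis is built from the small end: a new vector of \<open>F k\<close> is orthogonal to
  \<open>F (Suc k)\<close>, where its image under \<open>T\<close> lies, so it contributes nothing
  to the trace.\<close>

lemma trace_flag_nilpotent:
  fixes T :: "'a::euclidean_space \<Rightarrow> 'a" and F :: "nat \<Rightarrow> 'a set"
  assumes T: "linear T" and F: "\<And>k. subspace (F k)" "\<And>k. F (Suc k) \<subseteq> F k" "F 0 = UNIV" "F K = {0}"
    and TF: "\<And>k x. x \<in> F k \<Longrightarrow> T x \<in> F (Suc k)"
  shows "(\<Sum>b\<in>Basis. T b \<bullet> b) = 0"
proof -
  have "\<exists>B. finite B \<and> pairwise orthogonal B \<and> span B = F (K - n) \<and> (\<Sum>e\<in>B. (T e \<bullet> e) / (e \<bullet> e)) = 0"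
    if "n \<le> K" for n
    using that
  proof (induction n)
    case 0
    show ?case by (rule exI[of _ "{}"]) (simp add: F(4) pairwise_def)
  next
    case (Suc n)
    then obtain B where B: "finite B" "pairwise orthogonal B" "span B = F (K - n)" "(\<Sum>e\<in>B. (T e \<bullet> e) / (e \<bullet> e)) = 0"
      by auto
    define k where "k = K - Suc n"
    have k: "K - n = Suc k" using Suc.prems by (simp add: k_def)
    obtain U where U: "U \<inter> (insert 0 B) = {}" "pairwise orthogonal (B \<union> U)" "span (B \<union> U) = span (B \<union> F k)"
      using orthogonal_extension_strong[OF B(2)] by metis
    have BF: "B \<subseteq> F k" using span_superset[of B] B(3) F(2)[of k] k by auto
    have sp: "span (B \<union> U) = F k" unfolding U(3) using BF F(1) by (metis span_eq_iff sup.absorb2)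
    have fin: "finite (B \<union> U)" by (rule pairwise_orthogonal_imp_finite[OF U(2)])
    have "(\<Sum>e\<in>U. (T e \<bullet> e) / (e \<bullet> e)) = 0"
    proof (rule sum.neutral, rule ballI)
      fix e assume e: "e \<in> U"
      have "e \<in> F k" using sp span_superset[of "B \<union> U"] e by blast
      then have "T e \<in> span B" using TF B(3) k by simp
      moreover have "orthogonal e y" if "y \<in> B" for y
      proof (rule pairwiseD[OF U(2)])
        show "e \<noteq> y" using U(1) e that by auto
      qed (use e that in auto)
      ultimately have "orthogonal e (T e)" using orthogonal_to_span by blast
      then show "(T e \<bullet> e) / (e \<bullet> e) = 0" by (simp add: orthogonal_def inner_commute)
    qed
    then have "(\<Sum>e\<in>B \<union> U. (T e \<bullet> e) / (e \<bullet> e)) = 0"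
      using B(1,4) fin U(1) by (subst sum.union_disjoint) auto
    then show ?case using fin U(2) sp k_def by blast
  qed
  from this[of K] obtain B where "finite B" "pairwise orthogonal B" "span B = UNIV"
    "(\<Sum>e\<in>B. (T e \<bullet> e) / (e \<bullet> e)) = 0" using F(3) by auto
  then show ?thesis using trace_orthogonal_basis[OF T] by simp
qed

section \<open>Left-invariant vector fields\<close>

context carnot_group
begin

abbreviation "gm \<equiv> mult G"
abbreviation "lf v \<equiv> left_field G v"

lemma gm_assoc: "gm (gm x y) z = gm x (gm y z)"
  and gm_0_left [simp]: "gm 0 x = x" and gm_0_right [simp]: "gm x 0 = x"
  and gm_minus_left [simp]: "gm (- x) x = 0" and gm_minus_right [simp]: "gm x (- x) = 0"
proof -
  interpret gp: group "mult G" 0 uminus by (rule group_mult)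
  show "gm (gm x y) z = gm x (gm y z)" "gm 0 x = x" "gm x 0 = x" "gm (- x) x = 0" "gm x (- x) = 0"
    by (simp_all add: gp.assoc)
qed

abbreviation "mm \<equiv> (\<lambda>(x, y). gm x y)"

definition left_diff :: "'a \<Rightarrow> 'a \<Rightarrow> 'a \<Rightarrow> 'a" where
  "left_diff g x v = frechet_derivative (gm g) (at x) v"

lemma mm_Ck: "Ck_on k UNIV mm"
  using smooth_mult by (simp add: smooth_on_def)

lemma gm_has_derivative: "(gm g has_derivative left_diff g x) (at x)"
  and left_diff_mm: "left_diff g x v = frechet_derivative mm (at (g, x)) (0, v)"
proof -
  have m: "(mm has_derivative frechet_derivative mm (at (g, x))) (at (g, x))"
    using C1_on_has_derivative[OF mm_Ck] by simp
  have p: "((\<lambda>y. (g, y)) has_derivative (\<lambda>v. (0, v))) (at x)" by (auto intro!: derivative_eq_intros)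
  have d: "(gm g has_derivative (\<lambda>v. frechet_derivative mm (at (g, x)) (0, v))) (at x)"
    using has_derivative_compose[OF p m] by simp
  then show "left_diff g x v = frechet_derivative mm (at (g, x)) (0, v)"
    by (simp add: left_diff_def frechet_derivative_eqI)
  show "(gm g has_derivative left_diff g x) (at x)"
    using d by (simp add: left_diff_def[abs_def] frechet_derivative_eqI)
qed

lemma lf_eq: "lf v g = left_diff g 0 v"
  by (simp add: left_field_def left_diff_def)

lemma left_diff_linear: "linear (left_diff g x)"
  using gm_has_derivative has_derivative_linear by blast

lemma left_diff_Ck:
  assumes "open U" "Ck_on k U p" "Ck_on k U q"
  shows "Ck_on k U (\<lambda>y. left_diff (p y) (q y) v)"
proof -
  have "Ck_on k UNIV (\<lambda>z. frechet_derivative mm (at z) (0, v))"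
    by (rule Ck_on_derivative[OF mm_Ck])
  moreover have "Ck_on k U (\<lambda>y. (p y, q y))"
  proof -
    have "bounded_linear (\<lambda>x::'a. (x, 0::'a))" "bounded_linear (\<lambda>x::'a. (0::'a, x))"
      by (auto intro!: bounded_linear_intros)
    then have "Ck_on k U (\<lambda>y. (p y, 0) + (0, q y))"
      using assms by (intro Ck_on_add) (auto intro: Ck_on_linear[of U "\<lambda>x. (x, 0)"] Ck_on_linear[of U "\<lambda>x. (0, x)"])
    then show ?thesis by simp
  qed
  ultimately show ?thesis
    unfolding left_diff_mm by (rule Ck_on_compose[OF assms(1) open_UNIV]) simp
qed

lemma lf_Ck: "Ck_on k UNIV (lf v)"
  unfolding lf_eq[abs_def] by (intro left_diff_Ck Ck_on_ident Ck_on_const open_UNIV)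

lemma lf_linear: "linear (\<lambda>v. lf v g)"
  using left_diff_linear by (simp add: lf_eq)

lemma lf_sum: "(\<Sum>b\<in>Basis. (v \<bullet> b) *\<^sub>R lf b g) = lf v g"
  by (rule linear_sum_Basis[OF lf_linear, symmetric])

lemma lf_has_derivative: "(lf v has_derivative frechet_derivative (lf v) (at x)) (at x)"
  using C1_on_has_derivative[OF lf_Ck] by simp

lemma lf_differentiable: "lf v differentiable (at x)"
  using C1_on_differentiable[OF lf_Ck] by simp

lemma lf_gm: "lf v (gm g x) = left_diff g x (lf v x)"
proof -
  have "(gm (gm g x) has_derivative (\<lambda>v. left_diff g x (left_diff x 0 v))) (at 0)"
  proof -
    have "gm (gm g x) = (\<lambda>y. gm g (gm x y))" by (auto simp: gm_assoc)
    then show ?thesis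
      using has_derivative_compose[OF gm_has_derivative[of x 0] gm_has_derivative[of g "gm x 0"]] by simp
  qed
  then show ?thesis by (simp add: left_field_def frechet_derivative_eqI lf_eq[symmetric])
qed

lemma lf_0: "lf v 0 = v"
proof -
  have "gm 0 = (\<lambda>x. x)" by auto
  then show ?thesis by (simp add: left_field_def)
qed

text \<open>Carries a tangent vector at \<open>g\<close> back to the identity by left translation by
  the inverse \<open>- g\<close>. Compared with an abstract inverse of \<open>lf\<close>, this form
  depends smoothly on \<open>g\<close> by construction.\<close>

definition lf_inv :: "'a \<Rightarrow> 'a \<Rightarrow> 'a" where
  "lf_inv g z = left_diff (- g) g z"

lemma lf_inv_lf: "lf_inv g (lf v g) = v"
  using lf_gm[of v "- g" g] by (simp add: lf_inv_def lf_0)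

lemma lf_lf_inv: "lf (lf_inv g z) g = z"
proof -
  have "inj (\<lambda>v. lf v g)" by (rule injI) (metis lf_inv_lf)
  then have "surj (\<lambda>v. lf v g)" using linear_injective_imp_surjective[OF lf_linear] by blast
  then obtain v where "z = lf v g" by (metis surjD)
  then show ?thesis by (simp add: lf_inv_lf)
qed

text \<open>Left invariance writes \<open>lf w\<close> near \<open>g\<close> as the differential of
  left translation by \<open>g\<close> applied to \<open>lf w\<close> near 0. Differentiating at 0
  produces the derivative at the identity and a second derivative of the translation; the latter is
  symmetric in \<open>v\<close> and \<open>w\<close> and cancels in the commutator.\<close>

lemma lf_bracket:
  "frechet_derivative (lf w) (at g) (lf v g) - frechet_derivative (lf v) (at g) (lf w g) = lf (lie_bracket G v w) g"
proof -
  define S where "S a b = frechet_derivative (\<lambda>y. left_diff g y a) (at 0) b" for a b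
  have gC: "Ck_on k UNIV (gm g)" for k
    using Ck_on_compose[OF open_UNIV open_UNIV mm_Ck, of k "\<lambda>y. (g, y)"]
      Ck_on_add[OF open_UNIV Ck_on_const[of k UNIV "(g, 0)"] Ck_on_linear[OF open_UNIV _ Ck_on_ident, of "\<lambda>y. (0, y)" k]]
    by (simp add: bounded_linear_Pair bounded_linear_zero bounded_linear_ident)
  have sym: "S a b = S b a" for a b
    unfolding S_def left_diff_def by (rule second_derivative_symmetric[OF open_UNIV gC]) simp
  have ldd: "((\<lambda>y. left_diff g y a) has_derivative S a) (at 0)" for a
    unfolding S_def[abs_def]
    by (rule C1_on_has_derivative[where U = UNIV])
      (intro left_diff_Ck Ck_on_ident Ck_on_const open_UNIV, rule UNIV_I)
  have Slin: "linear (S a)" for a using ldd has_derivative_linear by blast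
  have main: "frechet_derivative (lf w) (at g) (lf v g) = lf (frechet_derivative (lf w) (at 0) v) g + S w v" for v w
  proof -
    have g0: "(gm g has_derivative (\<lambda>v. lf v g)) (at 0)" using gm_has_derivative[of g 0] by (simp add: lf_eq)
    note lw = lf_has_derivative[of w]
    have d1: "((\<lambda>y. lf w (gm g y)) has_derivative (\<lambda>v. frechet_derivative (lf w) (at g) (lf v g))) (at 0)"
      using has_derivative_compose[OF g0, of "lf w" "frechet_derivative (lf w) (at g)"] lw[of g] by simp
    have e: "(\<lambda>y. lf w (gm g y)) = (\<lambda>y. \<Sum>b\<in>Basis. (lf w y \<bullet> b) *\<^sub>R left_diff g y b)"
      unfolding lf_gm by (rule ext) (rule linear_sum_Basis[OF left_diff_linear])
    have d2: "((\<lambda>y. lf w (gm g y)) has_derivative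
        (\<lambda>v. \<Sum>b\<in>Basis. (lf w 0 \<bullet> b) *\<^sub>R S b v + (frechet_derivative (lf w) (at 0) v \<bullet> b) *\<^sub>R left_diff g 0 b)) (at 0)"
      unfolding e by (intro has_derivative_sum has_derivative_scaleR ldd has_derivative_inner_left lw)
    from fun_cong[OF has_derivative_unique[OF d1 d2], of v]
    have "frechet_derivative (lf w) (at g) (lf v g) =
       (\<Sum>b\<in>Basis. (w \<bullet> b) *\<^sub>R S b v + (frechet_derivative (lf w) (at 0) v \<bullet> b) *\<^sub>R left_diff g 0 b)"
      by (simp only: lf_0)
    also have "\<dots> = (\<Sum>b\<in>Basis. (w \<bullet> b) *\<^sub>R S v b) + (\<Sum>b\<in>Basis. (frechet_derivative (lf w) (at 0) v \<bullet> b) *\<^sub>R left_diff g 0 b)"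
      using sym by (simp add: sum.distrib)
    also have "\<dots> = S v w + left_diff g 0 (frechet_derivative (lf w) (at 0) v)"
      using linear_sum_Basis[OF Slin[of v], of w]
        linear_sum_Basis[OF left_diff_linear[of g 0], of "frechet_derivative (lf w) (at 0) v"] by simp
    finally show ?thesis using sym[of v w] by (simp add: lf_eq add.commute)
  qed
  show ?thesis
    using main[of w v] main[of v w] sym[of v w]
    by (simp add: lie_bracket_def linear_diff[OF lf_linear])
qed

text \<open>By the one-parameter condition, left translation by \<open>t x\<close> sends the ray
  \<open>s x\<close> to \<open>(t + s) x\<close>, whose velocity is \<open>x\<close> at every
  time.\<close>

lemma lf_ray: "lf x (t *\<^sub>R x) = x"
proof (cases "t = 0")
  case False
  let ?g = "t *\<^sub>R x"
  have "((\<lambda>s. gm ?g (s *\<^sub>R x)) has_derivative (\<lambda>s. left_diff ?g 0 (s *\<^sub>R x))) (at 0)"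
    by (rule has_derivative_compose[of "\<lambda>s. s *\<^sub>R x"])
      (auto intro!: derivative_eq_intros simp: gm_has_derivative)
  then have "((\<lambda>s. (t + s) *\<^sub>R x) has_derivative (\<lambda>s. left_diff ?g 0 (s *\<^sub>R x))) (at 0)"
    by (simp add: one_param)
  moreover have "((\<lambda>s. (t + s) *\<^sub>R x) has_derivative (\<lambda>s. s *\<^sub>R x)) (at 0)" by (auto intro!: derivative_eq_intros)
  ultimately have "(\<lambda>s. left_diff ?g 0 (s *\<^sub>R x)) = (\<lambda>s. s *\<^sub>R x)" by (rule has_derivative_unique)
  from fun_cong[OF this, of 1] show ?thesis by (simp add: lf_eq)
qed (simp add: lf_0)

lemma lf_self: "lf y y = y"
  using lf_ray[of y 1] by simp

text \<open>Obtained by differentiating \<open>lf y y = y\<close> in \<open>y\<close>.\<close>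

lemma lf_radial: "t *\<^sub>R frechet_derivative (lf x) (at (t *\<^sub>R x)) z = z - lf z (t *\<^sub>R x)"
proof -
  let ?g = "t *\<^sub>R x"
  note lb = lf_has_derivative[of _ ?g]
  have e1: "(\<lambda>y. \<Sum>b\<in>Basis. (y \<bullet> b) *\<^sub>R lf b y) = (\<lambda>y. y)"
    by (rule ext) (simp only: lf_sum lf_self)
  have "((\<lambda>y. \<Sum>b\<in>Basis. (y \<bullet> b) *\<^sub>R lf b y) has_derivative
      (\<lambda>z. \<Sum>b\<in>Basis. (?g \<bullet> b) *\<^sub>R frechet_derivative (lf b) (at ?g) z + (z \<bullet> b) *\<^sub>R lf b ?g)) (at ?g)"
    by (intro has_derivative_sum has_derivative_scaleR lb has_derivative_inner_left has_derivative_ident)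
  from fun_cong[OF has_derivative_unique[OF this[unfolded e1] has_derivative_ident], of z]
  have 1: "(\<Sum>b\<in>Basis. (?g \<bullet> b) *\<^sub>R frechet_derivative (lf b) (at ?g) z) + lf z ?g = z"
    by (simp only: sum.distrib lf_sum)
  have e2: "(\<lambda>y. \<Sum>b\<in>Basis. (?g \<bullet> b) *\<^sub>R lf b y) = (\<lambda>y. t *\<^sub>R lf x y)"
    by (rule ext) (simp only: lf_sum linear_scale[OF lf_linear])
  have d2: "((\<lambda>y. \<Sum>b\<in>Basis. (?g \<bullet> b) *\<^sub>R lf b y) has_derivative
      (\<lambda>z. \<Sum>b\<in>Basis. (?g \<bullet> b) *\<^sub>R frechet_derivative (lf b) (at ?g) z)) (at ?g)"
    by (intro has_derivative_sum bounded_linear.has_derivative[OF bounded_linear_scaleR_right] lb)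
  have d3: "((\<lambda>y. t *\<^sub>R lf x y) has_derivative (\<lambda>z. t *\<^sub>R frechet_derivative (lf x) (at ?g) z)) (at ?g)"
    by (intro bounded_linear.has_derivative[OF bounded_linear_scaleR_right] lb)
  from fun_cong[OF has_derivative_unique[OF d2[unfolded e2] d3], of z]
  show ?thesis using 1 by (metis add_diff_cancel_right')
qed

section \<open>Left-invariant fields and the lower central series\<close>

abbreviation "flag k \<equiv> lower_central G k"

lemma flag_subspace: "subspace (flag k)"
  by (cases k) (auto simp: bracket_span_def)

lemma bracket_flag: "y \<in> flag k \<Longrightarrow> lie_bracket G x y \<in> flag (Suc k)"
  by (auto simp: bracket_span_def intro!: span_base)

lemma flag_decreasing: "flag (Suc k) \<subseteq> flag k"
proof (induction k)
  case (Suc k)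
  have "{lie_bracket G x y | x y. x \<in> UNIV \<and> y \<in> flag (Suc k)} \<subseteq> flag (Suc k)"
    using bracket_flag Suc by blast
  then show ?case
    using span_minimal[OF _ flag_subspace[of "Suc k"]] by (simp add: bracket_span_def)
qed simp

lemma flag_antimono: "j \<le> k \<Longrightarrow> flag k \<subseteq> flag j"
  by (rule lift_Suc_antimono_le[of flag]) (use flag_decreasing in auto)

text \<open>The curve \<open>c t = t \<cdot> (lf \<cdot> (tx))\<^sup>-\<^sup>1 w\<close> solves \<open>c' = w - [x, c]\<close>: this is the formula for the
  differential of the exponential map, which here is the identity.\<close>

lemma lf_inv_curve:
  assumes c_def: "\<And>t. c t = t *\<^sub>R lf_inv (t *\<^sub>R x) w"
  shows "(c has_vector_derivative w - lie_bracket G x (c t)) (at t)"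
proof -
  have inv_C: "Ck_on k UNIV (\<lambda>t::real. lf_inv (t *\<^sub>R x) w)" for k
    unfolding lf_inv_def
    by (intro left_diff_Ck Ck_on_minus Ck_on_scaleR Ck_on_ident Ck_on_const open_UNIV)
  have cC: "Ck_on 1 UNIV c"
    unfolding c_def[abs_def] by (intro Ck_on_scaleR Ck_on_ident inv_C open_UNIV)
  define c' where "c' t = vector_derivative c (at t)" for t
  have c': "(c has_vector_derivative c' t) (at t)" for t
    using C1_on_differentiable[OF cC] vector_derivative_works by (auto simp: c'_def)
  have lin: "linear (\<lambda>v. lf v g)" for g by (rule lf_linear)
  have Ac: "lf (c t) (t *\<^sub>R x) = t *\<^sub>R w" for t
    by (simp add: c_def linear_scale[OF lin] lf_lf_inv)
  have ne: "c' t = w - lie_bracket G x (c t)" if t: "t \<noteq> 0" for t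
  proof -
    let ?g = "t *\<^sub>R x"
    have ray: "((\<lambda>t. t *\<^sub>R x) has_vector_derivative x) (at t)" by (auto intro!: derivative_eq_intros)
    have dl: "((\<lambda>t. lf b (t *\<^sub>R x)) has_vector_derivative frechet_derivative (lf b) (at ?g) x) (at t)" for b
      using has_derivative_compose[OF ray[unfolded has_vector_derivative_def] lf_has_derivative[of b ?g]]
        linear_scale[OF has_derivative_linear[OF lf_has_derivative[of b ?g]]]
      by (simp add: has_vector_derivative_def)
    have dcb: "((\<lambda>t. c t \<bullet> b) has_real_derivative c' t \<bullet> b) (at t)" for b
      using bounded_linear.has_vector_derivative[OF bounded_linear_inner_left c']
      by (simp add: has_real_derivative_iff_has_vector_derivative)
    have e1: "(\<lambda>t. \<Sum>b\<in>Basis. (c t \<bullet> b) *\<^sub>R lf b (t *\<^sub>R x)) = (\<lambda>t. t *\<^sub>R w)"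
      by (rule ext) (simp only: lf_sum Ac)
    have d1: "((\<lambda>t. \<Sum>b\<in>Basis. (c t \<bullet> b) *\<^sub>R lf b (t *\<^sub>R x)) has_vector_derivative
      (\<Sum>b\<in>Basis. (c t \<bullet> b) *\<^sub>R frechet_derivative (lf b) (at ?g) x + (c' t \<bullet> b) *\<^sub>R lf b ?g)) (at t)"
      by (intro has_vector_derivative_sum has_vector_derivative_scaleR dcb dl)
    have d2: "((\<lambda>t. t *\<^sub>R w) has_vector_derivative w) (at t)" by (auto intro!: derivative_eq_intros)
    have w1: "(\<Sum>b\<in>Basis. (c t \<bullet> b) *\<^sub>R frechet_derivative (lf b) (at ?g) x) + lf (c' t) ?g = w"
      using vector_derivative_unique_at[OF d1[unfolded e1] d2] by (simp only: sum.distrib lf_sum)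
    have "(\<Sum>b\<in>Basis. (c t \<bullet> b) *\<^sub>R frechet_derivative (lf b) (at ?g) x) = frechet_derivative (lf (c t)) (at ?g) x"
    proof -
      have e2: "(\<lambda>y. \<Sum>b\<in>Basis. (c t \<bullet> b) *\<^sub>R lf b y) = lf (c t)"
        by (rule ext) (rule lf_sum)
      have "((\<lambda>y. \<Sum>b\<in>Basis. (c t \<bullet> b) *\<^sub>R lf b y) has_derivative
          (\<lambda>z. \<Sum>b\<in>Basis. (c t \<bullet> b) *\<^sub>R frechet_derivative (lf b) (at ?g) z)) (at ?g)"
        by (intro has_derivative_sum bounded_linear.has_derivative[OF bounded_linear_scaleR_right] lf_has_derivative)
      from frechet_derivative_eqI[OF this[unfolded e2]] show ?thesis by simp
    qed
    then have w2: "w = frechet_derivative (lf (c t)) (at ?g) x + lf (c' t) ?g" using w1 by simp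
    have br: "frechet_derivative (lf (c t)) (at ?g) x =
        frechet_derivative (lf x) (at ?g) (lf (c t) ?g) + lf (lie_bracket G x (c t)) ?g"
      using lf_bracket[of "c t" ?g x] lf_ray[of x t] by (simp add: algebra_simps)
    have "t *\<^sub>R frechet_derivative (lf x) (at ?g) (lf (c t) ?g) = lf (c t) ?g - lf (lf (c t) ?g) ?g"
      by (rule lf_radial)
    also have "\<dots> = t *\<^sub>R (w - lf w ?g)"
      by (simp add: Ac linear_scale[OF lin] scaleR_diff_right)
    finally have "frechet_derivative (lf x) (at ?g) (lf (c t) ?g) = w - lf w ?g" using t by simp
    then have "lf w ?g = lf (lie_bracket G x (c t) + c' t) ?g"
      using w2 br by (simp add: linear_add[OF lin] algebra_simps)
    then have "w = lie_bracket G x (c t) + c' t" by (metis lf_inv_lf)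
    then show ?thesis by simp
  qed
  have z: "c' 0 = w - lie_bracket G x (c 0)"
  proof -
    have d: "((\<lambda>t. lf_inv (t *\<^sub>R x) w) has_vector_derivative vector_derivative (\<lambda>t. lf_inv (t *\<^sub>R x) w) (at 0)) (at 0)"
      using C1_on_differentiable[OF inv_C] vector_derivative_works by auto
    have "(c has_vector_derivative (0 *\<^sub>R vector_derivative (\<lambda>t. lf_inv (t *\<^sub>R x) w) (at 0) + 1 *\<^sub>R lf_inv (0 *\<^sub>R x) w)) (at 0)"
      unfolding c_def[abs_def] by (intro has_vector_derivative_scaleR d DERIV_ident)
    then have "c' 0 = lf_inv 0 w" using c'[of 0] vector_derivative_unique_at by fastforce
    also have "\<dots> = w" using lf_inv_lf[of 0 w] by (simp add: lf_0)
    moreover have "lie_bracket G x 0 = 0"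
    proof -
      have "lf 0 = (\<lambda>_. 0)" using linear_0[OF lin] by auto
      then show ?thesis
        using linear_0[OF has_derivative_linear[OF lf_has_derivative[of x 0]]] by (simp add: lie_bracket_def)
    qed
    ultimately show ?thesis by (simp add: c_def)
  qed
  show ?thesis using c'[of t] ne[of t] z by (cases "t = 0") auto
qed

text \<open>The equation \<open>c' = w - [x, c]\<close> with \<open>c 0 = 0\<close> is bootstrapped:
  as long as \<open>c\<close> lies in \<open>flag j\<close> with \<open>j < k\<close>, its velocity
  lies in \<open>flag (Suc j)\<close>, and so does \<open>c\<close>. Once \<open>c\<close> lies in
  \<open>flag k\<close>, the curve \<open>c t - t w\<close> has velocity in
  \<open>flag (Suc k)\<close>; it is evaluated at \<open>t = 1\<close>.\<close>

lemma lf_inv_flag: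
  assumes w: "w \<in> flag k"
  shows "lf_inv x w - w \<in> flag (Suc k)"
proof -
  define c where "c t = t *\<^sub>R lf_inv (t *\<^sub>R x) w" for t
  have c': "(c has_vector_derivative w - lie_bracket G x (c t)) (at t)" for t
    by (rule lf_inv_curve) (simp add: c_def)
  have c0: "c 0 = 0" by (simp add: c_def)
  have "\<forall>t. c t \<in> flag j" if "j \<le> k" for j
    using that
  proof (induction j)
    case (Suc j)
    show ?case
    proof
      fix t
      show "c t \<in> flag (Suc j)"
      proof (rule curve_in_subspace[OF flag_subspace c'])
        show "w - lie_bracket G x (c t) \<in> flag (Suc j)" for t
          using w flag_antimono[OF Suc.prems] Suc bracket_flag
          by (intro subspace_diff[OF flag_subspace]) auto
      qed (simp only: c0 subspace_0[OF flag_subspace])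
    qed
  qed simp
  then have ck: "c t \<in> flag k" for t by blast
  have "((\<lambda>t. c t - t *\<^sub>R w) has_vector_derivative - lie_bracket G x (c t)) (at t)" for t
    using c'[of t] by (auto intro!: derivative_eq_intros)
  then have "(\<lambda>t. c t - t *\<^sub>R w) 1 \<in> flag (Suc k)"
    by (rule curve_in_subspace[OF flag_subspace])
      (use ck bracket_flag c0 in \<open>auto intro!: subspace_neg[OF flag_subspace] subspace_0[OF flag_subspace] simp del: lower_central.simps\<close>)
  then show ?thesis by (simp add: c_def)
qed

text \<open>Inverts the preceding lemma. With \<open>d = lf_inv x w - w\<close>, which lies one step
  deeper, \<open>lf w x - w\<close> equals \<open>- lf d x\<close>; the induction runs up from the
  end of the series, where \<open>flag\<close> is trivial.\<close>

lemma lf_flag: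
  assumes "w \<in> flag k"
  shows "lf w x - w \<in> flag (Suc k)"
proof -
  obtain K where K: "flag K = {0}" using nilpotent by blast
  have z: "lf 0 x - 0 \<in> flag j" for j
    using linear_0[OF lf_linear] subspace_0[OF flag_subspace] by (simp del: lower_central.simps)
  have top: "lf w x - w \<in> flag (Suc k)" if "w \<in> flag k" "k \<ge> K" for k w
  proof -
    have "w = 0" using flag_antimono[OF that(2)] K that(1) by blast
    then show ?thesis using z by (simp only:)
  qed
  have "\<forall>w\<in>flag k. lf w x - w \<in> flag (Suc k)" if "k + n = K" for n k
    using that
  proof (induction n arbitrary: k)
    case 0
    then show ?case using top by (simp del: lower_central.simps)
  next
    case (Suc n)
    show ?case
    proof
      fix w assume w: "w \<in> flag k"
      define d where "d = lf_inv x w - w"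
      have d: "d \<in> flag (Suc k)" unfolding d_def by (rule lf_inv_flag[OF w])
      have "Suc k + n = K" using Suc.prems by simp
      then have "lf d x - d \<in> flag (Suc (Suc k))" using Suc.IH d by blast
      then have "lf d x - d \<in> flag (Suc k)" by (rule set_mp[OF flag_decreasing])
      from subspace_add[OF flag_subspace this d] have "lf d x \<in> flag (Suc k)"
        by (simp only: diff_add_cancel)
      from subspace_neg[OF flag_subspace this] have "- lf d x \<in> flag (Suc k)" .
      moreover have "lf w x - w = - lf d x"
        using lf_lf_inv[of x w] by (simp add: d_def linear_diff[OF lf_linear])
      ultimately show "lf w x - w \<in> flag (Suc k)" by (simp only:)
    qed
  qed
  from this[of k "K - k"] show ?thesis using top[OF assms] assms by (cases "k \<le> K") (simp_all del: lower_central.simps)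
qed

text \<open>The divergence is the trace of the derivative at \<open>g\<close>, and that derivative
  maps \<open>flag k\<close> into \<open>flag (Suc k)\<close>, hence has trace 0.\<close>

theorem div_lf: "euclidean_div (lf v) g = 0"
  unfolding euclidean_div_def
proof -
  obtain K where K: "flag K = {0}" using nilpotent by blast
  let ?T = "frechet_derivative (lf v) (at g)"
  have lin: "linear ?T"
    using lf_differentiable frechet_derivative_works has_derivative_linear by blast
  show "(\<Sum>b\<in>Basis. ?T b \<bullet> b) = 0"
  proof (rule trace_flag_nilpotent[OF lin flag_subspace flag_decreasing _ K])
    fix k z assume z: "z \<in> flag k"
    define w where "w = lf_inv g z"
    have zw: "z = lf w g" by (simp add: w_def lf_lf_inv)
    have "w - z \<in> flag k" unfolding w_def by (rule set_mp[OF flag_decreasing lf_inv_flag[OF z]])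
    from subspace_add[OF flag_subspace this z] have w: "w \<in> flag k" by (simp only: diff_add_cancel)
    \<comment> \<open>The bracket formula exchanges the two fields: instead of \<open>lf v\<close>
      the field \<open>lf w\<close> is differentiated, and it differs from the constant
      \<open>w\<close> only by values in \<open>flag (Suc k)\<close>.\<close>
    have "?T z = frechet_derivative (lf w) (at g) (lf v g) - lf (lie_bracket G v w) g"
      using lf_bracket[of w g v] zw by (simp add: algebra_simps)
    moreover have "frechet_derivative (lf w) (at g) (lf v g) \<in> flag (Suc k)"
      by (rule derivative_in_subspace[OF flag_subspace lf_differentiable lf_flag[OF w]])
    moreover have "lf (lie_bracket G v w) g \<in> flag (Suc k)"
    proof -
      have b: "lie_bracket G v w \<in> flag (Suc k)" by (rule bracket_flag[OF w])
      have "lf (lie_bracket G v w) g - lie_bracket G v w \<in> flag (Suc k)"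
        by (rule set_mp[OF flag_decreasing lf_flag[OF b]])
      from subspace_add[OF flag_subspace this b] show ?thesis by (simp only: diff_add_cancel)
    qed
    ultimately show "?T z \<in> flag (Suc k)" by (simp only: subspace_diff[OF flag_subspace])
  qed simp
qed

theorem integral_lf_zero:
  fixes f :: "'a \<Rightarrow> real"
  assumes f: "Ck_on 1 UNIV f" and K: "compact K" "\<And>x. x \<notin> K \<Longrightarrow> f x = 0"
  shows "(LINT x|lborel. frechet_derivative f (at x) (lf v x)) = 0"
proof -
  have "(LINT x|lborel. euclidean_div (\<lambda>x. f x *\<^sub>R lf v x) x) = 0"
    by (rule integral_euclidean_div_zero[OF _ K(1)]) (intro Ck_on_scaleR f lf_Ck open_UNIV, simp add: K(2))
  then show ?thesis
    using euclidean_div_scaleR[OF C1_on_differentiable[OF f] lf_differentiable] by (simp add: div_lf)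
qed

end

section \<open>Horizontal calculus\<close>

lemma frechet_derivative_diff:
  assumes "f differentiable (at x)" "g differentiable (at x)"
  shows "frechet_derivative (\<lambda>y. f y - g y) (at x) v = frechet_derivative f (at x) v - frechet_derivative g (at x) v"
  using frechet_derivative_eqI[OF has_derivative_diff[OF
      assms(1)[unfolded frechet_derivative_works] assms(2)[unfolded frechet_derivative_works]]] by simp

context carnot_group
begin

text \<open>\<open>X_deriv\<close> for an arbitrary element of the Lie algebra instead of a frame
  index; brackets of frame vectors need this generality.\<close>

definition XD :: "'a \<Rightarrow> ('a \<Rightarrow> real) \<Rightarrow> 'a \<Rightarrow> real" where
  "XD v f g = frechet_derivative f (at g) (lf v g)"

lemma X_deriv_XD: "X_deriv G i f = XD (frame G i) f"
  by (rule ext) (simp add: X_deriv_def XD_def)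

lemma XD_Ck:
  assumes "open U" "Ck_on (Suc k) U f"
  shows "Ck_on k U (XD v f)"
proof -
  have "Ck_on k U (\<lambda>g. \<Sum>b\<in>Basis. (lf v g \<bullet> b) *\<^sub>R frechet_derivative f (at g) b)"
    by (intro Ck_on_sum Ck_on_scaleR Ck_on_inner Ck_on_const Ck_on_derivative assms Ck_on_subset[OF lf_Ck]) simp
  moreover have "XD v f g = (\<Sum>b\<in>Basis. (lf v g \<bullet> b) *\<^sub>R frechet_derivative f (at g) b)" if "g \<in> U" for g
    unfolding XD_def
    by (rule linear_sum_Basis[OF has_derivative_linear[OF Ck_on_has_derivative[OF assms(2) that]]])
  ultimately show ?thesis by (subst Ck_on_cong[OF assms(1)]) auto
qed

lemma XD_cong: "open U \<Longrightarrow> x \<in> U \<Longrightarrow> (\<And>y. y \<in> U \<Longrightarrow> f y = g y) \<Longrightarrow> XD v f x = XD v g x"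
  unfolding XD_def using frechet_derivative_cong_open[of U x f g] by simp

lemma XD_zero_outside: "closed K \<Longrightarrow> (\<And>x. x \<notin> K \<Longrightarrow> f x = 0) \<Longrightarrow> x \<notin> K \<Longrightarrow> XD v f x = 0"
  unfolding XD_def by (rule frechet_derivative_zero_outside)

lemma XD_mult: "f differentiable (at x) \<Longrightarrow> g differentiable (at x) \<Longrightarrow>
    XD v (\<lambda>y. f y * g y) x = f x * XD v g x + XD v f x * g x"
  unfolding XD_def by (rule frechet_derivative_mult)

lemma XD_diff: "f differentiable (at x) \<Longrightarrow> g differentiable (at x) \<Longrightarrow>
    XD v (\<lambda>y. f y - g y) x = XD v f x - XD v g x"
  unfolding XD_def by (rule frechet_derivative_diff)

lemma XD_chain: "f differentiable (at x) \<Longrightarrow> (k has_real_derivative k') (at (f x)) \<Longrightarrow>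
    XD v (\<lambda>y. k (f y)) x = k' * XD v f x"
  unfolding XD_def by (rule frechet_derivative_chain_real(2))

lemma integral_XD_zero:
  assumes U: "open U" and f: "Ck_on 1 U f" and K: "compact K" "K \<subseteq> U" "\<And>x. x \<notin> K \<Longrightarrow> f x = 0"
  shows "(LINT x|lborel. XD v f x) = 0"
  unfolding XD_def
  by (rule integral_lf_zero[OF Ck_on_zero_extension[OF U f compact_imp_closed[OF K(1)] K(2,3)] K(1,3)])

lemma haar_scale: obtains c where "c > 0" "haar G = scale_measure (ennreal c) lebesgue"
  using haar by blast

lemma haar_integral_eq_0_iff:
  fixes f :: "'a \<Rightarrow> real"
  assumes "f \<in> borel_measurable borel"
  shows "(LINT g|haar G. f g) = 0 \<longleftrightarrow> (LINT g|lborel. f g) = 0"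
proof -
  obtain c where c: "c > 0" "haar G = scale_measure (ennreal c) lebesgue" by (rule haar_scale)
  have fm: "f \<in> borel_measurable lborel" using assms by simp
  have "(LINT g|haar G. f g) = (LINT g|lebesgue. c *\<^sub>R f g)"
    unfolding c(2) scale_measure_eq_density
    using measurable_completion[OF fm] c(1) by (intro integral_density) auto
  also have "\<dots> = c * (LINT g|lborel. f g)" by (simp add: integral_completion[OF fm])
  finally show ?thesis using c(1) by simp
qed

subsection \<open>The frame\<close>

lemma layer_subspace: "j \<in> {1..nsteps G} \<Longrightarrow> subspace (layer G j)"
  using stratified by (simp add: stratified_def)

lemma nsteps_pos: "1 \<le> nsteps G"
  using stratified by (simp add: stratified_def)

lemma layer1_subspace: "subspace (layer G 1)"
  by (rule layer_subspace) (use nsteps_pos in simp)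

abbreviation "I1 \<equiv> {1..hdim G}"

lemma inner0_add: "x \<in> layer G 1 \<Longrightarrow> y \<in> layer G 1 \<Longrightarrow> z \<in> layer G 1 \<Longrightarrow>
    inner0 G (x + y) z = inner0 G x z + inner0 G y z"
  and inner0_scale: "x \<in> layer G 1 \<Longrightarrow> z \<in> layer G 1 \<Longrightarrow> inner0 G (r *\<^sub>R x) z = r * inner0 G x z"
  and inner0_commute: "x \<in> layer G 1 \<Longrightarrow> z \<in> layer G 1 \<Longrightarrow> inner0 G x z = inner0 G z x"
  using inner0 unfolding inner_product_on_def by blast+

lemma inner0_sum_left:
  assumes "finite I" "\<And>i. i \<in> I \<Longrightarrow> e i \<in> layer G 1" "y \<in> layer G 1"
  shows "inner0 G (\<Sum>i\<in>I. a i *\<^sub>R e i) y = (\<Sum>i\<in>I. a i * inner0 G (e i) y)"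
  using assms
proof (induction I rule: finite_induct)
  case empty
  have "inner0 G (0 *\<^sub>R y) y = 0 * inner0 G y y"
    by (rule inner0_scale[OF empty(2) empty(2)])
  then show ?case by simp
next
  case (insert i I)
  have e: "a i *\<^sub>R e i \<in> layer G 1" "(\<Sum>i\<in>I. a i *\<^sub>R e i) \<in> layer G 1" "e i \<in> layer G 1"
    using insert layer1_subspace by (auto intro!: subspace_scale subspace_sum)
  have "inner0 G (a i *\<^sub>R e i + (\<Sum>i\<in>I. a i *\<^sub>R e i)) y = a i * inner0 G (e i) y + inner0 G (\<Sum>i\<in>I. a i *\<^sub>R e i) y"
    by (simp only: inner0_add[OF e(1,2) insert.prems(2)] inner0_scale[OF e(3) insert.prems(2)])
  then show ?case using insert by simp
qed

lemma frame_sum_in_layer: "(\<Sum>i\<in>I1. a i *\<^sub>R frame G i) \<in> layer G 1"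
  by (intro subspace_sum[OF layer1_subspace] subspace_scale[OF layer1_subspace] frame_layer)

lemma inner0_frame_sum:
  "inner0 G (\<Sum>i\<in>I1. a i *\<^sub>R frame G i) (\<Sum>i\<in>I1. b i *\<^sub>R frame G i) = (\<Sum>i\<in>I1. a i * b i)"
proof -
  have one: "inner0 G (frame G i) (\<Sum>j\<in>I1. b j *\<^sub>R frame G j) = b i" if i: "i \<in> I1" for i
  proof -
    have "inner0 G (frame G i) (\<Sum>j\<in>I1. b j *\<^sub>R frame G j) = inner0 G (\<Sum>j\<in>I1. b j *\<^sub>R frame G j) (frame G i)"
      by (rule inner0_commute[OF frame_layer[OF i] frame_sum_in_layer])
    also have "\<dots> = (\<Sum>j\<in>I1. b j * inner0 G (frame G j) (frame G i))"
      by (rule inner0_sum_left) (use frame_layer i in auto)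
    also have "\<dots> = (\<Sum>j\<in>I1. if j = i then b i else 0)"
      by (rule sum.cong) (use frame_orthonormal i in auto)
    also have "\<dots> = b i" using i by simp
    finally show ?thesis .
  qed
  have "inner0 G (\<Sum>i\<in>I1. a i *\<^sub>R frame G i) (\<Sum>i\<in>I1. b i *\<^sub>R frame G i) =
      (\<Sum>i\<in>I1. a i * inner0 G (frame G i) (\<Sum>j\<in>I1. b j *\<^sub>R frame G j))"
    by (rule inner0_sum_left) (use frame_layer frame_sum_in_layer in auto)
  then show ?thesis using one by simp
qed

lemma hinner_frame:
  "hinner G g (\<Sum>i\<in>I1. a i *\<^sub>R lf (frame G i) g) (\<Sum>i\<in>I1. b i *\<^sub>R lf (frame G i) g) = (\<Sum>i\<in>I1. a i * b i)"
proof -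
  have inj: "inj (\<lambda>z. lf z g)" by (rule injI) (metis lf_inv_lf)
  have "(\<Sum>i\<in>I1. a i *\<^sub>R lf (frame G i) g) = (\<lambda>z. lf z g) (\<Sum>i\<in>I1. a i *\<^sub>R frame G i)" for a
    by (simp add: linear_sum[OF lf_linear] linear_scale[OF lf_linear])
  then have "inv (\<lambda>z. lf z g) (\<Sum>i\<in>I1. a i *\<^sub>R lf (frame G i) g) = (\<Sum>i\<in>I1. a i *\<^sub>R frame G i)" for a
    by (simp only: inv_f_f[OF inj])
  then show ?thesis by (simp only: hinner_def inner0_frame_sum)
qed

definition sqgrad :: "('a \<Rightarrow> real) \<Rightarrow> 'a \<Rightarrow> real" where
  "sqgrad f g = (\<Sum>i\<in>I1. (XD (frame G i) f g)\<^sup>2)"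

lemma sqgrad_nonneg: "sqgrad f g \<ge> 0"
  by (simp add: sqgrad_def sum_nonneg)

lemma hgrad_XD: "hgrad G f g = (\<Sum>i\<in>I1. XD (frame G i) f g *\<^sub>R lf (frame G i) g)"
  by (simp add: hgrad_def X_deriv_XD)

lemma hinner_hgrad: "hinner G g (hgrad G f g) (hgrad G k g) = (\<Sum>i\<in>I1. XD (frame G i) f g * XD (frame G i) k g)"
  unfolding hgrad_XD by (rule hinner_frame)

lemma hnorm_hgrad: "hnorm G g (hgrad G f g) = sqrt (sqgrad f g)"
  by (simp add: hnorm_def hinner_hgrad sqgrad_def power2_eq_square)

lemma inf_laplace_eq: "inf_laplace G f g = 1 / 2 * (\<Sum>i\<in>I1. XD (frame G i) (sqgrad f) g * XD (frame G i) f g)"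
  by (simp add: inf_laplace_def hnorm_hgrad sqgrad_nonneg hinner_hgrad)

lemma hlaplace_eq: "hlaplace G f g = (\<Sum>i\<in>I1. XD (frame G i) (XD (frame G i) f) g)"
  by (simp add: hlaplace_def X_deriv_XD)

text \<open>Orthonormality for \<open>inner0\<close> makes the frame injective and independent, and
  its cardinality is the dimension of the layer.\<close>

lemma layer1_span: "layer G 1 \<subseteq> span (frame G ` I1)"
proof -
  have inj: "inj_on (frame G) I1"
  proof (rule inj_onI)
    fix i j assume ij: "i \<in> I1" "j \<in> I1" "frame G i = frame G j"
    have "inner0 G (frame G i) (frame G j) = 1" using ij frame_orthonormal[OF ij(2,2)] by simp
    then show "i = j" using frame_orthonormal[OF ij(1,2)] by (auto split: if_splits)
  qed
  have "independent (frame G ` I1)"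
  proof (subst dependent_finite, simp, safe)
    fix w i assume i: "i \<in> I1" "w (frame G i) \<noteq> 0" and z: "(\<Sum>v\<in>frame G ` I1. w v *\<^sub>R v) = 0"
    have z': "(\<Sum>j\<in>I1. w (frame G j) *\<^sub>R frame G j) = 0" using z unfolding sum.reindex[OF inj] by (simp only: o_def)
    have "(\<Sum>j\<in>I1. w (frame G j) * w (frame G j)) = inner0 G 0 0"
      using inner0_frame_sum[of "\<lambda>j. w (frame G j)" "\<lambda>j. w (frame G j)"] z' by simp
    also have "\<dots> = 0" using inner0_frame_sum[of "\<lambda>_. 0" "\<lambda>_. 0"] by simp
    finally have "\<forall>j\<in>I1. w (frame G j) * w (frame G j) = 0"
      by (subst (asm) sum_nonneg_eq_0_iff) auto
    then show False using i by simp
  qed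
  moreover have "frame G ` I1 \<subseteq> layer G 1" using frame_layer by auto
  moreover have "card (frame G ` I1) = dim (layer G 1)"
  proof -
    have "card (frame G ` I1) = hdim G" unfolding card_image[OF inj] by simp
    then show ?thesis by (simp only: hdim_def)
  qed
  ultimately show ?thesis using card_eq_dim[of "frame G ` I1" "layer G 1"] by blast
qed

subsection \<open>Dilations\<close>

text \<open>The projection onto the \<open>j\<close>-th layer along the others; uniqueness of the
  decomposition is what makes it linear.\<close>

definition comp :: "nat \<Rightarrow> 'a \<Rightarrow> 'a" where
  "comp j x = (THE c. (\<forall>j\<in>{1..nsteps G}. c j \<in> layer G j) \<and> (\<forall>j. j \<notin> {1..nsteps G} \<longrightarrow> c j = 0) \<and>
            x = (\<Sum>j=1..nsteps G. c j)) j"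

lemma comp_unique:
  assumes "\<And>j. j \<in> {1..nsteps G} \<Longrightarrow> c j \<in> layer G j" "x = (\<Sum>j=1..nsteps G. c j)" "j \<in> {1..nsteps G}"
  shows "comp j x = c j"
proof -
  let ?P = "\<lambda>c. (\<forall>j\<in>{1..nsteps G}. c j \<in> layer G j) \<and> (\<forall>j. j \<notin> {1..nsteps G} \<longrightarrow> c j = 0) \<and>
            x = (\<Sum>j=1..nsteps G. c j)"
  have "\<exists>!c. ?P c" using stratified by (simp add: stratified_def)
  moreover have "?P (\<lambda>j. if j \<in> {1..nsteps G} then c j else 0)" using assms by auto
  ultimately have "(THE c. ?P c) = (\<lambda>j. if j \<in> {1..nsteps G} then c j else 0)" by (rule the1_equality[where P = ?P])
  then show ?thesis using assms(3) by (simp add: comp_def)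
qed

lemma comp_in_layer: "j \<in> {1..nsteps G} \<Longrightarrow> comp j x \<in> layer G j"
  and comp_sum: "(\<Sum>j=1..nsteps G. comp j x) = x"
proof -
  let ?P = "\<lambda>c. (\<forall>j\<in>{1..nsteps G}. c j \<in> layer G j) \<and> (\<forall>j. j \<notin> {1..nsteps G} \<longrightarrow> c j = 0) \<and>
            x = (\<Sum>j=1..nsteps G. c j)"
  have "\<exists>!c. ?P c" using stratified by (simp add: stratified_def)
  then have P: "?P (THE c. ?P c)" by (rule theI')
  have c: "comp = (\<lambda>j x. (THE c. (\<forall>j\<in>{1..nsteps G}. c j \<in> layer G j) \<and> (\<forall>j. j \<notin> {1..nsteps G} \<longrightarrow> c j = 0) \<and>
            x = (\<Sum>j=1..nsteps G. c j)) j)" by (intro ext) (simp add: comp_def)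
  show "j \<in> {1..nsteps G} \<Longrightarrow> comp j x \<in> layer G j" using P unfolding c by blast
  show "(\<Sum>j=1..nsteps G. comp j x) = x" using P unfolding c by (elim conjE) (erule sym)
qed

lemmas comp_sum_Suc = comp_sum[unfolded One_nat_def]

lemma comp_linear:
  assumes "j \<in> {1..nsteps G}"
  shows "linear (comp j)"
proof (rule linearI)
  fix x y r
  show "comp j (x + y) = comp j x + comp j y"
    by (rule comp_unique[OF _ _ assms])
      (auto simp: sum.distrib comp_sum_Suc intro!: subspace_add[OF layer_subspace] comp_in_layer)
  show "comp j (r *\<^sub>R x) = r *\<^sub>R comp j x"
    by (rule comp_unique[OF _ _ assms])
      (auto simp: comp_sum_Suc scaleR_sum_right[symmetric] intro!: subspace_scale[OF layer_subspace] comp_in_layer)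
qed

lemma comp_layer:
  assumes "i \<in> {1..nsteps G}" "x \<in> layer G i" "j \<in> {1..nsteps G}"
  shows "comp j x = (if j = i then x else 0)"
  by (rule comp_unique[OF _ _ assms(3)])
    (use assms(1,2) subspace_0[OF layer_subspace] in auto)

lemma dilation_eq: "dilation G r x = (\<Sum>j=1..nsteps G. r ^ j *\<^sub>R comp j x)"
proof -
  let ?D = "\<lambda>x. \<Sum>j=1..nsteps G. r ^ j *\<^sub>R comp j x"
  let ?P = "\<lambda>f. linear f \<and> (\<forall>j\<in>{1..nsteps G}. \<forall>x\<in>layer G j. f x = r ^ j *\<^sub>R x)"
  have "linear ?D"
    by (intro linear_compose_sum ballI linear_compose_scale_right comp_linear) auto
  moreover have "?D x = r ^ i *\<^sub>R x" if "i \<in> {1..nsteps G}" "x \<in> layer G i" for i x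
  proof -
    have "?D x = (\<Sum>j=1..nsteps G. if j = i then r ^ i *\<^sub>R x else 0)"
      by (rule sum.cong) (use comp_layer[OF that] in auto)
    then show ?thesis using that(1) by simp
  qed
  ultimately have PD: "?P ?D" by blast
  have "f = ?D" if "?P f" for f
  proof
    fix x
    have "f x = f (\<Sum>j=1..nsteps G. comp j x)" by (simp add: comp_sum_Suc)
    also have "\<dots> = (\<Sum>j=1..nsteps G. f (comp j x))" using that by (simp add: linear_sum)
    also have "\<dots> = ?D x" by (rule sum.cong) (use that comp_in_layer in auto)
    finally show "f x = ?D x" .
  qed
  then have "dilation G r = ?D" unfolding dilation_def using PD by (intro the_equality) blast+
  then show ?thesis by simp
qed

lemma continuous_on_dilation: "continuous_on UNIV (\<lambda>(r, x). dilation G r x)"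
proof -
  have "continuous_on UNIV (\<lambda>z. comp j (snd z))" if "j \<in> {1..nsteps G}" for j
  proof -
    have "bounded_linear (comp j)" using comp_linear[OF that] linear_conv_bounded_linear by blast
    then show ?thesis by (rule bounded_linear.continuous_on) (intro continuous_intros)
  qed
  then show ?thesis
    unfolding dilation_eq split_beta by (intro continuous_intros) auto
qed

lemma dilation_dilation: "dilation G r (dilation G s x) = dilation G (r * s) x"
proof -
  have "comp j (dilation G s x) = s ^ j *\<^sub>R comp j x" if "j \<in> {1..nsteps G}" for j
    by (rule comp_unique[OF _ _ that])
      (auto simp: dilation_eq intro!: subspace_scale[OF layer_subspace] comp_in_layer)
  then show ?thesis by (simp add: dilation_eq[of r] dilation_eq[of "r * s"] power_mult_distrib)
qed

lemma dilation_1: "dilation G 1 x = x" and dilation_0_left: "dilation G 0 x = 0"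
  and dilation_0_right: "dilation G r 0 = 0"
  by (auto simp: dilation_eq comp_sum_Suc linear_0[OF comp_linear] power_0_left intro!: sum.neutral)

lemma dilation_nz:
  assumes "r > 0" "x \<noteq> 0"
  shows "dilation G r x \<noteq> 0"
proof
  assume "dilation G r x = 0"
  then have "dilation G (inverse r * r) x = 0"
    by (simp only: dilation_dilation[symmetric] dilation_0_right)
  then show False using assms by (simp add: dilation_1)
qed

lemma dilation_has_vector_derivative:
  "((\<lambda>r. dilation G r x) has_vector_derivative (\<Sum>j=1..nsteps G. real j *\<^sub>R comp j x)) (at 1)"
proof -
  have "((\<lambda>r. \<Sum>j=1..nsteps G. r ^ j *\<^sub>R comp j x) has_vector_derivative
      (\<Sum>j=1..nsteps G. 1 ^ j *\<^sub>R 0 + (real j * 1 ^ (j - Suc 0)) *\<^sub>R comp j x)) (at 1)"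
    by (intro has_vector_derivative_sum has_vector_derivative_scaleR DERIV_pow has_vector_derivative_const)
  then show ?thesis by (simp add: dilation_eq)
qed

text \<open>The norm of the dilated vector depends continuously on the parameter, is 0 at parameter
  0 and at least 1 for some larger one, so the intermediate value theorem gives the value 1.\<close>

lemma dilation_reaches_sphere:
  assumes "x \<noteq> 0"
  obtains r y where "r > 0" "norm y = 1" "x = dilation G r y"
proof -
  let ?f = "\<lambda>s. norm (dilation G s x)"
  have c: "continuous_on UNIV (\<lambda>s. dilation G s x)"
    using continuous_on_compose2[OF continuous_on_dilation, of UNIV "\<lambda>s. (s, x)"]
    by (simp add: continuous_on_Pair)
  have "\<exists>s>0. ?f s \<ge> 1"
  proof -
    have "\<exists>j\<in>{1..nsteps G}. comp j x \<noteq> 0" 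
    proof (rule ccontr)
      assume "\<not> ?thesis"
      then have "(\<Sum>j=1..nsteps G. comp j x) = 0" by (intro sum.neutral) blast
      then show False using assms by (simp only: comp_sum)
    qed
    then obtain i where i: "i \<in> {1..nsteps G}" "comp i x \<noteq> 0" by blast
    have "bounded_linear (comp i)" using comp_linear[OF i(1)] linear_conv_bounded_linear by blast
    then obtain B where B: "B > 0" "\<And>y. norm (comp i y) \<le> norm y * B" using bounded_linear.pos_bounded by blast
    \<comment> \<open>With this choice the component in layer \<open>i\<close> has norm at least
      \<open>B\<close>, which by the operator bound forces the whole vector to have norm at least
      1.\<close>
    define s where "s = max 1 (B / norm (comp i x))"
    have s: "s \<ge> 1" by (simp add: s_def)
    have "comp i (dilation G s x) = s ^ i *\<^sub>R comp i x"
      by (rule comp_unique[OF _ _ i(1)])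
        (auto simp: dilation_eq intro!: subspace_scale[OF layer_subspace] comp_in_layer)
    then have "s ^ i * norm (comp i x) \<le> ?f s * B" using B(2)[of "dilation G s x"] s by simp
    moreover have "s * norm (comp i x) \<le> s ^ i * norm (comp i x)"
      using s i self_le_power[of s i] by (intro mult_right_mono) auto
    moreover have "B \<le> s * norm (comp i x)"
      using i(2) by (simp add: s_def max_def field_simps)
    ultimately have "B \<le> ?f s * B" by linarith
    then show ?thesis using B(1) s by (intro exI[of _ s]) auto
  qed
  then obtain s where s: "s > 0" "?f s \<ge> 1" by blast
  have "\<exists>t\<ge>0. t \<le> s \<and> ?f t = 1"
    by (rule IVT') (use s in \<open>auto simp: dilation_0_left intro!: continuous_on_norm continuous_on_subset[OF c]\<close>)
  then obtain t where t: "t \<ge> 0" "?f t = 1" by blast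
  have "t \<noteq> 0" using t dilation_0_left by auto
  then have t0: "t > 0" using t by simp
  show ?thesis
  proof (rule that[of "inverse t" "dilation G t x"])
    show "x = dilation G (inverse t) (dilation G t x)"
      using t0 by (simp add: dilation_dilation dilation_1)
  qed (use t t0 in auto)
qed

end

section \<open>Folland's quasi-norm\<close>

locale folland = carnot_group G for G :: "'a::euclidean_space carnot" +
  fixes u :: "'a \<Rightarrow> real"
  assumes hom_dim_gt_2: "hom_dim G > 2" and folland_u: "folland_solution G u"
begin

abbreviation "qN \<equiv> folland_norm G u"
abbreviation "U0 \<equiv> - {0 :: 'a}"
abbreviation "rQ \<equiv> real (hom_dim G)"
abbreviation "hN \<equiv> sqgrad qN"

lemma U0_open: "open U0"
  by auto

lemma rQ_gt: "rQ > 2"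
  using hom_dim_gt_2 by simp

lemma u_pos: "x \<noteq> 0 \<Longrightarrow> u x > 0" and u_Ck: "Ck_on k U0 u"
  and u_dilation: "r > 0 \<Longrightarrow> x \<noteq> 0 \<Longrightarrow> u (dilation G r x) = r powr (2 - rQ) * u x"
  and u_dirac: "test_function UNIV \<phi> \<Longrightarrow> - (LINT g|haar G. u g * hlaplace G \<phi> g) = \<phi> 0"
  using folland_u by (auto simp: folland_solution_def smooth_on_def)

lemma qN_eq: "x \<noteq> 0 \<Longrightarrow> qN x = u x powr (1 / (2 - rQ))"
  by (simp add: folland_norm_def)

lemma qN_pos: "x \<noteq> 0 \<Longrightarrow> qN x > 0"
  using u_pos[of x] by (simp add: qN_eq)

lemma qN_Ck: "Ck_on k U0 qN"
proof -
  have "Ck_on k U0 (\<lambda>x. u x powr (1 / (2 - rQ)))"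
    by (rule Ck_on_powr[OF U0_open u_Ck]) (use u_pos in auto)
  then show ?thesis by (subst Ck_on_cong[OF U0_open]) (auto simp: qN_eq)
qed

lemma u_eq: "x \<noteq> 0 \<Longrightarrow> u x = qN x powr (2 - rQ)"
  using u_pos[of x] rQ_gt by (simp add: qN_eq powr_powr)

lemma qN_dilation:
  assumes "r > 0" "x \<noteq> 0"
  shows "qN (dilation G r x) = r * qN x"
proof -
  have "qN (dilation G r x) = (r powr (2 - rQ) * u x) powr (1 / (2 - rQ))"
    using qN_eq[OF dilation_nz[OF assms]] u_dilation[OF assms] by simp
  also have "\<dots> = r * qN x"
    using assms u_pos[of x] rQ_gt by (simp add: powr_mult powr_powr qN_eq)
  finally show ?thesis .
qed

text \<open>On the Euclidean unit sphere \<open>qN\<close> has a positive minimum and a maximum. By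
  homogeneity the dilation parameter of a point of the annulus lies in a compact interval of
  positive numbers, so the annulus is a relatively closed part of a compact set that avoids the
  pole.\<close>

lemma compact_annulus:
  assumes "0 < a"
  shows "compact {x. x \<noteq> 0 \<and> a \<le> qN x \<and> qN x \<le> b}"
proof -
  have c: "continuous_on U0 qN" using Ck_on_continuous_on[OF qN_Ck] .
  have cs: "continuous_on (sphere 0 1) qN" by (rule continuous_on_subset[OF c]) auto
  have ne: "sphere (0::'a) 1 \<noteq> {}" by simp
  obtain y1 where y1: "norm y1 = 1" "\<And>y. norm y = 1 \<Longrightarrow> qN y1 \<le> qN y"
    using continuous_attains_inf[OF compact_sphere ne cs] by auto
  obtain y2 where y2: "norm y2 = 1" "\<And>y. norm y = 1 \<Longrightarrow> qN y \<le> qN y2"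
    using continuous_attains_sup[OF compact_sphere ne cs] by auto
  have m: "qN y1 > 0" "qN y2 > 0" using y1 y2 by (auto intro!: qN_pos)
  define K where "K = (\<lambda>(r, x). dilation G r x) ` ({a / qN y2..b / qN y1} \<times> sphere 0 1)"
  have K: "compact K"
    unfolding K_def
    by (intro compact_continuous_image compact_Times continuous_on_subset[OF continuous_on_dilation]) auto
  have K0: "K \<subseteq> U0"
  proof
    fix z assume "z \<in> K"
    then obtain r y where ry: "z = dilation G r y" "a / qN y2 \<le> r" "norm y = 1" by (auto simp: K_def)
    have "r > 0" using ry(2) assms m(2) by (meson divide_pos_pos less_le_trans)
    moreover have "y \<noteq> 0" using ry(3) by auto
    ultimately show "z \<in> U0" using dilation_nz ry(1) by auto
  qed
  have sub: "x \<in> K" if x: "x \<noteq> 0" "a \<le> qN x" "qN x \<le> b" for x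
  proof -
    obtain r y where ry: "r > 0" "norm y = 1" "x = dilation G r y" by (rule dilation_reaches_sphere[OF x(1)])
    have "y \<noteq> 0" using ry(2) by auto
    then have N: "qN x = r * qN y" using qN_dilation ry by simp
    have "r * qN y1 \<le> qN x" "qN x \<le> r * qN y2"
      using y1(2)[OF ry(2)] y2(2)[OF ry(2)] ry(1) by (auto simp: N intro!: mult_left_mono)
    then have "r \<in> {a / qN y2..b / qN y1}"
      using x m by (auto simp: divide_le_eq le_divide_eq intro: order_trans)
    then show ?thesis using ry unfolding K_def by (intro image_eqI[of _ _ "(r, y)"]) auto
  qed
  have "closed (K \<inter> qN -` {a..b})"
    by (rule continuous_closed_preimage[OF continuous_on_subset[OF c K0] compact_imp_closed[OF K]]) simp
  then have "compact (K \<inter> (K \<inter> qN -` {a..b}))" by (rule compact_Int_closed[OF K])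
  moreover have "K \<inter> (K \<inter> qN -` {a..b}) = {x. x \<noteq> 0 \<and> a \<le> qN x \<and> qN x \<le> b}"
    using sub K0 by auto
  ultimately show ?thesis by simp
qed

subsection \<open>Harmonicity\<close>

lemma test_function_Ck: "test_function V \<phi> \<Longrightarrow> Ck_on k UNIV \<phi>"
  by (simp add: test_function_def smooth_on_def)

lemma XD1_Ck: "Ck_on k U0 (XD v qN)"
  and XDu_Ck: "Ck_on k U0 (XD v u)" and XD2u_Ck: "Ck_on k U0 (XD v (XD w u))"
  using qN_Ck u_Ck by (auto intro!: XD_Ck U0_open simp del: Ck_on.simps)

lemma hN_Ck: "Ck_on k U0 hN"
  unfolding sqgrad_def[abs_def] by (intro Ck_on_sum Ck_on_power XD1_Ck U0_open)

lemma hlaplace_u_Ck: "Ck_on k U0 (hlaplace G u)"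
  unfolding hlaplace_eq[abs_def] by (intro Ck_on_sum XD2u_Ck U0_open)

text \<open>Green's second identity, one frame field at a time:
  \<open>\<phi> X X u - u X X \<phi>\<close> is the \<open>X\<close>-derivative of
  \<open>\<phi> X u - u X \<phi>\<close>, and such derivatives integrate to 0 because left-invariant
  fields are divergence free.\<close>

lemma integral_hlaplace_u_test:
  assumes \<phi>: "Ck_on 3 UNIV \<phi>" "compact K" "K \<subseteq> U0" "\<And>x. x \<notin> K \<Longrightarrow> \<phi> x = 0"
    and z: "(LINT g|lborel. u g * hlaplace G \<phi> g) = 0"
  shows "(LINT x|lborel. \<phi> x * hlaplace G u x) = 0"
proof -
  have cl: "closed K" using \<phi>(2) by (rule compact_imp_closed)
  have X\<phi>0: "XD v \<phi> x = 0" if "x \<notin> K" for v x by (rule XD_zero_outside[OF cl \<phi>(4) that])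
  have XX\<phi>0: "XD w (XD v \<phi>) x = 0" if "x \<notin> K" for v w x by (rule XD_zero_outside[OF cl X\<phi>0 that])
  have \<phi>C: "Ck_on 3 U0 \<phi>" by (rule Ck_on_subset[OF \<phi>(1)]) simp
  have \<phi>1: "Ck_on 1 U0 \<phi>" by (rule Ck_on_mono[OF \<phi>C]) simp
  have X\<phi>C: "Ck_on 2 U0 (XD v \<phi>)" for v
    by (rule XD_Ck[OF U0_open]) (use \<phi>C in \<open>simp add: numeral_3_eq_3 numeral_2_eq_2 del: Ck_on.simps\<close>)
  have X\<phi>1: "Ck_on 1 U0 (XD v \<phi>)" for v by (rule Ck_on_mono[OF X\<phi>C]) simp
  have XX\<phi>C: "Ck_on 1 U0 (XD w (XD v \<phi>))" for v w
    by (rule XD_Ck[OF U0_open]) (use X\<phi>C[of v] in \<open>simp add: numeral_2_eq_2 del: Ck_on.simps\<close>)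
  have int: "integrable lborel f" if "Ck_on 1 U0 f" "\<And>x. x \<notin> K \<Longrightarrow> f x = 0" for f :: "'a \<Rightarrow> real"
    by (rule integrable_continuous_compact_support[OF Ck_on_continuous_on[OF
          Ck_on_zero_extension[OF U0_open that(1) cl \<phi>(3) that(2)]] \<phi>(2) that(2)])
  let ?e = "frame G"
  have one: "(LINT x|lborel. \<phi> x * XD v (XD v u) x - u x * XD v (XD v \<phi>) x) = 0" for v
  proof -
    let ?F = "\<lambda>x. \<phi> x * XD v u x - u x * XD v \<phi> x"
    have "Ck_on 1 U0 ?F" by (intro Ck_on_diff Ck_on_mult \<phi>1 XDu_Ck u_Ck X\<phi>1 U0_open)
    then have "(LINT x|lborel. XD v ?F x) = 0"
      by (rule integral_XD_zero[OF U0_open _ \<phi>(2,3)]) (simp add: \<phi>(4) X\<phi>0)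
    moreover have "XD v ?F x = \<phi> x * XD v (XD v u) x - u x * XD v (XD v \<phi>) x" for x
    proof (cases "x \<in> K")
      case True
      then have x: "x \<in> U0" using \<phi>(3) by auto
      have d: "\<phi> differentiable (at x)" "u differentiable (at x)" "XD v u differentiable (at x)" "XD v \<phi> differentiable (at x)"
        using C1_on_differentiable[OF \<phi>1 x] C1_on_differentiable[OF u_Ck x] C1_on_differentiable[OF XDu_Ck x]
          C1_on_differentiable[OF X\<phi>1 x] by auto
      show ?thesis
        using XD_diff[of "\<lambda>x. \<phi> x * XD v u x" x "\<lambda>x. u x * XD v \<phi> x" v] d
        by (simp add: XD_mult differentiable_mult)
    next
      case False
      have "XD v ?F x = 0" by (rule XD_zero_outside[OF cl _ False]) (simp add: \<phi>(4) X\<phi>0)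
      then show ?thesis using False by (simp add: \<phi>(4) XX\<phi>0)
    qed
    ultimately show ?thesis by simp
  qed
  have i1: "integrable lborel (\<lambda>x. \<phi> x * XD v (XD v u) x)" for v
    by (rule int) (auto intro!: Ck_on_mult \<phi>1 XD2u_Ck simp: \<phi>(4) simp del: Ck_on.simps One_nat_def)
  have i2: "integrable lborel (\<lambda>x. u x * XD v (XD v \<phi>) x)" for v
    by (rule int) (auto intro!: Ck_on_mult u_Ck XX\<phi>C simp: XX\<phi>0 simp del: Ck_on.simps One_nat_def)
  have "(LINT x|lborel. \<phi> x * hlaplace G u x) = (\<Sum>i\<in>I1. LINT x|lborel. \<phi> x * XD (?e i) (XD (?e i) u) x)"
    by (simp add: hlaplace_eq sum_distrib_left i1)
  also have "\<dots> = (\<Sum>i\<in>I1. LINT x|lborel. u x * XD (?e i) (XD (?e i) \<phi>) x)"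
    using one i1 i2 by (intro sum.cong) auto
  also have "\<dots> = (LINT x|lborel. u x * hlaplace G \<phi> x)"
    by (simp add: hlaplace_eq sum_distrib_left i2)
  finally show ?thesis using z by simp
qed

text \<open>The distributional equation becomes pointwise by testing with a bump near
  \<open>x0\<close>. Its support avoids the pole, so the Dirac mass returns 0; if the sub-Laplacian
  of \<open>u\<close> were nonzero at \<open>x0\<close>, it would keep its sign on a small ball and
  the integral could not vanish.\<close>

lemma hlaplace_u:
  assumes x0: "x0 \<noteq> 0"
  shows "hlaplace G u x0 = 0"
proof (rule ccontr)
  assume ne: "hlaplace G u x0 \<noteq> 0"
  define s where "s = sgn (hlaplace G u x0)"
  have c: "continuous_on U0 (\<lambda>x. s * hlaplace G u x)"
    by (intro continuous_intros Ck_on_continuous_on[OF hlaplace_u_Ck])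
  have "open (U0 \<inter> (\<lambda>x. s * hlaplace G u x) -` {0<..})"
    by (rule continuous_open_preimage[OF c U0_open]) simp
  moreover have "x0 \<in> U0 \<inter> (\<lambda>x. s * hlaplace G u x) -` {0<..}"
    using ne x0 by (simp add: s_def sgn_if)
  ultimately obtain r where r: "r > 0" "cball x0 r \<subseteq> U0 \<inter> (\<lambda>x. s * hlaplace G u x) -` {0<..}"
    unfolding open_contains_cball by blast
  let ?\<phi> = "bump x0 r"
  have \<phi>0: "?\<phi> x = 0" if "x \<notin> cball x0 r" for x using bump_zero[OF r(1), of x0 x] that by simp
  have cl: "closure {x. ?\<phi> x \<noteq> 0} \<subseteq> cball x0 r" by (rule closure_minimal) (use \<phi>0 in blast, simp)
  have tf: "test_function UNIV ?\<phi>"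
    unfolding test_function_def smooth_on_def
    using Ck_on_bump cl compact_closure bounded_subset[OF bounded_cball order_trans[OF closure_subset cl]] by auto
  have sub: "cball x0 r \<subseteq> U0" using r(2) by auto
  have z0: "?\<phi> 0 = 0" using sub by (intro \<phi>0) auto
  have \<phi>C: "Ck_on k UNIV ?\<phi>" for k by (rule Ck_on_bump)
  have XX0: "XD v (XD v ?\<phi>) x = 0" if "x \<notin> cball x0 r" for v x
    by (rule XD_zero_outside[OF closed_cball XD_zero_outside[OF closed_cball \<phi>0] that])
  have "Ck_on 0 U0 (\<lambda>g. u g * hlaplace G ?\<phi> g)"
    unfolding hlaplace_eq
    by (intro Ck_on_mult Ck_on_sum u_Ck U0_open XD_Ck Ck_on_subset[OF \<phi>C]) auto
  then have "Ck_on 0 UNIV (\<lambda>g. u g * hlaplace G ?\<phi> g)"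
    by (rule Ck_on_zero_extension[OF U0_open _ closed_cball sub]) (simp add: hlaplace_eq XX0)
  then have m: "(\<lambda>g. u g * hlaplace G ?\<phi> g) \<in> borel_measurable borel"
    by (intro borel_measurable_continuous_onI) simp
  have "(LINT g|haar G. u g * hlaplace G ?\<phi> g) = 0" using u_dirac[OF tf] z0 by simp
  then have "(LINT g|lborel. u g * hlaplace G ?\<phi> g) = 0" using haar_integral_eq_0_iff[OF m] by simp
  from integral_hlaplace_u_test[OF \<phi>C compact_cball sub \<phi>0 this]
  have int0: "(LINT x|lborel. ?\<phi> x * hlaplace G u x) = 0" .
  have C0: "Ck_on 0 UNIV (\<lambda>x. ?\<phi> x * hlaplace G u x)"
    by (rule Ck_on_zero_extension[OF U0_open _ closed_cball sub])
      (auto intro!: Ck_on_mult Ck_on_subset[OF \<phi>C] hlaplace_u_Ck simp: \<phi>0 simp del: Ck_on.simps)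
  have i: "integrable lborel (\<lambda>x. s * (?\<phi> x * hlaplace G u x))"
    by (intro integrable_mult_right integrable_continuous_compact_support[OF Ck_on_continuous_on[OF C0] compact_cball[of x0 r]])
      (simp add: \<phi>0)
  have nn: "0 \<le> s * (?\<phi> x * hlaplace G u x)" for x
  proof (cases "x \<in> cball x0 r")
    case True
    then have "s * hlaplace G u x > 0" using r(2) by auto
    then have "?\<phi> x * (s * hlaplace G u x) \<ge> 0" using bump_nonneg[of x0 r x] by simp
    then show ?thesis by (simp add: mult_ac)
  qed (simp add: \<phi>0)
  have "(LINT x|lborel. s * (?\<phi> x * hlaplace G u x)) = 0" using int0 by simp
  then have "AE x in lborel. s * (?\<phi> x * hlaplace G u x) = 0"
    using integral_nonneg_eq_0_iff_AE[OF i] nn by simp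
  then have "AE x in lborel. x \<notin> ball x0 r"
  proof eventually_elim
    fix x assume *: "s * (?\<phi> x * hlaplace G u x) = 0"
    show "x \<notin> ball x0 r"
    proof
      assume x: "x \<in> ball x0 r"
      then have "?\<phi> x > 0" by (subst bump_pos_iff[OF r(1)]) simp
      moreover have "s * hlaplace G u x > 0" using x r(2) by (auto simp: subset_iff)
      ultimately have "?\<phi> x * (s * hlaplace G u x) > 0" by simp
      moreover have "?\<phi> x * (s * hlaplace G u x) = s * (?\<phi> x * hlaplace G u x)" by (simp only: mult.left_commute)
      ultimately show False using * by linarith
    qed
  qed
  then have "ball x0 r \<in> null_sets lborel" by (subst (asm) AE_iff_null_sets[symmetric]) auto
  then have "negligible (ball x0 r)" by (simp add: negligible_iff_null_sets null_sets_completionI)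
  then show False using open_not_negligible[of "ball x0 r"] r(1) by auto
qed

lemma XD_powr_qN:
  assumes "x \<noteq> 0"
  shows "XD v (\<lambda>y. qN y powr a) x = a * qN x powr (a - 1) * XD v qN x"
proof -
  have "qN differentiable (at x)" using C1_on_differentiable[OF qN_Ck] assms by auto
  moreover have "((\<lambda>t. t powr a) has_real_derivative a * qN x powr (a - 1)) (at (qN x))"
    using qN_pos[OF assms] by (rule has_real_derivative_powr)
  ultimately show ?thesis by (rule XD_chain)
qed

text \<open>Harmonicity of \<open>u = qN powr (2 - Q)\<close>, expanded by the chain rule. The
  common factor \<open>(2 - Q) qN powr (- Q)\<close> is nonzero since \<open>Q > 2\<close>.\<close>

lemma hlaplace_qN:
  assumes x: "x \<noteq> 0"
  shows "hlaplace G qN x = (rQ - 1) * hN x / qN x"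
proof -
  have xU: "x \<in> U0" using x by simp
  have Xu: "XD v u y = (2 - rQ) * (qN y powr (1 - rQ) * XD v qN y)" if "y \<in> U0" for v y
  proof -
    have "XD v u y = XD v (\<lambda>y. qN y powr (2 - rQ)) y"
      by (rule XD_cong[OF U0_open that]) (simp add: u_eq)
    then show ?thesis using that by (simp add: XD_powr_qN)
  qed
  have XXu: "XD v (XD v u) x = (2 - rQ) * qN x powr (- rQ) * (qN x * XD v (XD v qN) x - (rQ - 1) * (XD v qN x)\<^sup>2)" for v
  proof -
    have d: "(\<lambda>y. qN y powr (1 - rQ)) differentiable (at x)" "XD v qN differentiable (at x)"
      using C1_on_differentiable[OF Ck_on_powr[OF U0_open qN_Ck] xU] qN_pos C1_on_differentiable[OF XD1_Ck xU] by auto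
    have "XD v (XD v u) x = XD v (\<lambda>y. (2 - rQ) * (qN y powr (1 - rQ) * XD v qN y)) x"
      by (rule XD_cong[OF U0_open xU Xu])
    also have "\<dots> = (2 - rQ) * XD v (\<lambda>y. qN y powr (1 - rQ) * XD v qN y) x"
      by (rule XD_chain) (use d in \<open>auto intro!: differentiable_mult derivative_eq_intros\<close>)
    also have "XD v (\<lambda>y. qN y powr (1 - rQ) * XD v qN y) x =
        qN x powr (1 - rQ) * XD v (XD v qN) x + ((1 - rQ) * qN x powr (- rQ) * XD v qN x) * XD v qN x"
      using XD_mult[OF d, of v] XD_powr_qN[OF x, of v "1 - rQ"] by simp
    also have "qN x powr (1 - rQ) = qN x * qN x powr (- rQ)"
      using qN_pos[OF x] by (simp add: powr_diff powr_minus divide_inverse)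
    finally show ?thesis by (simp add: algebra_simps power2_eq_square)
  qed
  have "0 = (\<Sum>i\<in>I1. (2 - rQ) * qN x powr (- rQ) * (qN x * XD (frame G i) (XD (frame G i) qN) x - (rQ - 1) * (XD (frame G i) qN x)\<^sup>2))"
    using hlaplace_u[OF x] by (simp add: hlaplace_eq XXu)
  also have "\<dots> = (2 - rQ) * qN x powr (- rQ) * (qN x * hlaplace G qN x - (rQ - 1) * hN x)"
    unfolding hlaplace_eq sqgrad_def by (simp only: sum_distrib_left[symmetric] sum_subtractf)
  finally have "(2 - rQ) * qN x powr (- rQ) * (qN x * hlaplace G qN x - (rQ - 1) * hN x) = 0" by simp
  then have "qN x * hlaplace G qN x = (rQ - 1) * hN x" using rQ_gt qN_pos[OF x] by simp
  then show ?thesis using qN_pos[OF x] by (simp add: field_simps)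
qed

subsection \<open>The characteristic set\<close>

text \<open>Euler's identity for a function of homogeneous degree 1; the direction is the generator
  of the dilations at \<open>x\<close>.\<close>

lemma derivative_qN_nz:
  assumes "x \<noteq> 0"
  shows "frechet_derivative qN (at x) (\<Sum>j=1..nsteps G. real j *\<^sub>R comp j x) = qN x"
proof -
  let ?w = "\<Sum>j=1..nsteps G. real j *\<^sub>R comp j x"
  have N: "(qN has_derivative frechet_derivative qN (at x)) (at x)"
    using C1_on_has_derivative[OF qN_Ck] assms by auto
  have "((\<lambda>r. qN (dilation G r x)) has_derivative (\<lambda>r. frechet_derivative qN (at x) (r *\<^sub>R ?w))) (at 1)"
    using has_derivative_compose[OF dilation_has_vector_derivative[unfolded has_vector_derivative_def], of qN "frechet_derivative qN (at x)"] N
    by (simp add: dilation_1)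
  moreover have "((\<lambda>r. qN (dilation G r x)) has_derivative (\<lambda>r. r * qN x)) (at 1)"
  proof (rule has_derivative_transform_within_open[of "\<lambda>r. r * qN x" _ _ _ "{0<..}"])
    show "((\<lambda>r. r * qN x) has_derivative (\<lambda>r. r * qN x)) (at 1)" by (auto intro!: derivative_eq_intros)
  qed (auto simp: qN_dilation assms)
  ultimately have "(\<lambda>r. frechet_derivative qN (at x) (r *\<^sub>R ?w)) = (\<lambda>r. r * qN x)" by (rule has_derivative_unique)
  from fun_cong[OF this, of 1] show ?thesis by simp
qed

definition char_set :: "'a set" where
  "char_set = {x. x \<noteq> 0 \<and> hN x = 0}"

lemma hN_zero_iff: "hN x = 0 \<longleftrightarrow> (\<forall>i\<in>I1. XD (frame G i) qN x = 0)"
  unfolding sqgrad_def by (simp add: sum_nonneg_eq_0_iff)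

text \<open>The directions annihilating \<open>qN\<close> almost everywhere on the characteristic set form a Lie algebra
  containing the first layer, hence all of \<open>'a\<close>; but \<open>qN\<close> grows along dilations.\<close>

definition flat_dirs :: "'a set" where
  "flat_dirs = {v. negligible {x \<in> char_set. XD v qN x \<noteq> 0}}"

lemma flat_dirs_subspace: "subspace flat_dirs"
proof (rule subspaceI)
  have lin: "XD (v + w) qN x = XD v qN x + XD w qN x" "XD (r *\<^sub>R v) qN x = r * XD v qN x" if "x \<noteq> 0" for v w r x
  proof -
    have l: "linear (frechet_derivative qN (at x))"
      using has_derivative_linear[OF C1_on_has_derivative[OF qN_Ck]] that by auto
    show "XD (v + w) qN x = XD v qN x + XD w qN x" "XD (r *\<^sub>R v) qN x = r * XD v qN x"
      by (simp_all add: XD_def linear_add[OF lf_linear] linear_scale[OF lf_linear] linear_add[OF l] linear_scale[OF l])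
  qed
  have "{x \<in> char_set. XD 0 qN x \<noteq> 0} = {}"
    using lin(2)[of _ 0 0] by (auto simp: char_set_def)
  then show "0 \<in> flat_dirs" unfolding flat_dirs_def mem_Collect_eq by (simp only: negligible_empty)
  fix v w r assume v: "v \<in> flat_dirs"
  have "{x \<in> char_set. XD (r *\<^sub>R v) qN x \<noteq> 0} \<subseteq> {x \<in> char_set. XD v qN x \<noteq> 0}"
    using lin(2) by (auto simp: char_set_def)
  then show "r *\<^sub>R v \<in> flat_dirs"
    using negligible_subset[OF v[unfolded flat_dirs_def mem_Collect_eq]]
    unfolding flat_dirs_def mem_Collect_eq by blast
  assume w: "w \<in> flat_dirs"
  have "{x \<in> char_set. XD (v + w) qN x \<noteq> 0} \<subseteq> {x \<in> char_set. XD v qN x \<noteq> 0} \<union> {x \<in> char_set. XD w qN x \<noteq> 0}"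
    using lin(1) by (auto simp: char_set_def)
  then show "v + w \<in> flat_dirs"
    using negligible_subset[OF negligible_Un[OF v[unfolded flat_dirs_def mem_Collect_eq] w[unfolded flat_dirs_def mem_Collect_eq]]]
    unfolding flat_dirs_def mem_Collect_eq by blast
qed

lemma XD_bracket:
  assumes "x \<noteq> 0"
  shows "XD (lie_bracket G v w) qN x = XD v (XD w qN) x - XD w (XD v qN) x"
proof -
  have D2: "XD v (XD w qN) x = frechet_derivative qN (at x) (frechet_derivative (lf w) (at x) (lf v x)) +
     frechet_derivative (\<lambda>y. frechet_derivative qN (at y) (lf w x)) (at x) (lf v x)" for v w
  proof -
    have xU: "x \<in> U0" using assms by simp
    have Db: "((\<lambda>y. frechet_derivative qN (at y) b) has_derivative
        frechet_derivative (\<lambda>y. frechet_derivative qN (at y) b) (at x)) (at x)" for b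
      using C1_on_has_derivative[OF _ xU, of "\<lambda>y. frechet_derivative qN (at y) b"] Ck_on_derivative[OF qN_Ck] by simp
    have lin: "linear (frechet_derivative qN (at y))" if "y \<in> U0" for y
      using has_derivative_linear[OF C1_on_has_derivative[OF qN_Ck that]] .
    let ?L = "\<lambda>v. \<Sum>b\<in>Basis. (lf w x \<bullet> b) * frechet_derivative (\<lambda>y. frechet_derivative qN (at y) b) (at x) v
          + (frechet_derivative (lf w) (at x) v \<bullet> b) * frechet_derivative qN (at x) b"
    have "((\<lambda>y. \<Sum>b\<in>Basis. (lf w y \<bullet> b) * frechet_derivative qN (at y) b) has_derivative ?L) (at x)"
      by (intro has_derivative_sum has_derivative_mult has_derivative_inner_left lf_has_derivative Db)
    then have "(XD w qN has_derivative ?L) (at x)"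
    proof (rule has_derivative_transform_within_open[OF _ U0_open xU])
      fix y assume "y \<in> U0"
      from linear_sum_Basis[OF lin[OF this], of "lf w y"]
      show "(\<Sum>b\<in>Basis. (lf w y \<bullet> b) * frechet_derivative qN (at y) b) = XD w qN y" by (simp add: XD_def)
    qed
    then have 1: "XD v (XD w qN) x = ?L (lf v x)" by (simp add: XD_def frechet_derivative_eqI)
    have "((\<lambda>y. \<Sum>b\<in>Basis. (lf w x \<bullet> b) * frechet_derivative qN (at y) b) has_derivative
        (\<lambda>v. \<Sum>b\<in>Basis. (lf w x \<bullet> b) * frechet_derivative (\<lambda>y. frechet_derivative qN (at y) b) (at x) v)) (at x)"
      by (intro has_derivative_sum has_derivative_mult_right Db)
    then have "((\<lambda>y. frechet_derivative qN (at y) (lf w x)) has_derivative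
        (\<lambda>v. \<Sum>b\<in>Basis. (lf w x \<bullet> b) * frechet_derivative (\<lambda>y. frechet_derivative qN (at y) b) (at x) v)) (at x)"
    proof (rule has_derivative_transform_within_open[OF _ U0_open xU])
      fix y assume "y \<in> U0"
      from linear_sum_Basis[OF lin[OF this], of "lf w x"]
      show "(\<Sum>b\<in>Basis. (lf w x \<bullet> b) * frechet_derivative qN (at y) b) = frechet_derivative qN (at y) (lf w x)" by simp
    qed
    then have 2: "frechet_derivative (\<lambda>y. frechet_derivative qN (at y) (lf w x)) (at x) (lf v x) =
        (\<Sum>b\<in>Basis. (lf w x \<bullet> b) * frechet_derivative (\<lambda>y. frechet_derivative qN (at y) b) (at x) (lf v x))"
      by (simp add: frechet_derivative_eqI)
    show ?thesis
      using 1 2 linear_sum_Basis[OF lin[OF xU], of "frechet_derivative (lf w) (at x) (lf v x)"]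
      by (simp add: sum.distrib)
  qed
  have sym: "frechet_derivative (\<lambda>y. frechet_derivative qN (at y) (lf w x)) (at x) (lf v x) =
      frechet_derivative (\<lambda>y. frechet_derivative qN (at y) (lf v x)) (at x) (lf w x)"
    by (rule second_derivative_symmetric_real[OF U0_open qN_Ck]) (use assms in simp)
  have l: "linear (frechet_derivative qN (at x))"
    using has_derivative_linear[OF C1_on_has_derivative[OF qN_Ck]] assms by auto
  show ?thesis
    unfolding D2 sym by (simp add: XD_def lf_bracket[symmetric] linear_diff[OF l])
qed

text \<open>Almost everywhere on the zero set of a \<open>C^1\<close> function its derivative
  vanishes too. Applied to \<open>XD w qN\<close> and \<open>XD v qN\<close>, this kills both second
  order terms of the commutator almost everywhere on the characteristic set.\<close>

lemma flat_dirs_bracket: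
  assumes "v \<in> flat_dirs" "w \<in> flat_dirs"
  shows "lie_bracket G v w \<in> flat_dirs"
proof -
  let ?Z = "\<lambda>v w. {x \<in> U0. XD w qN x = 0 \<and> XD v (XD w qN) x \<noteq> 0}"
  have Z: "negligible (?Z v w)" for v w
  proof -
    have "?Z v w \<subseteq> (\<Union>b\<in>Basis. {x \<in> U0. XD w qN x = 0 \<and> frechet_derivative (XD w qN) (at x) b \<noteq> 0})"
    proof
      fix x assume x: "x \<in> ?Z v w"
      have l: "linear (frechet_derivative (XD w qN) (at x))"
        using has_derivative_linear[OF C1_on_has_derivative[OF XD1_Ck]] x by auto
      have "(\<Sum>b\<in>Basis. (lf v x \<bullet> b) *\<^sub>R frechet_derivative (XD w qN) (at x) b) \<noteq> 0"
        using x linear_sum_Basis[OF l, of "lf v x"] by (simp add: XD_def)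
      then obtain b where "b \<in> Basis" "(lf v x \<bullet> b) *\<^sub>R frechet_derivative (XD w qN) (at x) b \<noteq> 0"
        by (meson sum.neutral)
      then show "x \<in> (\<Union>b\<in>Basis. {x \<in> U0. XD w qN x = 0 \<and> frechet_derivative (XD w qN) (at x) b \<noteq> 0})"
        using x by auto
    qed
    moreover have "negligible (\<Union>b\<in>Basis. {x \<in> U0. XD w qN x = 0 \<and> frechet_derivative (XD w qN) (at x) b \<noteq> 0})"
    proof (rule negligible_Union)
      fix T assume "T \<in> (\<lambda>b. {x \<in> U0. XD w qN x = 0 \<and> frechet_derivative (XD w qN) (at x) b \<noteq> 0}) ` Basis"
      then show "negligible T" using negligible_zeros_with_nonzero_derivative[OF U0_open XD1_Ck] by blast
    qed simp
    ultimately show ?thesis using negligible_subset by blast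
  qed
  have "{x \<in> char_set. XD (lie_bracket G v w) qN x \<noteq> 0} \<subseteq>
      {x \<in> char_set. XD v qN x \<noteq> 0} \<union> {x \<in> char_set. XD w qN x \<noteq> 0} \<union> ?Z v w \<union> ?Z w v"
    by (auto simp: char_set_def XD_bracket)
  moreover have "negligible ({x \<in> char_set. XD v qN x \<noteq> 0} \<union> {x \<in> char_set. XD w qN x \<noteq> 0} \<union> ?Z v w \<union> ?Z w v)"
    using assms Z by (intro negligible_Un) (auto simp: flat_dirs_def)
  ultimately show ?thesis unfolding flat_dirs_def using negligible_subset by blast
qed

lemma layer_flat_dirs: "j \<in> {1..nsteps G} \<Longrightarrow> layer G j \<subseteq> flat_dirs"
proof (induction j)
  case (Suc j)
  have 1: "layer G 1 \<subseteq> flat_dirs"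
  proof -
    have "frame G i \<in> flat_dirs" if "i \<in> I1" for i
    proof -
      have "{x \<in> char_set. XD (frame G i) qN x \<noteq> 0} = {}" using that hN_zero_iff by (auto simp: char_set_def)
      then show ?thesis unfolding flat_dirs_def mem_Collect_eq by (simp only: negligible_empty)
    qed
    then have "span (frame G ` I1) \<subseteq> flat_dirs" by (intro span_minimal flat_dirs_subspace) auto
    then show ?thesis using layer1_span by blast
  qed
  show ?case
  proof (cases "j = 0")
    case False
    then have j: "j \<in> {1..<nsteps G}" "j \<in> {1..nsteps G}" using Suc.prems by auto
    have "layer G (Suc j) = bracket_span G (layer G 1) (layer G j)"
      using stratified j(1) by (simp add: stratified_def)
    also have "\<dots> \<subseteq> flat_dirs"
      unfolding bracket_span_def
      by (intro span_minimal flat_dirs_subspace) (use 1 Suc.IH[OF j(2)] flat_dirs_bracket in blast)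
    finally show ?thesis .
  qed (use 1 in simp)
qed simp

theorem negligible_char_set: "negligible char_set"
proof -
  have all: "v \<in> flat_dirs" for v
  proof -
    have "(\<Sum>j=1..nsteps G. comp j v) \<in> flat_dirs"
    proof (rule subspace_sum[OF flat_dirs_subspace])
      fix j assume j: "j \<in> {1..nsteps G}"
      show "comp j v \<in> flat_dirs" by (rule subsetD[OF layer_flat_dirs[OF j] comp_in_layer[OF j]])
    qed
    then show ?thesis by (simp only: comp_sum)
  qed
  have "char_set \<subseteq> (\<Union>b\<in>Basis. {x \<in> char_set. XD b qN x \<noteq> 0})"
  proof
    fix x assume x: "x \<in> char_set"
    then have x0: "x \<noteq> 0" by (simp add: char_set_def)
    \<comment> \<open>The generator of the dilations, transported to the identity. Since it depends
      on \<open>x\<close>, it is expanded over \<open>Basis\<close>, which covers the characteristic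
      set by finitely many sets with fixed directions.\<close>
    define w where "w = lf_inv x (\<Sum>j=1..nsteps G. real j *\<^sub>R comp j x)"
    have "XD w qN x = qN x" using derivative_qN_nz[OF x0] by (simp add: XD_def w_def lf_lf_inv)
    then have "XD w qN x \<noteq> 0" using qN_pos[OF x0] by simp
    have l: "linear (frechet_derivative qN (at x))"
      using has_derivative_linear[OF C1_on_has_derivative[OF qN_Ck]] x0 by auto
    have "linear (\<lambda>w. XD w qN x)" unfolding XD_def using linear_compose[OF lf_linear l] by (simp add: o_def)
    from linear_sum_Basis[OF this, of w] \<open>XD w qN x \<noteq> 0\<close>
    have "(\<Sum>b\<in>Basis. (w \<bullet> b) *\<^sub>R XD b qN x) \<noteq> 0" by simp
    then obtain b where "b \<in> Basis" "(w \<bullet> b) *\<^sub>R XD b qN x \<noteq> 0" by (meson sum.neutral)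
    then show "x \<in> (\<Union>b\<in>Basis. {x \<in> char_set. XD b qN x \<noteq> 0})" using x by auto
  qed
  moreover have "negligible (\<Union>b\<in>Basis. {x \<in> char_set. XD b qN x \<noteq> 0})"
    using all by (intro negligible_Union) (auto simp: flat_dirs_def)
  ultimately show ?thesis using negligible_subset by blast
qed

end

lemma euclidean_div_sum:
  assumes "\<And>i. i \<in> I \<Longrightarrow> Z i differentiable (at x)"
  shows "euclidean_div (\<lambda>x. \<Sum>i\<in>I. Z i x) x = (\<Sum>i\<in>I. euclidean_div (Z i) x)"
proof -
  have "((\<lambda>x. \<Sum>i\<in>I. Z i x) has_derivative (\<lambda>v. \<Sum>i\<in>I. frechet_derivative (Z i) (at x) v)) (at x)"
    using assms by (intro has_derivative_sum) (simp add: frechet_derivative_works)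
  then have "frechet_derivative (\<lambda>x. \<Sum>i\<in>I. Z i x) (at x) v = (\<Sum>i\<in>I. frechet_derivative (Z i) (at x) v)" for v
    by (simp add: frechet_derivative_eqI)
  then show ?thesis
    unfolding euclidean_div_def by (simp add: inner_sum_left sum.swap[of _ I])
qed

context folland
begin

lemma qN_0: "qN 0 = 0"
  by (simp add: folland_norm_def)

lemma derivative_hgrad:
  assumes "f differentiable (at x)"
  shows "frechet_derivative f (at x) (hgrad G k x) = (\<Sum>i\<in>I1. XD (frame G i) f x * XD (frame G i) k x)"
proof -
  have l: "linear (frechet_derivative f (at x))"
    using assms has_derivative_linear by (simp add: frechet_derivative_works)
  show ?thesis
    unfolding hgrad_XD linear_sum[OF l] by (rule sum.cong) (simp_all add: linear_scale[OF l] XD_def)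
qed

lemma derivative_qN_hgrad: "x \<noteq> 0 \<Longrightarrow> frechet_derivative qN (at x) (hgrad G qN x) = hN x"
  using C1_on_differentiable[OF qN_Ck, of x] by (simp add: derivative_hgrad sqgrad_def power2_eq_square)

lemma derivative_hN_hgrad: "x \<noteq> 0 \<Longrightarrow> frechet_derivative hN (at x) (hgrad G qN x) = 2 * inf_laplace G qN x"
  using C1_on_differentiable[OF hN_Ck, of x] by (simp add: derivative_hgrad inf_laplace_eq)

lemma hnorm_scaled_hgrad: "hnorm G x (r *\<^sub>R hgrad G qN x) = \<bar>r\<bar> * sqrt (hN x)"
proof -
  have "r *\<^sub>R hgrad G qN x = (\<Sum>i\<in>I1. (r * XD (frame G i) qN x) *\<^sub>R lf (frame G i) x)"
    unfolding hgrad_XD scaleR_sum_right by simp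
  then have "hnorm G x (r *\<^sub>R hgrad G qN x) = sqrt (\<Sum>i\<in>I1. r\<^sup>2 * (XD (frame G i) qN x)\<^sup>2)"
    unfolding hnorm_def by (simp only: hinner_frame) (simp add: power2_eq_square mult_ac)
  then show ?thesis by (simp add: sqgrad_def sum_distrib_left[symmetric] real_sqrt_mult)
qed

lemma null_sets_haar: "null_sets (haar G) = null_sets lebesgue"
proof -
  obtain c where "c > 0" "haar G = scale_measure (ennreal c) lebesgue" by (rule haar_scale)
  then show ?thesis by (auto simp: null_sets_def)
qed

subsection \<open>Polar coordinates imply the infinity Laplace equation\<close>

lemma inf_laplace_along_curve:
  assumes c: "horizontal_curve G c" and Nc: "\<And>s. s > 0 \<Longrightarrow> qN (c s) = s"
    and r: "\<And>s. s > 0 \<Longrightarrow> \<exists>r. vector_derivative c (at s) = r *\<^sub>R hgrad G qN (c s)"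
    and k: "\<And>s. s > 0 \<Longrightarrow> hnorm G (c s) (vector_derivative c (at s)) = k"
    and s: "s > 0"
  shows "inf_laplace G qN (c s) = 0"
proof -
  have nz: "c t \<noteq> 0" if "t > 0" for t using Nc[OF that] qN_0 that by auto
  have vd: "(c has_vector_derivative vector_derivative c (at t)) (at t)" if "t > 0" for t
    using c that by (simp add: horizontal_curve_def vector_derivative_works)
  obtain r where r: "\<And>s. s > 0 \<Longrightarrow> vector_derivative c (at s) = r s *\<^sub>R hgrad G qN (c s)" using r by metis
  have lin: "linear (frechet_derivative f (at x))" if "f differentiable (at x)" for f :: "'a \<Rightarrow> real" and x
    using that has_derivative_linear by (simp add: frechet_derivative_works)
  have rh: "r t * hN (c t) = 1" if t: "t > 0" for t
  proof -
    have d: "qN differentiable (at (c t))" using C1_on_differentiable[OF qN_Ck] nz[OF t] by simp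
    have "((\<lambda>s. qN (c s)) has_real_derivative r t * hN (c t)) (at t)"
      using has_real_derivative_along_curve[OF vd[OF t] d] nz[OF t]
      by (simp add: r[OF t] linear_scale[OF lin[OF d]] derivative_qN_hgrad)
    moreover have "((\<lambda>s. qN (c s)) has_real_derivative 1) (at t)"
      by (rule has_field_derivative_transform_within_open[OF DERIV_ident, of "{0<..}"]) (use t Nc in auto)
    ultimately show ?thesis by (rule DERIV_unique)
  qed
  have hk: "hN (c t) = 1 / k\<^sup>2" if t: "t > 0" for t
  proof -
    have h: "hN (c t) > 0" using rh[OF t] sqgrad_nonneg[of qN "c t"] by (cases "hN (c t) = 0") auto
    then have "r t = 1 / hN (c t)" using rh[OF t] by (simp add: field_simps)
    moreover have "k = \<bar>r t\<bar> * sqrt (hN (c t))" using k[OF t] r[OF t] hnorm_scaled_hgrad by simp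
    ultimately have "k\<^sup>2 = (1 / hN (c t))\<^sup>2 * hN (c t)" using h by (simp add: power_mult_distrib power_divide)
    then show ?thesis using h by (simp add: power2_eq_square)
  qed
  have d: "hN differentiable (at (c s))" using C1_on_differentiable[OF hN_Ck] nz[OF s] by simp
  have "((\<lambda>s. hN (c s)) has_real_derivative r s * (2 * inf_laplace G qN (c s))) (at s)"
    using has_real_derivative_along_curve[OF vd[OF s] d] nz[OF s]
    by (simp add: r[OF s] linear_scale[OF lin[OF d]] derivative_hN_hgrad)
  moreover have "((\<lambda>s. hN (c s)) has_real_derivative 0) (at s)"
    by (rule has_field_derivative_transform_within_open[OF DERIV_const, of "{0<..}"]) (use s hk in auto)
  ultimately have "r s * (2 * inf_laplace G qN (c s)) = 0" by (rule DERIV_unique)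
  then show ?thesis using rh[OF s] by auto
qed

lemma continuous_inf_laplace: "continuous_on U0 (inf_laplace G qN)"
proof -
  have "Ck_on 0 U0 (\<lambda>x. (\<Sum>i\<in>I1. XD (frame G i) hN x * XD (frame G i) qN x))"
    by (intro Ck_on_sum Ck_on_mult XD1_Ck XD_Ck hN_Ck U0_open)
  then show ?thesis unfolding inf_laplace_eq[abs_def] by (intro continuous_on_mult_left) simp
qed

theorem polar_imp_inf_laplace:
  assumes "horizontal_polar_coordinates G qN" "x \<noteq> 0"
  shows "inf_laplace G qN x = 0"
proof (rule ccontr)
  assume ne: "inf_laplace G qN x \<noteq> 0"
  obtain Z \<gamma> where Z: "Z \<in> null_sets (haar G)"
    and cover: "UNIV - Z = (\<Union>a\<in>{g. qN g = 1} - Z. \<gamma> a ` {0<..})"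
    and \<gamma>: "\<And>a. a \<in> {g. qN g = 1} - Z \<Longrightarrow> horizontal_curve G (\<gamma> a) \<and> (\<forall>s>0. qN (\<gamma> a s) = s) \<and>
           (\<forall>s>0. \<exists>r. vector_derivative (\<gamma> a) (at s) = r *\<^sub>R hgrad G qN (\<gamma> a s)) \<and>
           (\<exists>k. \<forall>s>0. hnorm G (\<gamma> a s) (vector_derivative (\<gamma> a) (at s)) = k)"
    using assms(1) unfolding horizontal_polar_coordinates_def Let_def by auto
  have off: "inf_laplace G qN y = 0" if y: "y \<notin> Z" for y
  proof -
    have "y \<in> (\<Union>a\<in>{g. qN g = 1} - Z. \<gamma> a ` {0<..})" using y cover by blast
    then obtain a s where a: "a \<in> {g. qN g = 1} - Z" and s: "s > 0" "y = \<gamma> a s" by auto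
    obtain k where "\<And>s. s > 0 \<Longrightarrow> hnorm G (\<gamma> a s) (vector_derivative (\<gamma> a) (at s)) = k"
      using \<gamma>[OF a] by auto
    then show ?thesis unfolding s(2) using \<gamma>[OF a] s(1) by (intro inf_laplace_along_curve[of "\<gamma> a"]) auto
  qed
  have "open (U0 \<inter> inf_laplace G qN -` (- {0}))"
    by (rule continuous_open_preimage[OF continuous_inf_laplace U0_open]) (intro open_Compl closed_singleton)
  moreover have "negligible (U0 \<inter> inf_laplace G qN -` (- {0}))"
  proof (rule negligible_subset)
    show "negligible Z" using Z null_sets_haar by (simp add: negligible_iff_null_sets)
  qed (use off in auto)
  ultimately show False using open_not_negligible[of "U0 \<inter> inf_laplace G qN -` (- {0})"] ne assms(2) by auto
qed

subsection \<open>The infinity Laplace equation implies polar coordinates\<close>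

lemma hgrad_Ck: "Ck_on k U0 (hgrad G qN)"
  unfolding hgrad_XD[abs_def]
  by (intro Ck_on_sum Ck_on_scaleR XD1_Ck U0_open Ck_on_subset[OF lf_Ck]) auto

lemma euclidean_div_hgrad:
  assumes "x \<noteq> 0"
  shows "euclidean_div (hgrad G qN) x = hlaplace G qN x"
proof -
  have d: "XD v qN differentiable (at x)" for v using C1_on_differentiable[OF XD1_Ck] assms by auto
  have "euclidean_div (hgrad G qN) x = (\<Sum>i\<in>I1. euclidean_div (\<lambda>y. XD (frame G i) qN y *\<^sub>R lf (frame G i) y) x)"
    unfolding hgrad_XD[abs_def]
    by (rule euclidean_div_sum) (intro differentiable_scaleR d lf_differentiable)
  then show ?thesis
    by (simp only: euclidean_div_scaleR[OF d lf_differentiable] div_lf hlaplace_eq XD_def[of _ "XD _ qN"] mult_zero_right add_0_left)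
qed

lemma horizontal_space_hgrad: "r *\<^sub>R hgrad G qN x \<in> horizontal_space G x"
proof -
  have "r *\<^sub>R hgrad G qN x = lf (\<Sum>i\<in>I1. (r * XD (frame G i) qN x) *\<^sub>R frame G i) x"
    unfolding hgrad_XD scaleR_sum_right linear_sum[OF lf_linear] by (simp add: linear_scale[OF lf_linear])
  then show ?thesis unfolding horizontal_space_def by (rule image_eqI[OF _ frame_sum_in_layer])
qed

theorem inf_laplace_imp_polar:
  assumes inf0: "\<And>x. x \<noteq> 0 \<Longrightarrow> inf_laplace G qN x = 0"
  shows "horizontal_polar_coordinates G qN"
proof -
  define \<Omega> where "\<Omega> = {x. x \<noteq> 0 \<and> hN x \<noteq> 0}"
  define W where "W = (\<lambda>x. inverse (hN x) *\<^sub>R hgrad G qN x)"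
  have \<Omega>0: "\<Omega> \<subseteq> U0" by (auto simp: \<Omega>_def)
  have op: "open \<Omega>"
  proof -
    have "open (U0 \<inter> hN -` (- {0}))"
      by (rule continuous_open_preimage[OF Ck_on_continuous_on[OF hN_Ck] U0_open]) (intro open_Compl closed_singleton)
    also have "U0 \<inter> hN -` (- {0}) = \<Omega>" by (auto simp: \<Omega>_def)
    finally show ?thesis .
  qed
  have hC: "Ck_on k \<Omega> hN" and NC: "Ck_on k \<Omega> qN" and gC: "Ck_on k \<Omega> (hgrad G qN)" for k
    using Ck_on_subset[OF hN_Ck \<Omega>0] Ck_on_subset[OF qN_Ck \<Omega>0] Ck_on_subset[OF hgrad_Ck \<Omega>0] by auto
  have iC: "Ck_on k \<Omega> (\<lambda>x. inverse (hN x))" for k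
    by (rule Ck_on_inverse[OF op hC]) (simp add: \<Omega>_def)
  have WC: "Ck_on k \<Omega> W" for k unfolding W_def by (rule Ck_on_scaleR[OF op iC gC])
  have lin: "linear (frechet_derivative f (at x))" if "Ck_on 1 \<Omega> f" "x \<in> \<Omega>" for f :: "'a \<Rightarrow> real" and x
    using has_derivative_linear[OF C1_on_has_derivative[OF that]] .
  interpret polar_flow \<Omega> qN hN W "hom_dim G"
  proof
    fix x assume x: "x \<in> \<Omega>"
    then have x0: "x \<noteq> 0" "hN x \<noteq> 0" by (auto simp: \<Omega>_def)
    show "qN x > 0" using qN_pos x0 by simp
    show "hN x > 0" using x0 sqgrad_nonneg[of qN x] by simp
    show "frechet_derivative qN (at x) (W x) = 1"
      using x0 by (simp add: W_def linear_scale[OF lin[OF NC x]] derivative_qN_hgrad)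
    show "frechet_derivative hN (at x) (W x) = 0"
      using x0 inf0 by (simp add: W_def linear_scale[OF lin[OF hC x]] derivative_hN_hgrad)
    \<comment> \<open>In this product rule the second term is a multiple of the infinity Laplacian
      and vanishes; the first is the sub-Laplacian of \<open>qN\<close> divided by
      \<open>hN\<close>, which equals \<open>(Q - 1) / qN\<close>.\<close>
    have "euclidean_div W x = inverse (hN x) * euclidean_div (hgrad G qN) x
        + frechet_derivative (\<lambda>x. inverse (hN x)) (at x) (hgrad G qN x)"
      unfolding W_def by (rule euclidean_div_scaleR[OF C1_on_differentiable[OF iC x] C1_on_differentiable[OF gC x]])
    also have "frechet_derivative (\<lambda>x. inverse (hN x)) (at x) (hgrad G qN x) =
        - (inverse (hN x) ^ Suc (Suc 0)) * frechet_derivative hN (at x) (hgrad G qN x)"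
      by (rule frechet_derivative_chain_real(2)[OF C1_on_differentiable[OF hC x] DERIV_inverse]) (rule x0)
    finally show "euclidean_div W x = (real (hom_dim G) - 1) / qN x"
      using x0 inf0 by (simp add: derivative_hN_hgrad euclidean_div_hgrad hlaplace_qN)
  next
    fix a b c :: real assume a: "0 < a" and c: "0 < c"
    let ?A = "{x. x \<noteq> 0 \<and> a \<le> qN x \<and> qN x \<le> b}"
    have "closed (?A \<inter> hN -` {c..})"
      by (rule continuous_closed_preimage[OF continuous_on_subset[OF Ck_on_continuous_on[OF hN_Ck]]
            compact_imp_closed[OF compact_annulus[OF a]]]) auto
    then have "compact (?A \<inter> (?A \<inter> hN -` {c..}))" by (rule compact_Int_closed[OF compact_annulus[OF a]])
    also have "?A \<inter> (?A \<inter> hN -` {c..}) = {x \<in> \<Omega>. a \<le> qN x \<and> qN x \<le> b \<and> c \<le> hN x}"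
      using c by (auto simp: \<Omega>_def)
    finally show "compact {x \<in> \<Omega>. a \<le> qN x \<and> qN x \<le> b \<and> c \<le> hN x}" .
  next
    fix a b :: real assume a: "0 < a"
    show "bounded {x \<in> \<Omega>. a \<le> qN x \<and> qN x \<le> b}"
      by (rule bounded_subset[OF compact_imp_bounded[OF compact_annulus[OF a, of b]]]) (auto simp: \<Omega>_def)
  qed (use op NC hC WC hom_dim_gt_2 in \<open>simp_all del: Ck_on.simps One_nat_def\<close>)
  let ?S = "{g. qN g = 1}"
  have null: "- \<Omega> \<in> null_sets lebesgue"
  proof -
    have "- \<Omega> = insert 0 char_set" by (auto simp: \<Omega>_def char_set_def)
    then show ?thesis using negligible_char_set by (simp add: negligible_iff_null_sets[symmetric])
  qed
  have S: "?S \<in> sets borel"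
  proof -
    have "?S = {x. x \<noteq> 0 \<and> 1 \<le> qN x \<and> qN x \<le> 1}" using qN_0 by (auto intro: antisym)
    then show ?thesis using compact_annulus[of 1 1] by (simp add: borel_compact)
  qed
  have S\<Omega>: "?S \<inter> \<Omega> = {x \<in> \<Omega>. qN x = 1}" by auto
  obtain c where c: "c > 0" "haar G = scale_measure (ennreal c) lebesgue" by (rule haar_scale)
  have vd: "vector_derivative (flow a) (at s) = inverse (hN (flow a s)) *\<^sub>R hgrad G qN (flow a s)"
    if "a \<in> \<Omega>" "s > 0" for a s
    using vector_derivative_at[OF flow_derivative[OF that]] by (simp add: W_def)
  have "\<exists>!\<sigma>. polar_measure G ?S (- \<Omega>) flow \<sigma>"
    using polar_measure_exists[OF c(2,1) refl S S\<Omega> null] polar_measure_unique[OF c(2,1) refl S S\<Omega>] by blast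
  moreover have "UNIV - - \<Omega> = (\<Union>a\<in>?S - - \<Omega>. flow a ` {0<..})"
  proof (intro equalityI subsetI)
    fix x assume "x \<in> UNIV - - \<Omega>"
    then have x: "x \<in> \<Omega>" by simp
    have "flow x 1 \<in> ?S - - \<Omega>" using flow_in[OF x] N_flow[OF x] by simp
    moreover have "x = flow (flow x 1) (qN x)" using flow_flow[OF x] N_pos[OF x] flow_self[OF x] by simp
    ultimately show "x \<in> (\<Union>a\<in>?S - - \<Omega>. flow a ` {0<..})" using N_pos[OF x] by blast
  qed (use flow_in in auto)
  moreover have "disjoint_family_on (\<lambda>a. flow a ` {0<..}) (?S - - \<Omega>)"
    unfolding disjoint_family_on_def using flow_same_level by fastforce
  moreover have "horizontal_curve G (flow a) \<and> flow a 1 = a" if "a \<in> ?S - - \<Omega>" for a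
  proof -
    have a: "a \<in> \<Omega>" "qN a = 1" using that by auto
    have "flow a differentiable (at s)" if "s > 0" for s
      using flow_derivative[OF a(1) that] by (auto simp: differentiableI_vector)
    then show ?thesis
      using a vd flow_self[OF a(1)] by (simp add: horizontal_curve_def horizontal_space_hgrad)
  qed
  moreover have "(\<forall>s>0. qN (flow a s) = s) \<and>
      (\<forall>s>0. \<exists>r. vector_derivative (flow a) (at s) = r *\<^sub>R hgrad G qN (flow a s)) \<and>
      (\<exists>k. \<forall>s>0. hnorm G (flow a s) (vector_derivative (flow a) (at s)) = k)" if "a \<in> ?S - - \<Omega>" for a
  proof -
    have a: "a \<in> \<Omega>" using that by auto
    then show ?thesis using N_flow h_flow vd by (auto simp: hnorm_scaled_hgrad)
  qed
  moreover have "- \<Omega> \<in> null_sets (haar G)" using null null_sets_haar by simp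
  ultimately show ?thesis
    unfolding horizontal_polar_coordinates_def Let_def by (intro bexI[of _ "- \<Omega>"] exI[of _ flow]) auto
qed

subsection \<open>The coherent family\<close>

lemma coherent_imp_inf_laplace:
  assumes "coherent_family G u" "x \<noteq> 0"
  shows "inf_laplace G qN x = 0"
proof -
  have "singular_solution G qN \<infinity> = qN" by (intro ext) (simp add: singular_solution_def)
  then show ?thesis using assms(1)[unfolded coherent_family_def, rule_format, of \<infinity>] assms(2)
    by (simp add: p_harmonic_def)
qed

text \<open>The logarithmic case fits the same formula: for \<open>q = Q\<close> the exponent is
  \<open>- 1\<close> and the constant is \<open>- 1\<close>. Only the shape of the gradient is used
  afterwards, so the constant stays existential.\<close>

lemma XD_singular_solution:
  assumes "q > 1"
  shows "\<exists>\<kappa>. \<forall>v x. x \<noteq> 0 \<longrightarrow>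
    XD v (singular_solution G qN (ereal q)) x = \<kappa> * (qN x powr ((1 - rQ) / (q - 1)) * XD v qN x)"
proof (cases "q = rQ")
  case True
  have "XD v (singular_solution G qN (ereal q)) x = - 1 * (qN x powr ((1 - rQ) / (q - 1)) * XD v qN x)"
    if x: "x \<noteq> 0" for v x
  proof -
    have d: "qN differentiable (at x)" using C1_on_differentiable[OF qN_Ck] x by simp
    have "singular_solution G qN (ereal q) = (\<lambda>y. ln (1 / qN y))"
      using True by (intro ext) (simp add: singular_solution_def)
    moreover have "XD v (\<lambda>y. ln (1 / qN y)) x = - 1 / qN x * XD v qN x"
    proof (rule XD_chain[OF d])
      show "((\<lambda>t. ln (1 / t)) has_real_derivative - 1 / qN x) (at (qN x))"
        using qN_pos[OF x] by (auto intro!: derivative_eq_intros simp: power2_eq_square)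
    qed
    ultimately have "XD v (singular_solution G qN (ereal q)) x = - 1 / qN x * XD v qN x" by simp
    moreover have "(1 - rQ) / (q - 1) = - 1" using True rQ_gt by (simp add: field_simps)
    ultimately show ?thesis using qN_pos[OF x] by (simp add: powr_minus divide_inverse)
  qed
  then show ?thesis by blast
next
  case False
  have "XD v (singular_solution G qN (ereal q)) x =
      (q - rQ) / (q - 1) * (qN x powr ((1 - rQ) / (q - 1)) * XD v qN x)" if x: "x \<noteq> 0" for v x
  proof -
    have "singular_solution G qN (ereal q) = (\<lambda>y. qN y powr ((q - rQ) / (q - 1)))"
      using False by (intro ext) (simp add: singular_solution_def)
    moreover have "(q - rQ) / (q - 1) - 1 = (1 - rQ) / (q - 1)" using assms by (simp add: field_simps)
    ultimately show ?thesis using XD_powr_qN[OF x, of v "(q - rQ) / (q - 1)"] by simp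
  qed
  then show ?thesis by blast
qed

text \<open>\<open>N\<close> to the power \<open>1 - Q\<close> times the horizontal gradient of \<open>N\<close> is a multiple of the horizontal
  gradient of \<open>u\<close>, hence divergence free. By the infinity Laplace equation it is tangent to the level
  sets of \<open>hN\<close>, so it stays divergence free when multiplied by a function of \<open>hN\<close>.\<close>

lemma regularised_flux:
  fixes s \<epsilon> :: real
  assumes inf0: "\<And>x. x \<noteq> 0 \<Longrightarrow> inf_laplace G qN x = 0" and \<phi>: "test_function U0 \<phi>" and \<epsilon>: "\<epsilon> > 0"
  defines "f \<equiv> \<lambda>x. (hN x + \<epsilon>) powr s * qN x powr (1 - rQ) * (\<Sum>i\<in>I1. XD (frame G i) qN x * XD (frame G i) \<phi> x)"
  shows "integrable lborel f" "(LINT x|lborel. f x) = 0"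
proof -
  define K where "K = closure {x. \<phi> x \<noteq> 0}"
  have K: "compact K" "K \<subseteq> U0" "closed K" using \<phi> by (auto simp: K_def test_function_def)
  have \<phi>0: "\<phi> x = 0" if "x \<notin> K" for x 
    using that closure_subset[of "{x. \<phi> x \<noteq> 0}"] by (auto simp: K_def)
  have X\<phi>0: "XD v \<phi> x = 0" if "x \<notin> K" for v x by (rule XD_zero_outside[OF K(3) \<phi>0 that])
  have \<phi>C: "Ck_on k U0 \<phi>" for k by (rule Ck_on_subset[OF test_function_Ck[OF \<phi>]]) simp
  let ?A = "\<lambda>x. (hN x + \<epsilon>) powr s" and ?B = "\<lambda>x. qN x powr (1 - rQ)"
  let ?e = "frame G"
  have hp: "hN x + \<epsilon> > 0" for x using sqgrad_nonneg[of qN x] \<epsilon> by simp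
  have AC: "Ck_on k U0 ?A" for k
    by (intro Ck_on_powr Ck_on_add hN_Ck Ck_on_const U0_open hp)
  have BC: "Ck_on k U0 ?B" for k
    by (rule Ck_on_powr[OF U0_open qN_Ck]) (use qN_pos in auto)
  let ?Y = "\<lambda>i x. ?B x * XD (?e i) qN x"
  \<comment> \<open>The components of the regularised flux times the test function. Each of their
    derivatives along the frame integrates to 0, and the sum of these derivatives turns out to be
    \<open>f\<close>.\<close>
  let ?F = "\<lambda>i x. (?A x * ?Y i x) * \<phi> x"
  have YC: "Ck_on k U0 (?Y i)" for k i by (intro Ck_on_mult BC XD1_Ck U0_open)
  have AYC: "Ck_on k U0 (\<lambda>x. ?A x * ?Y i x)" for k i by (intro Ck_on_mult AC YC U0_open)
  have FC: "Ck_on k U0 (?F i)" for k i by (intro Ck_on_mult AYC \<phi>C U0_open)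
  have F0: "?F i x = 0" if "x \<notin> K" for i x using \<phi>0[OF that] by simp
  have XF0: "XD v (?F i) x = 0" if "x \<notin> K" for v i x by (rule XD_zero_outside[OF K(3) F0 that])
  have int: "integrable lborel (XD (?e i) (?F i))" for i
    by (rule integrable_continuous_compact_support[OF Ck_on_continuous_on[OF Ck_on_zero_extension[OF
          U0_open XD_Ck[OF U0_open FC] K(3,2) XF0]] K(1) XF0])
  have "(LINT x|lborel. XD (?e i) (?F i) x) = 0" for i
    by (rule integral_XD_zero[OF U0_open FC K(1,2) F0])
  then have z: "(LINT x|lborel. (\<Sum>i\<in>I1. XD (?e i) (?F i) x)) = 0"
    using int by (subst Bochner_Integration.integral_sum) auto
  have "(\<Sum>i\<in>I1. XD (?e i) (?F i) x) = f x" for x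
  proof (cases "x \<in> K")
    case True
    then have x: "x \<in> U0" "x \<noteq> 0" using K(2) by auto
    note d = C1_on_differentiable[OF _ x(1)]
    have A: "XD v ?A x = s * (hN x + \<epsilon>) powr (s - 1) * XD v hN x" for v
    proof (rule XD_chain[OF d[OF hN_Ck]])
      show "((\<lambda>t. (t + \<epsilon>) powr s) has_real_derivative s * (hN x + \<epsilon>) powr (s - 1)) (at (hN x))"
        using hp[of x] by (auto intro!: derivative_eq_intros)
    qed
    have sA: "(\<Sum>i\<in>I1. XD (?e i) ?A x * ?Y i x) = 0"
    proof -
      have "(\<Sum>i\<in>I1. XD (?e i) ?A x * ?Y i x) =
          (s * (hN x + \<epsilon>) powr (s - 1) * ?B x) * (\<Sum>i\<in>I1. XD (?e i) hN x * XD (?e i) qN x)"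
        unfolding A sum_distrib_left by (simp only: mult_ac)
      then show ?thesis using inf0[OF x(2)] unfolding inf_laplace_eq by simp
    qed
    have sY: "(\<Sum>i\<in>I1. XD (?e i) (?Y i) x) = 0"
    proof -
      have B: "qN x powr (1 - rQ) = qN x * qN x powr (- rQ)"
        using qN_pos[OF x(2)] by (simp add: powr_diff powr_minus divide_inverse)
      have "XD (?e i) (?Y i) x = ?B x * XD (?e i) (XD (?e i) qN) x + (1 - rQ) * qN x powr (- rQ) * (XD (?e i) qN x)\<^sup>2" for i
        using XD_mult[OF d[OF BC] d[OF XD1_Ck]] XD_powr_qN[OF x(2), of "?e i" "1 - rQ"] by (simp add: power2_eq_square)
      then have "(\<Sum>i\<in>I1. XD (?e i) (?Y i) x) = ?B x * hlaplace G qN x + (1 - rQ) * qN x powr (- rQ) * hN x"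
        unfolding hlaplace_eq sqgrad_def by (simp only: sum.distrib sum_distrib_left)
      then show ?thesis
        using qN_pos[OF x(2)] unfolding hlaplace_qN[OF x(2)] B by (simp add: field_simps)
    qed
    have "XD (?e i) (?F i) x = (?A x * ?B x) * (XD (?e i) qN x * XD (?e i) \<phi> x)
        + (?A x * \<phi> x) * XD (?e i) (?Y i) x + \<phi> x * (XD (?e i) ?A x * ?Y i x)" for i
      unfolding XD_mult[OF d[OF AYC] d[OF \<phi>C]] XD_mult[OF d[OF AC] d[OF YC]] by (simp only: algebra_simps)
    then have "(\<Sum>i\<in>I1. XD (?e i) (?F i) x) = (?A x * ?B x) * (\<Sum>i\<in>I1. XD (?e i) qN x * XD (?e i) \<phi> x)
        + (?A x * \<phi> x) * (\<Sum>i\<in>I1. XD (?e i) (?Y i) x) + \<phi> x * (\<Sum>i\<in>I1. XD (?e i) ?A x * ?Y i x)"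
      by (simp only: sum.distrib sum_distrib_left)
    then show ?thesis by (simp only: sA sY f_def mult_zero_right add_0_right)
  next
    case False
    then show ?thesis by (simp add: f_def X\<phi>0 XF0)
  qed
  then have fe: "f = (\<lambda>x. \<Sum>i\<in>I1. XD (?e i) (?F i) x)" by auto
  show "(LINT x|lborel. f x) = 0" unfolding fe by (rule z)
  show "integrable lborel f" unfolding fe using int by (intro Bochner_Integration.integrable_sum)
qed

lemma abs_XD_le: "i \<in> I1 \<Longrightarrow> \<bar>XD (frame G i) qN x\<bar> \<le> sqrt (hN x)"
  unfolding sqgrad_def real_sqrt_abs[symmetric]
  by (intro real_sqrt_le_mono member_le_sum) auto

text \<open>For \<open>s < 0\<close> the first factor is singular at the zeros of \<open>hN\<close>; it is controlled by the gradient of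
  \<open>qN\<close>, which is at most \<open>sqrt hN\<close>, because \<open>s + 1/2 > 0\<close>.\<close>

lemma flux:
  fixes s :: real
  assumes inf0: "\<And>x. x \<noteq> 0 \<Longrightarrow> inf_laplace G qN x = 0" and \<phi>: "test_function U0 \<phi>" and s: "s > - 1 / 2"
  defines "f \<equiv> \<lambda>x. hN x powr s * qN x powr (1 - rQ) * (\<Sum>i\<in>I1. XD (frame G i) qN x * XD (frame G i) \<phi> x)"
  shows "f \<in> borel_measurable borel" "(LINT x|lborel. f x) = 0"
proof -
  define K where "K = closure {x. \<phi> x \<noteq> 0}"
  have K: "compact K" "K \<subseteq> U0" "closed K" using \<phi> by (auto simp: K_def test_function_def)
  have \<phi>0: "\<phi> x = 0" if "x \<notin> K" for x 
    using that closure_subset[of "{x. \<phi> x \<noteq> 0}"] by (auto simp: K_def)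
  have X\<phi>0: "XD v \<phi> x = 0" if "x \<notin> K" for v x by (rule XD_zero_outside[OF K(3) \<phi>0 that])
  have \<phi>C: "Ck_on k U0 \<phi>" for k by (rule Ck_on_subset[OF test_function_Ck[OF \<phi>]]) simp
  let ?B = "\<lambda>x. qN x powr (1 - rQ)" and ?S = "\<lambda>x. \<Sum>i\<in>I1. XD (frame G i) qN x * XD (frame G i) \<phi> x"
  define \<epsilon> where "\<epsilon> n = inverse (real (Suc n))" for n
  have \<epsilon>: "\<epsilon> n > 0" "\<epsilon> n \<le> 1" for n by (auto simp: \<epsilon>_def inverse_le_1_iff)
  have \<epsilon>lim: "\<epsilon> \<longlonglongrightarrow> 0" unfolding \<epsilon>_def[abs_def] by (rule LIMSEQ_inverse_real_of_nat)
  define g where "g n x = (hN x + \<epsilon> n) powr s * ?B x * ?S x" for n x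
  note flux = regularised_flux[OF inf0 \<phi> \<epsilon>(1), where s = s, folded g_def]
  \<comment> \<open>The dominating function: as the added constants are at most 1,
    \<open>(hN + \<epsilon> n) powr s * sqrt hN\<close> is at most
    \<open>(hN + 1) powr (s + 1 / 2)\<close>.\<close>
  define w where "w x = (hN x + 1) powr (s + 1 / 2) * ?B x * (\<Sum>i\<in>I1. \<bar>XD (frame G i) \<phi> x\<bar>)" for x
  have w: "integrable lborel w"
  proof -
    have "continuous_on U0 w"
      unfolding w_def[abs_def]
    proof (intro continuous_on_mult continuous_on_powr continuous_on_add continuous_on_const
        continuous_on_sum continuous_on_rabs ballI)
      show "continuous_on U0 hN" "continuous_on U0 qN" "\<And>i. continuous_on U0 (XD (frame G i) \<phi>)"
        by (auto intro!: Ck_on_continuous_on[OF hN_Ck] Ck_on_continuous_on[OF qN_Ck] Ck_on_continuous_on[OF XD_Ck[OF U0_open \<phi>C]])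
    next
      fix x assume "x \<in> U0"
      then show "qN x \<noteq> 0" using qN_pos by force
      show "hN x + 1 \<noteq> 0" using sqgrad_nonneg[of qN x] by simp
    qed
    then have "Ck_on 0 UNIV w"
      by (intro Ck_on_zero_extension[OF U0_open _ K(3,2)]) (auto simp: w_def X\<phi>0)
    then show ?thesis
      by (intro integrable_continuous_compact_support[OF _ K(1)]) (auto simp: w_def X\<phi>0)
  qed
  have lim: "(\<lambda>n. g n x) \<longlonglongrightarrow> f x" for x
  proof (cases "hN x = 0")
    case True
    \<comment> \<open>All horizontal derivatives of \<open>qN\<close> vanish here, so both the
      approximations and the limit are 0, although the regularised powers may diverge.\<close>
    then have "?S x = 0" by (simp add: hN_zero_iff)
    then show ?thesis by (simp only: g_def f_def mult_zero_right tendsto_const)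
  next
    case False
    have "(\<lambda>n. hN x + \<epsilon> n) \<longlonglongrightarrow> hN x + 0" by (intro tendsto_intros \<epsilon>lim)
    then have "(\<lambda>n. (hN x + \<epsilon> n) powr s) \<longlonglongrightarrow> hN x powr s"
      using False by (intro tendsto_powr) auto
    then show ?thesis unfolding g_def f_def by (intro tendsto_mult tendsto_const)
  qed
  have gm: "g n \<in> borel_measurable borel" for n
    using borel_measurable_integrable[OF flux(1)] by (simp add: g_def[abs_def])
  show fm: "f \<in> borel_measurable borel" by (rule borel_measurable_LIMSEQ_real[OF lim gm])
  have bound: "norm (g n x) \<le> w x" for n x
  proof -
    have h: "hN x \<ge> 0" by (rule sqgrad_nonneg)
    have "\<bar>?S x\<bar> \<le> (\<Sum>i\<in>I1. \<bar>XD (frame G i) qN x * XD (frame G i) \<phi> x\<bar>)" by (rule sum_abs)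
    also have "\<dots> \<le> (\<Sum>i\<in>I1. sqrt (hN x) * \<bar>XD (frame G i) \<phi> x\<bar>)"
      by (rule sum_mono) (auto simp only: abs_mult intro!: mult_right_mono abs_XD_le abs_ge_zero)
    finally have S: "\<bar>?S x\<bar> \<le> sqrt (hN x) * (\<Sum>i\<in>I1. \<bar>XD (frame G i) \<phi> x\<bar>)" by (simp only: sum_distrib_left)
    have "(hN x + \<epsilon> n) powr s * sqrt (hN x) \<le> (hN x + \<epsilon> n) powr s * (hN x + \<epsilon> n) powr (1 / 2)"
      using h \<epsilon>[of n] by (intro mult_left_mono) (auto simp: powr_half_sqrt)
    also have "\<dots> = (hN x + \<epsilon> n) powr (s + 1 / 2)" by (simp add: powr_add)
    also have "\<dots> \<le> (hN x + 1) powr (s + 1 / 2)"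
      using h \<epsilon>[of n] s by (intro powr_mono2) auto
    finally have P: "(hN x + \<epsilon> n) powr s * sqrt (hN x) \<le> (hN x + 1) powr (s + 1 / 2)" .
    let ?R = "\<Sum>i\<in>I1. \<bar>XD (frame G i) \<phi> x\<bar>"
    have R: "?R \<ge> 0" by (rule sum_nonneg) simp
    have "norm (g n x) = (hN x + \<epsilon> n) powr s * ?B x * \<bar>?S x\<bar>" by (simp add: g_def abs_mult)
    also have "\<dots> \<le> (hN x + \<epsilon> n) powr s * ?B x * (sqrt (hN x) * ?R)" by (rule mult_left_mono[OF S]) simp
    also have "\<dots> = ((hN x + \<epsilon> n) powr s * sqrt (hN x)) * (?B x * ?R)" by (simp only: mult_ac)
    also have "\<dots> \<le> (hN x + 1) powr (s + 1 / 2) * (?B x * ?R)" by (rule mult_right_mono[OF P]) (simp add: R)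
    finally show ?thesis by (simp only: w_def mult.assoc)
  qed
  have "(\<lambda>n. LINT x|lborel. g n x) \<longlonglongrightarrow> (LINT x|lborel. f x)"
    by (rule integral_dominated_convergence[OF _ _ w]) (use fm gm lim bound in auto)
  then have "(\<lambda>n. 0) \<longlonglongrightarrow> (LINT x|lborel. f x)" using flux(2) by (simp add: g_def[abs_def])
  then show "(LINT x|lborel. f x) = 0" using LIMSEQ_unique tendsto_const by blast
qed

theorem inf_laplace_imp_coherent:
  assumes inf0: "\<And>x. x \<noteq> 0 \<Longrightarrow> inf_laplace G qN x = 0"
  shows "coherent_family G u"
  unfolding coherent_family_def
proof (intro allI impI)
  fix p :: ereal assume p: "1 < p \<and> p \<le> \<infinity>"
  show "p_harmonic G p (singular_solution G qN p) U0"
  proof (cases p)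
    case PInf
    have "singular_solution G qN \<infinity> = qN" by (intro ext) (simp add: singular_solution_def)
    then show ?thesis using inf0 PInf by (simp add: p_harmonic_def)
  next
    case MInf
    then show ?thesis using p by simp
  next
    case (real q)
    then have q: "q > 1" using p by simp
    let ?f = "singular_solution G qN (ereal q)" and ?m = "\<lambda>x. qN x powr ((1 - rQ) / (q - 1))"
    obtain \<kappa> where X: "\<And>v x. x \<noteq> 0 \<Longrightarrow> XD v ?f x = \<kappa> * (?m x * XD v qN x)"
      using XD_singular_solution[OF q] by blast
    have "(LINT g:U0|haar G. hnorm G g (hgrad G ?f g) powr (q - 2) * hinner G g (hgrad G ?f g) (hgrad G \<phi> g)) = 0"
      if \<phi>: "test_function U0 \<phi>" for \<phi>
    proof -
      let ?T = "\<lambda>x. hN x powr ((q - 2) / 2) * qN x powr (1 - rQ) * (\<Sum>i\<in>I1. XD (frame G i) qN x * XD (frame G i) \<phi> x)"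
      \<comment> \<open>Equivalent to \<open>q > 1\<close>.\<close>
      have s: "(q - 2) / 2 > - 1 / 2" using q by simp
      have T: "?T \<in> borel_measurable borel" by (rule flux(1)[OF inf0 \<phi> s])
      have T0: "(LINT x|lborel. ?T x) = 0" by (rule flux(2)[OF inf0 \<phi> s])
      have "indicator U0 x *\<^sub>R (hnorm G x (hgrad G ?f x) powr (q - 2) * hinner G x (hgrad G ?f x) (hgrad G \<phi> x)) =
          (\<bar>\<kappa>\<bar> powr (q - 2) * \<kappa>) * ?T x" for x
      proof (cases "x = 0")
        case True
        \<comment> \<open>At the pole the left side is removed by the indicator; the right side
          vanishes because the support of \<open>\<phi>\<close> is closed and avoids 0.\<close>
        have "0 \<notin> closure {x. \<phi> x \<noteq> 0}" using \<phi> by (auto simp: test_function_def)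
        then have "XD v \<phi> 0 = 0" for v
          using closure_subset[of "{x. \<phi> x \<noteq> 0}"] by (intro XD_zero_outside[OF closed_closure[of "{x. \<phi> x \<noteq> 0}"]]) auto
        then show ?thesis using True by simp
      next
        case False
        have m: "?m x > 0" using qN_pos[OF False] by simp
        have "sqgrad ?f x = (\<kappa> * ?m x)\<^sup>2 * hN x"
          unfolding sqgrad_def X[OF False] by (simp only: sum_distrib_left power_mult_distrib mult_ac)
        then have n: "hnorm G x (hgrad G ?f x) = \<bar>\<kappa>\<bar> * ?m x * sqrt (hN x)"
          using m by (simp add: hnorm_hgrad real_sqrt_mult abs_mult)
        have "hnorm G x (hgrad G ?f x) powr (q - 2) = \<bar>\<kappa>\<bar> powr (q - 2) * ?m x powr (q - 2) * hN x powr ((q - 2) / 2)"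
          unfolding n using m sqgrad_nonneg[of qN x] by (simp add: powr_mult powr_powr powr_half_sqrt[symmetric])
        moreover have "hinner G x (hgrad G ?f x) (hgrad G \<phi> x) =
            \<kappa> * ?m x * (\<Sum>i\<in>I1. XD (frame G i) qN x * XD (frame G i) \<phi> x)"
          unfolding hinner_hgrad X[OF False] by (simp only: sum_distrib_left mult_ac)
        \<comment> \<open>The exponents of the singular solutions are matched to this identity: the
          flux carries \<open>qN powr (1 - Q)\<close> for every \<open>q\<close>, and only the power
          of \<open>hN\<close> still depends on \<open>q\<close>.\<close>
        moreover have "?m x powr (q - 2) * ?m x = qN x powr (1 - rQ)"
        proof -
          have "?m x powr (q - 2) * ?m x = ?m x powr (q - 1)"
            using powr_add[of "?m x" "q - 2" 1] m by simp
          then show ?thesis using q by (simp add: powr_powr)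
        qed
        moreover have "k * M * H * (\<kappa> * m * S) = (k * \<kappa>) * (H * (M * m) * S)" for k M H m S :: real
          by (simp only: mult_ac)
        ultimately have "hnorm G x (hgrad G ?f x) powr (q - 2) * hinner G x (hgrad G ?f x) (hgrad G \<phi> x) =
          (\<bar>\<kappa>\<bar> powr (q - 2) * \<kappa>) * ?T x" by (simp only:)
        then show ?thesis using False by simp
      qed
      moreover have "(LINT x|haar G. (\<bar>\<kappa>\<bar> powr (q - 2) * \<kappa>) * ?T x) = 0"
      proof (subst haar_integral_eq_0_iff)
        show "(\<lambda>x. (\<bar>\<kappa>\<bar> powr (q - 2) * \<kappa>) * ?T x) \<in> borel_measurable borel"
          by (intro borel_measurable_times[OF borel_measurable_const T])
        show "(LINT x|lborel. (\<bar>\<kappa>\<bar> powr (q - 2) * \<kappa>) * ?T x) = 0"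
          unfolding integral_mult_right_zero T0 by (rule mult_zero_right)
      qed
      ultimately show ?thesis unfolding set_lebesgue_integral_def by (simp only:)
    qed
    then show ?thesis using real by (simp add: p_harmonic_def weak_p_harmonic_def)
  qed
qed

end

theorem theorem1p1:
  fixes G :: "'a::euclidean_space carnot" and u :: "'a \<Rightarrow> real"
  assumes "carnot_group G"
    and "hom_dim G > 2"
    and "folland_solution G u"
  shows "((\<forall>g. g \<noteq> 0 \<longrightarrow> inf_laplace G (folland_norm G u) g = 0) \<longleftrightarrow> coherent_family G u) \<and>
         (coherent_family G u \<longleftrightarrow> horizontal_polar_coordinates G (folland_norm G u))"
proof -
  interpret carnot_group G by fact
  interpret folland G u by unfold_locales fact+
  show ?thesis
    using coherent_imp_inf_laplace inf_laplace_imp_coherent polar_imp_inf_laplace inf_laplace_imp_polar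
    by blast
qed

end
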